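(* Let $\nu\in(-\frac12,\frac12)$. There exists a constant $C_\nu>0$ such that the following holds. Let $T\in(0,1]$, $I:=(0,T)$, $K\in H^1(I^2;\mathbb{C})$ and $C_K,D_K>0$ be such that, for all $u,v\in\mathcal{H}$, $$\left|\int_{I^2}K(s,t)u(s)\overline v(t)\,\mathrm{d}s\,\mathrm{d}t\right|\leq C_K\|u_1\|_{L^2}\|v_1\|_{L^2}+D_K\|u_1\|_{\widetilde H^\nu}\|v_1\|_{\widetilde H^\nu}.$$ Let $\chi\in W^{1,\infty}(I^2;\mathbb{C})$ vanish on the diagonal $\{s=t\}$, with $\chi\in W^{2,\infty}(\Delta_+;\mathbb{C})$ and $\chi\in W^{2,\infty}(\Delta_-;\mathbb{C})$ (but not necessarily across the diagonal). There exists $C_\chi>0$, depending only on the $W^{2,\infty}$ norm of $\chi$ (on $\Delta_\pm$), such that, for all $u,v\in\mathcal{H}$, $$\Bigg|\int_{I^2}\chi(s,t)K(s,t)u(s)\overline v(t)\,\mathrm{d}s\,\mathrm{d}t-\int_Iw\,u_1\overline{v_1}-\int_{\Delta_+\cup\Delta_-}\Upsilon(s,t)u_1(s)\overline{v_1}(t)\,\mathrm{d}s\,\mathrm{d}t\Bigg|\leq TC_\nu C_\chi\left(C_K\|u_1\|_{L^2}\|v_1\|_{L^2}+D_K\|u_1\|_{\widetilde H^\nu}\|v_1\|_{\widetilde H^\nu}\right),$$ where $w(s):=(\partial_1\chi(s,s+0)-\partial_1\chi(s,s-0))K(s,s)$ and $\Upsilon:=K\,\partial_{21}\chi+\partial_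2\chi\,\partial_1K+\partial_1\chi\,\partial_2K$.
   Context: $\mathcal{H}:=\{u\in L^2((0,T);\mathbb{C}):\int_0^Tu=0\}$, and for $u\in L^2((0,T);\mathbb{C})$, $u_1(t):=\int_0^tu$ on $(0,T)$ (similarly $v_1$). $\Delta_\pm:=\{(s,t)\in(0,T)^2:\pm(t-s)>0\}$. $\partial_1,\partial_2$ are derivatives with respect to the first variable $s$ and the second variable $t$; $\partial_1\chi(s,s+0)$ (resp. $\partial_1\chi(s,s-0)$) is the trace on the diagonal of $\partial_1\chi$ from inside $\Delta_+$ (resp. $\Delta_-$); $K(s,s)$ is the trace of $K$ on the diagonal. $\widehat f(\omega):=\int_{\mathbb{R}}f(t)e^{-i\omega t}\mathrm{d}t$. For $f\in L^2((0,T);\mathbb{C})$ for which it is finite, $\|f\|_{\widetilde H^\nu}:=\left(\frac1{2\pi}\int_{\mathbb{R}}(1+\omega^2)^{\nu}|\widehat f(\omega)|^2\mathrm{d}\omega\right)^{1/2}$ with $f$ extended by $0$ to $\mathbb{R}$. *)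

theory Defs
  imports "HOL-Analysis.Analysis" "HOL-Probability.Essential_Supremum"
begin

section \<open>Lebesgue spaces\<close>

text \<open>Elements of \<open>L\<^sup>p(\<Omega>)\<close> are represented by functions on the whole ambient space, whose
  values outside \<open>\<Omega>\<close> are irrelevant. Every class has a Borel measurable representative, so
  the Borel version \<^const>\<open>lborel\<close> of Lebesgue measure is used.\<close>

definition L2_on :: "'a::euclidean_space set \<Rightarrow> ('a \<Rightarrow> complex) \<Rightarrow> bool" where
  "L2_on \<Omega> f \<longleftrightarrow> set_borel_measurable lborel \<Omega> f \<and>
     set_integrable lborel \<Omega> (\<lambda>x. (cmod (f x))\<^sup>2)"

definition L2_norm :: "'a::euclidean_space set \<Rightarrow> ('a \<Rightarrow> complex) \<Rightarrow> real" where
  "L2_norm \<Omega> f = sqrt (LINT x:\<Omega>|lborel. (cmod (f x))\<^sup>2)"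

definition Linf_on :: "'a::euclidean_space set \<Rightarrow> ('a \<Rightarrow> complex) \<Rightarrow> bool" where
  "Linf_on \<Omega> f \<longleftrightarrow> set_borel_measurable lborel \<Omega> f \<and>
     (\<exists>C. AE x\<in>\<Omega> in lborel. cmod (f x) \<le> C)"

definition Linf_norm :: "'a::euclidean_space set \<Rightarrow> ('a \<Rightarrow> complex) \<Rightarrow> real" where
  "Linf_norm \<Omega> f =
     real_of_ereal (esssup (restrict_space lborel \<Omega>) (\<lambda>x. ereal (cmod (f x))))"

section \<open>Weak derivatives and Sobolev spaces\<close>

definition pderiv_dir ::
  "'a::euclidean_space \<Rightarrow> ('a \<Rightarrow> 'b::real_normed_vector) \<Rightarrow> 'a \<Rightarrow> 'b" where
  "pderiv_dir e f x = frechet_derivative f (at x) e"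

primrec C_k :: "nat \<Rightarrow> ('a::euclidean_space \<Rightarrow> 'b::real_normed_vector) \<Rightarrow> bool" where
  "C_k 0 f \<longleftrightarrow> continuous_on UNIV f"
| "C_k (Suc k) f \<longleftrightarrow>
     (\<forall>x. f differentiable (at x)) \<and> (\<forall>e\<in>Basis. C_k k (pderiv_dir e f))"

definition smooth :: "('a::euclidean_space \<Rightarrow> 'b::real_normed_vector) \<Rightarrow> bool" where
  "smooth f \<longleftrightarrow> (\<forall>k. C_k k f)"

definition test_function :: "'a::euclidean_space set \<Rightarrow> ('a \<Rightarrow> real) \<Rightarrow> bool" where
  "test_function \<Omega> \<phi> \<longleftrightarrow> smooth \<phi> \<and>
     compact (closure {x. \<phi> x \<noteq> 0}) \<and> closure {x. \<phi> x \<noteq> 0} \<subseteq> \<Omega>"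

definition locally_integrable :: "'a::euclidean_space set \<Rightarrow> ('a \<Rightarrow> complex) \<Rightarrow> bool" where
  "locally_integrable \<Omega> f \<longleftrightarrow> (\<forall>S. compact S \<and> S \<subseteq> \<Omega> \<longrightarrow> set_integrable lborel S f)"

definition has_weak_deriv ::
  "'a::euclidean_space set \<Rightarrow> 'a \<Rightarrow> ('a \<Rightarrow> complex) \<Rightarrow> ('a \<Rightarrow> complex) \<Rightarrow> bool" where
  "has_weak_deriv \<Omega> e f g \<longleftrightarrow> locally_integrable \<Omega> f \<and> locally_integrable \<Omega> g \<and>
     (\<forall>\<phi>. test_function \<Omega> \<phi> \<longrightarrow>
        (LINT x:\<Omega>|lborel. pderiv_dir e \<phi> x *\<^sub>R f x) = - (LINT x:\<Omega>|lborel. \<phi> x *\<^sub>R g x))"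

text \<open>A weak derivative is determined only almost everywhere; the following picks some
  representative.\<close>

definition weak_deriv ::
  "'a::euclidean_space set \<Rightarrow> 'a \<Rightarrow> ('a \<Rightarrow> complex) \<Rightarrow> 'a \<Rightarrow> complex" where
  "weak_deriv \<Omega> e f = (SOME g. has_weak_deriv \<Omega> e f g)"

primrec sobolev ::
  "(('a::euclidean_space \<Rightarrow> complex) \<Rightarrow> bool) \<Rightarrow> 'a set \<Rightarrow> nat \<Rightarrow> ('a \<Rightarrow> complex) \<Rightarrow> bool" where
  "sobolev X \<Omega> 0 f \<longleftrightarrow> X f"
| "sobolev X \<Omega> (Suc k) f \<longleftrightarrow>
     X f \<and> (\<forall>e\<in>Basis. \<exists>g. has_weak_deriv \<Omega> e f g \<and> sobolev X \<Omega> k g)"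

abbreviation H_k :: "nat \<Rightarrow> 'a::euclidean_space set \<Rightarrow> ('a \<Rightarrow> complex) \<Rightarrow> bool" where
  "H_k k \<Omega> \<equiv> sobolev (L2_on \<Omega>) \<Omega> k"

abbreviation W_k_inf :: "nat \<Rightarrow> 'a::euclidean_space set \<Rightarrow> ('a \<Rightarrow> complex) \<Rightarrow> bool" where
  "W_k_inf k \<Omega> \<equiv> sobolev (Linf_on \<Omega>) \<Omega> k"

text \<open>The maximum of the \<open>L\<^sup>\<infinity>\<close> norms of all weak derivatives of order at most \<open>k\<close>.\<close>

primrec W_k_inf_norm ::
  "nat \<Rightarrow> 'a::euclidean_space set \<Rightarrow> ('a \<Rightarrow> complex) \<Rightarrow> real" where
  "W_k_inf_norm 0 \<Omega> f = Linf_norm \<Omega> f"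
| "W_k_inf_norm (Suc k) \<Omega> f =
     Max (insert (Linf_norm \<Omega> f) ((\<lambda>e. W_k_inf_norm k \<Omega> (weak_deriv \<Omega> e f)) ` Basis))"

section \<open>The square, the triangles and the diagonal\<close>

definition square :: "real \<Rightarrow> (real \<times> real) set" where
  "square T = {0<..<T} \<times> {0<..<T}"

definition Delta_plus :: "real \<Rightarrow> (real \<times> real) set" where
  "Delta_plus T = {(s, t). (s, t) \<in> square T \<and> t - s > 0}"

definition Delta_minus :: "real \<Rightarrow> (real \<times> real) set" where
  "Delta_minus T = {(s, t). (s, t) \<in> square T \<and> - (t - s) > 0}"

text \<open>The trace on the diagonal of a function in \<open>H\<^sup>1(\<Omega>)\<close>, where \<open>\<Omega>\<close> is the square or one of
  the triangles: the extension by continuity, from \<open>H\<^sup>1(\<Omega>)\<close> to \<open>L\<^sup>2((0,T))\<close>, of the restriction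
  \<open>\<phi> \<mapsto> (s \<mapsto> \<phi>(s,s))\<close> defined for functions that are smooth up to the boundary.
  It applies in particular to \<open>W\<^sup>1\<^sup>,\<^sup>\<infinity>(\<Omega>)\<close>. It is determined only almost everywhere.\<close>

definition has_diag_trace ::
  "real \<Rightarrow> (real \<times> real) set \<Rightarrow> (real \<times> real \<Rightarrow> complex) \<Rightarrow> (real \<Rightarrow> complex) \<Rightarrow> bool" where
  "has_diag_trace T \<Omega> f \<tau> \<longleftrightarrow> H_k 1 \<Omega> f \<and> L2_on {0<..<T} \<tau> \<and>
     (\<exists>\<phi> :: nat \<Rightarrow> real \<times> real \<Rightarrow> complex.
        (\<forall>n. smooth (\<phi> n)) \<and>
        (\<lambda>n. L2_norm \<Omega> (\<lambda>p. \<phi> n p - f p)) \<longlonglongrightarrow> 0 \<and>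
        (\<forall>e\<in>Basis. (\<lambda>n. L2_norm \<Omega> (\<lambda>p. pderiv_dir e (\<phi> n) p - weak_deriv \<Omega> e f p)) \<longlonglongrightarrow> 0) \<and>
        (\<lambda>n. L2_norm {0<..<T} (\<lambda>s. \<phi> n (s, s) - \<tau> s)) \<longlonglongrightarrow> 0)"

definition diag_trace ::
  "real \<Rightarrow> (real \<times> real) set \<Rightarrow> (real \<times> real \<Rightarrow> complex) \<Rightarrow> real \<Rightarrow> complex" where
  "diag_trace T \<Omega> f = (SOME \<tau>. has_diag_trace T \<Omega> f \<tau>)"

text \<open>A function in \<open>W\<^sup>1\<^sup>,\<^sup>\<infinity>\<close> of the square has a continuous representative; pointwise
  vanishing refers to that representative.\<close>

definition vanishes_on_diagonal :: "real \<Rightarrow> (real \<times> real \<Rightarrow> complex) \<Rightarrow> bool" where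
  "vanishes_on_diagonal T chi \<longleftrightarrow>
     (\<exists>chi'. continuous_on (square T) chi' \<and> (AE p\<in>square T in lborel. chi p = chi' p) \<and>
        (\<forall>s\<in>{0<..<T}. chi' (s, s) = 0))"

section \<open>Functions on the interval\<close>

definition H_space :: "real \<Rightarrow> (real \<Rightarrow> complex) set" where
  "H_space T = {u. L2_on {0<..<T} u \<and> (LINT t:{0<..<T}|lborel. u t) = 0}"

definition primitive :: "(real \<Rightarrow> complex) \<Rightarrow> real \<Rightarrow> complex" where
  "primitive u t = (LINT x:{0<..<t}|lborel. u x)"

definition fourier :: "(real \<Rightarrow> complex) \<Rightarrow> real \<Rightarrow> complex" where
  "fourier f \<omega> = (LINT t|lborel. f t * exp (- \<i> * complex_of_real (\<omega> * t)))"

text \<open>The norm is only meaningful when the integral is finite. This is the case for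
  \<^term>\<open>primitive u\<close> with \<^term>\<open>u \<in> H_space T\<close> and \<open>\<nu> < 1/2\<close>, since the extension by zero of
  such a function belongs to \<open>H\<^sup>1(\<real>)\<close>.\<close>

definition Htilde_norm :: "real \<Rightarrow> real \<Rightarrow> (real \<Rightarrow> complex) \<Rightarrow> real" where
  "Htilde_norm T \<nu> f =
     sqrt (1 / (2 * pi) * (LINT \<omega>|lborel. (1 + \<omega>\<^sup>2) powr \<nu> *
       (cmod (fourier (\<lambda>t. indicator {0<..<T} t * f t) \<omega>))\<^sup>2))"

definition CD_bound ::
  "real \<Rightarrow> real \<Rightarrow> real \<Rightarrow> real \<Rightarrow> (real \<Rightarrow> complex) \<Rightarrow> (real \<Rightarrow> complex) \<Rightarrow> real" where
  "CD_bound T \<nu> C D u v =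
     C * L2_norm {0<..<T} (primitive u) * L2_norm {0<..<T} (primitive v) +
     D * Htilde_norm T \<nu> (primitive u) * Htilde_norm T \<nu> (primitive v)"

section \<open>The weight on the diagonal and the remaining kernel\<close>

definition diag_weight ::
  "real \<Rightarrow> (real \<times> real \<Rightarrow> complex) \<Rightarrow> (real \<times> real \<Rightarrow> complex) \<Rightarrow> real \<Rightarrow> complex" where
  "diag_weight T chi K s =
     (diag_trace T (Delta_plus T) (weak_deriv (square T) (1, 0) chi) s
      - diag_trace T (Delta_minus T) (weak_deriv (square T) (1, 0) chi) s)
     * diag_trace T (square T) K s"

text \<open>The second derivative of \<open>chi\<close> is taken on the open set \<open>\<Delta>\<^sub>+ \<union> \<Delta>\<^sub>-\<close>, hence does not see
  the jump of \<open>\<partial>\<^sub>1chi\<close> across the diagonal.\<close>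

definition Upsilon ::
  "real \<Rightarrow> (real \<times> real \<Rightarrow> complex) \<Rightarrow> (real \<times> real \<Rightarrow> complex) \<Rightarrow> real \<times> real \<Rightarrow> complex" where
  "Upsilon T chi K p =
     K p * weak_deriv (Delta_plus T \<union> Delta_minus T) (0, 1) (weak_deriv (square T) (1, 0) chi) p
     + weak_deriv (square T) (0, 1) chi p * weak_deriv (square T) (1, 0) K p
     + weak_deriv (square T) (1, 0) chi p * weak_deriv (square T) (0, 1) K p"

end

theory Submission
  imports Defs "HOL-Probability.Probability" "HOL-Real_Asymp.Real_Asymp"
begin

text \<open>Both sides are tested against the primitives \<open>f = u\<^sub>1\<close> and \<open>g = v\<^sub>1\<close>. Integrating by parts in
  \<open>s\<close> on the square and in \<open>t\<close> on each triangle, the two correction terms cancel and what remains is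
  \<open>- \<integral>\<integral> \<partial>\<^sub>1K(s,t) f(s) \<partial>\<^sub>t(\<chi>(s,t) g\<^sup>*(t))\<close>; the hypothesis says that the form with kernel
  \<open>\<partial>\<^sub>1K\<close> is bounded on pairs \<open>(f, g')\<close>. On a triangle \<open>\<chi>(s,t)\<close> is the integral over \<open>a\<close>
  between \<open>s\<close> and \<open>t\<close> of \<open>\<partial>\<^sub>1\<chi>(a,t)\<close> up to sign, so the remaining form is a superposition over \<open>a \<in> (0,T)\<close>
  of the same form applied to the cut function \<open>1\<^bsub>s < a\<^esub> f\<close> and to a multiple of \<open>g\<close> that is itself
  a superposition of cuts. For \<open>\<bar>\<nu>\<bar> < 1/2\<close> the squared \<open>H\<^sup>\<nu>\<close> norm of a cut of \<open>f\<close>, averaged over \<open>a\<close>, is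
  controlled by that of \<open>f\<close>; integrating over \<open>a \<in> (0,T)\<close> yields the factor \<open>T\<close>.\<close>

text \<open>The hypothesis sees only products of a function of \<open>s\<close> and a function of
  \<open>t\<close>, which is why \<open>chi\<close> is resolved into cuts at \<open>a\<close>. A cut
  jumps at \<open>a\<close> and is no admissible primitive; it is reached through ramps. Its Fourier
  transform decays like 1/|om|, so its norm is finite for nu < 1/2; nu > -1/2 makes
  \<open>|om| powr (2 * nu)\<close> integrable near 0.

  Cuts are estimated on average over \<open>a\<close> because, at a fixed frequency, the Fourier
  transform of a cut is a primitive in the variable \<open>a\<close>. Its L2 norm over (0,T) is
  controlled by Plancherel with the weight 1 / (1 / T^2 + y^2), whose integral pi * T is the source
  of the factor T. For nu > 0 an excess T^(-2 nu) remains at low frequencies; it is absorbed since a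
  function supported in (0,T) has at least half of its spectral mass beyond 1 / T.

  As \<open>chi\<close> has two derivatives only inside each triangle, it is smoothed there.
  Smoothing destroys the vanishing on the diagonal, so the diagonal values of the approximants and
  their derivatives have to be shown to disappear in the limit.\<close>

abbreviation (input) cpx :: "real => complex" where "cpx == complex_of_real"

abbreviation (input) nsq :: "complex => real" where "nsq z == (cmod z)^2"

abbreviation (input) nnl :: "('a::euclidean_space => ennreal) => ennreal" where "nnl f == nn_integral lborel f"

abbreviation (input) seq_lim :: "(nat => 'a::topological_space) => 'a => bool" (infix "--->" 60) where "X ---> l == X \<longlonglongrightarrow> l"

abbreviation (input) scl :: "real => 'a::real_vector => 'a" (infixr "*R" 75) where "a *R x == a *\<^sub>R x"

abbreviation (input) ind :: "'a set => 'a => 'b::zero_neq_one" where "ind == indicator"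

abbreviation (input) bmeas :: "'a measure => ('a => 'b::topological_space) set" where "bmeas == borel_measurable"

abbreviation (input) enn :: "real => ennreal" where "enn == ennreal"

type_synonym plane = "real * real"

abbreviation (input) borel2 :: "plane measure" where "borel2 == borel"

lemmas B_integrable_add = Bochner_Integration.integrable_add
lemmas B_integrable_bound = Bochner_Integration.integrable_bound
lemmas B_integrable_diff = Bochner_Integration.integrable_diff
lemmas B_integrable_sum = Bochner_Integration.integrable_sum
lemmas B_integral_add = Bochner_Integration.integral_add
lemmas B_integral_cnj = Bochner_Integration.integral_cnj
lemmas B_integral_cong = Bochner_Integration.integral_cong
lemmas B_integral_diff = Bochner_Integration.integral_diff
lemmas B_integral_nonneg = Bochner_Integration.integral_nonneg
lemmas B_integral_norm_bound_integral = Bochner_Integration.integral_norm_bound_integral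

section \<open>Calculus of \<open>C_k\<close> functions and partial derivatives\<close>

lemma pderiv_dir_eqI: "(f has_derivative f') (at x) ==> pderiv_dir e f x = f' e"
 unfolding pderiv_dir_def by (metis frechet_derivative_at)

lemma sum_Basis_pick:
 fixes F :: "'a::euclidean_space => 'b::real_vector"
 shows "e \<in> Basis ==> (\<Sum>b\<in>Basis. (e \<bullet> b) *R F b) = F e"
proof -
 assume "e \<in> Basis"
 then have "(\<Sum>b\<in>Basis. (e \<bullet> b) *R F b) = (\<Sum>b\<in>Basis. if b = e then F b else 0)"
  by (intro sum.cong) (auto simp: inner_Basis)
 then show ?thesis using \<open>e \<in> Basis\<close> by simp
qed

lemmas sum_Basis_pick_real = sum_Basis_pick[where 'b = real, simplified]

lemma C_k_SucI:
 assumes "!!x. (f has_derivative f' x) (at x)" "!!e. e \<in> Basis ==> C_k k (%x. f' x e)"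
 shows "C_k (Suc k) f"
proof -
 have "pderiv_dir e f = (%x. f' x e)" for e
  using assms(1) pderiv_dir_eqI by blast
 then show ?thesis
  using assms by (auto simp: differentiable_def)
qed

lemma C_k_Suc_has_derivative:
 assumes "C_k (Suc k) f"
 shows "(f has_derivative (%v. \<Sum>b\<in>Basis. (v \<bullet> b) *R pderiv_dir b f x)) (at x)"
proof -
 have d: "f differentiable (at x)"
  using assms by simp
 let ?D = "frechet_derivative f (at x)"
 have D: "(f has_derivative ?D) (at x)"
  using d by (simp add: frechet_derivative_works)
 have lin: "linear ?D"
  using D has_derivative_linear by blast
 have "?D = (%v. \<Sum>b\<in>Basis. (v \<bullet> b) *R pderiv_dir b f x)"
 proof
  fix v
  have "?D v = ?D (\<Sum>b\<in>Basis. (v \<bullet> b) *R b)"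
   by (simp add: euclidean_representation)
  also have "... = (\<Sum>b\<in>Basis. (v \<bullet> b) *R pderiv_dir b f x)"
   using lin by (simp add: linear_sum linear_scale pderiv_dir_def)
  finally show "?D v = (\<Sum>b\<in>Basis. (v \<bullet> b) *R pderiv_dir b f x)" .
 qed
 then show ?thesis using D by simp
qed

lemma C_k_Suc_imp: "C_k (Suc k) f ==> C_k k f"
proof (induction k arbitrary: f)
 case 0
 then show ?case
  by (simp add: continuous_at_imp_continuous_on differentiable_imp_continuous_within)
next
 case (Suc k)
 then show ?case by (metis C_k.simps(2))
qed

lemma C_k_continuous: "C_k k f ==> continuous_on UNIV f"
 by (induction k) (use C_k_Suc_imp in auto)

lemma smooth_continuous: "smooth f ==> continuous_on UNIV f"
 unfolding smooth_def using C_k_continuous by blast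

lemma smooth_pderiv_dir: "smooth f ==> e \<in> Basis ==> smooth (pderiv_dir e f)"
 unfolding smooth_def by (metis C_k.simps(2))

lemma smooth_has_derivative:
 "smooth f ==> (f has_derivative (%v. \<Sum>b\<in>Basis. (v \<bullet> b) *R pderiv_dir b f x)) (at x)"
 unfolding smooth_def using C_k_Suc_has_derivative by blast

lemma C_k_const: "C_k k (%x. c)"
proof (induction k arbitrary: c)
 case (Suc k)
 show ?case
  by (rule C_k_SucI[where f'="%_ _. 0"]) (use Suc in auto)
qed auto

lemma C_k_add: "C_k k f ==> C_k k g ==> C_k k (%x. f x + g x)"
proof (induction k arbitrary: f g)
 case 0
 then show ?case by (auto intro: continuous_intros)
next
 case (Suc k)
 show ?case
  by (rule C_k_SucI[OF has_derivative_add[OF C_k_Suc_has_derivative[OF Suc.prems(1)]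
     C_k_Suc_has_derivative[OF Suc.prems(2)]]])
   (use Suc in "auto simp: sum_Basis_pick")
qed

lemma C_k_scaleR:
 fixes f :: "'a::euclidean_space => real"
 shows "C_k k f ==> C_k k g ==> C_k k (%x. f x *R g x)"
proof (induction k arbitrary: f g)
 case 0
 then show ?case by (auto intro: continuous_intros)
next
 case (Suc k)
 note d = has_derivative_scaleR[OF C_k_Suc_has_derivative[OF Suc.prems(1)]
     C_k_Suc_has_derivative[OF Suc.prems(2)]]
 have "C_k k f" "C_k k g"
  using Suc.prems C_k_Suc_imp by blast+
 then show ?case
  by (intro C_k_SucI[OF d])
   (use Suc in "auto simp: sum_Basis_pick sum_Basis_pick_real intro!: C_k_add")
qed

lemma C_k_mult:
 fixes f g :: "'a::euclidean_space => real"
 shows "C_k k f ==> C_k k g ==> C_k k (%x. f x * g x)"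
 using C_k_scaleR[of k f g] by simp

lemma C_k_sum:
 "finite I ==> (!!i. i \<in> I ==> C_k k (f i)) ==> C_k k (%x. \<Sum>i\<in>I. f i x)"
 by (induction I rule: finite_induct) (auto intro: C_k_const C_k_add)

lemma C_k_compose_affine:
 fixes l :: "'c::euclidean_space => 'a::euclidean_space"
 assumes "bounded_linear l"
 shows "C_k k f ==> C_k k (%x. f (l x + a))"
proof (induction k arbitrary: f)
 case 0
 interpret l: bounded_linear l by fact
 have "continuous_on UNIV l"
  by (simp add: assms linear_continuous_on)
 then have "continuous_on UNIV (%x. f (l x + a))"
  by (intro continuous_on_compose2[of UNIV f UNIV "%x. l x + a"])
   (use 0 in "auto intro: continuous_intros")
 then show ?case by simp
next
 case (Suc k)
 have l: "((%x. l x + a) has_derivative l) (at x)" for x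
  using bounded_linear_imp_has_derivative[OF assms, of "at x"]
  by (auto intro!: derivative_eq_intros)
 have "C_k k (%x. \<Sum>b\<in>Basis. (l e \<bullet> b) *R pderiv_dir b f (l x + a))" for e
  using Suc by (intro C_k_sum C_k_scaleR C_k_const) auto
 then show ?case
  using has_derivative_compose[OF l C_k_Suc_has_derivative[OF Suc.prems]]
  by (intro C_k_SucI[where f'="%x v. \<Sum>b\<in>Basis. (l v \<bullet> b) *R pderiv_dir b f (l x + a)"]) auto
qed

text \<open>Being \<open>C_k\<close> is a local property. This serves functions defined by cases,
  above all a test function on a disjoint union of open sets that is set to zero on one of
  them.\<close>

lemma C_k_local:
 assumes "!!x. \<exists>U g. open U & x \<in> U & C_k k g & (\<forall>y\<in>U. f y = g y)"
 shows "C_k k f"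
 using assms
proof (induction k arbitrary: f)
 case 0
 have "isCont f x" for x
 proof -
  obtain U g where U: "open U" "x \<in> U" "continuous_on UNIV g" "\<forall>y\<in>U. f y = g y"
   using 0[of x] by auto
  have "isCont g x" using U by (simp add: continuous_on_eq_continuous_at)
  then show ?thesis
   using U by (metis (no_types, lifting) continuous_on_cong continuous_on_eq_continuous_at continuous_on_subset top_greatest)
 qed
 then show ?case
  by (simp add: continuous_at_imp_continuous_on)
next
 case (Suc k)
 have D: "f differentiable (at x) & (\<forall>e\<in>Basis. \<exists>U g. open U & x \<in> U & C_k k g & (\<forall>y\<in>U. pderiv_dir e f y = g y))" for x
 proof -
  obtain U g where U: "open U" "x \<in> U" "C_k (Suc k) g" "\<forall>y\<in>U. f y = g y"
   using Suc.prems[of x] by blast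
  have d: "(f has_derivative (%v. \<Sum>b\<in>Basis. (v \<bullet> b) *R pderiv_dir b g y)) (at y)" if "y \<in> U" for y
   using has_derivative_transform_within_open[OF C_k_Suc_has_derivative[OF U(3)] U(1) that] U(4)
   by auto
  have "\<forall>y\<in>U. pderiv_dir e f y = pderiv_dir e g y" if "e \<in> Basis" for e
   using pderiv_dir_eqI[OF d] that by (auto simp: sum_Basis_pick)
  then show ?thesis
   using U(1,2,3) d[OF U(2)] unfolding differentiable_def C_k.simps by metis
 qed
 have "C_k k (pderiv_dir e f)" if "e \<in> Basis" for e
  using Suc.IH[of "pderiv_dir e f"] D that by blast
 then show ?case using D by simp
qed

section \<open>Bump functions\<close>

text \<open>The derivative of a member of this family is a linear combination of members with larger
  \<open>j\<close>. Carrying the index turns smoothness into a single induction over all members at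
  once.\<close>

definition exp_inv :: "nat => real => real" where
 "exp_inv j x = (if x <= 0 then 0 else exp (- (1 / x)) * (1 / x) ^ j)"

lemma exp_inv_tendsto_0: "(exp_inv j \<longlongrightarrow> 0) (at 0)"
proof -
 have 1: "((%x::real. (1 / x) ^ j / exp (1 / x)) \<longlongrightarrow> 0) (at_right 0)"
  using filterlim_compose[OF tendsto_power_div_exp_0[of j] filterlim_inverse_at_top_right]
  by (simp add: inverse_eq_divide)
 have "(exp_inv j \<longlongrightarrow> 0) (at_right 0)"
  by (rule Lim_transform_eventually[OF 1])
   (auto simp: eventually_at_filter exp_inv_def exp_minus field_simps)
 moreover have "(exp_inv j \<longlongrightarrow> 0) (at_left 0)"
  by (rule tendsto_eventually) (auto simp: eventually_at_filter exp_inv_def)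
 ultimately show ?thesis
  by (simp add: filterlim_split_at)
qed

lemma exp_inv_has_real_derivative:
 "(exp_inv j has_real_derivative (exp_inv (j + 2) x - real j * exp_inv (j + 1) x)) (at x)"
proof (cases x "0::real" rule: linorder_cases)
 case less
 have "((%x. 0) has_real_derivative 0) (at x)" by simp
 then have "(exp_inv j has_real_derivative 0) (at x)"
  by (rule DERIV_cong_ev[THEN iffD1, rotated -1])
   (use less in \<open>auto simp: exp_inv_def eventually_nhds intro!: exI[of _ "{..<0}"]\<close>)
 then show ?thesis using less by (simp add: exp_inv_def)
next
 case greater
 have pw: "(1 / x) ^ j * (real j) * (1/x) = real j * (1 / x) ^ (j - 1) * (1 / x^2)"
  by (cases j) (auto simp: power2_eq_square)
 have "((%x. exp (- (1 / x)) * (1 / x) ^ j) has_real_derivative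
   exp (- (1 / x)) * (1/x^2) * (1 / x) ^ j + exp (- (1 / x)) * (real j * (1 / x) ^ (j - 1) * (- 1 / x^2))) (at x)"
  using greater by (auto intro!: derivative_eq_intros simp: power2_eq_square)
 also have "exp (- (1 / x)) * (1/x^2) * (1 / x) ^ j + exp (- (1 / x)) * (real j * (1 / x) ^ (j - 1) * (- 1 / x^2))
   = exp_inv (j + 2) x - real j * exp_inv (j + 1) x"
  using greater by (cases j) (simp_all add: exp_inv_def power2_eq_square field_simps)
 finally show ?thesis
  by (rule DERIV_cong_ev[THEN iffD1, rotated -1])
   (use greater in \<open>auto simp: exp_inv_def eventually_nhds intro!: exI[of _ "{0<..}"]\<close>)
next
 case equal
 \<comment> \<open>At the origin the difference quotient is \<open>exp_inv (Suc j)\<close>, whose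
   limit 0 is already known.\<close>
 have "((%h. exp_inv j h / h) \<longlongrightarrow> 0) (at 0)"
  by (rule Lim_transform_eventually[OF exp_inv_tendsto_0[of "Suc j"]])
   (auto simp: eventually_at_filter exp_inv_def)
 then show ?thesis
  using equal by (simp add: DERIV_def exp_inv_def cong: if_cong)
qed

lemma C_k_exp_inv: "C_k k (exp_inv j)"
proof (induction k arbitrary: j)
 case 0
 show ?case
  using exp_inv_has_real_derivative DERIV_isCont continuous_at_imp_continuous_on
  by (metis C_k.simps(1))
next
 case (Suc k)
 have "(exp_inv j has_derivative (%v. (exp_inv (j + 2) x - real j * exp_inv (j + 1) x) * v)) (at x)" for x
  using exp_inv_has_real_derivative by (simp add: has_field_derivative_def mult_commute_abs)
 moreover have "C_k k (%x. exp_inv (j + 2) x + (- real j) * exp_inv (j + 1) x)"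
  by (intro C_k_add C_k_mult C_k_const Suc)
 ultimately show ?case
  by (intro C_k_SucI[where f'="%x v. (exp_inv (j + 2) x - real j * exp_inv (j + 1) x) * v"]) auto
qed

definition bump0 :: "real => real" where
 "bump0 x = exp_inv 0 (x + 1) * exp_inv 0 (- x + 1)"

lemma C_k_bump0: "C_k k bump0"
 unfolding bump0_def
 using C_k_compose_affine[OF bounded_linear_ident C_k_exp_inv[of k 0], of 1]
   C_k_compose_affine[OF bounded_linear_minus[OF bounded_linear_ident] C_k_exp_inv[of k 0], of 1]
 by (intro C_k_mult) auto

lemma bump0_nonneg: "bump0 x >= 0"
 by (simp add: bump0_def exp_inv_def)

lemma bump0_pos: "(abs x) < 1 ==> bump0 x > 0"
 by (auto simp: bump0_def exp_inv_def)

lemma bump0_zero: "(abs x) >= 1 ==> bump0 x = 0"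
 by (auto simp: bump0_def exp_inv_def)

text \<open>A product rather than a radial profile: smoothness follows from that of one variable,
  and the support is a square, the shape in which room is measured in
  \<open>convex_domain\<close>.\<close>

definition bump :: "plane => real" where
 "bump p = bump0 (fst p) * bump0 (snd p)"

lemma smooth_bump: "smooth bump"
 unfolding smooth_def bump_def
 using C_k_compose_affine[OF bounded_linear_fst C_k_bump0, of _ 0]
   C_k_compose_affine[OF bounded_linear_snd C_k_bump0, of _ 0]
 by (auto intro!: C_k_mult)

lemma continuous_bump: "continuous_on UNIV bump"
 using smooth_bump smooth_continuous by blast

lemma bump_nonneg: "bump p >= 0"
 by (simp add: bump_def bump0_nonneg)

lemma bump_zero: "\<bar>fst p\<bar> >= 1 | \<bar>snd p\<bar> >= 1 ==> bump p = 0"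
 by (auto simp: bump_def bump0_zero)

section \<open>Convolution with a smooth kernel\<close>

definition conv :: "('a::euclidean_space => real) => ('a => complex) => 'a => complex" where
 "conv psi h z = (LINT y|lborel. psi (z - y) *R h y)"

lemma uniformly_continuous_bounded_support:
 fixes f :: "'a::euclidean_space => real"
 assumes "continuous_on UNIV f" and supp: "!!x. norm x > R ==> f x = 0"
 shows "uniformly_continuous_on UNIV f"
unfolding uniformly_continuous_on_def
proof (intro allI impI)
 fix e :: real assume "e > 0"
 have "uniformly_continuous_on (cball 0 ((abs R) + 1)) f"
  by (rule compact_uniformly_continuous) (use assms(1) in "auto intro: continuous_on_subset")
 then obtain d where d: "d > 0" "!!x y. x \<in> cball 0 ((abs R) + 1) ==> y \<in> cball 0 ((abs R) + 1) ==> dist y x < d ==> dist (f y) (f x) < e"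
  using \<open>e > 0\<close> unfolding uniformly_continuous_on_def by metis
 have "dist (f y) (f x) < e" if "dist y x < min d 1" for x y
 proof (cases "norm x <= (abs R) + 1 & norm y <= (abs R) + 1")
  case True
  then show ?thesis using d that by auto
 next
  case False
  have "\<bar>norm x - norm y\<bar> < 1"
   using that norm_triangle_ineq3[of y x] by (simp add: dist_norm abs_minus_commute)
  then have "norm x > R" "norm y > R" using False by linarith+
  then show ?thesis using supp \<open>e > 0\<close> by simp
 qed
 then show "\<exists>d>0. \<forall>x\<in>UNIV. \<forall>x'\<in>UNIV. dist x' x < d --> dist (f x') (f x) < e"
  using \<open>d > 0\<close> by (intro exI[of _ "min d 1"]) auto
qed

lemma bounded_bounded_support:
 fixes f :: "'a::euclidean_space => real"
 assumes "continuous_on UNIV f" and supp: "!!x. norm x > R ==> f x = 0"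
 obtains B where "!!x. \<bar>f x\<bar> <= B"
proof -
 have "compact (f ` cball 0 (abs R))"
  using assms(1) by (intro compact_continuous_image) (auto intro: continuous_on_subset)
 then obtain B where B: "!!x. x \<in> cball 0 (abs R) ==> \<bar>f x\<bar> <= B"
  using compact_imp_bounded bounded_iff by (metis image_eqI real_norm_def)
 have "\<bar>f x\<bar> <= max B 0" for x
  using B[of x] supp[of x] by (cases "norm x > R") (simp_all add: le_max_iff_disj)
 then show ?thesis using that by blast
qed

lemma integrable_conv:
 fixes psi :: "'a::euclidean_space => real"
  and h :: "'a => complex"
 assumes "continuous_on UNIV psi" "!!x. norm x > R ==> psi x = 0" "integrable lborel h"
 shows "integrable lborel (%y. psi (z - y) *R h y)"
proof -
 obtain B where B: "!!x. \<bar>psi x\<bar> <= B"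
  using bounded_bounded_support[OF assms(1,2)] by blast
 have [measurable]: "psi \<in> bmeas borel"
  by (simp add: assms(1) borel_measurable_continuous_onI)
 have [measurable]: "h \<in> bmeas borel"
  using assms(3) by auto
 show ?thesis
  by (rule B_integrable_bound[of _ "%y. B *R h y"])
   (use assms(3) B in "auto intro!: AE_I2 mult_right_mono order_trans[OF B abs_ge_self]")
qed

lemma pderiv_dir_support:
 assumes "!!x. norm x > R ==> psi x = 0" "norm x > R"
 shows "pderiv_dir e psi x = 0"
proof -
 have "open {x. norm x > R}"
  by (auto intro!: open_Collect_less continuous_intros)
 then have "(psi has_derivative (%_. 0)) (at x)"
  by (rule has_derivative_transform_within_open[OF has_derivative_const[of 0]]) (use assms in auto)
 then show ?thesis using pderiv_dir_eqI by fastforce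
qed

text \<open>The partial derivatives of \<open>psi\<close> are uniformly continuous because of the
  bounded support, so the linearisation error of \<open>psi\<close> is small uniformly in the base
  point and can be integrated against a merely integrable \<open>h\<close>.\<close>

lemma conv_has_derivative:
 fixes psi :: "'a::euclidean_space => real"
 assumes "C_k (Suc 0) psi" and supp: "!!x. norm x > R ==> psi x = 0" and h: "integrable lborel h"
 shows "(conv psi h has_derivative (%v. \<Sum>b\<in>Basis. (v \<bullet> b) *R conv (pderiv_dir b psi) h z)) (at z)"
proof -
 define D where "D x v = (\<Sum>b\<in>Basis. (v \<bullet> b) *R pderiv_dir b psi x)" for x v
 have D: "(psi has_derivative D x) (at x)" for x
  unfolding D_def by (rule C_k_Suc_has_derivative[OF assms(1)])
 have cont: "continuous_on UNIV (pderiv_dir b psi)" if "b \<in> Basis" for b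
  using assms(1) that by simp
 have psic: "continuous_on UNIV psi" using C_k_continuous assms(1) by blast
 note supp' = pderiv_dir_support[of R psi, OF supp]
 have uc: "uniformly_continuous_on UNIV (pderiv_dir b psi)" if "b \<in> Basis" for b
  using uniformly_continuous_bounded_support[OF cont[OF that] supp'] by blast
 have intD: "integrable lborel (%y. pderiv_dir b psi (z - y) *R h y)" if "b \<in> Basis" for b z
  by (rule integrable_conv[OF cont[OF that] _ h, of R]) (use supp' in auto)
 have intpsi: "integrable lborel (%y. psi (z - y) *R h y)" for z
  by (rule integrable_conv[OF psic _ h, of R]) (use supp in auto)
 define H where "H = (LINT y|lborel. cmod (h y))"
 have H0: "H >= 0" unfolding H_def by simp
 have "\<exists>d>0. \<forall>z'. norm (z' - z) < d -->
   norm (conv psi h z' - conv psi h z - (\<Sum>b\<in>Basis. ((z' - z) \<bullet> b) *R conv (pderiv_dir b psi) h z)) <= e * norm (z' - z)"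
  if "e > 0" for e
 proof -
  \<comment> \<open>Room for the number of coordinate directions and for the mass \<open>H\<close>
    of \<open>h\<close>; the summand 1 covers \<open>H = 0\<close>.\<close>
  define e' where "e' = e / ((H + 1) * DIM('a))"
  have e': "e' > 0" using that H0 by (simp add: e'_def)
  have "\<forall>b\<in>Basis. \<exists>d>0. \<forall>x y. dist x y < d --> dist (pderiv_dir b psi x) (pderiv_dir b psi y) < e'"
   using uc e' unfolding uniformly_continuous_on_def by (metis UNIV_I)
  then obtain d where d: "!!b. b \<in> Basis ==> d b > 0"
   "!!b x y. b \<in> Basis ==> dist x y < d b ==> dist (pderiv_dir b psi x) (pderiv_dir b psi y) < e'"
   by metis
  define d0 where "d0 = Min (d ` (Basis :: 'a set))"
  have d0: "d0 > 0" "!!b. b \<in> Basis ==> d0 <= d b"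
   using d by (auto simp: d0_def)
  have key: "norm (psi y - psi x - D x (y - x)) <= norm (y - x) * (DIM('a) * e')" if "norm (y - x) < d0" for x y
  proof (rule differentiable_bound_linearization[where S="ball x d0" and f'=D])
   show "x + t *R (y - x) \<in> ball x d0" if "t \<in> {0..1}" for t
   proof -
    have "norm (t *R (y - x)) <= norm (y - x)" using that by (simp add: mult_left_le_one_le)
    then show ?thesis using \<open>norm (y - x) < d0\<close> by (simp add: dist_norm)
   qed
   show "x \<in> ball x d0" using d0 by simp
   show "(psi has_derivative D w) (at w within ball x d0)" if "w \<in> ball x d0" for w
    using D has_derivative_at_withinI by blast
   show "onorm (D w - D x) <= DIM('a) * e'" if "w \<in> ball x d0" for w
   proof (rule onorm_le)
    fix v
    have "norm ((D w - D x) v) = norm (\<Sum>b\<in>Basis. (v \<bullet> b) *R (pderiv_dir b psi w - pderiv_dir b psi x))"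
     by (simp add: D_def sum_subtractf scaleR_diff_right right_diff_distrib)
    also have "... <= (\<Sum>b\<in>(Basis::'a set). norm v * e')"
    proof (rule sum_norm_le)
     fix b :: 'a assume b: "b \<in> Basis"
     have "\<bar>v \<bullet> b\<bar> <= norm v" using Basis_le_norm b by blast
     moreover have "dist w x < d b"
      using d0(2)[OF b] that by (simp add: dist_commute)
     then have "\<bar>pderiv_dir b psi w - pderiv_dir b psi x\<bar> <= e'"
      using d(2)[OF b] by (fastforce simp: dist_norm)
     ultimately show "norm ((v \<bullet> b) *R (pderiv_dir b psi w - pderiv_dir b psi x)) <= norm v * e'"
      by (auto simp: abs_mult intro!: mult_mono)
    qed
    finally show "norm ((D w - D x) v) <= DIM('a) * e' * norm v"
     by (simp add: mult_ac)
   qed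
  qed
  show ?thesis
  proof (intro exI[of _ d0] conjI allI impI)
   fix z' assume z': "norm (z' - z) < d0"
   have "conv psi h z' - conv psi h z - (\<Sum>b\<in>Basis. ((z' - z) \<bullet> b) *R conv (pderiv_dir b psi) h z)
    = (LINT y|lborel. psi (z' - y) *R h y - psi (z - y) *R h y - (\<Sum>b\<in>Basis. ((z' - z) \<bullet> b) *R (pderiv_dir b psi (z - y) *R h y)))"
    unfolding conv_def using intD intpsi by (simp del: scaleR_scaleR)
   also have "... = (LINT y|lborel. (psi (z' - y) - psi (z - y) - D (z - y) (z' - z)) *R h y)"
    by (intro B_integral_cong) (auto simp: D_def scaleR_diff_left scaleR_sum_left)
   also have "norm ... <= (LINT y|lborel. norm (z' - z) * (DIM('a) * e') * cmod (h y))"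
   proof (rule B_integral_norm_bound_integral)
    have "integrable lborel (%y. psi (z' - y) *R h y - psi (z - y) *R h y - (\<Sum>b\<in>Basis. ((z' - z) \<bullet> b) *R (pderiv_dir b psi (z - y) *R h y)))"
     using intD intpsi by (intro B_integrable_diff B_integrable_sum integrable_scaleR_right) auto
    then show "integrable lborel (%y. (psi (z' - y) - psi (z - y) - D (z - y) (z' - z)) *R h y)"
     by (simp add: D_def scaleR_diff_left scaleR_sum_left)
    show "integrable lborel (%y. norm (z' - z) * (DIM('a) * e') * cmod (h y))"
     using h by auto
    fix y
    show "norm ((psi (z' - y) - psi (z - y) - D (z - y) (z' - z)) *R h y) <= norm (z' - z) * (DIM('a) * e') * cmod (h y)"
     using key[of "z' - y" "z - y"] z' by (auto intro!: mult_right_mono)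
   qed
   also have "... = norm (z' - z) * (e * (H / (H + 1)))"
    by (simp add: H_def e'_def)
   also have "... <= norm (z' - z) * (e * 1)"
    using that H0 by (intro mult_left_mono) (auto simp: field_simps)
   finally show "norm (conv psi h z' - conv psi h z - (\<Sum>b\<in>Basis. ((z' - z) \<bullet> b) *R conv (pderiv_dir b psi) h z)) <= e * norm (z' - z)"
    by (simp add: mult_ac)
  qed (use d0 in auto)
 qed
 moreover have "bounded_linear (%v. \<Sum>b\<in>Basis. (v \<bullet> b) *R conv (pderiv_dir b psi) h z)"
  by (intro bounded_linear_sum bounded_linear_scaleR_const bounded_linear_inner_left)
 ultimately show ?thesis
  unfolding has_derivative_at_alt by blast
qed

text \<open>One derivative is given away so that the base case, continuity, can be read off from
  \<open>conv_has_derivative\<close>. For smooth kernels this costs nothing.\<close>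

lemma C_k_conv:
 fixes psi :: "'a::euclidean_space => real"
 assumes "integrable lborel h"
 shows "C_k (Suc k) psi ==> (!!x. norm x > R ==> psi x = 0) ==> C_k k (conv psi h)"
proof (induction k arbitrary: psi)
 case 0
 have "isCont (conv psi h) z" for z
  using has_derivative_continuous[OF conv_has_derivative[OF 0(1,2) assms]] by blast
 then show ?case by (simp add: continuous_at_imp_continuous_on)
next
 case (Suc k)
 have 1: "C_k (Suc 0) psi"
  using Suc.prems(1) C_k_Suc_imp C_k_continuous by (metis C_k.simps)
 have "C_k k (conv (pderiv_dir e psi) h)" if "e \<in> Basis" for e
  using Suc.IH[of "pderiv_dir e psi"] Suc.prems pderiv_dir_support[of R psi] that by auto
 then show ?case
  by (intro C_k_SucI[OF conv_has_derivative[OF 1 Suc.prems(2) assms]])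
   (auto simp: sum_Basis_pick)
qed

lemma smooth_conv:
 assumes "smooth psi" "!!x. norm x > R ==> psi x = 0" "integrable lborel h"
 shows "smooth (conv psi h)"
 using C_k_conv[OF assms(3)] assms unfolding smooth_def by blast

section \<open>Mollification in the plane\<close>

lemma nn_integral_affine:
 fixes t :: "'a::euclidean_space"
 assumes [measurable]: "f \<in> bmeas borel" and c: "c ~= 0"
 shows "(nnl (%x. f x)) = enn ((abs c) ^ DIM('a)) * (nnl (%x. f (t + c *R x)))"
 by (subst lborel_affine[OF c, of t])
   (simp add: nn_integral_density nn_integral_distr nn_integral_cmult)

lemma nn_integral_reflect_shift:
 fixes z :: "'a::euclidean_space"
 assumes [measurable]: "f \<in> bmeas borel"
 shows "(nnl (%y. f (z - y))) = (nnl (%y. f y))"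
 using nn_integral_affine[OF assms, of "-1" z] by simp

lemma nn_integral_shift:
 fixes z :: "'a::euclidean_space"
 assumes [measurable]: "f \<in> bmeas borel"
 shows "(nnl (%y. f (y - z))) = (nnl (%y. f y))"
 using nn_integral_affine[OF assms, of "1" "-z"] by simp

lemma bump_borel [measurable]: "bump \<in> bmeas borel"
 using continuous_bump by (rule borel_measurable_continuous_onI)

lemma bump_pos: "p \<in> {-1<..<1} \<times> {-1<..<1} ==> bump p > 0"
 by (auto simp: bump_def intro!: mult_pos_pos bump0_pos)

lemma bump_support: "norm p > 2 ==> bump p = 0"
 using norm_Pair_le[of "fst p" "snd p"] bump_zero[of p] by fastforce

lemma integrable_bump: "integrable lborel bump"
proof -
 obtain B where B: "!!x. \<bar>bump x\<bar> <= B"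
  using bounded_bounded_support[OF continuous_bump bump_support] by blast
 show ?thesis
 proof (rule B_integrable_bound)
  show "integrable lborel (%x::real\<times>real. B * ind (cball 0 2) x)"
   using emeasure_bounded_finite[of "cball (0::real\<times>real) 2"]
   by (intro integrable_mult_right) (auto simp: top.not_eq_extremum)
  have "norm (bump x) <= norm (B * ind (cball 0 2) x)" for x
   using order_trans[OF B[of x] abs_ge_self] bump_support[of x] by (cases "norm x > 2") auto
  then show "AE x in lborel. norm (bump x) <= norm (B * ind (cball 0 2) x)"
   by simp
 qed auto
qed

lemma bump_integral_pos: "(LINT p|lborel. bump p) > 0"
proof -
 have "(LINT p|lborel. bump p) ~= 0"
 proof
  assume "(LINT p|lborel. bump p) = 0"
  then have "AE p in lborel. bump p = 0"
   using integral_nonneg_eq_0_iff_AE[OF integrable_bump] bump_nonneg by auto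
  then have "AE p in lborel. p ~: box (-1, -1) (1::real, 1::real)"
  proof eventually_elim
   case (elim p)
   then show ?case using bump_pos[of p] by (cases p, auto simp: mem_box Basis_prod_def)
  qed
  then have "emeasure lborel (box (-1, -1) (1::real, 1::real)) = 0"
   by (subst (asm) AE_iff_measurable[where N="box (-1, -1) (1::real, 1::real)"]) auto
  moreover have "emeasure lborel (box (-1, -1) (1::real, 1::real)) = enn 4"
   by (subst emeasure_lborel_box) (auto simp: Basis_prod_def)
  ultimately show False by simp
 qed
 moreover have "(LINT p|lborel. bump p) >= 0"
  using bump_nonneg by simp
 ultimately show ?thesis by linarith
qed

definition moll :: "real => plane => real" where
 "moll dl p = bump ((1 / dl) *R p) / (dl\<^sup>2 * (LINT q|lborel. bump q))"

lemma moll_nonneg: "moll dl p >= 0"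
 using bump_nonneg bump_integral_pos by (simp add: moll_def)

lemma smooth_moll: "smooth (moll dl)"
proof -
 have "C_k k (%p. (1 / (dl\<^sup>2 * (LINT q|lborel. bump q))) * bump ((1 / dl) *R p))" for k
  using C_k_compose_affine[OF bounded_linear_scaleR_right, of k bump "1/dl" 0] smooth_bump
  by (intro C_k_mult C_k_const) (auto simp: smooth_def)
 then show ?thesis
  unfolding smooth_def moll_def by simp
qed

lemma continuous_moll: "continuous_on UNIV (moll dl)"
 using smooth_moll smooth_continuous by blast

lemma moll_borel [measurable]: "moll dl \<in> bmeas borel"
 using continuous_moll by (rule borel_measurable_continuous_onI)

lemma moll_zero: "dl > 0 ==> \<bar>fst p\<bar> >= dl | \<bar>snd p\<bar> >= dl ==> moll dl p = 0"
 unfolding moll_def by (subst bump_zero) auto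

lemma moll_support: "dl > 0 ==> norm p > 2 * dl ==> moll dl p = 0"
 unfolding moll_def by (subst bump_support) (auto simp: field_simps)

lemma nn_integral_moll:
 assumes "dl > 0"
 shows "(nnl (%p. enn (moll dl p))) = 1"
proof -
 let ?Z = "LINT q|lborel. bump q"
 have "(nnl (%p. enn (moll dl p))) = enn (dl\<^sup>2) * (nnl (%p. enn (moll dl (dl *R p))))"
  using nn_integral_affine[of "%p. enn (moll dl p)" dl 0] assms by (simp add: power2_eq_square)
 also have "(nnl (%p. enn (moll dl (dl *R p)))) = (nnl (%p. enn (1 / (dl\<^sup>2 * ?Z)) * enn (bump p)))"
  using assms bump_integral_pos by (simp add: moll_def ennreal_mult'[symmetric] bump_nonneg)
 also have "... = enn (1 / (dl\<^sup>2 * ?Z)) * enn ?Z"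
  by (subst nn_integral_cmult) (auto simp: nn_integral_eq_integral[OF integrable_bump] bump_nonneg)
 also have "enn (dl\<^sup>2) * ... = 1"
  using assms bump_integral_pos by (simp add: ennreal_mult'[symmetric])
 finally show ?thesis .
qed

lemma nn_integral_moll_shift:
 assumes "dl > 0"
 shows "(nnl (%y. enn (moll dl (z - y)))) = 1" "(nnl (%y. enn (moll dl (y - z)))) = 1"
 using nn_integral_reflect_shift[of "%p. enn (moll dl p)" z] nn_integral_shift[of "%p. enn (moll dl p)" z]
  nn_integral_moll[OF assms] by auto

lemma integral_moll_shift:
 assumes "dl > 0"
 shows "integrable lborel (%y. moll dl (z - y))" "(LINT y|lborel. moll dl (z - y)) = 1"
proof -
 show "integrable lborel (%y. moll dl (z - y))"
  by (rule integrableI_bounded) (auto simp: moll_nonneg nn_integral_moll_shift assms)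
 show "(LINT y|lborel. moll dl (z - y)) = 1"
  by (subst integral_eq_nn_integral) (auto simp: moll_nonneg nn_integral_moll_shift assms)
qed

lemma integrable_conv_moll:
 fixes h :: "plane => complex"
 assumes "dl > 0" "integrable lborel h"
 shows "integrable lborel (%y. moll dl (z - y) *R h y)"
 by (rule integrable_conv[OF continuous_moll _ assms(2), of "2 * dl"]) (use moll_support assms in auto)

text \<open>An average with respect to a probability density cannot be further from \<open>c\<close>
  than the values it averages. Only the values of \<open>h\<close> where the kernel is nonzero
  count; this yields uniform bounds, pointwise limits and vanishing far away.\<close>

lemma conv_moll_dist:
 assumes "dl > 0" and h: "integrable lborel h"
  and AE: "AE y in lborel. moll dl (z - y) ~= 0 --> cmod (h y - c) <= e"
 shows "cmod (conv (moll dl) h z - c) <= e"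
proof -
 have "conv (moll dl) h z - c = (LINT y|lborel. moll dl (z - y) *R h y - moll dl (z - y) *R c)"
  using integral_moll_shift[OF assms(1)] integrable_conv_moll[OF assms(1) h]
  by (subst B_integral_diff) (auto simp: conv_def)
 also have "cmod ... <= (LINT y|lborel. cmod (moll dl (z - y) *R h y - moll dl (z - y) *R c))"
  by (rule integral_norm_bound)
 also have "... <= (LINT y|lborel. moll dl (z - y) * e)"
 proof (rule integral_mono_AE)
  show "integrable lborel (%y. cmod (moll dl (z - y) *R h y - moll dl (z - y) *R c))"
   using integral_moll_shift[OF assms(1)] integrable_conv_moll[OF assms(1) h] by auto
  show "AE y in lborel. cmod (moll dl (z - y) *R h y - moll dl (z - y) *R c) <= moll dl (z - y) * e"
   using AE
  proof eventually_elim
   case (elim y)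
   have "cmod (moll dl (z - y) *R h y - moll dl (z - y) *R c) = moll dl (z - y) * cmod (h y - c)"
    by (simp flip: scaleR_diff_right add: moll_nonneg)
   then show ?case using elim moll_nonneg[of dl "z - y"]
    by (cases "moll dl (z - y) = 0") (auto intro: mult_left_mono)
  qed
 qed (use integral_moll_shift[OF assms(1)] in auto)
 also have "... = e" using integral_moll_shift[OF assms(1)] by simp
 finally show ?thesis .
qed

lemma conv_moll_bound:
 assumes "dl > 0" "integrable lborel h" "AE y in lborel. cmod (h y) <= M"
 shows "cmod (conv (moll dl) h z) <= M"
proof -
 have "AE y in lborel. moll dl (z - y) ~= 0 --> cmod (h y - 0) <= M"
  using assms(3) by eventually_elim auto
 then show ?thesis using conv_moll_dist[OF assms(1,2), of z 0 M] by simp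
qed

lemma conv_borel [measurable]:
 assumes [measurable]: "psi \<in> bmeas borel" "h \<in> bmeas borel"
 shows "conv psi h \<in> bmeas borel"
proof -
 have "(%z. LINT y|lborel. psi (z - y) *R h y) \<in> bmeas lborel"
  by measurable
 then show ?thesis unfolding conv_def[abs_def] by simp
qed

text \<open>Jensen's inequality for the probability kernel (Cauchy-Schwarz with the weight split
  into two square roots when \<open>p = 2\<close>), followed by Tonelli. Where the integral defining
  the convolution does not exist, its default value 0 satisfies the bound as well.\<close>

lemma conv_Lp:
 fixes p :: nat
 assumes p: "p = 1 | p = 2" and d: "dl > 0" and [measurable]: "h \<in> bmeas borel"
 shows "(nnl (%z. enn (cmod (conv (moll dl) h z) ^ p))) <= (nnl (%y. enn (cmod (h y) ^ p)))"
proof -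
 have pw: "enn (cmod (conv (moll dl) h z) ^ p) <= (nnl (%y. enn (moll dl (z - y)) * enn (cmod (h y) ^ p)))" for z
 proof -
  have 1: "enn (cmod (conv (moll dl) h z)) <= (nnl (%y. enn (moll dl (z - y)) * enn (cmod (h y))))"
  proof (cases "integrable lborel (%y. moll dl (z - y) *R h y)")
   case True
   have "enn (cmod (conv (moll dl) h z)) <= (nnl (%y. enn (cmod (moll dl (z - y) *R h y))))"
    unfolding conv_def using True by (rule integral_norm_bound_ennreal)
   then show ?thesis by (simp add: ennreal_mult' moll_nonneg)
  next
   case False
   then show ?thesis by (simp add: conv_def not_integrable_integral_eq)
  qed
  show ?thesis
  proof (cases "p = 1")
   case True
   then show ?thesis using 1 by simp
  next
   case False
   then have p2: "p = 2" using p by simp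
   have "enn (cmod (conv (moll dl) h z) ^ p) = enn (cmod (conv (moll dl) h z)) ^ 2"
    by (simp add: p2 ennreal_power)
   also have "... <= (nnl (%y. enn (moll dl (z - y)) * enn (cmod (h y)))) ^ 2"
    by (rule power_mono[OF 1]) simp
   also have "... = (nnl (%y. enn (sqrt (moll dl (z - y))) * enn (sqrt (moll dl (z - y)) * cmod (h y)))) ^ 2"
    by (simp add: ennreal_mult'[symmetric] moll_nonneg mult.assoc[symmetric])
   also have "... <= (nnl (%y. enn (sqrt (moll dl (z - y))) ^ 2)) * (nnl (%y. enn (sqrt (moll dl (z - y)) * cmod (h y)) ^ 2))"
    by (rule Cauchy_Schwarz_nn_integral) measurable
   also have "... = (nnl (%y. enn (moll dl (z - y)) * enn (cmod (h y) ^ p)))"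
    using nn_integral_moll_shift[OF d]
    by (simp add: p2 ennreal_power moll_nonneg power_mult_distrib ennreal_mult')
   finally show ?thesis .
  qed
 qed
 have "(nnl (%z. enn (cmod (conv (moll dl) h z) ^ p))) <= (nnl (%z. (nnl (%y. enn (moll dl (z - y)) * enn (cmod (h y) ^ p)))))"
  by (intro nn_integral_mono pw)
 also have "... = (nnl (%y. (nnl (%z. enn (moll dl (z - y)) * enn (cmod (h y) ^ p)))))"
  by (intro lborel_pair.Fubini') measurable
 also have "... = (nnl (%y. enn (cmod (h y) ^ p)))"
  by (subst nn_integral_multc) (auto simp: nn_integral_moll_shift[OF d])
 finally show ?thesis .
qed

text \<open>The dilation towards \<^term>\<open>c\<close> leaves room for the convolution kernel, so that only values
 of \<^term>\<open>h\<close> in a domain that is convex and contains a neighbourhood of \<^term>\<open>c\<close> are used.\<close>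

definition smoothing :: "plane => real => nat => (plane => complex) => plane => complex" where
 "smoothing c r n h x =
   conv (moll (r / (real n + 2))) h ((1 - 1 / (real n + 2)) *R x + (1 / (real n + 2)) *R c)"

lemma smooth_smoothing:
 assumes "r > 0" "integrable lborel h"
 shows "smooth (smoothing c r n h)"
proof -
 have "smooth (conv (moll (r / (real n + 2))) h)"
  by (rule smooth_conv[OF smooth_moll _ assms(2), of "2 * (r / (real n + 2))"]) (use assms(1) moll_support in auto)
 then show ?thesis
  unfolding smooth_def smoothing_def[abs_def]
  using C_k_compose_affine[OF bounded_linear_scaleR_right] by blast
qed

lemma pderiv_dir_smoothing:
 assumes "r > 0" "integrable lborel h" "e \<in> Basis"
 shows "pderiv_dir e (smoothing c r n h) x = (1 - 1 / (real n + 2)) *R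
   conv (pderiv_dir e (moll (r / (real n + 2)))) h ((1 - 1 / (real n + 2)) *R x + (1 / (real n + 2)) *R c)"
proof -
 let ?l = "1 - 1 / (real n + 2)" and ?m = "moll (r / (real n + 2))"
 let ?a = "%x. ?l *R x + (1 / (real n + 2)) *R c"
 have supp: "!!x. norm x > 2 * (r / (real n + 2)) ==> ?m x = 0"
  using assms(1) moll_support by auto
 have C1: "C_k (Suc 0) ?m" using smooth_moll unfolding smooth_def by blast
 have a: "(?a has_derivative (%v. ?l *R v)) (at x)"
  by (auto intro!: derivative_eq_intros)
 have "(smoothing c r n h has_derivative
   (%v. \<Sum>b\<in>Basis. ((?l *R v) \<bullet> b) *R conv (pderiv_dir b ?m) h (?a x))) (at x)"
  unfolding smoothing_def[abs_def]
  by (rule has_derivative_compose[OF a conv_has_derivative[OF C1 _ assms(2), of "2 * (r / (real n + 2))"]])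
   (rule supp)
 then have "pderiv_dir e (smoothing c r n h) x = (\<Sum>b\<in>Basis. ((?l *R e) \<bullet> b) *R conv (pderiv_dir b ?m) h (?a x))"
  by (rule pderiv_dir_eqI)
 also have "... = ?l *R (\<Sum>b\<in>Basis. (e \<bullet> b) *R conv (pderiv_dir b ?m) h (?a x))"
  by (simp add: scaleR_sum_right)
 finally show ?thesis using assms(3) by (simp add: sum_Basis_pick)
qed

lemma smoothing_bound:
 assumes "r > 0" "integrable lborel h" "AE y in lborel. cmod (h y) <= M"
 shows "cmod (smoothing c r n h z) <= M"
 unfolding smoothing_def using assms by (intro conv_moll_bound) auto

text \<open>The factor 4 pays for the dilation: its ratio is at least 1/2, hence its Jacobian in the
  plane is at least 1/4.\<close>

lemma smoothing_Lp:
 fixes p :: nat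
 assumes p: "p = 1 | p = 2" and r: "r > 0" and [measurable]: "h \<in> bmeas borel"
 shows "(nnl (%x. enn (cmod (smoothing c r n h x) ^ p))) <= 4 * (nnl (%y. enn (cmod (h y) ^ p)))"
proof -
 let ?l = "1 - 1 / (real n + 2)" and ?m = "moll (r / (real n + 2))"
 have l: "?l >= 1/2" by (simp add: field_simps)
 have l2: "1/4 <= ?l\<^sup>2"
  using power_mono[OF l, of 2] by (simp add: power2_eq_square)
 have "(nnl (%z. enn (cmod (conv ?m h z) ^ p)))
  = enn (?l\<^sup>2) * (nnl (%x. enn (cmod (smoothing c r n h x) ^ p)))"
  using nn_integral_affine[of "%z. enn (cmod (conv ?m h z) ^ p)" ?l "(1 / (real n + 2)) *R c"] l
  by (simp add: smoothing_def add.commute power2_eq_square)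
 moreover have "enn (1/4) * (nnl (%x. enn (cmod (smoothing c r n h x) ^ p))) <= enn (?l\<^sup>2) * (nnl (%x. enn (cmod (smoothing c r n h x) ^ p)))"
  using l2 by (intro mult_right_mono ennreal_leI) auto
 ultimately have "enn (1/4) * (nnl (%x. enn (cmod (smoothing c r n h x) ^ p))) <= (nnl (%y. enn (cmod (h y) ^ p)))"
  using conv_Lp[OF p, of "r / (real n + 2)" h] r by (simp add: order_trans)
 then have "enn 4 * (enn (1/4) * (nnl (%x. enn (cmod (smoothing c r n h x) ^ p)))) <= enn 4 * (nnl (%y. enn (cmod (h y) ^ p)))"
  by (rule mult_left_mono) simp
 then show ?thesis
  by (simp add: mult.assoc[symmetric] ennreal_mult'[symmetric] flip: ennreal_numeral)
qed

lemma smoothing_borel [measurable]: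
 assumes [measurable]: "h \<in> bmeas borel"
 shows "smoothing c r n h \<in> bmeas borel"
 unfolding smoothing_def by measurable

text \<open>The limit \<open>a\<close> is tied only to the values of \<open>h\<close> almost
  everywhere near \<open>x\<close>. This allows \<open>x\<close> on the boundary of the domain, in
  particular on the diagonal, for functions extended by zero from a triangle.\<close>

lemma smoothing_pointwise:
 assumes r: "r > 0" and h: "integrable lborel h"
  and loc: "!!e. e > 0 ==> \<exists>d>0. AE y in lborel. dist y x < d --> cmod (h y - a) <= e"
 shows "(%n. smoothing c r n h x) ---> a"
proof (rule LIMSEQ_I)
 fix e :: real assume "e > 0"
 then obtain d where d: "d > 0" "AE y in lborel. dist y x < d --> cmod (h y - a) <= e / 2"
  using loc[of "e/2"] by auto
 \<comment> \<open>The averaging takes place within this distance of \<open>x\<close>: the radius of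
   the kernel plus the displacement of \<open>x\<close> by the dilation towards
   \<open>c\<close>.\<close>
 have "(%n. 2 * (r / (real n + 2)) + norm (c - x) / (real n + 2)) ---> 0"
  by real_asymp
 then have "eventually (%n. 2 * (r / (real n + 2)) + norm (c - x) / (real n + 2) < d) sequentially"
  using d(1) by (rule order_tendstoD(2))
 then obtain N where N: "!!n. n >= N ==> 2 * (r / (real n + 2)) + norm (c - x) / (real n + 2) < d"
  by (auto simp: eventually_sequentially)
 have "cmod (smoothing c r n h x - a) <= e / 2" if "n >= N" for n
  unfolding smoothing_def
 proof (rule conv_moll_dist[OF _ h])
  let ?z = "(1 - 1 / (real n + 2)) *R x + (1 / (real n + 2)) *R c"
  have "dist y x < d" if nz: "moll (r / (real n + 2)) (?z - y) ~= 0" for y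
  proof -
   have 1: "norm (?z - y) <= 2 * (r / (real n + 2))"
    using moll_support[of "r / (real n + 2)" "?z - y"] r nz by (force simp: not_less add.commute)
   have "?z - x = (1 / (real n + 2)) *R (c - x)"
    by (simp add: algebra_simps)
   then have 2: "norm (?z - x) = norm (c - x) / (real n + 2)"
    by (simp add: add.commute)
   have "dist y x <= norm (?z - y) + norm (?z - x)"
    using norm_triangle_ineq4[of "?z - x" "?z - y"] by (simp add: dist_norm algebra_simps)
   then show ?thesis using 1 2 N[OF \<open>n >= N\<close>] by linarith
  qed
  then show "AE y in lborel. moll (r / (real n + 2)) (?z - y) ~= 0 --> cmod (h y - a) <= e / 2"
   using d(2) by auto
 qed (use r in auto)
 then show "\<exists>no. \<forall>n\<ge>no. norm (smoothing c r n h x - a) < e"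
  using \<open>e > 0\<close> by (intro exI[of _ N]) fastforce
qed

lemma smoothing_diff:
 assumes "r > 0" "integrable lborel h" "integrable lborel g"
 shows "smoothing c r n (%x. h x - g x) x = smoothing c r n h x - smoothing c r n g x"
 unfolding smoothing_def conv_def
 using assms by (simp add: scaleR_diff_right integrable_conv_moll)

section \<open>Approximation in the L1 and L2 norms\<close>

lemma bounded_measurable_approx:
 fixes h :: "'a::euclidean_space => complex"
 assumes h: "h \<in> bmeas borel" and bd: "!!x. cmod (h x) <= M" and supp: "!!x. norm x > R ==> h x = 0"
 obtains g where "!!n. continuous_on UNIV (g n)" "!!n x. cmod (g n x) <= M" "!!n x. norm x > R + 1 ==> g n x = 0"
  "AE x in lborel. (%n. g n x) ---> h x"
proof -
 have M: "M >= 0" using order_trans[OF norm_ge_zero bd[of 0]] .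
 have "h \<in> bmeas lebesgue"
  using h by (simp add: measurable_completion)
 then have "h measurable_on UNIV"
  by (subst measurable_on_iff_borel_measurable) auto
 then obtain N g where N: "negligible N" and g: "!!n. continuous_on UNIV (g n)"
  "!!x. x ~: N ==> (%n. g n x) ---> h x"
  unfolding measurable_on_def by auto
 \<comment> \<open>The continuous approximants at hand need not respect the bound or the support.
   Projection onto the ball of radius \<open>M\<close> and multiplication by a Lipschitz cutoff
   enforce both, and neither changes the limit \<open>h x\<close>.\<close>
 define cut where "cut x = max 0 (min 1 (R + 1 - norm x))" for x :: 'a
 define P where "P = closest_point (cball (0::complex) M)"
 have Pc: "continuous_on UNIV P" unfolding P_def
  using M by (intro continuous_on_closest_point) auto
 have Pn: "cmod (P z) <= M" for z
  using closest_point_in_set[of "cball (0::complex) M" z] M by (auto simp: P_def)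
 have Pid: "P z = z" if "cmod z <= M" for z
  using that by (auto simp: P_def intro!: closest_point_self)
 define g' where "g' n x = cut x *R P (g n x)" for n x
 show ?thesis
 proof (rule that[of g'])
  show "continuous_on UNIV (g' n)" for n
   unfolding g'_def cut_def
   by (intro continuous_intros continuous_on_compose2[OF Pc g(1)]) auto
  show "cmod (g' n x) <= M" for n x
  proof -
   have "cut x >= 0" "cut x <= 1" by (auto simp: cut_def)
   then have "cut x * cmod (P (g n x)) <= 1 * M"
    using Pn[of "g n x"] by (intro mult_mono) auto
   then show ?thesis using \<open>cut x >= 0\<close> by (simp add: g'_def)
  qed
  show "g' n x = 0" if "norm x > R + 1" for n x
   using that by (simp add: g'_def cut_def)
  have "AE x in lebesgue. x ~: N"
   using N by (simp add: negligible_iff_null_sets AE_not_in)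
  then have "AE x in lborel. x ~: N"
   by (simp add: AE_completion_iff)
  then show "AE x in lborel. (%n. g' n x) ---> h x"
  proof eventually_elim
   case (elim x)
   have "(%n. P (g n x)) ---> P (h x)"
    using g(2)[OF elim] Pc by (auto simp: continuous_on_eq_continuous_at intro: isCont_tendsto_compose)
   then have "(%n. g' n x) ---> cut x *R h x"
    unfolding g'_def using Pid[OF bd[of x]] by (auto intro!: tendsto_intros)
   moreover have "cut x *R h x = h x"
    using supp[of x] by (cases "norm x > R") (auto simp: cut_def)
   ultimately show ?case by simp
  qed
 qed
qed

lemma nn_integral_dominated_to_0:
 fixes f :: "nat => 'a => real"
 assumes [measurable]: "!!n. f n \<in> bmeas M" and w: "integrable M w"
  and "!!n. AE x in M. 0 <= f n x" "!!n. AE x in M. f n x <= w x" "AE x in M. (%n. f n x) ---> 0"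
 shows "(%n. \<integral>\<^sup>+x. enn (f n x) \<partial>M) ---> 0"
proof -
 have [measurable]: "w \<in> bmeas M" using w by simp
 have "(%n. \<integral>\<^sup>+x. enn (f n x) \<partial>M) ---> (\<integral>\<^sup>+x. 0 \<partial>M)"
 proof (rule nn_integral_dominated_convergence[where w="%x. enn (w x)"])
  show "(\<integral>\<^sup>+x. enn (w x) \<partial>M) < \<infinity>"
  proof (rule le_less_trans)
   show "(\<integral>\<^sup>+x. enn (w x) \<partial>M) <= (\<integral>\<^sup>+x. enn (norm (w x)) \<partial>M)"
    by (intro nn_integral_mono ennreal_leI) simp
  qed (use w in "simp add: integrable_iff_bounded")
  show "AE x in M. (%n. enn (f n x)) ---> 0"
   using assms(5) by eventually_elim (auto simp flip: ennreal_0 intro!: tendsto_ennrealI)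
  show "AE x in M. enn (f n x) <= enn (w x)" for n
   using assms(4)[of n] by eventually_elim (rule ennreal_leI)
 qed auto
 then show ?thesis by simp
qed

lemma integrable_cball_const: "integrable lborel (%x::'a::euclidean_space. c * ind (cball 0 R) x :: real)"
 using emeasure_bounded_finite[of "cball (0::'a) R"]
 by (intro integrable_mult_right) (auto simp: top.not_eq_extremum)

text \<open>Truncate \<open>h\<close> in space and in size, then approximate the truncation by
  bounded continuous functions on a fixed ball, dominated convergence being available in both steps.
  The factor \<open>2 ^ p\<close> comes from the power of a sum of two terms.\<close>

lemma Lp_continuous_approx:
 fixes h :: "'a::euclidean_space => complex" and p :: nat
 assumes p: "p >= 1" and [measurable]: "h \<in> bmeas borel"
  and hp: "integrable lborel (%x. cmod (h x) ^ p)" and e: "e > (0::ennreal)"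
 obtains g M R where "continuous_on UNIV g" "!!x. cmod (g x) <= M" "!!x. norm x > R ==> g x = 0"
  "(nnl (%x. enn (cmod (h x - g x) ^ p))) < e"
proof -
 have double: "eventually (%k. X k * 2 ^ p < d) sequentially"
  if X: "X ---> 0" and d: "d > 0" for X :: "nat => ennreal" and d
 proof -
  have "(2::ennreal) ^ p < top"
   by (simp add: power_less_top_ennreal)
  then have "(%k. 2 ^ p * X k) ---> 2 ^ p * 0"
   using X by (rule ennreal_tendsto_cmult)
  then have "(%k. X k * 2 ^ p) ---> 0" by (simp add: mult.commute)
  then show ?thesis using d by (rule order_tendstoD(2))
 qed
 define hk where "hk k x = (if norm x <= real k & cmod (h x) <= real k then h x else 0)" for k x
 have [measurable]: "hk k \<in> bmeas borel" for k unfolding hk_def by measurable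
 have "(%k. (nnl (%x. enn (cmod (h x - hk k x) ^ p)))) ---> 0"
 proof (rule nn_integral_dominated_to_0[OF _ hp])
  show "AE x in lborel. (%k. cmod (h x - hk k x) ^ p) ---> 0"
  proof (rule AE_I2)
   fix x
   have "eventually (%k. max (norm x) (cmod (h x)) <= real k) sequentially"
    using eventually_ge_at_top[of "nat \<lceil>max (norm x) (cmod (h x))\<rceil>"]
   by eventually_elim linarith
   then have "eventually (%k. cmod (h x - hk k x) ^ p = 0) sequentially"
    by eventually_elim (use p in "auto simp: hk_def")
   then show "(%k. cmod (h x - hk k x) ^ p) ---> 0"
    by (rule tendsto_eventually)
  qed
  show "!!n. AE x in lborel. cmod (h x - hk n x) ^ p <= cmod (h x) ^ p"
   using p by (intro AE_I2) (auto simp: hk_def power_0_left)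
 qed auto
 moreover have e2: "e / 2 > 0" using e by (simp add: ennreal_divide_eq_0_iff zero_less_iff_neq_zero)
 ultimately have "eventually (%k. (nnl (%x. enn (cmod (h x - hk k x) ^ p))) * 2 ^ p < e / 2) sequentially"
  using double by blast
 then obtain k where k: "(nnl (%x. enn (cmod (h x - hk k x) ^ p))) * 2 ^ p < e / 2"
  by (meson eventually_happens trivial_limit_sequentially)
 obtain g where g: "!!n. continuous_on UNIV (g n)" "!!n x. cmod (g n x) <= real k" "!!n x. norm x > real k + 1 ==> g n x = 0"
  "AE x in lborel. (%n. g n x) ---> hk k x"
  by (rule bounded_measurable_approx[of "hk k" "real k" "real k"]) (auto simp: hk_def)
 have [measurable]: "g n \<in> bmeas borel" for n
  using g(1) by (rule borel_measurable_continuous_onI)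
 have "(%n. (nnl (%x. enn (cmod (hk k x - g n x) ^ p)))) ---> 0"
 proof (rule nn_integral_dominated_to_0[OF _ integrable_cball_const[of "(2 * real k) ^ p" "real k + 1"]])
  show "AE x in lborel. (%n. cmod (hk k x - g n x) ^ p) ---> 0"
   using g(4)
  proof eventually_elim
   case (elim x)
   have "(%n. cmod (hk k x - g n x) ^ p) ---> cmod (hk k x - hk k x) ^ p"
    by (intro tendsto_intros elim)
   then show ?case using p by (simp add: power_0_left)
  qed
  have b: "cmod (hk k x) <= real k" for x by (auto simp: hk_def)
  show "AE x in lborel. cmod (hk k x - g n x) ^ p <= (2 * real k) ^ p * ind (cball 0 (real k + 1)) x" for n
  proof (rule AE_I2)
   fix x
   have "cmod (hk k x - g n x) <= 2 * real k"
    using norm_triangle_ineq4[of "hk k x" "g n x"] b[of x] g(2)[of n x] by linarith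
   then have "cmod (hk k x - g n x) ^ p <= (2 * real k) ^ p"
    by (intro power_mono) auto
   moreover have "hk k x - g n x = 0" if "norm x > real k + 1"
    using g(3)[OF that] that by (auto simp: hk_def)
   ultimately show "cmod (hk k x - g n x) ^ p <= (2 * real k) ^ p * ind (cball 0 (real k + 1)) x"
    using p by (auto simp: indicator_def power_0_left)
  qed
 qed auto
 then have "eventually (%n. (nnl (%x. enn (cmod (hk k x - g n x) ^ p))) * 2 ^ p < e / 2) sequentially"
  using e2 double by blast
 then obtain n where n: "(nnl (%x. enn (cmod (hk k x - g n x) ^ p))) * 2 ^ p < e / 2"
  by (meson eventually_happens trivial_limit_sequentially)
 have pw: "cmod (a + b) ^ p <= cmod a ^ p * 2 ^ p + cmod b ^ p * 2 ^ p" for a b :: complex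
 proof -
  have "cmod (a + b) <= 2 * max (cmod a) (cmod b)"
   using norm_triangle_ineq[of a b] by linarith
  then have "cmod (a + b) ^ p <= (2 * max (cmod a) (cmod b)) ^ p"
   by (intro power_mono) auto
  also have "... = 2 ^ p * max (cmod a) (cmod b) ^ p"
   by (rule power_mult_distrib)
  also have "... <= cmod a ^ p * 2 ^ p + cmod b ^ p * 2 ^ p"
   by (cases "cmod a <= cmod b") (simp_all add: mult.commute)
  finally show ?thesis .
 qed
 have "(nnl (%x. enn (cmod (h x - g n x) ^ p))) <=
   (nnl (%x. enn (cmod (h x - hk k x) ^ p) * 2 ^ p + enn (cmod (hk k x - g n x) ^ p) * 2 ^ p))"
 proof (rule nn_integral_mono)
  fix x
  have "enn (cmod (h x - g n x) ^ p) <= enn (cmod (h x - hk k x) ^ p * 2 ^ p + cmod (hk k x - g n x) ^ p * 2 ^ p)"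
   using pw[of "h x - hk k x" "hk k x - g n x"] by (intro ennreal_leI) simp
  also have "... = enn (cmod (h x - hk k x) ^ p) * 2 ^ p + enn (cmod (hk k x - g n x) ^ p) * 2 ^ p"
   by (simp add: ennreal_plus ennreal_mult' flip: ennreal_power ennreal_numeral)
  finally show "enn (cmod (h x - g n x) ^ p) <= enn (cmod (h x - hk k x) ^ p) * 2 ^ p + enn (cmod (hk k x - g n x) ^ p) * 2 ^ p" .
 qed
 also have "... = (nnl (%x. enn (cmod (h x - hk k x) ^ p))) * 2 ^ p + (nnl (%x. enn (cmod (hk k x - g n x) ^ p))) * 2 ^ p"
  by (subst nn_integral_add) (auto simp: nn_integral_multc)
 also have "... < e / 2 + e / 2"
  using k n by (rule add_strict_mono)
 also have "... = e"
 proof -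
  have "(inverse 2 + inverse 2 :: ennreal) = enn (1/2) + enn (1/2)"
   by (simp only: ennreal_half)
  also have "... = 1" by (subst ennreal_plus[symmetric]) auto
  finally show ?thesis
   by (simp add: divide_ennreal_def mult.commute[of e] flip: distrib_right)
 qed
 finally have "(nnl (%x. enn (cmod (h x - g n x) ^ p))) < e" .
 with g(1-3) show ?thesis
  by (rule that[of "g n" "real k" "real k + 1"])
qed

text \<open>The dilation ratio is at least 1/2, so supports spread by at most a fixed amount. This
  provides a dominating function that does not depend on \<open>n\<close>.\<close>

lemma smoothing_eq_0:
 assumes r: "r > 0" and h: "integrable lborel g" and g: "!!y. norm y > R ==> g y = 0"
  and x: "norm x > 2 * ((abs R) + norm c + r)"
 shows "smoothing c r n g x = 0"
proof -
 let ?z = "(1 - 1 / (real n + 2)) *R x + (1 / (real n + 2)) *R c"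
 have "cmod (smoothing c r n g x - 0) <= 0"
  unfolding smoothing_def
 proof (rule conv_moll_dist[OF _ h])
  show "r / (real n + 2) > 0" using r by simp
  show "AE y in lborel. moll (r / (real n + 2)) (?z - y) ~= 0 --> cmod (g y - 0) <= 0"
  proof (intro AE_I2 impI)
   fix y assume "moll (r / (real n + 2)) (?z - y) ~= 0"
   then have "norm (?z - y) <= 2 * (r / (real n + 2))"
    using moll_support[of "r / (real n + 2)" "?z - y"] r by (force simp: not_less)
   also have "... <= r" using r by (simp add: field_simps)
   finally have 1: "norm (?z - y) <= r" .
   have "norm x / 2 <= (1 - 1 / (real n + 2)) * norm x"
    using mult_right_mono[of "1/2" "1 - 1 / (real n + 2)" "norm x"] by (simp add: field_simps)
   also have "... = norm ((1 - 1 / (real n + 2)) *R x)"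
    by simp
   finally have 2: "norm x / 2 <= norm ((1 - 1 / (real n + 2)) *R x)" .
   have "norm ((1 / (real n + 2)) *R c) = (1 / (real n + 2)) * norm c" by simp
   also have "... <= 1 * norm c" by (intro mult_right_mono) auto
   finally have 3: "norm ((1 / (real n + 2)) *R c) <= norm c" by simp
   have "norm ((1 - 1 / (real n + 2)) *R x) <= norm ?z + norm ((1 / (real n + 2)) *R c)"
    using norm_triangle_ineq4[of ?z "(1 / (real n + 2)) *R c"] by simp
   moreover have "norm ?z <= norm y + norm (?z - y)"
    using norm_triangle_ineq[of y "?z - y"] by simp
   ultimately have "norm y > R"
    using 1 2 3 x[unfolded distrib_left] abs_ge_self[of R] norm_ge_zero[of c] r by argo
   then show "cmod (g y - 0) <= 0" using g by simp
  qed
 qed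
 then show ?thesis by simp
qed

lemma integrable_bounded_support:
 fixes g :: "'a::euclidean_space => complex"
 assumes [measurable]: "g \<in> bmeas borel" and "!!x. cmod (g x) <= M" "!!x. norm x > R ==> g x = 0"
 shows "integrable lborel g"
proof (rule B_integrable_bound[OF integrable_cball_const[of M R]])
 have "norm (g x) <= norm (M * ind (cball 0 R) x)" for x
  using assms(3)[of x] order_trans[OF assms(2)[of x] abs_ge_self] by (cases "norm x > R") auto
 then show "AE x in lborel. norm (g x) <= norm (M * ind (cball 0 R) x)"
  by simp
qed simp

lemma smoothing_tendsto_continuous:
 fixes p :: nat
 assumes r: "r > 0" and p: "p >= 1" and g: "continuous_on UNIV g" and M: "!!x. cmod (g x) <= M" and R: "!!x. norm x > R ==> g x = 0"
 shows "(%n. (nnl (%x. enn (cmod (smoothing c r n g x - g x) ^ p)))) ---> 0"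
proof -
 have [measurable]: "g \<in> bmeas borel"
  using g by (rule borel_measurable_continuous_onI)
 have int: "integrable lborel g"
  using integrable_bounded_support[of g M R] M R by auto
 define R' where "R' = 2 * ((abs R) + norm c + r)"
 have R': "R <= R'" using r norm_ge_zero[of c] unfolding R'_def distrib_left by (smt (verit))
 show ?thesis
 proof (rule nn_integral_dominated_to_0[OF _ integrable_cball_const[of "(2 * M) ^ p" R']])
  show "AE x in lborel. cmod (smoothing c r n g x - g x) ^ p <= (2 * M) ^ p * ind (cball 0 R') x" for n
  proof (rule AE_I2)
   fix x
   have "cmod (smoothing c r n g x) <= M"
    by (rule smoothing_bound[OF r int]) (simp add: M)
   then have "cmod (smoothing c r n g x - g x) <= 2 * M"
    using norm_triangle_ineq4[of "smoothing c r n g x" "g x"] M[of x] by linarith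
   then have "cmod (smoothing c r n g x - g x) ^ p <= (2 * M) ^ p"
    by (intro power_mono) auto
   moreover have "smoothing c r n g x - g x = 0" if "norm x > R'"
    using that R' R[of x] smoothing_eq_0[OF r int R, where x=x and c=c and n=n] unfolding R'_def by simp
   ultimately show "cmod (smoothing c r n g x - g x) ^ p <= (2 * M) ^ p * ind (cball 0 R') x"
    using p by (cases "norm x > R'") (auto simp: power_0_left)
  qed
  show "AE x in lborel. (%n. cmod (smoothing c r n g x - g x) ^ p) ---> 0"
  proof (rule AE_I2)
   fix x
   have "(%n. smoothing c r n g x) ---> g x"
   proof (rule smoothing_pointwise[OF r int])
    fix e :: real assume "e > 0"
    moreover have "isCont g x" using g continuous_on_eq_continuous_at[OF open_UNIV] by blast
    ultimately obtain d where "d > 0" "!!y. dist y x < d ==> dist (g y) (g x) < e"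
     unfolding continuous_at_eps_delta by blast
    then show "\<exists>d>0. AE y in lborel. dist y x < d --> cmod (g y - g x) <= e"
     by (intro exI[of _ d]) (auto simp: dist_norm intro!: AE_I2 less_imp_le)
   qed
   then have "(%n. cmod (smoothing c r n g x - g x) ^ p) ---> cmod (g x - g x) ^ p"
    by (intro tendsto_intros)
   then show "(%n. cmod (smoothing c r n g x - g x) ^ p) ---> 0"
    using p by (simp add: power_0_left)
  qed
 qed auto
qed

lemma power_sum3_le:
 fixes p :: nat and a b c :: complex
 assumes "p = 1 | p = 2"
 shows "cmod (a + b + c) ^ p <= 9 * (cmod a ^ p + cmod b ^ p + cmod c ^ p)"
proof -
 have 1: "cmod (a + b + c) <= cmod a + cmod b + cmod c"
  using norm_triangle_ineq[of "a + b" c] norm_triangle_ineq[of a b] by linarith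
 show ?thesis
 proof (cases "p = 1")
  case True
  then show ?thesis using 1 norm_ge_zero[of a] norm_ge_zero[of b] norm_ge_zero[of c]
   by (simp only: power_one_right distrib_left)
 next
  case False
  then have p: "p = 2" using assms by simp
  have "cmod (a + b + c) ^ 2 <= (cmod a + cmod b + cmod c) ^ 2"
   using 1 by (intro power_mono) auto
  also have "... <= 3 * (cmod a ^ 2 + cmod b ^ 2 + cmod c ^ 2)"
   using sum_squares_ge_zero[of "cmod a - cmod b" "cmod b - cmod c"] zero_le_power2[of "cmod a - cmod c"]
   by (simp add: power2_eq_square algebra_simps)
  also have "... <= 9 * (cmod a ^ 2 + cmod b ^ 2 + cmod c ^ 2)"
   by (intro mult_right_mono) auto
  finally show ?thesis using p by simp
 qed
qed

text \<open>Density argument: \<open>h\<close> is close to a continuous function with bounded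
  support, for which convergence is known, and \<open>smoothing_Lp\<close> bounds the smoothing of
  the difference uniformly in \<open>n\<close>.\<close>

lemma smoothing_tendsto_Lp:
 fixes p :: nat
 assumes p: "p = 1 | p = 2" and r: "r > 0" and hi: "integrable lborel h"
  and hp: "integrable lborel (%x. cmod (h x) ^ p)"
 shows "(%n. (nnl (%x. enn (cmod (smoothing c r n h x - h x) ^ p)))) ---> 0"
proof -
 have h[measurable]: "h \<in> bmeas borel" using hi by auto
 have p1: "p >= 1" using p by auto
 have "eventually (%n. (nnl (%x. enn (cmod (smoothing c r n h x - h x) ^ p))) < enn e) sequentially"
  if e: "e > 0" for e :: real
 proof -
  \<comment> \<open>The fractions 1/90 and 1/36 are chosen so that the total 9 * (4/90 + 1/36 +
    1/90) = 3/4 stays below 1.\<close>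
  have "enn (e / 90) > 0" using e by simp
  then obtain g M R where g: "continuous_on UNIV g" "!!x. cmod (g x) <= M" "!!x. norm x > R ==> g x = 0"
   and D: "(nnl (%x. enn (cmod (h x - g x) ^ p))) < enn (e / 90)"
   using Lp_continuous_approx[OF p1 h hp] by blast
  have [measurable]: "g \<in> bmeas borel"
   using g(1) by (rule borel_measurable_continuous_onI)
  have gi: "integrable lborel g"
   using integrable_bounded_support[of g M R] g by auto
  have "eventually (%n. (nnl (%x. enn (cmod (smoothing c r n g x - g x) ^ p))) < enn (e / 36)) sequentially"
   using smoothing_tendsto_continuous[OF r p1 g] e by (intro order_tendstoD(2)[where y=0]) auto
  then show ?thesis
  proof eventually_elim
   case (elim n)
   have "(nnl (%x. enn (cmod (smoothing c r n h x - h x) ^ p))) <=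
    (nnl (%x. enn 9 * (enn (cmod (smoothing c r n (%y. h y - g y) x) ^ p) + enn (cmod (smoothing c r n g x - g x) ^ p) + enn (cmod (h x - g x) ^ p))))"
   proof (rule nn_integral_mono)
    fix x
    have "smoothing c r n h x - h x = smoothing c r n (%y. h y - g y) x + (smoothing c r n g x - g x) + (g x - h x)"
     using smoothing_diff[OF r hi gi, of c n x] by simp
    then have "cmod (smoothing c r n h x - h x) ^ p <= 9 * (cmod (smoothing c r n (%y. h y - g y) x) ^ p + cmod (smoothing c r n g x - g x) ^ p + cmod (h x - g x) ^ p)"
     using power_sum3_le[OF p, of "smoothing c r n (%y. h y - g y) x" "smoothing c r n g x - g x" "g x - h x"]
     by (simp only: norm_minus_commute[of "g x" "h x"])
    then have "enn (cmod (smoothing c r n h x - h x) ^ p) <= enn (9 * (cmod (smoothing c r n (%y. h y - g y) x) ^ p + cmod (smoothing c r n g x - g x) ^ p + cmod (h x - g x) ^ p))"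
     by (rule ennreal_leI)
    also have "... = enn 9 * (enn (cmod (smoothing c r n (%y. h y - g y) x) ^ p) + enn (cmod (smoothing c r n g x - g x) ^ p) + enn (cmod (h x - g x) ^ p))"
     by (simp add: ennreal_mult' ennreal_plus distrib_left del: ennreal_numeral)
    finally show "enn (cmod (smoothing c r n h x - h x) ^ p) <= ..." .
   qed
   also have "... = enn 9 * ((nnl (%x. enn (cmod (smoothing c r n (%y. h y - g y) x) ^ p))) + (nnl (%x. enn (cmod (smoothing c r n g x - g x) ^ p))) + (nnl (%x. enn (cmod (h x - g x) ^ p))))"
    by (simp add: nn_integral_cmult nn_integral_add del: ennreal_numeral)
   also have "... <= enn 9 * (enn 4 * enn (e / 90) + enn (e / 36) + enn (e / 90))"
   proof (intro mult_left_mono add_mono)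
    have "(nnl (%x. enn (cmod (smoothing c r n (%y. h y - g y) x) ^ p))) <= 4 * (nnl (%x. enn (cmod (h x - g x) ^ p)))"
     by (rule smoothing_Lp[OF p r]) measurable
    also have "... <= enn 4 * enn (e / 90)"
     using D by (auto intro!: mult_left_mono)
    finally show "(nnl (%x. enn (cmod (smoothing c r n (%y. h y - g y) x) ^ p))) <= enn 4 * enn (e / 90)" .
   qed (use elim D in auto)
   also have "... = enn (9 * (4 * (e / 90) + e / 36 + e / 90))"
    using e by (simp add: ennreal_mult'[symmetric] ennreal_plus[symmetric] del: ennreal_numeral ennreal_plus)
   also have "... < enn e"
    using e by (intro ennreal_lessI) auto
   finally show ?case .
  qed
 qed
 then show ?thesis by (rule tendsto_zero_ennreal)
qed

section \<open>Weak derivatives\<close>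

lemma test_function_moll:
 assumes "dl > 0" and sub: "!!v. \<bar>fst v\<bar> <= dl ==> \<bar>snd v\<bar> <= dl ==> z + v \<in> Om"
 shows "test_function Om (%y. moll dl (z - y))"
proof -
 let ?C = "cbox (fst z - dl, snd z - dl) (fst z + dl, snd z + dl)"
 have "C_k k (%y. moll dl (- y + z))" for k
  by (rule C_k_compose_affine) (use smooth_moll in "auto simp: smooth_def bounded_linear_minus bounded_linear_ident")
 then have "smooth (%y. moll dl (z - y))"
  by (simp add: smooth_def)
 moreover have "{y. moll dl (z - y) ~= 0} \<subseteq> ?C"
 proof
  fix y assume "y \<in> {y. moll dl (z - y) ~= 0}"
  then have "\<bar>fst (z - y)\<bar> < dl" "\<bar>snd (z - y)\<bar> < dl"
   using moll_zero[OF assms(1), of "z - y"] by force+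
  then show "y \<in> ?C" by (cases y) (auto simp: cbox_Pair_iff)
 qed
 then have cl: "closure {y. moll dl (z - y) ~= 0} \<subseteq> ?C"
  by (rule closure_minimal) (rule closed_cbox)
 moreover have "compact (closure {y. moll dl (z - y) ~= 0})"
  using cl by (meson bounded_cbox bounded_subset closed_closure compact_eq_bounded_closed)
 moreover have "?C \<subseteq> Om"
 proof
  fix y assume "y \<in> ?C"
  then have "z + (y - z) \<in> Om" by (intro sub) (cases y; auto)+
  then show "y \<in> Om" by simp
 qed
 ultimately show ?thesis unfolding test_function_def by blast
qed

lemma pderiv_dir_reflect:
 assumes "smooth psi"
 shows "pderiv_dir e (%y. psi (z - y)) y = - (pderiv_dir e psi (z - y))"
proof -
 have "(psi has_derivative frechet_derivative psi (at (z - y))) (at (z - y))"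
  using smooth_has_derivative[OF assms, of "z - y"] by (metis frechet_derivative_at)
 then have "((%y. psi (z - y)) has_derivative (%v. frechet_derivative psi (at (z - y)) (- v))) (at y)"
  by (rule has_derivative_compose[rotated]) (auto intro!: derivative_eq_intros)
 then have "pderiv_dir e (%y. psi (z - y)) y = frechet_derivative psi (at (z - y)) (- e)"
  by (rule pderiv_dir_eqI)
 also have "... = - frechet_derivative psi (at (z - y)) e"
  using smooth_has_derivative[OF assms, of "z - y"]
  by (metis (no_types, lifting) frechet_derivative_at has_derivative_linear linear_neg)
 finally show ?thesis by (simp add: pderiv_dir_def)
qed

text \<open>The kernel reflected and shifted to \<open>z\<close> is a legitimate test function. Its
  derivative carries a minus sign from the reflection, which cancels the one in the definition of
  the weak derivative.\<close>

lemma has_weak_deriv_conv_moll: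
 assumes w: "has_weak_deriv Om e f g" and d: "dl > 0"
  and sub: "!!v. \<bar>fst v\<bar> <= dl ==> \<bar>snd v\<bar> <= dl ==> z + v \<in> Om"
 shows "conv (pderiv_dir e (moll dl)) (%x. ind Om x *R f x) z = conv (moll dl) (%x. ind Om x *R g x) z"
proof -
 have "(LINT x:Om|lborel. pderiv_dir e (%y. moll dl (z - y)) x *R f x) = - (LINT x:Om|lborel. moll dl (z - x) *R g x)"
  using w test_function_moll[OF d sub] unfolding has_weak_deriv_def by blast
 then have "(LINT x|lborel. - (pderiv_dir e (moll dl) (z - x) *R (ind Om x *R f x))) = - (LINT x|lborel. moll dl (z - x) *R (ind Om x *R g x))"
  unfolding set_lebesgue_integral_def by (simp add: pderiv_dir_reflect[OF smooth_moll] mult.commute)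
 then show ?thesis unfolding conv_def by simp
qed

text \<open>The condition on \<^term>\<open>c\<close> and \<^term>\<open>r\<close> is what makes the smoothing of a function
 on \<^term>\<open>Om\<close> commute with weak derivatives up to the boundary.\<close>

locale convex_domain =
 fixes Om :: "plane set" and c :: "plane" and r :: real
 assumes open_dom: "open Om" and convex_dom: "convex Om" and bounded_dom: "bounded Om" and r_pos: "r > 0"
  and box_in_dom: "!!v. \<bar>fst v\<bar> <= r ==> \<bar>snd v\<bar> <= r ==> c + v \<in> Om"
begin

definition smo :: "nat => (plane => complex) => plane => complex" where
 "smo n f = smoothing c r n (%x. ind Om x *R f x)"

lemma smooth_smo: "set_integrable lborel Om f ==> smooth (smo n f)"
 unfolding smo_def set_integrable_def using smooth_smoothing[OF r_pos] by blast

text \<open>The point is a convex combination of \<open>x\<close>, with weight 1 - 1/(n+2), and of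
  \<open>c + (real n + 2) *R v\<close>, which lies in the box around \<open>c\<close>.\<close>

lemma contraction_in_dom:
 assumes "x \<in> Om" "\<bar>fst v\<bar> <= r / (real n + 2)" "\<bar>snd v\<bar> <= r / (real n + 2)"
 shows "(1 - 1 / (real n + 2)) *R x + (1 / (real n + 2)) *R c + v \<in> Om"
proof -
 have "c + (real n + 2) *R v \<in> Om"
  by (rule box_in_dom) (use assms(2,3) in "simp_all add: abs_mult pos_le_divide_eq mult.commute")
 then have "(1 - 1 / (real n + 2)) *R x + (1 / (real n + 2)) *R (c + (real n + 2) *R v) \<in> Om"
  using convexD_alt[OF convex_dom assms(1), of "c + (real n + 2) *R v" "1 / (real n + 2)"] by simp
 then show ?thesis by (simp add: scaleR_add_right add.assoc)
qed

lemma pderiv_dir_smo: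
 assumes w: "has_weak_deriv Om e f g" and f: "set_integrable lborel Om f" and e: "e \<in> Basis" and x: "x \<in> Om"
 shows "pderiv_dir e (smo n f) x = (1 - 1 / (real n + 2)) *R smo n g x"
proof -
 have "pderiv_dir e (smo n f) x = (1 - 1 / (real n + 2)) *R
   conv (pderiv_dir e (moll (r / (real n + 2)))) (%x. ind Om x *R f x) ((1 - 1 / (real n + 2)) *R x + (1 / (real n + 2)) *R c)"
  unfolding smo_def by (rule pderiv_dir_smoothing[OF r_pos _ e]) (use f in "simp add: set_integrable_def")
 also have "... = (1 - 1 / (real n + 2)) *R smo n g x"
  unfolding smo_def smoothing_def
  by (subst has_weak_deriv_conv_moll[OF w]) (use r_pos contraction_in_dom[OF x] in auto)
 finally show ?thesis .
qed

lemma smo_bound: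
 assumes "set_integrable lborel Om f" "AE x\<in>Om in lborel. cmod (f x) <= M" "M >= 0"
 shows "cmod (smo n f x) <= M"
 unfolding smo_def
proof (rule smoothing_bound[OF r_pos])
 show "AE y in lborel. cmod (ind Om y *R f y) <= M"
  using assms(2) by eventually_elim (use assms(3) in "auto simp: indicator_def")
qed (use assms in "simp add: set_integrable_def")

end

text \<open>On a ball the difference of the two candidates, cut off to the ball, is annihilated by
  all small mollifiers centred near the middle; its smoothings vanish there, while they converge to
  it in L1.\<close>

lemma has_weak_deriv_unique:
 fixes f :: "plane => complex"
 assumes Om: "open Om" and w: "has_weak_deriv Om e f g1" "has_weak_deriv Om e f g2"
 shows "AE x\<in>Om in lborel. g1 x = g2 x"
proof -
 have ball: "\<exists>U. open U & c \<in> U & U \<subseteq> Om & (AE x\<in>U in lborel. g1 x = g2 x)" if c: "c \<in> Om" for c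
 proof -
  obtain rho where rho: "rho > 0" "cball c rho \<subseteq> Om"
   using Om c open_contains_cball by blast
  define h where "h x = ind (cball c rho) x *R (g1 x - g2 x)" for x
  have li: "set_integrable lborel (cball c rho) g1" "set_integrable lborel (cball c rho) g2"
   using w rho unfolding has_weak_deriv_def locally_integrable_def by auto
  then have h: "integrable lborel h"
   unfolding h_def set_integrable_def by (simp add: scaleR_diff_right)
  have [measurable]: "h \<in> bmeas borel" using h by auto
  have z: "smoothing c (rho / 4) n h x = 0" if x: "x \<in> ball c (rho / 2)" for x n
  proof -
   let ?dl = "rho / 4 / (real n + 2)"
   define z where "z = (1 - 1 / (real n + 2)) *R x + (1 / (real n + 2)) *R c"
   have dl: "?dl > 0" "?dl <= rho / 8" using rho by (auto simp: field_simps)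
   have "z - c = (1 - 1 / (real n + 2)) *R (x - c)"
    by (simp add: z_def algebra_simps)
   then have "norm (z - c) = (1 - 1 / (real n + 2)) * norm (x - c)" by simp
   also have "... <= 1 * norm (x - c)" by (intro mult_right_mono) auto
   finally have zc: "norm (z - c) < rho / 2" using x by (simp add: dist_norm norm_minus_commute)
   have sub: "z + v \<in> cball c rho" if "\<bar>fst v\<bar> <= ?dl" "\<bar>snd v\<bar> <= ?dl" for v
   proof -
    have "norm v <= rho / 4"
     using norm_Pair_le[of "fst v" "snd v"] that dl(2) unfolding prod.collapse real_norm_def by argo
    then have "norm (z + v - c) <= rho"
     using norm_triangle_ineq[of "z - c" v] zc rho by (simp add: algebra_simps)
    then show ?thesis by (simp add: dist_norm norm_minus_commute)
   qed
   have t: "test_function Om (%y. moll ?dl (z - y))"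
    by (rule test_function_moll[OF dl(1)]) (rule subsetD[OF rho(2)], rule sub)
   then have eq: "(LINT x:Om|lborel. moll ?dl (z - x) *R g1 x) = (LINT x:Om|lborel. moll ?dl (z - x) *R g2 x)"
    using w(1)[unfolded has_weak_deriv_def, THEN conjunct2, THEN conjunct2, rule_format, OF t]
     w(2)[unfolded has_weak_deriv_def, THEN conjunct2, THEN conjunct2, rule_format, OF t] by simp
   have supp: "ind Om y *R (moll ?dl (z - y) *R g y) = moll ?dl (z - y) *R (ind (cball c rho) y *R g y)" for y and g :: "plane => complex"
   proof (cases "moll ?dl (z - y) = 0")
    case False
    then have "\<bar>fst (y - z)\<bar> <= ?dl" "\<bar>snd (y - z)\<bar> <= ?dl"
     using moll_zero[OF dl(1), of "z - y"] by force+
    then have "y \<in> cball c rho" using sub[of "y - z"] by simp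
    then show ?thesis using rho by (auto simp: indicator_def)
   qed simp
   have "conv (moll ?dl) h z = (LINT y|lborel. moll ?dl (z - y) *R (ind (cball c rho) y *R g1 y) - moll ?dl (z - y) *R (ind (cball c rho) y *R g2 y))"
    unfolding conv_def h_def by (simp only: scaleR_diff_right)
   also have "... = (LINT y|lborel. moll ?dl (z - y) *R (ind (cball c rho) y *R g1 y)) - (LINT y|lborel. moll ?dl (z - y) *R (ind (cball c rho) y *R g2 y))"
    using li unfolding set_integrable_def
    by (intro B_integral_diff integrable_conv_moll[OF dl(1)])
   also have "... = 0"
    using eq unfolding set_lebesgue_integral_def supp by simp
   finally have "conv (moll ?dl) h z = 0" .
   then show ?thesis by (simp add: smoothing_def z_def)
  qed
  have "(%n. (nnl (%x. enn (cmod (smoothing c (rho / 4) n h x - h x) ^ 1)))) ---> 0"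
   using rho h by (intro smoothing_tendsto_Lp) auto
  moreover have "(nnl (%x. enn (cmod (h x)) * ind (ball c (rho / 2)) x)) <= (nnl (%x. enn (cmod (smoothing c (rho / 4) n h x - h x) ^ 1)))" for n
   using z by (intro nn_integral_mono) (auto simp: indicator_def)
  ultimately have "(nnl (%x. enn (cmod (h x)) * ind (ball c (rho / 2)) x)) <= 0"
   by (intro LIMSEQ_le_const) auto
  then have "AE x in lborel. enn (cmod (h x)) * ind (ball c (rho / 2)) x = 0"
   by (subst (asm) le_zero_eq, subst (asm) nn_integral_0_iff_AE) (measurable, simp)
  then have "AE x\<in>ball c (rho / 2) in lborel. g1 x = g2 x"
   by eventually_elim (use rho in "auto simp: h_def indicator_def split: if_splits")
  moreover have "ball c (rho / 2) \<subseteq> Om" using rho by (auto simp: subset_iff)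
  ultimately show ?thesis
   using rho by (intro exI[of _ "ball c (rho / 2)"]) auto
 qed
 \<comment> \<open>The exceptional null set depends on the ball, so a countable subcover is required
   before the null sets are united.\<close>
 define F where "F = {U. open U & U \<subseteq> Om & (AE x\<in>U in lborel. g1 x = g2 x)}"
 have "\<Union> F = Om" using ball unfolding F_def by blast
 moreover obtain F' where F': "F' \<subseteq> F" "countable F'" "\<Union> F' = \<Union> F"
  using Lindelof[of F] unfolding F_def by auto
 moreover have "AE x in lborel. \<forall>U\<in>F'. x \<in> U --> g1 x = g2 x"
  using F' by (subst AE_ball_countable) (auto simp: F_def)
 ultimately have "AE x in lborel. \<forall>U\<in>F'. x \<in> U --> g1 x = g2 x" "Om = \<Union> F'"
  by auto
 then show ?thesis
  by (elim eventually_mono) blast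
qed

section \<open>Square integrable functions\<close>

text \<open>Square integrability over an arbitrary measure. Functions on a domain enter through
  their extension by zero, so that a single set of lemmas covers the line, the plane and all
  subdomains.\<close>

definition sq_int :: "'a measure => ('a => complex) => bool" where
 "sq_int M f \<longleftrightarrow> f \<in> bmeas M & integrable M (%x. (nsq (f x)))"

definition sq_norm :: "'a measure => ('a => complex) => real" where
 "sq_norm M f = sqrt (LINT x|M. (nsq (f x)))"

lemma cmod_indicator_power2: "(nsq (ind Om x *R f x)) = ind Om x *R (nsq (f x))"
 by (simp add: indicator_def)

lemma L2_on_sq_int: "L2_on Om f \<longleftrightarrow> sq_int lborel (%x. ind Om x *R f x)"
 unfolding L2_on_def sq_int_def set_borel_measurable_def set_integrable_def
 by (simp add: cmod_indicator_power2 del: norm_scaleR)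

lemma L2_norm_sq_norm: "L2_norm Om f = sq_norm lborel (%x. ind Om x *R f x)"
 unfolding L2_norm_def sq_norm_def set_lebesgue_integral_def
 by (simp add: cmod_indicator_power2 del: norm_scaleR)

lemma sq_int_measurable [measurable_dest]: "sq_int M f ==> f \<in> bmeas M"
 by (simp add: sq_int_def)

lemma sq_norm_nonneg [simp]: "sq_norm M f >= 0"
 by (simp add: sq_norm_def)

lemma L2_norm_nonneg [simp]: "L2_norm Om f >= 0"
 by (simp add: L2_norm_sq_norm)

lemma sq_norm_power2: "(sq_norm M f)\<^sup>2 = (LINT x|M. (nsq (f x)))"
 by (simp add: sq_norm_def)

lemma sq_int_iff_nn:
 "sq_int M f \<longleftrightarrow> f \<in> bmeas M & (\<integral>\<^sup>+x. enn (nsq (f x)) \<partial>M) < \<infinity>"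
 unfolding sq_int_def by (auto simp: integrable_iff_bounded)

lemma sq_norm_nn: "sq_int M f ==> (\<integral>\<^sup>+x. enn (nsq (f x)) \<partial>M) = enn ((sq_norm M f)\<^sup>2)"
 unfolding sq_norm_power2 by (rule nn_integral_eq_integral) (auto simp: sq_int_def)

lemma sq_int_mult:
 assumes "sq_int M f" "sq_int M g"
 shows "integrable M (%x. f x * g x)"
proof (rule B_integrable_bound)
 show "integrable M (%x. (nsq (f x)) + (nsq (g x)))"
  using assms by (auto simp: sq_int_def)
 show "(%x. f x * g x) \<in> bmeas M"
  using assms by (auto simp: sq_int_def)
 have "cmod a * cmod b <= (nsq a) + (nsq b)" for a b
  using sum_squares_bound[of "cmod a" "cmod b"] mult_nonneg_nonneg[OF norm_ge_zero[of a] norm_ge_zero[of b]]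
  by linarith
 then show "AE x in M. norm (f x * g x) <= norm ((nsq (f x)) + (nsq (g x)))"
  by (auto simp: norm_mult)
qed

lemma sq_int_norm_mult:
 assumes "sq_int M f" "sq_int M g"
 shows "integrable M (%x. cmod (f x) * cmod (g x))"
  "(LINT x|M. cmod (f x) * cmod (g x)) <= sq_norm M f * sq_norm M g"
proof -
 note [measurable] = assms[THEN sq_int_measurable]
 show i: "integrable M (%x. cmod (f x) * cmod (g x))"
  using integrable_norm[OF sq_int_mult[OF assms]] by (simp add: norm_mult)
 have "enn ((LINT x|M. cmod (f x) * cmod (g x))\<^sup>2) = (\<integral>\<^sup>+x. enn (cmod (f x)) * enn (cmod (g x)) \<partial>M)\<^sup>2"
  using i by (simp add: nn_integral_eq_integral ennreal_mult'[symmetric] ennreal_power)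
 also have "... <= (\<integral>\<^sup>+x. enn (cmod (f x)) ^ 2 \<partial>M) * (\<integral>\<^sup>+x. enn (cmod (g x)) ^ 2 \<partial>M)"
  by (rule Cauchy_Schwarz_nn_integral) measurable
 also have "... = enn ((sq_norm M f * sq_norm M g)\<^sup>2)"
  using assms by (simp add: ennreal_power sq_norm_nn ennreal_mult'[symmetric] power_mult_distrib)
 finally have "(LINT x|M. cmod (f x) * cmod (g x))\<^sup>2 <= (sq_norm M f * sq_norm M g)\<^sup>2"
  by (subst (asm) ennreal_le_iff) auto
 then show "(LINT x|M. cmod (f x) * cmod (g x)) <= sq_norm M f * sq_norm M g"
  by (rule power2_le_imp_le) simp
qed

lemma sq_int_CS:
 assumes "sq_int M f" "sq_int M g"
 shows "cmod (LINT x|M. f x * g x) <= sq_norm M f * sq_norm M g"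
 using integral_norm_bound[of M "%x. f x * g x"] sq_int_norm_mult[OF assms] by (simp add: norm_mult)

lemma sq_int_add:
 assumes "sq_int M f" "sq_int M g"
 shows "sq_int M (%x. f x + g x)" "sq_norm M (%x. f x + g x) <= sq_norm M f + sq_norm M g"
proof -
 note [measurable] = assms[THEN sq_int_measurable]
 have i: "integrable M (%x. (nsq (f x)) + 2 * (cmod (f x) * cmod (g x)) + (nsq (g x)))"
  using assms sq_int_norm_mult[OF assms] by (auto simp: sq_int_def)
 have le: "(nsq (f x + g x)) <= (nsq (f x)) + 2 * (cmod (f x) * cmod (g x)) + (nsq (g x))" for x
  using power_mono[OF norm_triangle_ineq[of "f x" "g x"], of 2] by (simp add: power2_sum)
 have i2: "integrable M (%x. (nsq (f x + g x)))"
  by (rule B_integrable_bound[OF i]) (use le in "auto simp: order_trans[OF le abs_ge_self]")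
 then show "sq_int M (%x. f x + g x)"
  by (simp add: sq_int_def)
 have "(sq_norm M (%x. f x + g x))\<^sup>2 <= (LINT x|M. (nsq (f x)) + 2 * (cmod (f x) * cmod (g x)) + (nsq (g x)))"
  unfolding sq_norm_power2 by (rule integral_mono[OF i2 i le])
 also have "... = (sq_norm M f)\<^sup>2 + 2 * (LINT x|M. cmod (f x) * cmod (g x)) + (sq_norm M g)\<^sup>2"
  using assms sq_int_norm_mult[OF assms] by (simp add: sq_int_def sq_norm_power2)
 also have "... <= (sq_norm M f + sq_norm M g)\<^sup>2"
  using sq_int_norm_mult[OF assms] by (simp add: power2_sum)
 finally show "sq_norm M (%x. f x + g x) <= sq_norm M f + sq_norm M g"
  by (rule power2_le_imp_le) simp
qed

lemma sq_int_bounded_mult: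
 assumes f: "sq_int M f" and b: "b \<in> bmeas M" "AE x in M. cmod (b x) <= B" and B: "B >= 0"
 shows "sq_int M (%x. b x * f x)" "sq_norm M (%x. b x * f x) <= B * sq_norm M f"
proof -
 note [measurable] = f[THEN sq_int_measurable] b(1)
 have i: "integrable M (%x. B\<^sup>2 * (nsq (f x)))"
  using f by (auto simp: sq_int_def)
 have le: "AE x in M. (nsq (b x * f x)) <= B\<^sup>2 * (nsq (f x))"
  using b(2) by eventually_elim (auto simp: norm_mult power_mult_distrib intro!: mult_right_mono power_mono)
 have i2: "integrable M (%x. (nsq (b x * f x)))"
  by (rule B_integrable_bound[OF i]) (use le in auto)
 then show "sq_int M (%x. b x * f x)"
  by (simp add: sq_int_def)
 have "(sq_norm M (%x. b x * f x))\<^sup>2 <= (LINT x|M. B\<^sup>2 * (nsq (f x)))"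
  unfolding sq_norm_power2 by (rule integral_mono_AE[OF i2 i le])
 also have "... = (B * sq_norm M f)\<^sup>2"
  by (simp add: power_mult_distrib sq_norm_power2)
 finally show "sq_norm M (%x. b x * f x) <= B * sq_norm M f"
  by (rule power2_le_imp_le) (use B in simp)
qed

lemma sq_int_scale:
 assumes "sq_int M f"
 shows "sq_int M (%x. c * f x)" "sq_norm M (%x. c * f x) = cmod c * sq_norm M f"
 using assms by (auto simp: sq_int_def sq_norm_def norm_mult power_mult_distrib real_sqrt_mult)

lemma sq_int_diff:
 assumes "sq_int M f" "sq_int M g"
 shows "sq_int M (%x. f x - g x)" "sq_norm M (%x. f x - g x) <= sq_norm M f + sq_norm M g"
 using sq_int_add[OF assms(1) sq_int_scale(1)[OF assms(2), of "-1"]] sq_int_scale(2)[OF assms(2), of "-1"]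
 by auto

lemma sq_int_cong_AE:
 assumes "AE x in M. f x = g x" "f \<in> bmeas M" "g \<in> bmeas M"
 shows "sq_int M f \<longleftrightarrow> sq_int M g" "sq_norm M f = sq_norm M g"
proof -
 have 1: "AE x in M. (nsq (f x)) = (nsq (g x))"
  using assms(1) by eventually_elim simp
 show "sq_int M f \<longleftrightarrow> sq_int M g"
  unfolding sq_int_def using assms by (auto intro!: integrable_cong_AE_imp[OF _ _ 1] simp: 1 AE_symmetric[OF 1] intro: integrable_cong_AE_imp[OF _ _ AE_symmetric[OF 1]])
 show "sq_norm M f = sq_norm M g"
  unfolding sq_norm_def using assms by (simp add: integral_cong_AE[OF _ _ 1])
qed

lemma sq_int_bound:
 assumes g: "sq_int M g" and f: "f \<in> bmeas M" and le: "AE x in M. cmod (f x) <= cmod (g x)"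
 shows "sq_int M f" "sq_norm M f <= sq_norm M g"
proof -
 have i: "integrable M (%x. (nsq (g x)))" using g by (simp add: sq_int_def)
 have le2: "AE x in M. (nsq (f x)) <= (nsq (g x))"
  using le by eventually_elim (simp add: power_mono)
 have i2: "integrable M (%x. (nsq (f x)))"
  by (rule B_integrable_bound[OF i]) (use f le2 in auto)
 then show "sq_int M f" using f by (simp add: sq_int_def)
 show "sq_norm M f <= sq_norm M g"
  unfolding sq_norm_def by (intro real_sqrt_le_mono integral_mono_AE[OF i2 i le2])
qed

lemma sq_int_tendsto_integral:
 assumes f: "!!n. sq_int M (f n)" "sq_int M f0" and g: "sq_int M g"
  and lim: "(%n. sq_norm M (%x. f n x - f0 x)) ---> 0"
 shows "(%n. LINT x|M. f n x * g x) ---> (LINT x|M. f0 x * g x)"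
proof (rule LIM_zero_cancel, rule Lim_null_comparison)
 have "(LINT x|M. f n x * g x) - (LINT x|M. f0 x * g x) = (LINT x|M. (f n x - f0 x) * g x)" for n
  using sq_int_mult[OF f(1) g] sq_int_mult[OF f(2) g] by (simp add: left_diff_distrib)
 then show "eventually (%n. norm ((LINT x|M. f n x * g x) - (LINT x|M. f0 x * g x)) <= sq_norm M (%x. f n x - f0 x) * sq_norm M g) sequentially"
  using sq_int_CS[OF sq_int_diff(1)[OF f] g] by simp
 show "(%n. sq_norm M (%x. f n x - f0 x) * sq_norm M g) ---> 0"
  using tendsto_mult_left_zero[OF lim] by simp
qed

lemma sq_int_tendsto_AE_subseq:
 assumes f: "!!n. sq_int M (f n)" "sq_int M f0"
  and lim: "(%n. sq_norm M (%x. f n x - f0 x)) ---> 0"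
 obtains r :: "nat => nat" where "strict_mono r" "AE x in M. (%n. f (r n) x) ---> f0 x"
proof -
 have "\<exists>r::nat=>nat. strict_mono r & (AE x in M. (%n. (nsq (f (r n) x - f0 x))) ---> 0)"
 proof (rule tendsto_L1_AE_subseq)
  show "integrable M (%x. (nsq (f n x - f0 x)))" for n
   using sq_int_diff(1)[OF f] by (simp add: sq_int_def)
  have "(%n. (sq_norm M (%x. f n x - f0 x))\<^sup>2) ---> 0\<^sup>2"
   by (intro tendsto_intros lim)
  then show "(%n. LINT x|M. norm (nsq (f n x - f0 x))) ---> 0"
   by (simp add: sq_norm_power2)
 qed
 then obtain r where r: "strict_mono r" "AE x in M. (%n. (nsq (f (r n) x - f0 x))) ---> 0"
  by blast
 from r(2) have "AE x in M. (%n. f (r n) x) ---> f0 x"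
 proof eventually_elim
  case (elim x)
  then have "(%n. sqrt (nsq (f (r n) x - f0 x))) ---> sqrt 0"
   by (intro tendsto_intros)
  then have "(%n. f (r n) x - f0 x) ---> 0"
   by (simp add: tendsto_norm_zero_iff)
  then show ?case by (rule LIM_zero_cancel)
 qed
 with r(1) show ?thesis using that by blast
qed

lemma sq_int_finite_integrable:
 assumes "sq_int M f" "emeasure M A < \<infinity>" "A \<in> sets M"
 shows "integrable M (%x. ind A x *R f x)"
proof -
 have "sq_int M (%x. ind A x)"
 proof -
  have "(%x. (nsq (ind A x))) = (ind A :: _ => real)"
   by (auto simp: indicator_def)
  then show ?thesis
   using integrable_real_indicator[OF assms(3,2)] assms(3) by (simp add: sq_int_def)
 qed
 moreover have "(%x. ind A x * f x) = (%x. ind A x *R f x)"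
  by (auto simp: indicator_def)
 ultimately show ?thesis
  using sq_int_mult[OF _ assms(1), of "%x. ind A x"] by simp
qed

lemma nn_tendsto_sq_norm:
 assumes "!!n. f n \<in> bmeas M" "(%n. \<integral>\<^sup>+x. enn (nsq (f n x)) \<partial>M) ---> 0"
 shows "(%n. sq_norm M (f n)) ---> 0"
proof -
 have "(%n. enn2real (\<integral>\<^sup>+x. enn (nsq (f n x)) \<partial>M)) ---> enn2real 0"
  using assms(2) by (intro tendsto_enn2real) auto
 then have "(%n. sqrt (enn2real (\<integral>\<^sup>+x. enn (nsq (f n x)) \<partial>M))) ---> sqrt 0"
  by (intro tendsto_real_sqrt) simp
 moreover have "sq_norm M (f n) = sqrt (enn2real (\<integral>\<^sup>+x. enn (nsq (f n x)) \<partial>M))" for n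
  unfolding sq_norm_def using assms(1) by (subst integral_eq_nn_integral) auto
 ultimately show ?thesis by simp
qed

section \<open>Fourier transforms\<close>

lemma cnj_borel [measurable]: "cnj \<in> bmeas borel"
 by (intro borel_measurable_continuous_onI continuous_intros)

text \<open>Domination by a product of two integrable functions of one variable is the situation of
  most interchanges below, so every consequence of Fubini is collected here once.\<close>

lemma fubini_dominated:
 fixes F :: "'a::euclidean_space => 'b::euclidean_space => complex" and g h :: "_ => real"
 assumes [measurable]: "(%(x, y). F x y) \<in> bmeas (borel \<Otimes>\<^sub>M borel)"
  and g: "integrable lborel g" and h: "integrable lborel h"
  and le: "!!x y. cmod (F x y) <= g x * h y"
 shows "integrable (lborel \<Otimes>\<^sub>M lborel) (%(x, y). F x y)"
  "(LINT x|lborel. LINT y|lborel. F x y) = (LINT y|lborel. LINT x|lborel. F x y)"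
  "!!x. integrable lborel (F x)" "!!y. integrable lborel (%x. F x y)"
  "integrable lborel (%x. LINT y|lborel. F x y)" "integrable lborel (%y. LINT x|lborel. F x y)"
proof -
 show i1: "integrable lborel (F x)" for x
  by (rule B_integrable_bound[of _ "%y. g x * h y"])
   (use h order_trans[OF le abs_ge_self] in auto)
 show i2: "integrable lborel (%x. F x y)" for y
  by (rule B_integrable_bound[of _ "%x. g x * h y"])
   (use g order_trans[OF le abs_ge_self] in auto)
 show i: "integrable (lborel \<Otimes>\<^sub>M lborel) (%(x, y). F x y)"
 proof (rule lborel_pair.Fubini_integrable)
  show "integrable lborel (%x. LINT y|lborel. norm (case (x, y) of (x, y) => F x y))"
  proof (rule B_integrable_bound)
   show "integrable lborel (%x. g x * (LINT y|lborel. h y))" using g by simp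
   have "norm (LINT y|lborel. norm (F x y)) <= norm (g x * (LINT y|lborel. h y))" for x
   proof -
    have "norm (LINT y|lborel. norm (F x y)) = (LINT y|lborel. norm (F x y))" by simp
    also have "... <= (LINT y|lborel. g x * h y)"
     by (rule integral_mono) (use i1 h le in auto)
    also have "... = g x * (LINT y|lborel. h y)" by simp
    finally show ?thesis by simp
   qed
   then show "AE x in lborel. norm (LINT y|lborel. norm (case (x, y) of (x, y) => F x y)) <= norm (g x * (LINT y|lborel. h y))"
    by simp
  qed measurable
 qed (use i1 in auto)
 show "(LINT x|lborel. LINT y|lborel. F x y) = (LINT y|lborel. LINT x|lborel. F x y)"
  using lborel_pair.Fubini_integral[OF i] by simp
 show "integrable lborel (%x. LINT y|lborel. F x y)"
  using lborel_pair.integrable_fst[OF i] by simp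
 show "integrable lborel (%y. LINT x|lborel. F x y)"
  using lborel_pair.integrable_snd[OF i] by simp
qed

definition ker :: "real => real => complex" where
 "ker om t = exp (- \<i> * cpx (om * t))"

lemma ker_eq_cis: "ker om t = cis (- (om * t))"
 by (simp add: ker_def cis_conv_exp)

lemma norm_ker [simp]: "cmod (ker om t) = 1"
 by (simp add: ker_eq_cis)

lemma ker_add: "ker (om + eta) t = ker om t * ker eta t" "ker om (s + t) = ker om s * ker om t"
 by (simp_all add: ker_eq_cis cis_mult distrib_left distrib_right)

lemma ker_borel [measurable (raw)]:
 assumes "f \<in> bmeas M" "g \<in> bmeas M"
 shows "(%x. ker (f x) (g x)) \<in> bmeas M"
 unfolding ker_def using assms by measurable

lemma fourier_ker: "fourier f om = (LINT t|lborel. f t * ker om t)"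
 by (simp add: fourier_def ker_def)

lemma integrable_mult_ker: "integrable lborel f ==> integrable lborel (%t. f t * ker om t)"
 by (rule B_integrable_bound[of _ f]) (auto simp: norm_mult)

lemma fourier_borel [measurable]:
 assumes [measurable]: "f \<in> bmeas borel"
 shows "fourier f \<in> bmeas borel"
proof -
 have "(%om. LINT t|lborel. f t * ker om t) \<in> bmeas lborel"
  by measurable
 then show ?thesis by (simp add: fourier_ker[abs_def])
qed

lemma norm_fourier_le:
 "cmod (fourier f om) <= (LINT t|lborel. cmod (f t))"
 unfolding fourier_ker using integral_norm_bound[of lborel "%t. f t * ker om t"] by (simp add: norm_mult)

text \<open>The characteristic function of the standard normal distribution, rescaled by
  \<open>sig\<close>.\<close>

lemma fourier_gaussian:
 fixes sig :: real
 assumes "sig > 0"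
 shows "(LINT om|lborel. cpx (exp (- (sig * om)\<^sup>2 / 2)) * ker om z)
   = cpx (2 * pi / sig * std_normal_density (z / sig))"
proof -
 have "(LINT x|lborel. cpx (std_normal_density x) * iexp (t * x)) = cpx (exp (- t\<^sup>2 / 2))" for t
 proof -
  have "(LINT x|lborel. std_normal_density x *R iexp (t * x)) = (CLINT x|std_normal_distribution. iexp (t * x))"
   by (subst integral_density) auto
  also have "... = cpx (exp (- t\<^sup>2 / 2))"
   using char_std_normal_distribution by (simp add: char_def fun_eq_iff)
  finally show ?thesis by (simp add: scaleR_conv_of_real)
 qed
 from this[of "- z / sig"]
 have "(LINT x|lborel. cpx (std_normal_density x) * iexp (- z / sig * x)) = cpx (exp (- (z / sig)\<^sup>2 / 2))"
  by simp
 moreover have "(LINT x|lborel. cpx (std_normal_density x) * iexp (- z / sig * x))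
   = sig *R (LINT om|lborel. cpx (std_normal_density (sig * om)) * iexp (- z / sig * (sig * om)))"
  by (subst lborel_integral_real_affine[where c=sig and t=0]) (use assms in auto)
 moreover have "(%om. cpx (std_normal_density (sig * om)) * iexp (- z / sig * (sig * om)))
  = (%om. cpx (1 / sqrt (2 * pi)) * (cpx (exp (- (sig * om)\<^sup>2 / 2)) * ker om z))"
  using assms by (intro ext) (simp add: std_normal_density_def ker_def mult_ac)
 ultimately have "cpx sig * (cpx (1 / sqrt (2 * pi)) * (LINT om|lborel. (cpx (exp (- (sig * om)\<^sup>2 / 2)) * ker om z))) = cpx (exp (- (z / sig)\<^sup>2 / 2))"
  by (simp only: integral_mult_right_zero scaleR_conv_of_real)
 then have "(LINT om|lborel. (cpx (exp (- (sig * om)\<^sup>2 / 2)) * ker om z)) = cpx (sqrt (2 * pi) / sig * exp (- (z / sig)\<^sup>2 / 2))"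
  using assms by (simp add: field_simps)
 also have "sqrt (2 * pi) / sig * exp (- (z / sig)\<^sup>2 / 2) = 2 * pi / sig * std_normal_density (z / sig)"
 proof -
  have "2 * pi / sig * std_normal_density (z / sig) = (2 * pi / sqrt (2 * pi)) / sig * exp (- (z / sig)\<^sup>2 / 2)"
   by (simp add: std_normal_density_def)
  moreover have "2 * pi / sqrt (2 * pi) = sqrt (2 * pi)"
   by (rule real_div_sqrt) simp
  ultimately show ?thesis by metis
 qed
 finally show ?thesis .
qed

lemma integrable_gaussian:
 fixes sig :: real
 assumes "sig > 0"
 shows "integrable lborel (%om. exp (- (sig * om)\<^sup>2 / 2))"
proof -
 have "integrable lborel (%om. sqrt (2 * pi) * std_normal_density (0 + sig * om))"
  using assms by (intro integrable_mult_right lborel_integrable_real_affine) auto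
 then show ?thesis by (simp add: std_normal_density_def)
qed

text \<open>Parseval's identity regularised by a Gaussian: the weight makes all integrals absolutely
  convergent, and on the other side it turns into an average of \<open>q\<close> over a normal
  distribution of width \<open>sig\<close>.\<close>

lemma fourier_gaussian_weight:
 assumes q: "integrable lborel q" and s: "sig > 0"
 shows "(LINT om|lborel. cpx (exp (- (sig * om)\<^sup>2 / 2) * (nsq (fourier q om))))
  = cpx (2 * pi) * (LINT x|lborel. q x * (LINT z|lborel. cnj (q (x - sig * z)) * cpx (std_normal_density z)))"
proof -
 let ?G = "%om. exp (- (sig * om)\<^sup>2 / 2)"
 let ?B = "LINT x|lborel. cmod (q x)"
 have [measurable]: "q \<in> bmeas borel" using q by auto
 have qn: "integrable lborel (%x. cmod (q x))" using q by auto
 have G: "integrable lborel ?G" by (rule integrable_gaussian[OF s])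
 have cnjF: "cnj (fourier q om) = (LINT y|lborel. cnj (q y) * ker om (- y))" for om
 proof -
  have "(LINT y|lborel. cnj (q y) * ker om (- y)) = (LINT y|lborel. cnj (q y * ker om y))"
   by (simp add: ker_eq_cis cis_cnj del: B_integral_cnj)
  then show ?thesis
   using B_integral_cnj[of lborel "%y. q y * ker om y"] by (simp only: fourier_ker)
 qed
 have inner: "(LINT om|lborel. cnj (fourier q om) * cpx (?G om) * ker om x)
   = cpx (2 * pi) * (LINT z|lborel. cnj (q (x - sig * z)) * cpx (std_normal_density z))" for x
 proof -
  have "(LINT om|lborel. cnj (fourier q om) * cpx (?G om) * ker om x)
   = (LINT om|lborel. LINT y|lborel. cnj (q y) * (cpx (?G om) * ker om (x - y)))"
  proof (rule B_integral_cong[OF refl])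
   fix om
   have "cnj (fourier q om) * cpx (?G om) * ker om x = (LINT y|lborel. (cnj (q y) * ker om (- y)) * (cpx (?G om) * ker om x))"
    unfolding cnjF by (rule trans[OF mult.assoc integral_mult_left_zero[symmetric]])
   also have "... = (LINT y|lborel. cnj (q y) * (cpx (?G om) * ker om (x - y)))"
    using ker_add(2)[of om x "- _"] by (intro B_integral_cong) (simp_all add: mult_ac)
   finally show "cnj (fourier q om) * cpx (?G om) * ker om x = ..." .
  qed
  also have "... = (LINT y|lborel. LINT om|lborel. cnj (q y) * (cpx (?G om) * ker om (x - y)))"
   by (rule fubini_dominated(2)[where g="?G" and h="%y. cmod (q y)"]) (use G qn in "auto simp: norm_mult")
  also have "... = (LINT y|lborel. cnj (q y) * cpx (2 * pi / sig * std_normal_density ((x - y) / sig)))"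
   using fourier_gaussian[OF s] by simp
  also have "... = \<bar>-sig\<bar> *R (LINT z|lborel. cnj (q (x + (-sig) * z)) * cpx (2 * pi / sig * std_normal_density ((x - (x + (-sig) * z)) / sig)))"
   by (rule lborel_integral_real_affine) (use s in auto)
  also have "... = (LINT z|lborel. sig *R (cnj (q (x + (-sig) * z)) * cpx (2 * pi / sig * std_normal_density ((x - (x + (-sig) * z)) / sig))))"
   using s by simp
  also have "... = (LINT z|lborel. cpx (2 * pi) * (cnj (q (x - sig * z)) * cpx (std_normal_density z)))"
   using s by (intro B_integral_cong) (auto simp: scaleR_conv_of_real field_simps)
  finally show ?thesis by simp
 qed
 have "(LINT om|lborel. cpx (?G om * (nsq (fourier q om))))
  = (LINT om|lborel. LINT x|lborel. q x * (cnj (fourier q om) * cpx (?G om) * ker om x))"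
 proof (rule B_integral_cong[OF refl])
  fix om
  have "cpx (?G om * (nsq (fourier q om))) = cpx (?G om) * (fourier q om * cnj (fourier q om))"
   by (simp only: complex_norm_square of_real_mult)
  also have "... = (LINT x|lborel. q x * ker om x) * (cpx (?G om) * cnj (fourier q om))"
   by (simp add: fourier_ker mult_ac)
  also have "... = (LINT x|lborel. (q x * ker om x) * (cpx (?G om) * cnj (fourier q om)))"
   by simp
  finally show "cpx (?G om * (nsq (fourier q om))) = (LINT x|lborel. q x * (cnj (fourier q om) * cpx (?G om) * ker om x))"
   by (simp add: mult_ac)
 qed
 also have "... = (LINT x|lborel. LINT om|lborel. q x * (cnj (fourier q om) * cpx (?G om) * ker om x))"
 proof (rule fubini_dominated(2)[where g="%om. ?B * ?G om" and h="%x. cmod (q x)"])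
  fix om x
  show "cmod (q x * (cnj (fourier q om) * cpx (?G om) * ker om x)) <= ?B * ?G om * cmod (q x)"
   using norm_fourier_le[of q om] by (auto simp: norm_mult mult_ac intro!: mult_mono)
 qed (use G qn in auto)
 also have "... = (LINT x|lborel. q x * (cpx (2 * pi) * (LINT z|lborel. cnj (q (x - sig * z)) * cpx (std_normal_density z))))"
  by (simp only: integral_mult_right_zero inner)
 also have "... = (LINT x|lborel. cpx (2 * pi) * (q x * (LINT z|lborel. cnj (q (x - sig * z)) * cpx (std_normal_density z))))"
  by (simp only: mult.left_commute)
 finally show ?thesis by (simp only: integral_mult_right_zero)
qed

text \<open>Let the width \<open>sig\<close> tend to 0 in the regularised identity: the Gaussian
  average of \<open>q\<close> converges to \<open>q\<close> by continuity, and on the frequency side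
  the weight never exceeds 1. The right-hand side is allowed to be infinite.\<close>

lemma plancherel_le:
 assumes q: "integrable lborel q" and cont: "continuous_on UNIV q" and bd: "!!x. cmod (q x) <= M"
 shows "enn (2 * pi) * (nnl (%x. enn (nsq (q x)))) <= (nnl (%om. enn (nsq (fourier q om))))"
proof -
 have [measurable]: "q \<in> bmeas borel" using q by auto
 have M: "M >= 0" using order_trans[OF norm_ge_zero bd[of 0]] .
 define sig where "sig n = 1 / (real n + 1)" for n
 have sig: "sig n > 0" for n by (simp add: sig_def)
 have sig0: "sig ---> 0" unfolding sig_def by real_asymp
 define A where "A n x = (LINT z|lborel. cnj (q (x - sig n * z)) * cpx (std_normal_density z))" for n x
 have A: "(%n. A n x) ---> (LINT z|lborel. cnj (q x) * cpx (std_normal_density z))" for x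
  unfolding A_def
 proof (rule integral_dominated_convergence[where w="%z. M * std_normal_density z"])
  show "AE z in lborel. (%n. cnj (q (x - sig n * z)) * cpx (std_normal_density z)) ---> cnj (q x) * cpx (std_normal_density z)"
  proof (rule AE_I2)
   fix z
   have "isCont q x" using cont continuous_on_eq_continuous_at[OF open_UNIV] by blast
   moreover have "(%n. x - sig n * z) ---> x"
    using tendsto_diff[OF tendsto_const[of x] tendsto_mult_left_zero[OF sig0, of z]] by simp
   ultimately have "(%n. q (x - sig n * z)) ---> q x" by (rule isCont_tendsto_compose)
   then show "(%n. cnj (q (x - sig n * z)) * cpx (std_normal_density z)) ---> cnj (q x) * cpx (std_normal_density z)"
    by (intro tendsto_intros)
  qed
  show "(%z. cnj (q (x - sig n * z)) * cpx (std_normal_density z)) \<in> bmeas lborel" for n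
   by measurable
 qed (auto simp: norm_mult intro!: mult_right_mono bd AE_I2)
 have int1: "(LINT z|lborel. cpx (std_normal_density z)) = 1"
  by (simp add: integral_complex_of_real)
 have A': "(%n. A n x) ---> cnj (q x)" for x
  using A[of x] int1 by simp
 have Ab: "cmod (A n x) <= M" for n x
 proof -
  have "cmod (A n x) <= (LINT z|lborel. cmod (cnj (q (x - sig n * z)) * cpx (std_normal_density z)))"
   unfolding A_def by (rule integral_norm_bound)
  also have "... <= (LINT z|lborel. M * std_normal_density z)"
  proof (rule integral_mono)
   show "integrable lborel (%z. cmod (cnj (q (x - sig n * z)) * cpx (std_normal_density z)))"
    by (rule B_integrable_bound[of _ "%z. M * std_normal_density z"])
     (use M in "auto simp: norm_mult abs_mult intro!: mult_right_mono bd")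
  qed (auto simp: norm_mult intro!: mult_right_mono bd)
  finally show ?thesis by simp
 qed
 have [measurable]: "A n \<in> bmeas borel" for n
 proof -
  have "A n \<in> bmeas lborel" unfolding A_def[abs_def] by measurable
  then show ?thesis by simp
 qed
 have lim: "(%n. LINT x|lborel. q x * A n x) ---> (LINT x|lborel. q x * cnj (q x))"
 proof (rule integral_dominated_convergence[where w="%x. M * cmod (q x)"])
  show "AE x in lborel. (%n. q x * A n x) ---> q x * cnj (q x)"
   by (intro AE_I2 tendsto_intros A')
  show "!!n. AE x in lborel. cmod (q x * A n x) <= M * cmod (q x)"
   using mult_left_mono[OF Ab norm_ge_zero] by (intro AE_I2) (simp add: norm_mult mult.commute[of M])
 qed (use q in auto)
 have q2: "integrable lborel (%x. (nsq (q x)))"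
  by (rule B_integrable_bound[of _ "%x. M * cmod (q x)"])
   (use q M in "auto simp: power2_eq_square abs_mult intro!: mult_right_mono bd")
 have "(LINT x|lborel. q x * cnj (q x)) = cpx (LINT x|lborel. (nsq (q x)))"
  by (simp only: complex_norm_square[symmetric] integral_complex_of_real)
 then have lim2: "(%n. Re (cpx (2 * pi) * (LINT x|lborel. q x * A n x))) ---> Re (cpx (2 * pi) * cpx (LINT x|lborel. (nsq (q x))))"
  using lim by (intro tendsto_intros) simp
 have le: "enn (Re (cpx (2 * pi) * (LINT x|lborel. q x * A n x))) <= (nnl (%om. enn (nsq (fourier q om))))" for n
 proof -
  let ?w = "%om. exp (- (sig n * om)\<^sup>2 / 2) * (nsq (fourier q om))"
  have "cpx (2 * pi) * (LINT x|lborel. q x * A n x) = cpx (LINT om|lborel. ?w om)"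
   using fourier_gaussian_weight[OF q sig[of n]] unfolding A_def by (simp only: integral_complex_of_real)
  then have "enn (Re (cpx (2 * pi) * (LINT x|lborel. q x * A n x))) = enn (LINT om|lborel. ?w om)"
   by simp
  also have "... <= (nnl (%om. enn (?w om)))"
   by (cases "integrable lborel ?w") (simp_all add: nn_integral_eq_integral not_integrable_integral_eq)
  also have "... <= (nnl (%om. enn (nsq (fourier q om))))"
   by (intro nn_integral_mono ennreal_leI) (simp add: mult_left_le_one_le)
  finally show ?thesis .
 qed
 have "enn (Re (cpx (2 * pi) * cpx (LINT x|lborel. (nsq (q x))))) <= (nnl (%om. enn (nsq (fourier q om))))"
  by (rule LIMSEQ_le_const2[OF tendsto_ennrealI[OF lim2]]) (use le in auto)
 also have "Re (cpx (2 * pi) * cpx (LINT x|lborel. (nsq (q x)))) = 2 * pi * (LINT x|lborel. (nsq (q x)))"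
  by simp
 finally show ?thesis
  using q2 by (simp add: nn_integral_eq_integral ennreal_mult')
qed

section \<open>Truncated primitives in L2\<close>

lemma continuous_indefinite_integral:
 fixes g :: "real => complex"
 assumes g: "integrable lborel g"
 shows "continuous_on UNIV (%x. LINT s|lborel. ind {..<x} s *R g s)"
proof -
 have [measurable]: "g \<in> bmeas borel" using g by auto
 have "isCont (%x. LINT s|lborel. ind {..<x} s *R g s) x" for x
  unfolding continuous_at_sequentially
 proof (intro allI impI)
  fix X :: "nat => real" assume X: "X ---> x"
  have "(%n. LINT s|lborel. ind {..<X n} s *R g s) ---> (LINT s|lborel. ind {..<x} s *R g s)"
  proof (rule integral_dominated_convergence[where w="%s. cmod (g s)"])
   have "AE s in lborel. s ~= x" by (rule AE_lborel_singleton)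
   then show "AE s in lborel. (%n. ind {..<X n} s *R g s) ---> ind {..<x} s *R g s"
   proof eventually_elim
    case (elim s)
    have "eventually (%n. ind {..<X n} s = (ind {..<x} s :: real)) sequentially"
    proof (cases "s < x")
     case True
     then show ?thesis using order_tendstoD(1)[OF X, of s] by (auto elim: eventually_mono)
    next
     case False
     then have "s > x" using elim by simp
     then show ?thesis using order_tendstoD(2)[OF X, of s] by (auto elim!: eventually_mono)
    qed
    then have "eventually (%n. ind {..<X n} s *R g s = ind {..<x} s *R g s) sequentially"
     by eventually_elim simp
    then show ?case by (rule tendsto_eventually)
   qed
  qed (use g in "auto simp: indicator_def")
  then show "((%x. LINT s|lborel. ind {..<x} s *R g s) \<circ> X) ---> (LINT s|lborel. ind {..<x} s *R g s)"
   by (simp add: o_def)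
 qed
 then show ?thesis by (simp add: continuous_at_imp_continuous_on)
qed

text \<open>The fundamental solution of \<open>q' + q / T\<close>; its Fourier transform 1 / (1 / T
  + i y) has squared inverse modulus 1 / T^2 + y^2.\<close>

definition decay :: "real => real => real" where
 "decay T z = (if z > 0 then exp (- z / T) else 0)"

lemma decay_borel [measurable]: "decay T \<in> bmeas borel"
 unfolding decay_def by measurable

lemma decay_bounds: "0 <= decay T z" "T > 0 ==> decay T z <= 1"
 by (auto simp: decay_def)

lemma integrable_decay:
 assumes T: "T > 0" shows "integrable lborel (decay T)"
proof (rule integrableI_bounded)
 have "((%x. - T * exp (- x / T)) \<longlongrightarrow> 0) at_top"
  using T by real_asymp
 then have "(nnl (%x. enn (exp (- x / T)) * ind {0..} x)) = enn (0 - (- T * exp (- 0 / T)))"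
  by (intro nn_integral_FTC_atLeast) (use T in "auto intro!: derivative_eq_intros")
 moreover have "(nnl (%x. enn (norm (decay T x)))) <= (nnl (%x. enn (exp (- x / T)) * ind {0..} x))"
  by (intro nn_integral_mono) (auto simp: decay_def indicator_def)
 ultimately show "(nnl (%x. enn (norm (decay T x)))) < \<infinity>"
  by (auto simp: le_less_trans)
qed simp

lemma fourier_decay:
 assumes T: "T > 0"
 shows "fourier (%x. cpx (decay T x)) y = 1 / (cpx (1 / T) + \<i> * cpx y)"
proof -
 let ?a = "cpx (1 / T) + \<i> * cpx y"
 have a: "?a ~= 0" using T by (auto simp: complex_eq_iff)
 let ?F = "%x. - (1 / ?a) * exp (- ?a * cpx x)"
 have eq: "exp (- ?a * cpx x) = cpx (exp (- x / T)) * ker y x" for x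
  unfolding ker_def exp_of_real[symmetric] exp_add[symmetric]
  by (rule arg_cong[where f=exp]) (simp add: algebra_simps)
 have "((%n. LINT x|lborel. ind {0..real n} x *R exp (- ?a * cpx x)) ---> (LINT x|lborel. cpx (decay T x) * ker y x))"
 proof (rule integral_dominated_convergence[where w="%x. ind {0} x + decay T x"])
  have "AE x in lborel. x ~= (0::real)" by (rule AE_lborel_singleton)
  then show "AE x in lborel. (%n. ind {0..real n} x *R exp (- ?a * cpx x)) ---> cpx (decay T x) * ker y x"
  proof eventually_elim
   case (elim x)
   have "eventually (%n. x <= real n) sequentially"
    using eventually_ge_at_top[of "nat \<lceil>x\<rceil>"] by eventually_elim linarith
   then have "eventually (%n. ind {0..real n} x *R exp (- ?a * cpx x) = cpx (decay T x) * ker y x) sequentially"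
    by eventually_elim (subst eq, use elim in "auto simp: decay_def indicator_def")
   then show ?case by (rule tendsto_eventually)
  qed
  show "AE x in lborel. norm (ind {0..real n} x *R exp (- ?a * cpx x)) <= ind {0} x + decay T x" for n
   by (intro AE_I2) (auto simp: eq norm_mult decay_def indicator_def)
  show "integrable lborel (%x. ind {0} x + decay T x)"
   using integrable_decay[OF T] by (intro B_integrable_add) (auto intro: integrable_real_indicator)
 qed auto
 moreover have "(LINT x|lborel. ind {0..real n} x *R exp (- ?a * cpx x)) = ?F (real n) - ?F 0" for n
 proof (rule integral_FTC_Icc)
  show "(?F has_vector_derivative exp (- ?a * cpx x)) (at x within {0..real n})" for x
  proof -
   have "((%z. - (1 / ?a) * exp (- ?a * z)) has_field_derivative exp (- ?a * cpx x)) (at (cpx x))"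
   proof -
    have "((%z. - (1 / b) * exp (- b * z)) has_field_derivative exp (- b * w)) (at w)" if "b ~= 0" for b w :: complex
     using that by (auto intro!: derivative_eq_intros)
    then show ?thesis using a by blast
   qed
   then show ?thesis
    by (intro has_vector_derivative_real_field has_vector_derivative_at_within)
  qed
 qed (auto intro!: continuous_intros)
 moreover have "(%n. ?F (real n) - ?F 0) ---> 1 / ?a"
 proof -
  have "(%n. exp (- real n / T)) ---> 0" using T by real_asymp
  then have "(%n. exp (- ?a * cpx (real n))) ---> 0"
   by (intro tendsto_norm_zero_cancel[of "%n. exp (- ?a * cpx (real n))"]) (simp only: eq norm_mult norm_ker norm_of_real, simp)
  then have "(%n. ?F (real n) - ?F 0) ---> - (1 / ?a) * 0 - ?F 0"
   by (intro tendsto_intros)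
  then show ?thesis by simp
 qed
 ultimately show ?thesis
  unfolding fourier_ker by (metis (no_types, lifting) LIMSEQ_unique ext)
qed

text \<open>The truncated primitive is compared with the solution of \<open>q' + q / T = F\<close>, which, unlike
 the primitive, is square integrable on the line with an explicit Fourier transform.\<close>

lemma truncated_primitive_bound:
 fixes F :: "real => complex"
 assumes T: "T > 0" and F: "integrable lborel F" and F0: "!!s. s ~: {0<..<T} ==> F s = 0"
 defines "P \<equiv> %a. LINT s|lborel. ind {..<a} s *R F s"
 shows "(nnl (%a. ind {0<..<T} a * enn (nsq (P a))))
  <= enn (2 / pi) * (nnl (%y. enn ((nsq (fourier F y)) / (1 / T\<^sup>2 + y\<^sup>2))))"
proof -
 have [measurable]: "F \<in> bmeas borel" using F by auto
 have Fn: "integrable lborel (%s. cmod (F s))" using F by auto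
 note Ei = integrable_decay[OF T]
 define q where "q x = (LINT s|lborel. F s * cpx (decay T (x - s)))" for x
 \<comment> \<open>As \<open>F\<close> lives on (0,T), the factor exp (s / T) is at most e. The
   bound splits into a function of \<open>x\<close> and a function of \<open>s\<close>, as Fubini
   demands.\<close>
 have le: "cmod (F s) * decay T (x - s) <= exp 1 * decay T x * cmod (F s)" for s x
 proof (cases "s \<in> {0<..<T} & x > s")
  case True
  have "decay T (x - s) = exp (s / T) * exp (- x / T)"
   using True by (simp add: decay_def exp_add[symmetric] diff_divide_distrib)
  also have "... <= exp 1 * exp (- x / T)"
   using True T by (intro mult_right_mono) auto
  also have "... = exp 1 * decay T x" using True by (simp add: decay_def)
  finally show ?thesis by (metis mult.commute mult_right_mono norm_ge_zero)
 next
  case False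
  then have "cmod (F s) * decay T (x - s) = 0" using F0[of s] by (auto simp: decay_def)
  moreover have "0 <= exp 1 * decay T x * cmod (F s)" using decay_bounds(1)[of T x] by simp
  ultimately show ?thesis by linarith
 qed
 have dom: "cmod (F s * cpx (decay T (x - s)) * c) <= exp 1 * decay T x * cmod (F s)" if "cmod c <= 1" for s x c
 proof -
  have "cmod (F s * cpx (decay T (x - s)) * c) <= cmod (F s) * decay T (x - s) * 1"
   using that decay_bounds(1)[of T "x - s"] unfolding norm_mult norm_of_real abs_of_nonneg[OF decay_bounds(1)]
   by (intro mult_left_mono) auto
  then show ?thesis using le[of s x] by simp
 qed
 have gi: "integrable lborel (%x. exp 1 * decay T x)" using Ei by simp
 note fub1 = fubini_dominated[where F="%x s. F s * cpx (decay T (x - s))" and g="%x. exp 1 * decay T x" and h="%s. cmod (F s)", OF _ gi Fn]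
 have dom1: "cmod (F s * cpx (decay T (x - s))) <= exp 1 * decay T x * cmod (F s)" for s x
  using dom[of 1 s x] by simp
 have qi: "integrable lborel q"
  unfolding q_def by (rule fub1(5)) (use dom1 in auto)
 have qint: "integrable lborel (%s. F s * cpx (decay T (x - s)))" for x
  by (rule fub1(3)) (use dom1 in auto)
 have qb: "cmod (q x) <= (LINT s|lborel. cmod (F s))" for x
 proof -
  have "cmod (q x) <= (LINT s|lborel. cmod (F s * cpx (decay T (x - s))))"
   unfolding q_def by (rule integral_norm_bound)
  also have "... <= (LINT s|lborel. cmod (F s))"
   using integrable_norm[OF qint[of x]] Fn decay_bounds[of T] T by (intro integral_mono) (auto simp: norm_mult mult_left_le)
  finally show ?thesis .
 qed
 have qcont: "continuous_on UNIV q"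
 proof -
  have i: "integrable lborel (%s. cpx (exp (s / T)) * F s)"
  proof (rule B_integrable_bound)
   show "integrable lborel (%s. exp 1 * cmod (F s))" using Fn by simp
   show "AE s in lborel. norm (cpx (exp (s / T)) * F s) <= norm (exp 1 * cmod (F s))"
   proof (rule AE_I2)
    fix s show "norm (cpx (exp (s / T)) * F s) <= norm (exp 1 * cmod (F s))"
     using F0[of s] T by (cases "s \<in> {0<..<T}") (auto simp: norm_mult intro!: mult_right_mono)
   qed
  qed simp
  have "q x = cpx (exp (- x / T)) * (LINT s|lborel. ind {..<x} s *R (cpx (exp (s / T)) * F s))" for x
  proof -
   have "q x = (LINT s|lborel. cpx (exp (- x / T)) * (ind {..<x} s *R (cpx (exp (s / T)) * F s)))"
    unfolding q_def
   proof (rule B_integral_cong[OF refl])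
    fix s
    have "exp (- (x - s) / T) = exp (- x / T) * exp (s / T)"
     by (simp add: exp_add[symmetric] diff_divide_distrib)
    then show "F s * cpx (decay T (x - s)) = cpx (exp (- x / T)) * (ind {..<x} s *R (cpx (exp (s / T)) * F s))"
     by (simp only: decay_def indicator_def) simp
   qed
   then show ?thesis by (simp only: integral_mult_right_zero)
  qed
  then have qeq: "q = (%x. cpx (exp (- x / T)) * (LINT s|lborel. ind {..<x} s *R (cpx (exp (s / T)) * F s)))"
   by blast
  show ?thesis
   unfolding qeq using T by (intro continuous_intros continuous_indefinite_integral i) auto
 qed
 have qF: "fourier q y = fourier F y * (1 / (cpx (1 / T) + \<i> * cpx y))" for y
 proof -
  have "fourier q y = (LINT x|lborel. LINT s|lborel. F s * cpx (decay T (x - s)) * ker y x)"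
   unfolding fourier_ker q_def by simp
  also have "... = (LINT s|lborel. LINT x|lborel. F s * cpx (decay T (x - s)) * ker y x)"
   by (rule fubini_dominated(2)[OF _ gi Fn]) (use dom in auto)
  also have "... = (LINT s|lborel. (F s * ker y s) * fourier (%x. cpx (decay T x)) y)"
  proof (rule B_integral_cong[OF refl])
   fix s
   have "(LINT x|lborel. F s * cpx (decay T (x - s)) * ker y x) = (LINT x|lborel. F s * cpx (decay T x) * ker y (s + x))"
    using lborel_integral_real_affine[of 1 "%x. F s * cpx (decay T (x - s)) * ker y x" s] by simp
   also have "... = (LINT x|lborel. (F s * ker y s) * (cpx (decay T x) * ker y x))"
    by (simp add: ker_add mult_ac)
   finally show "(LINT x|lborel. F s * cpx (decay T (x - s)) * ker y x) = (F s * ker y s) * fourier (%x. cpx (decay T x)) y"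
    by (simp add: fourier_ker)
  qed
  also have "... = fourier F y * (1 / (cpx (1 / T) + \<i> * cpx y))"
   unfolding fourier_decay[OF T] by (simp add: fourier_ker)
  finally show ?thesis .
 qed
 \<comment> \<open>This is the differential equation \<open>q' + q / T = F\<close> integrated from 0
   to \<open>a\<close>, where \<open>q\<close> vanishes at 0.\<close>
 have rel: "P a = q a + cpx (1 / T) * (LINT x|lborel. ind {0<..<a} x *R q x)" if a: "0 < a" for a
 proof -
  have "(LINT x|lborel. ind {0<..<a} x *R q x) = (LINT x|lborel. LINT s|lborel. F s * cpx (decay T (x - s)) * ind {0<..<a} x)"
   unfolding q_def integral_mult_left_zero by (rule B_integral_cong) (auto simp: indicator_def)
  also have "... = (LINT s|lborel. LINT x|lborel. F s * cpx (decay T (x - s)) * ind {0<..<a} x)"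
   by (rule fubini_dominated(2)[OF _ gi Fn]) (use dom in "auto simp: indicator_def")
  also have "... = (LINT s|lborel. cpx T * (ind {..<a} s *R F s - F s * cpx (decay T (a - s))))"
  proof (rule B_integral_cong[OF refl])
   fix s
   show "(LINT x|lborel. F s * cpx (decay T (x - s)) * ind {0<..<a} x) = cpx T * (ind {..<a} s *R F s - F s * cpx (decay T (a - s)))"
   proof (cases "s \<in> {0<..<T} & s < a")
    case True
    have "AE x in lborel. x ~= s & x ~= a"
     using AE_lborel_singleton[of s] AE_lborel_singleton[of a] by eventually_elim auto
    then have "(LINT x|lborel. cpx (decay T (x - s)) * ind {0<..<a} x) = (LINT x|lborel. ind {s..a} x *R cpx (exp (- (x - s) / T)))"
    proof (intro integral_cong_AE)
     assume "AE x in lborel. x ~= s & x ~= a"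
     then show "AE x in lborel. cpx (decay T (x - s)) * ind {0<..<a} x = ind {s..a} x *R cpx (exp (- (x - s) / T))"
      by eventually_elim (use True in "auto simp: decay_def indicator_def")
    qed measurable
    also have "... = cpx (- T * exp (- (a - s) / T)) - cpx (- T * exp (- (s - s) / T))"
    proof (rule integral_FTC_Icc)
     show "((%x. cpx (- T * exp (- (x - s) / T))) has_vector_derivative cpx (exp (- (x - s) / T))) (at x within {s..a})" for x
      by (rule has_vector_derivative_of_real) (use T in "auto simp: has_real_derivative_iff_has_vector_derivative[symmetric] intro!: derivative_eq_intros")
    qed (use True in "auto intro!: continuous_intros")
    finally have "(LINT x|lborel. cpx (decay T (x - s)) * ind {0<..<a} x) = cpx T * (1 - cpx (decay T (a - s)))"
     using True by (simp add: decay_def algebra_simps)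
    then show ?thesis using True
     by (simp only: mult.assoc integral_mult_right_zero) (simp add: algebra_simps)
   next
    case False
    then have "F s = 0 | (\<forall>x\<in>{0<..<a}. decay T (x - s) = 0) & decay T (a - s) = 0 & ind {..<a} s = (0::real)"
     using F0[of s] by (auto simp: decay_def)
    then show ?thesis
    proof
     assume *: "(\<forall>x\<in>{0<..<a}. decay T (x - s) = 0) & decay T (a - s) = 0 & ind {..<a} s = (0::real)"
     then have "(%x. F s * cpx (decay T (x - s)) * ind {0<..<a} x) = (%x. 0)"
      by (auto simp: indicator_def fun_eq_iff)
     then show ?thesis using * by simp
    qed simp
   qed
  qed
  also have "... = cpx T * (P a - q a)"
  proof -
   have "integrable lborel (%s. ind {..<a} s *R F s)"
    using F by (intro integrable_mult_indicator) auto
   then show ?thesis using qint[of a] by (simp add: P_def q_def)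
  qed
  finally show ?thesis using T by (simp add: field_simps)
 qed
 define Q where "Q = (nnl (%x. enn (nsq (q x))))"
 have [measurable]: "q \<in> bmeas borel" using qi by auto
 have CS: "enn (nsq (LINT x|lborel. ind {0<..<a} x *R q x)) <= enn T * Q" if "0 < a" "a < T" for a
 proof -
  have "enn (cmod (LINT x|lborel. ind {0<..<a} x *R q x)) <= (nnl (%x. enn (cmod (ind {0<..<a} x *R q x))))"
   by (rule integral_norm_bound_ennreal) (intro integrable_mult_indicator qi, simp)
  also have "... = (nnl (%x. ind {0<..<a} x * enn (cmod (q x))))"
   by (intro nn_integral_cong) (auto simp: indicator_def)
  finally have "enn (cmod (LINT x|lborel. ind {0<..<a} x *R q x)) ^ 2 <= (nnl (%x. ind {0<..<a} x * enn (cmod (q x)))) ^ 2"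
   by (rule power_mono) simp
  also have "... <= (nnl (%x. (ind {0<..<a} x)\<^sup>2)) * (nnl (%x. (enn (cmod (q x)))\<^sup>2))"
   by (rule Cauchy_Schwarz_nn_integral) measurable
  also have "(%x. (ind {0<..<a} x :: ennreal)\<^sup>2) = ind {0<..<a}"
   by (auto simp: indicator_def)
  also have "(nnl (%x. ind {0<..<a} x)) = enn a"
   using that by simp
  also have "enn a * (nnl (%x. (enn (cmod (q x)))\<^sup>2)) <= enn T * Q"
   using that unfolding Q_def by (intro mult_mono ennreal_leI) (auto simp: ennreal_power)
  finally show ?thesis by (simp add: ennreal_power)
 qed
 have pt: "ind {0<..<T} a * enn (nsq (P a)) <= enn 2 * enn (nsq (q a)) + enn (2 / T) * Q * ind {0<..<T} a" for a
 proof (cases "a \<in> {0<..<T}")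
  case True
  let ?I = "LINT x|lborel. ind {0<..<a} x *R q x"
  have "(nsq (P a)) <= 2 * (nsq (q a)) + 2 * (nsq (cpx (1 / T) * ?I))"
  proof -
   have "cmod (P a) <= cmod (q a) + cmod (cpx (1 / T) * ?I)"
    using rel[of a] True norm_triangle_ineq by auto
   then have "(nsq (P a)) <= (cmod (q a) + cmod (cpx (1 / T) * ?I))\<^sup>2"
    by (rule power_mono) simp
   also have "... <= 2 * (nsq (q a)) + 2 * (nsq (cpx (1 / T) * ?I))"
    using sum_squares_bound[of "cmod (q a)" "cmod (cpx (1 / T) * ?I)"] by (simp only: power2_sum)
   finally show ?thesis .
  qed
  also have "(nsq (cpx (1 / T) * ?I)) = 1 / T\<^sup>2 * (nsq ?I)"
   by (simp only: norm_mult norm_of_real power_mult_distrib power2_abs power_one_over)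
  finally have "enn (nsq (P a)) <= enn (2 * (nsq (q a)) + 2 / T\<^sup>2 * (nsq ?I))"
   by (intro ennreal_leI) simp
  also have "... = enn 2 * enn (nsq (q a)) + enn (2 / T\<^sup>2) * enn (nsq ?I)"
   by (simp only: ennreal_plus ennreal_mult'[symmetric] zero_le_mult_iff zero_le_divide_iff zero_le_numeral zero_le_power2 simp_thms)
  also have "... <= enn 2 * enn (nsq (q a)) + enn (2 / T\<^sup>2) * (enn T * Q)"
   using True CS[of a] by (intro add_left_mono mult_left_mono) auto
  also have "enn (2 / T\<^sup>2) * (enn T * Q) = enn (2 / T) * Q"
   using T by (simp add: mult.assoc[symmetric] ennreal_mult'[symmetric] power2_eq_square)
  finally show ?thesis using True by simp
 qed simp
 have "(nnl (%a. ind {0<..<T} a * enn (nsq (P a)))) <= (nnl (%a. enn 2 * enn (nsq (q a)) + enn (2 / T) * Q * ind {0<..<T} a))"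
  by (intro nn_integral_mono pt)
 also have "... = enn 2 * Q + enn (2 / T) * Q * enn T"
  using T by (subst nn_integral_add) (simp_all add: nn_integral_cmult Q_def del: ennreal_numeral)
 also have "enn (2 / T) * Q * enn T = enn 2 * Q"
  using T by (simp add: mult.commute[of _ Q] mult.assoc ennreal_mult'[symmetric] del: ennreal_numeral)
 \<comment> \<open>The direct term and the averaged term each contribute 2 Q, and 4 = (2 / pi) * (2
   * pi) prepares for Plancherel.\<close>
 also have "enn 2 * Q + enn 2 * Q = enn (2 / pi) * (enn (2 * pi) * Q)"
  by (simp add: mult.assoc[symmetric] ennreal_mult'[symmetric] distrib_right[symmetric] ennreal_plus[symmetric] del: ennreal_numeral ennreal_plus)
 also have "... <= enn (2 / pi) * (nnl (%y. enn (nsq (fourier q y))))"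
  unfolding Q_def by (intro mult_left_mono plancherel_le[OF qi qcont qb]) simp
 also have "(%y. enn (nsq (fourier q y))) = (%y. enn ((nsq (fourier F y)) / (1 / T\<^sup>2 + y\<^sup>2)))"
 proof
  fix y
  have "(nsq (cpx (1 / T) + \<i> * cpx y)) = 1 / T\<^sup>2 + y\<^sup>2"
   by (simp add: cmod_power2 power_one_over)
  then show "enn (nsq (fourier q y)) = enn ((nsq (fourier F y)) / (1 / T\<^sup>2 + y\<^sup>2))"
   by (simp only: qF norm_mult norm_divide norm_one power_mult_distrib power_divide) simp
 qed
 finally show ?thesis .
qed

section \<open>Weighted Fourier norms of truncations\<close>

lemma nn_integral_one_plus_square_powr:
 fixes s :: real
 assumes s: "s > 1/2"
 shows "(nnl (%x. enn ((1 + x\<^sup>2) powr (- s)))) < \<infinity>"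
proof -
 let ?t = "%x::real. enn (x powr (-2 * s)) * ind {1..} x"
 have I: "(nnl (%x. ?t x)) = enn (- (1 powr (-2 * s + 1)) / (-2 * s + 1))"
  by (rule nn_integral_has_integral_lebesgue'[OF _ has_integral_powr_to_inf]) (use s in auto)
 have "enn ((1 + x\<^sup>2) powr (- s)) <= ind {-1..1} x + (?t x + ?t (0 + (-1) * x))" for x
 proof (cases "(abs x) <= 1")
  case True
  have "(1 + x\<^sup>2) powr (- s) <= 1 powr (-s)"
   using s by (intro powr_mono2') auto
  then have "enn ((1 + x\<^sup>2) powr (- s)) <= ind {-1..1} x"
   using True by (simp add: abs_le_iff)
  then show ?thesis by (simp add: add_increasing2)
 next
  case False
  have "(abs x) powr (-2 * s) = (x\<^sup>2) powr (- s)"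
   using False powr_powr[of "(abs x)" 2 "-s"] powr_realpow[of "(abs x)" 2] by (simp add: powr_numeral)
  moreover have "(1 + x\<^sup>2) powr (- s) <= (x\<^sup>2) powr (- s)"
   using s False by (intro powr_mono2') auto
  ultimately have "enn ((1 + x\<^sup>2) powr (- s)) <= enn ((abs x) powr (-2 * s))"
   by (intro ennreal_leI) simp
  also have "... <= ?t x + ?t (0 + (-1) * x)"
   using False by (cases "x > 0") (auto simp: indicator_def)
  finally show ?thesis by (simp add: add_increasing)
 qed
 then have "(nnl (%x. enn ((1 + x\<^sup>2) powr (- s)))) <= (nnl (%x. ind {-1..1} x + (?t x + ?t (0 + (-1) * x))))"
  by (intro nn_integral_mono)
 also have "... = enn 2 + ((nnl (%x. ?t x)) + (nnl (%x. ?t (0 + (-1) * x))))"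
  by (simp add: nn_integral_add)
 also have "(nnl (%x. ?t (0 + (-1) * x))) = (nnl (%x. ?t x))"
  using nn_integral_real_affine[of ?t "-1" 0] by simp
 also have "enn 2 + ((nnl (%x. ?t x)) + (nnl (%x. ?t x))) < \<infinity>"
  unfolding I by simp
 finally show ?thesis .
qed

text \<open>Rescaling frequencies by 1 / T turns 1 / (1 / T^2 + x^2) into the fixed weight 1 / (1 +
  x^2) and releases one factor T, the one that ends up in the theorem.\<close>

lemma nn_integral_resolvent_scale:
 assumes T: "T > 0" and [measurable]: "g \<in> bmeas borel"
 shows "(nnl (%x. enn (1 / (1 / T\<^sup>2 + x\<^sup>2)) * g x))
  = enn T * (nnl (%x. enn (1 / (1 + x\<^sup>2)) * g (x / T)))"
proof -
 have "(nnl (%x. enn (1 / (1 / T\<^sup>2 + x\<^sup>2)) * g x)) = enn (1 / T) * (nnl (%x. enn (1 / (1 / T\<^sup>2 + (x / T)\<^sup>2)) * g (x / T)))"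
  using nn_integral_real_affine[of "%x. enn (1 / (1 / T\<^sup>2 + x\<^sup>2)) * g x" "1 / T" 0] T by simp
 also have "(%x. enn (1 / (1 / T\<^sup>2 + (x / T)\<^sup>2)) * g (x / T)) = (%x. enn (T\<^sup>2) * (enn (1 / (1 + x\<^sup>2)) * g (x / T)))"
 proof
  fix x
  have "1 / (1 / T\<^sup>2 + (x / T)\<^sup>2) = T\<^sup>2 * (1 / (1 + x\<^sup>2))"
   using T by (simp add: power_divide add_divide_distrib[symmetric])
  then show "enn (1 / (1 / T\<^sup>2 + (x / T)\<^sup>2)) * g (x / T) = enn (T\<^sup>2) * (enn (1 / (1 + x\<^sup>2)) * g (x / T))"
   by (simp only: ennreal_mult'[OF zero_le_power2] mult.assoc)
 qed
 also have "enn (1 / T) * (nnl (%x. enn (T\<^sup>2) * (enn (1 / (1 + x\<^sup>2)) * g (x / T))))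
  = enn T * (nnl (%x. enn (1 / (1 + x\<^sup>2)) * g (x / T)))"
  using T by (subst nn_integral_cmult) (auto simp: mult.assoc[symmetric] ennreal_mult'[symmetric] power2_eq_square)
 finally show ?thesis .
qed

text \<open>A variant of Peetre's inequality in additive form. The power of the difference is
  homogeneous, so it scales exactly under the substitution x / T.\<close>

lemma powr_one_plus_square_le:
 fixes a :: real
 assumes a: "0 <= a" "a <= 1"
 shows "(1 + x\<^sup>2) powr a <= 4 * ((1 + y\<^sup>2) powr a + \<bar>x - y\<bar> powr (2 * a))"
proof -
 have sq: "\<bar>x - y\<bar> powr (2 * a) = ((x - y)\<^sup>2) powr a" if "x ~= y"
  using that powr_powr[of "\<bar>x - y\<bar>" 2 a] by (simp add: powr_numeral)
 have "1 + x\<^sup>2 <= 2 * (1 + y\<^sup>2) + 2 * (x - y)\<^sup>2"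
  using zero_le_power2[of "2 * y - x"] by (simp add: power2_eq_square algebra_simps)
 also have "... <= 4 * max (1 + y\<^sup>2) ((x - y)\<^sup>2)"
 proof -
  have "2 * a + 2 * b <= 4 * max a b" for a b :: real by auto
  then show ?thesis .
 qed
 finally have "(1 + x\<^sup>2) powr a <= (4 * max (1 + y\<^sup>2) ((x - y)\<^sup>2)) powr a"
  using a by (intro powr_mono2) auto
 also have "... = 4 powr a * max (1 + y\<^sup>2) ((x - y)\<^sup>2) powr a"
  by (rule powr_mult)
 also have "... <= 4 * max (1 + y\<^sup>2) ((x - y)\<^sup>2) powr a"
  using powr_mono[of a 1 "4::real"] a by (intro mult_right_mono) auto
 also have "max (1 + y\<^sup>2) ((x - y)\<^sup>2) powr a <= (1 + y\<^sup>2) powr a + \<bar>x - y\<bar> powr (2 * a)"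
 proof (cases "x = y")
  case True
  then show ?thesis by simp
 next
  case False
  then show ?thesis using sq by (auto simp: max_def)
 qed
 finally show ?thesis by simp
qed

lemma abs_powr_le: "(abs x) powr (2 * a) <= (1 + x\<^sup>2) powr a" if "a >= 0" for x a :: real
proof (cases "x = 0")
 case False
 then have "(abs x) powr (2 * a) = (x\<^sup>2) powr a"
  using powr_powr[of "(abs x)" 2 a] by (simp add: powr_numeral)
 also have "... <= (1 + x\<^sup>2) powr a" using that by (intro powr_mono2) auto
 finally show ?thesis .
qed simp

text \<open>The excess \<open>T powr (-2 * nu)\<close> for positive \<open>nu\<close> cannot be absorbed pointwise; it is treated
 in \<open>low_frequency_bound\<close> below.\<close>

lemma resolvent_weight_bound:
 fixes nu :: real
 assumes nu: "-1/2 < nu" "nu < 1/2"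
 obtains C where "C > 0" "!!T z. 0 < T ==>
  (nnl (%om. enn ((1 + om\<^sup>2) powr nu * (1 / (1 / T\<^sup>2 + (z - om)\<^sup>2)))))
   <= enn (C * T * ((1 + z\<^sup>2) powr nu + (if nu > 0 then T powr (-2 * nu) else 0)))"
proof -
 define mu where "mu = (abs nu)"
 have mu: "0 <= mu" "mu < 1/2" using nu by (auto simp: mu_def)
 \<comment> \<open>The exponent 1 - mu exceeds 1/2, so one finite integral dominates both 1 / (1 +
   x^2) and its product with \<open>(abs x) powr (2 * mu)\<close>.\<close>
 define J where "J = (nnl (%x. enn ((1 + x\<^sup>2) powr (- (1 - mu)))))"
 have J: "J < \<infinity>" unfolding J_def using mu by (intro nn_integral_one_plus_square_powr) auto
 define j where "j = enn2real J"
 have j: "J = enn j" "j >= 0" using J by (auto simp: j_def)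
 have one: "1 / (1 + x\<^sup>2) = (1 + x\<^sup>2) powr (-1)" for x :: real
  using powr_minus_divide[of "1 + x\<^sup>2" 1] by (simp add: add_nonneg_eq_0_iff)
 have base0: "(nnl (%x. enn (1 / (1 + x\<^sup>2)))) <= enn j"
  unfolding j(1)[symmetric] J_def
 proof (intro nn_integral_mono ennreal_leI)
  fix x :: real
  show "1 / (1 + x\<^sup>2) <= (1 + x\<^sup>2) powr (- (1 - mu))"
   unfolding one using mu by (intro powr_mono) auto
 qed
 have basel: "(nnl (%x. enn (1 / (1 + x\<^sup>2)) * enn ((abs x) powr (2 * mu)))) <= enn j"
  unfolding j(1)[symmetric] J_def
 proof (intro nn_integral_mono)
  fix x :: real
  have "1 / (1 + x\<^sup>2) * (abs x) powr (2 * mu) <= (1 + x\<^sup>2) powr (-1) * (1 + x\<^sup>2) powr mu"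
   unfolding one using mu by (intro mult_left_mono abs_powr_le) auto
  also have "... = (1 + x\<^sup>2) powr (- (1 - mu))"
   unfolding powr_add[symmetric] by simp
  finally show "enn (1 / (1 + x\<^sup>2)) * enn ((abs x) powr (2 * mu)) <= enn ((1 + x\<^sup>2) powr (- (1 - mu)))"
   by (simp add: ennreal_mult'[symmetric] ennreal_leI)
 qed
 have R0: "(nnl (%x. enn (1 / (1 / T\<^sup>2 + x\<^sup>2)))) <= enn (T * j)" if "T > 0" for T
  using nn_integral_resolvent_scale[OF that, of "%_. 1"] mult_left_mono[OF base0, of "enn T"] that
  by (simp add: ennreal_mult')
 have Rl: "(nnl (%x. enn (1 / (1 / T\<^sup>2 + x\<^sup>2)) * enn ((abs x) powr (2 * mu)))) <= enn (T * (T powr (-2 * mu) * j))" if T: "T > 0" for T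
 proof -
  have "(nnl (%x. enn (1 / (1 / T\<^sup>2 + x\<^sup>2)) * enn ((abs x) powr (2 * mu))))
   = enn T * (nnl (%x. enn (1 / (1 + x\<^sup>2)) * enn (\<bar>x / T\<bar> powr (2 * mu))))"
   by (rule nn_integral_resolvent_scale[OF T]) measurable
  also have "(%x. enn (1 / (1 + x\<^sup>2)) * enn (\<bar>x / T\<bar> powr (2 * mu))) = (%x. enn (T powr (-2 * mu)) * (enn (1 / (1 + x\<^sup>2)) * enn ((abs x) powr (2 * mu))))"
  proof
   fix x
   have "\<bar>x / T\<bar> powr (2 * mu) = T powr (-2 * mu) * (abs x) powr (2 * mu)"
    using T by (simp add: abs_divide powr_divide powr_minus_divide)
   then show "enn (1 / (1 + x\<^sup>2)) * enn (\<bar>x / T\<bar> powr (2 * mu)) = enn (T powr (-2 * mu)) * (enn (1 / (1 + x\<^sup>2)) * enn ((abs x) powr (2 * mu)))"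
    by (simp only: ennreal_mult'[OF powr_ge_zero] mult_ac)
  qed
  also have "(nnl (%x. enn (T powr (-2 * mu)) * (enn (1 / (1 + x\<^sup>2)) * enn ((abs x) powr (2 * mu))))) <= enn (T powr (-2 * mu)) * enn j"
   by (subst nn_integral_cmult) (auto intro!: mult_left_mono basel)
  finally show ?thesis
   using T by (simp add: ennreal_mult' mult_left_mono)
 qed
 have shift: "(nnl (%om. h (z - om))) = (nnl (%x. h x))" if [measurable]: "h \<in> bmeas borel" for h :: "real => ennreal" and z
  by (rule nn_integral_reflect_shift) measurable
 define C where "C = 4 * (2 * j + 2 / (1 - 2 * mu) + 1)"
 have C0: "C > 0" using j mu by (simp add: C_def add_nonneg_pos)
 have Cj: "4 * j <= C" "8 * j <= C" "4 * (2 * j + 2 / (1 - 2 * mu)) <= C"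
  using j mu by (auto simp: C_def)
 show ?thesis
 proof (rule that[OF C0])
  fix T z :: real assume T: "0 < T"
  let ?R = "%x. 1 / (1 / T\<^sup>2 + x\<^sup>2)"
  have R: "?R x >= 0" for x by simp
  show "(nnl (%om. enn ((1 + om\<^sup>2) powr nu * ?R (z - om))))
   <= enn (C * T * ((1 + z\<^sup>2) powr nu + (if nu > 0 then T powr (-2 * nu) else 0)))"
  proof (cases "nu >= 0")
   case True
   then have numu: "nu = mu" by (simp add: mu_def)
   have pt: "enn ((1 + om\<^sup>2) powr nu * ?R (z - om)) <= enn (4 * (1 + z\<^sup>2) powr nu) * enn (?R (z - om)) + enn 4 * (enn (?R (z - om)) * enn (\<bar>z - om\<bar> powr (2 * mu)))" for om
   proof -
    have "(1 + om\<^sup>2) powr nu * ?R (z - om) <= 4 * ((1 + z\<^sup>2) powr nu + \<bar>om - z\<bar> powr (2 * nu)) * ?R (z - om)"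
     using powr_one_plus_square_le[of nu om z] nu True by (intro mult_right_mono R) auto
    also have "... = 4 * (1 + z\<^sup>2) powr nu * ?R (z - om) + 4 * (?R (z - om) * \<bar>z - om\<bar> powr (2 * mu))"
     by (simp only: numu abs_minus_commute[of om z] distrib_left distrib_right mult_ac)
    finally have "enn ((1 + om\<^sup>2) powr nu * ?R (z - om)) <= enn (4 * (1 + z\<^sup>2) powr nu * ?R (z - om) + 4 * (?R (z - om) * \<bar>z - om\<bar> powr (2 * mu)))"
     by (rule ennreal_leI)
    also have "... = enn (4 * (1 + z\<^sup>2) powr nu * ?R (z - om)) + enn (4 * (?R (z - om) * \<bar>z - om\<bar> powr (2 * mu)))"
     by (rule ennreal_plus) auto
    also have "... = enn (4 * (1 + z\<^sup>2) powr nu) * enn (?R (z - om)) + enn 4 * (enn (?R (z - om)) * enn (\<bar>z - om\<bar> powr (2 * mu)))"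
     by (subst ennreal_mult'[symmetric], simp)+ simp
    finally show ?thesis .
   qed
   have "(nnl (%om. enn ((1 + om\<^sup>2) powr nu * ?R (z - om))))
    <= (nnl (%om. enn (4 * (1 + z\<^sup>2) powr nu) * enn (?R (z - om)) + enn 4 * (enn (?R (z - om)) * enn (\<bar>z - om\<bar> powr (2 * mu)))))"
    by (intro nn_integral_mono pt)
   also have "... = enn (4 * (1 + z\<^sup>2) powr nu) * (nnl (%x. enn (?R x))) + enn 4 * (nnl (%x. enn (?R x) * enn ((abs x) powr (2 * mu))))"
    using shift[of "%x. enn (?R x)" z] shift[of "%x. enn (?R x) * enn ((abs x) powr (2 * mu))" z]
    by (simp add: nn_integral_add nn_integral_cmult del: ennreal_numeral)
   also have "... <= enn (4 * (1 + z\<^sup>2) powr nu) * enn (T * j) + enn 4 * enn (T * (T powr (-2 * mu) * j))"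
    by (intro add_mono mult_left_mono R0 Rl T) auto
   also have "... = enn (4 * j * T * ((1 + z\<^sup>2) powr nu + T powr (-2 * nu)))"
    using T j(2) by (simp add: ennreal_mult'[symmetric] ennreal_plus[symmetric] numu algebra_simps del: ennreal_plus ennreal_numeral)
   also have "... <= enn (C * T * ((1 + z\<^sup>2) powr nu + (if nu > 0 then T powr (-2 * nu) else 0)))"
   proof (cases "nu > 0")
    case True
    then show ?thesis
     using T mult_right_mono[OF Cj(1), of "T * ((1 + z\<^sup>2) powr nu + T powr (-2 * nu))"]
     by (intro ennreal_leI) (simp add: mult.assoc)
   next
    case False
    then have "nu = 0" using \<open>nu >= 0\<close> by simp
    then show ?thesis
     using T mult_right_mono[OF Cj(2), of T] power2_eq_square[of z] add_nonneg_eq_0_iff[of 1 "z\<^sup>2"] by (intro ennreal_leI) simp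
   qed
   finally show ?thesis .
  next
   case False
   then have numu: "nu = - mu" and mu0: "mu > 0" by (auto simp: mu_def)
   let ?S = "%om. (abs om) powr (-2 * mu)"
   \<comment> \<open>For negative \<open>nu\<close> the weight is replaced by the larger homogeneous
     power, which is singular at 0. On the natural scale 1 / T the singularity is integrable because
     2 mu < 1, and the value is a power of T.\<close>
   let ?near = "%om. enn (?S om) * ind {-(1/T)..1/T} om"
   have near: "(nnl (%om. ?near om)) <= enn (2 * ((1/T) powr (1 - 2 * mu) / (1 - 2 * mu)))"
   proof -
    let ?h = "%x. enn (x powr (-2 * mu)) * ind {0..1/T} x"
    have I: "(nnl (%x. ?h x)) = enn ((1/T) powr (-2 * mu + 1) / (-2 * mu + 1))"
     by (rule nn_integral_has_integral_lebesgue'[OF _ has_integral_powr_from_0]) (use T mu in auto)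
    have "?near om <= ?h om + ?h (0 + (-1) * om)" for om
     by (cases "om >= 0") (auto simp: indicator_def)
    then have "(nnl (%om. ?near om)) <= (nnl (%om. ?h om + ?h (0 + (-1) * om)))"
     by (intro nn_integral_mono)
    also have "... = (nnl (%om. ?h om)) + (nnl (%om. ?h (0 + (-1) * om)))"
     by (intro nn_integral_add) measurable
    also have "(nnl (%om. ?h (0 + (-1) * om))) = (nnl (%x. ?h x))"
     using nn_integral_real_affine[of ?h "-1" 0] by simp
    finally show ?thesis
     unfolding I using mu by (simp add: ennreal_plus[symmetric] del: ennreal_plus)
   qed
   have tpow: "T powr (2 - 2 * mu) * (1/T) powr (1 - 2 * mu) = T" "T powr (2 * mu) * T powr (-2 * mu) = 1"
   proof -
    have "(1 / T) powr (1 - 2 * mu) = T powr (- (1 - 2 * mu))"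
     unfolding powr_minus_divide using T powr_divide[of 1 T "1 - 2 * mu"] by simp
    then have "T powr (2 - 2 * mu) * (1 / T) powr (1 - 2 * mu) = T powr (2 - 2 * mu + - (1 - 2 * mu))"
     by (simp only: powr_add)
    then show "T powr (2 - 2 * mu) * (1/T) powr (1 - 2 * mu) = T" using T by simp
    show "T powr (2 * mu) * T powr (-2 * mu) = 1"
     using T by (simp add: powr_add[symmetric])
   qed
   have pt: "enn ((1 + om\<^sup>2) powr nu * ?R (z - om)) <= enn (4 * (1 + z\<^sup>2) powr nu) * (enn (?R (z - om))
     + (enn (T powr (2 - 2 * mu)) * ?near om + enn (T powr (2 * mu)) * (enn (?R (z - om)) * enn (\<bar>z - om\<bar> powr (2 * mu)))))" if om0: "om ~= 0" for om
   proof -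
    let ?p = "?R (z - om) * \<bar>z - om\<bar> powr (2 * mu)"
    have pos: "(1 + x\<^sup>2) powr a > 0" for x a :: real
     by (simp add: add_nonneg_eq_0_iff)
    \<comment> \<open>With these relations Peetre's inequality for the positive exponent, multiplied
      by both negative powers, becomes an inequality for the negative exponent.\<close>
    have inv: "(1 + om\<^sup>2) powr nu * (1 + om\<^sup>2) powr mu = 1" "(1 + z\<^sup>2) powr nu * (1 + z\<^sup>2) powr mu = 1"
     unfolding numu by (simp_all add: powr_add[symmetric] add_nonneg_eq_0_iff)
    have "(1 + z\<^sup>2) powr mu <= 4 * ((1 + om\<^sup>2) powr mu + \<bar>z - om\<bar> powr (2 * mu))"
     using powr_one_plus_square_le[of mu z om] mu by auto
    then have "(1 + z\<^sup>2) powr mu * ((1 + om\<^sup>2) powr nu * (1 + z\<^sup>2) powr nu) <= 4 * ((1 + om\<^sup>2) powr mu + \<bar>z - om\<bar> powr (2 * mu)) * ((1 + om\<^sup>2) powr nu * (1 + z\<^sup>2) powr nu)"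
     using pos by (intro mult_right_mono) auto
    then have "(1 + om\<^sup>2) powr nu <= 4 * (1 + z\<^sup>2) powr nu * (1 + \<bar>z - om\<bar> powr (2 * mu) * (1 + om\<^sup>2) powr nu)"
    proof -
     have "b <= 4 * c * (1 + e * b)" if "d * (b * c) <= 4 * (a + e) * (b * c)" "b * a = 1" "c * d = 1" for a b c d e :: real
     proof -
      have e1: "d * (b * c) = b" using that(3) by algebra
      have e2: "4 * (a + e) * (b * c) = 4 * c * (1 + e * b)" using that(2) by algebra
      show ?thesis using that(1) unfolding e1 e2 .
     qed
     then show ?thesis using inv \<open>(1 + z\<^sup>2) powr mu * ((1 + om\<^sup>2) powr nu * (1 + z\<^sup>2) powr nu) <= _\<close> by blast
    qed
    also have "... <= 4 * (1 + z\<^sup>2) powr nu * (1 + \<bar>z - om\<bar> powr (2 * mu) * ?S om)"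
    proof -
     have "(1 + om\<^sup>2) powr nu <= ?S om"
      unfolding numu using om0 powr_powr[of "(abs om)" 2 "-mu"] mu powr_mono2'[of "-mu" "om\<^sup>2" "1 + om\<^sup>2"] by (simp add: powr_numeral)
     then show ?thesis by (intro mult_left_mono add_left_mono) auto
    qed
    finally have 1: "(1 + om\<^sup>2) powr nu * ?R (z - om) <= 4 * (1 + z\<^sup>2) powr nu * (1 + \<bar>z - om\<bar> powr (2 * mu) * ?S om) * ?R (z - om)"
     by (rule mult_right_mono[OF _ R])
    \<comment> \<open>For |om| up to 1 / T the factor \<open>?p\<close> is bounded by its supremum
      and the singular power is kept; beyond 1 / T the power is bounded by its value there and
      \<open>?p\<close> is kept.\<close>
    have 2: "enn (?p * ?S om) <= enn (T powr (2 - 2 * mu)) * ?near om + enn (T powr (2 * mu)) * enn ?p"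
    proof (cases "(abs om) <= 1 / T")
     case True
     have "?p <= T powr (2 - 2 * mu)"
     proof -
      define y where "y = T * \<bar>z - om\<bar>"
      have y: "y >= 0" "\<bar>z - om\<bar> = y / T" using T by (auto simp: y_def)
      have "\<bar>z - om\<bar> powr (2 * mu) = y powr (2 * mu) * T powr (-2 * mu)"
       using T y by (simp add: powr_divide powr_minus_divide)
      moreover have "?R (z - om) = T\<^sup>2 / (1 + y\<^sup>2)"
      proof -
       have "(z - om)\<^sup>2 = (y / T)\<^sup>2" using y(2) by (metis power2_abs)
       then show ?thesis using T by (simp add: power_divide add_divide_distrib[symmetric])
      qed
      ultimately have "?p = (y powr (2 * mu) / (1 + y\<^sup>2)) * (T\<^sup>2 * T powr (-2 * mu))"
       by simp
      also have "T\<^sup>2 * T powr (-2 * mu) = T powr (2 - 2 * mu)"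
       using T by (simp add: powr_diff powr_numeral powr_minus_divide)
      also have "(y powr (2 * mu) / (1 + y\<^sup>2)) * T powr (2 - 2 * mu) <= 1 * T powr (2 - 2 * mu)"
      proof (rule mult_right_mono)
       have "y powr (2 * mu) <= (1 + y\<^sup>2) powr mu" using abs_powr_le[of mu y] mu y by simp
       also have "... <= (1 + y\<^sup>2) powr 1" using mu by (intro powr_mono) auto
       finally show "y powr (2 * mu) / (1 + y\<^sup>2) <= 1"
        by (simp add: divide_le_eq_1 add_nonneg_pos powr_one_gt_zero_iff add_pos_nonneg)
      qed simp
      finally show ?thesis by simp
     qed
     then have "enn (?p * ?S om) <= enn (T powr (2 - 2 * mu) * ?S om)"
      by (intro ennreal_leI mult_right_mono) auto
     also have "... = enn (T powr (2 - 2 * mu)) * ?near om"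
      using True by (simp add: ennreal_mult' abs_le_iff indicator_def)
     finally show ?thesis by (simp add: add_increasing2)
    next
     case False
     have "?S om <= (1 / T) powr (-2 * mu)"
      using False T mu by (intro powr_mono2') auto
     also have "(1 / T) powr (-2 * mu) = T powr (2 * mu)"
      using T by (simp add: powr_divide powr_minus_divide)
     finally have "enn (?p * ?S om) <= enn (T powr (2 * mu) * ?p)"
      by (subst mult.commute[of ?p]) (intro ennreal_leI mult_right_mono, auto)
     also have "... = enn (T powr (2 * mu)) * enn ?p"
      by (rule ennreal_mult') simp
     finally show ?thesis by (simp add: add_increasing)
    qed
    have "enn ((1 + om\<^sup>2) powr nu * ?R (z - om)) <= enn (4 * (1 + z\<^sup>2) powr nu * (?R (z - om) + ?p * ?S om))"
     using 1 by (intro ennreal_leI) (simp only: mult_ac distrib_left mult_1_left)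
    also have "... = enn (4 * (1 + z\<^sup>2) powr nu) * (enn (?R (z - om)) + enn (?p * ?S om))"
    proof -
     have "enn (a * (b + d)) = enn a * (enn b + enn d)" if "a >= 0" "b >= 0" "d >= 0" for a b d :: real
      using that by (simp add: ennreal_mult ennreal_plus)
     then show ?thesis by simp
    qed
    also have "... <= enn (4 * (1 + z\<^sup>2) powr nu) * (enn (?R (z - om)) + (enn (T powr (2 - 2 * mu)) * ?near om + enn (T powr (2 * mu)) * enn ?p))"
     by (intro mult_left_mono add_left_mono 2) simp
    also have "enn ?p = enn (?R (z - om)) * enn (\<bar>z - om\<bar> powr (2 * mu))"
     by (rule ennreal_mult'[OF R])
    finally show ?thesis .
   qed
   have "(nnl (%om. enn ((1 + om\<^sup>2) powr nu * ?R (z - om))))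
    <= (nnl (%om. enn (4 * (1 + z\<^sup>2) powr nu) * (enn (?R (z - om))
     + (enn (T powr (2 - 2 * mu)) * ?near om + enn (T powr (2 * mu)) * (enn (?R (z - om)) * enn (\<bar>z - om\<bar> powr (2 * mu)))))))"
    by (rule nn_integral_mono_AE, rule eventually_mono[OF AE_lborel_singleton[of 0]], rule pt)
   also have "... = enn (4 * (1 + z\<^sup>2) powr nu) * ((nnl (%x. enn (?R x)))
     + (enn (T powr (2 - 2 * mu)) * (nnl (%om. ?near om)) + enn (T powr (2 * mu)) * (nnl (%x. enn (?R x) * enn ((abs x) powr (2 * mu))))))"
    using shift[of "%x. enn (?R x)" z] shift[of "%x. enn (?R x) * enn ((abs x) powr (2 * mu))" z]
    by (simp add: nn_integral_add nn_integral_cmult)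
   also have "... <= enn (4 * (1 + z\<^sup>2) powr nu) * (enn (T * j)
     + (enn (T powr (2 - 2 * mu)) * enn (2 * ((1/T) powr (1 - 2 * mu) / (1 - 2 * mu))) + enn (T powr (2 * mu)) * enn (T * (T powr (-2 * mu) * j))))"
    by (intro add_mono mult_left_mono R0 Rl T near) auto
   also have "... = enn (4 * (1 + z\<^sup>2) powr nu * (T * j + (T powr (2 - 2 * mu) * (2 * ((1/T) powr (1 - 2 * mu) / (1 - 2 * mu))) + T powr (2 * mu) * (T * (T powr (-2 * mu) * j)))))"
    using T j(2) mu by (simp only: ennreal_mult'[symmetric] ennreal_plus[symmetric] powr_ge_zero zero_le_mult_iff zero_le_divide_iff) (simp add: ennreal_mult'[symmetric] ennreal_plus[symmetric] del: ennreal_plus)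
   also have "T powr (2 - 2 * mu) * (2 * ((1/T) powr (1 - 2 * mu) / (1 - 2 * mu))) = (T powr (2 - 2 * mu) * (1/T) powr (1 - 2 * mu)) * (2 / (1 - 2 * mu))"
    by simp
   also have "T powr (2 * mu) * (T * (T powr (-2 * mu) * j)) = (T powr (2 * mu) * T powr (-2 * mu)) * (T * j)"
    by simp
   also have "enn (4 * (1 + z\<^sup>2) powr nu * (T * j + ((T powr (2 - 2 * mu) * (1/T) powr (1 - 2 * mu)) * (2 / (1 - 2 * mu)) + (T powr (2 * mu) * T powr (-2 * mu)) * (T * j))))
     = enn (4 * (2 * j + 2 / (1 - 2 * mu)) * T * (1 + z\<^sup>2) powr nu)"
    unfolding tpow by (rule arg_cong[where f=enn]) (simp add: algebra_simps)
   also have "... <= enn (C * T * ((1 + z\<^sup>2) powr nu + (if nu > 0 then T powr (-2 * nu) else 0)))"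
    using T mu0 numu mult_right_mono[OF Cj(3), of "T * (1 + z\<^sup>2) powr nu"]
    by (intro ennreal_leI) (simp add: mult.assoc)
   finally show ?thesis .
  qed
 qed
qed

text \<open>This is 2 pi times the squared norm, with extended values, so that integrals over the
  cut point can be exchanged before finiteness is known.\<close>

definition HN :: "real => (real => complex) => ennreal" where
 "HN nu f = (nnl (%om. enn ((1 + om\<^sup>2) powr nu * (nsq (fourier f om)))))"

definition cut :: "real => (real => complex) => real => complex" where
 "cut a f s = (if s < a then f s else 0)"

lemma cut_borel [measurable]:
 assumes [measurable]: "f \<in> bmeas borel"
 shows "cut a f \<in> bmeas borel"
 unfolding cut_def[abs_def] by measurable

lemma integrable_cut: "integrable lborel f ==> integrable lborel (cut a f)"
 by (rule B_integrable_bound[of _ f]) (auto simp: cut_def)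

lemma fourier_cut_borel [measurable]:
 assumes [measurable]: "f \<in> bmeas borel"
 shows "(%(a, om). fourier (cut a f) om) \<in> bmeas (borel \<Otimes>\<^sub>M borel)"
proof -
 have "(%x. LINT s|lborel. (if s < fst x then f s else 0) * ker (snd x) s) \<in> bmeas (borel \<Otimes>\<^sub>M borel)"
  by measurable
 then show ?thesis unfolding fourier_ker cut_def by (simp add: case_prod_beta)
qed

text \<open>On an interval of length T one has |fourier f|^2 <= T * |f|^2 in L2 norm, so the band of
  width 2 / T around 0 carries at most the fraction 1 / pi of the spectral mass. Outside the band
  \<open>T powr (-2 * nu)\<close> is below the weight.\<close>

lemma low_frequency_bound:
 assumes nu: "0 < nu" and T: "0 < T" "T <= 1"
  and f: "integrable lborel f" "continuous_on UNIV f" "!!x. cmod (f x) <= M" "!!x. x ~: {0<..<T} ==> f x = 0"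
 shows "enn (T powr (-2 * nu)) * (nnl (%om. enn (nsq (fourier f om)))) <= 2 * HN nu f"
proof (cases "HN nu f = top")
 case True
 then show ?thesis by (simp add: ennreal_mult_top)
next
 case False
 have [measurable]: "f \<in> bmeas borel" using f(1) by auto
 let ?F = "%om. enn (nsq (fourier f om))"
 let ?I = "{-(1/T)..1/T}"
 define W where "W = (nnl (%om. ?F om))"
 define A where "A = (nnl (%om. ?F om * ind ?I om))"
 define B where "B = (nnl (%om. ?F om * ind (- ?I) om))"
 define S where "S = (nnl (%x. enn (nsq (f x))))"
 have WAB: "W = A + B"
  unfolding W_def A_def B_def by (subst nn_integral_add[symmetric]) (auto intro!: nn_integral_cong simp: indicator_def)
 have "W <= HN nu f"
  unfolding W_def HN_def
 proof (intro nn_integral_mono ennreal_leI)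
  fix om :: real
  have "1 powr nu <= (1 + om\<^sup>2) powr nu" using nu by (intro powr_mono2) auto
  then show "(nsq (fourier f om)) <= (1 + om\<^sup>2) powr nu * (nsq (fourier f om))"
   using mult_right_mono[of 1 "(1 + om\<^sup>2) powr nu" "(nsq (fourier f om))"] by simp
 qed
 then have Wfin: "W < top" using False by (simp add: le_less_trans top.not_eq_extremum)
 have L1: "enn ((LINT x|lborel. cmod (f x))\<^sup>2) <= enn T * S"
 proof -
  have "enn (LINT x|lborel. cmod (f x)) = (nnl (%x. enn (cmod (f x))))"
   by (rule nn_integral_eq_integral[symmetric]) (use f(1) in auto)
  also have "... = (nnl (%x. ind {0<..<T} x * enn (cmod (f x))))"
   using f(4) by (intro nn_integral_cong) (auto simp: indicator_def)
  finally have "enn ((LINT x|lborel. cmod (f x))\<^sup>2) = (nnl (%x. ind {0<..<T} x * enn (cmod (f x))))\<^sup>2"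
   by (simp add: ennreal_power[symmetric])
  also have "... <= (nnl (%x. (ind {0<..<T} x)\<^sup>2)) * (nnl (%x. (enn (cmod (f x)))\<^sup>2))"
   by (rule Cauchy_Schwarz_nn_integral) measurable
  also have "(%x. (ind {0<..<T} x :: ennreal)\<^sup>2) = ind {0<..<T}"
   by (auto simp: indicator_def)
  also have "(nnl (%x. ind {0<..<T} x)) = enn T" using T by simp
  finally show ?thesis by (simp add: S_def ennreal_power)
 qed
 have "A <= (nnl (%om. enn ((LINT x|lborel. cmod (f x))\<^sup>2) * ind ?I om))"
  unfolding A_def using norm_fourier_le[of f]
  by (intro nn_integral_mono mult_right_mono ennreal_leI power_mono) auto
 also have "... = enn ((LINT x|lborel. cmod (f x))\<^sup>2) * enn (2 / T)"
  using T by (simp add: nn_integral_cmult)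
 also have "... <= enn T * S * enn (2 / T)"
  by (intro mult_right_mono L1) simp
 also have "... = enn (1 / pi) * (enn (2 * pi) * S)"
 proof -
  have "enn T * S * enn (2 / T) = (enn T * enn (2 / T)) * S" by (simp add: mult_ac)
  also have "... = enn 2 * S" using T by (simp add: ennreal_mult'[symmetric] del: ennreal_numeral)
  also have "... = (enn (1 / pi) * enn (2 * pi)) * S"
   by (simp add: ennreal_mult'[symmetric] del: ennreal_numeral)
  finally show ?thesis by (simp only: mult.assoc)
 qed
 also have "... <= enn (1 / pi) * W"
  unfolding S_def W_def by (intro mult_left_mono plancherel_le[OF f(1,2,3)]) simp
 finally have A: "A <= enn (1 / pi) * W" .
 \<comment> \<open>From W <= W / pi + B and 1 / pi <= 1 / 2. Absorbing W on the left requires it to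
   be finite, hence the initial case distinction on \<open>HN nu f\<close>.\<close>
 have "W <= 2 * B"
 proof -
  obtain w where w: "W = enn w" "w >= 0" using Wfin by (cases W) auto
  have "B <= W" using WAB by simp
  then obtain b where b: "B = enn b" "b >= 0" using Wfin by (cases B) auto
  have "enn w <= enn (1 / pi * w) + enn b"
  proof -
   have "A <= enn (1 / pi * w)"
    using A unfolding w(1) by (subst ennreal_mult') auto
   moreover have "enn w = A + enn b" using WAB w(1) b(1) by simp
   ultimately show ?thesis by (simp only: add_right_mono)
  qed
  also have "... = enn (1 / pi * w + b)" using w b by (simp add: ennreal_plus)
  finally have "w <= 1 / pi * w + b" using w b by (subst (asm) ennreal_le_iff) auto
  moreover have "1 / pi * w <= 1 / 2 * w" using w pi_ge_two by (intro mult_right_mono) (auto simp: field_simps)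
  ultimately have "w <= 2 * b" by linarith
  then show ?thesis unfolding w b by (simp add: ennreal_mult'[symmetric] ennreal_leI flip: ennreal_numeral)
 qed
 then have "enn (T powr (-2 * nu)) * W <= enn (T powr (-2 * nu)) * (2 * B)"
  by (rule mult_left_mono) simp
 also have "... = 2 * (nnl (%om. enn (T powr (-2 * nu)) * (?F om * ind (- ?I) om)))"
  unfolding B_def by (subst nn_integral_cmult) (auto simp: mult_ac)
 also have "... <= 2 * HN nu f"
  unfolding HN_def
 proof (intro mult_left_mono nn_integral_mono)
  fix om :: real
  show "enn (T powr (-2 * nu)) * (?F om * ind (- ?I) om) <= enn ((1 + om\<^sup>2) powr nu * (nsq (fourier f om)))"
  proof (cases "om \<in> ?I")
   case False
   then have "1 / T <= (abs om)" by auto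
   then have "(1 / T) powr (2 * nu) <= (abs om) powr (2 * nu)" using T nu by (intro powr_mono2) auto
   also have "... <= (1 + om\<^sup>2) powr nu" using nu by (intro abs_powr_le) auto
   also have "(1 / T) powr (2 * nu) = T powr (-2 * nu)"
    using T powr_minus_divide[of T "2 * nu"] by (simp add: powr_divide)
   finally show ?thesis using False by (simp add: ennreal_mult'[symmetric] ennreal_leI mult_right_mono)
  qed simp
 qed simp
 finally show ?thesis unfolding W_def .
qed

text \<open>At frequency om the transform of a cut is a truncated primitive of f(s) exp(-i om s),
  whose transform is that of f shifted by om. After \<open>truncated_primitive_bound\<close> and
  Tonelli, the integral over om of the weight against the shifted resolvent is what
  \<open>resolvent_weight_bound\<close> estimates.\<close>

lemma cut_average:
 assumes nu: "-1/2 < nu" "nu < 1/2"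
 obtains C where "C > 0" "!!T f M. 0 < T ==> T <= 1 ==> integrable lborel f ==> continuous_on UNIV f ==>
  (!!x. cmod (f x) <= M) ==> (!!x. x ~: {0<..<T} ==> f x = 0) ==>
  (nnl (%a. ind {0<..<T} a * HN nu (cut a f))) <= enn (C * T) * HN nu f"
proof -
 obtain C where C: "C > 0" "!!T z. 0 < T ==>
  (nnl (%om. enn ((1 + om\<^sup>2) powr nu * (1 / (1 / T\<^sup>2 + (z - om)\<^sup>2)))))
   <= enn (C * T * ((1 + z\<^sup>2) powr nu + (if nu > 0 then T powr (-2 * nu) else 0)))"
  using resolvent_weight_bound[OF nu] by blast
 show ?thesis
 \<comment> \<open>The factor 2 / pi stems from \<open>truncated_primitive_bound\<close>; the 3 is 1
   for the weight itself plus 2 for the excess treated by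
   \<open>low_frequency_bound\<close>.\<close>
 proof (rule that[of "2 / pi * (3 * C)"])
  show "2 / pi * (3 * C) > 0" using C(1) by simp
  fix T M :: real and f
  assume T: "0 < T" "T <= 1" and f: "integrable lborel f" "continuous_on UNIV f" "!!x. cmod (f x) <= M" "!!x. x ~: {0<..<T} ==> f x = 0"
  have [measurable]: "f \<in> bmeas borel" using f(1) by auto
  let ?w = "%om::real. (1 + om\<^sup>2) powr nu"
  let ?R = "%z. 1 / (1 / T\<^sup>2 + z\<^sup>2)"
  have inner: "(nnl (%a. ind {0<..<T} a * enn (nsq (fourier (cut a f) om))))
    <= enn (2 / pi) * (nnl (%z. enn ((nsq (fourier f z)) * ?R (z - om))))" for om
  proof -
   have "fourier (cut a f) om = (LINT s|lborel. ind {..<a} s *R (f s * ker om s))" for a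
    unfolding fourier_ker by (intro B_integral_cong) (auto simp: cut_def indicator_def)
   moreover have "fourier (%s. f s * ker om s) y = fourier f (y + om)" for y
    unfolding fourier_ker by (simp add: ker_add mult_ac)
   ultimately have "(nnl (%a. ind {0<..<T} a * enn (nsq (fourier (cut a f) om))))
    <= enn (2 / pi) * (nnl (%y. enn ((nsq (fourier f (y + om))) / (1 / T\<^sup>2 + y\<^sup>2))))"
    using truncated_primitive_bound[OF T(1) integrable_mult_ker[OF f(1)], of om] f(4) by simp
   also have "(nnl (%y. enn ((nsq (fourier f (y + om))) / (1 / T\<^sup>2 + y\<^sup>2))))
    = (nnl (%z. enn ((nsq (fourier f z)) * ?R (z - om))))"
    using nn_integral_shift[of "%y. enn ((nsq (fourier f (y + om))) / (1 / T\<^sup>2 + y\<^sup>2))" om] by simp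
   finally show ?thesis .
  qed
  have "(nnl (%a. ind {0<..<T} a * HN nu (cut a f)))
   = (nnl (%a. (nnl (%om. enn (?w om) * (ind {0<..<T} a * enn (nsq (fourier (cut a f) om)))))))"
  proof (rule nn_integral_cong)
   fix a
   have "(nnl (%om. enn (?w om) * (ind {0<..<T} a * enn (nsq (fourier (cut a f) om)))))
    = (nnl (%om. ind {0<..<T} a * enn (?w om * (nsq (fourier (cut a f) om)))))"
    by (intro nn_integral_cong) (simp add: ennreal_mult' mult_ac)
   then show "ind {0<..<T} a * HN nu (cut a f) = (nnl (%om. enn (?w om) * (ind {0<..<T} a * enn (nsq (fourier (cut a f) om)))))"
    by (simp add: HN_def nn_integral_cmult)
  qed
  also have "... = (nnl (%om. (nnl (%a. enn (?w om) * (ind {0<..<T} a * enn (nsq (fourier (cut a f) om)))))))"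
   by (rule lborel_pair.Fubini') measurable
  also have "... = (nnl (%om. enn (?w om) * (nnl (%a. ind {0<..<T} a * enn (nsq (fourier (cut a f) om))))))"
   by (intro nn_integral_cong nn_integral_cmult) measurable
  also have "... <= (nnl (%om. enn (?w om) * (enn (2 / pi) * (nnl (%z. enn ((nsq (fourier f z)) * ?R (z - om)))))))"
   by (intro nn_integral_mono mult_left_mono inner) simp
  also have "... = enn (2 / pi) * (nnl (%om. (nnl (%z. enn (?w om) * enn ((nsq (fourier f z)) * ?R (z - om))))))"
   by (simp add: nn_integral_cmult[symmetric] mult.left_commute)
  also have "(nnl (%om. (nnl (%z. enn (?w om) * enn ((nsq (fourier f z)) * ?R (z - om))))))
   = (nnl (%z. (nnl (%om. enn (?w om) * enn ((nsq (fourier f z)) * ?R (z - om))))))"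
   by (rule lborel_pair.Fubini') measurable
  also have "... = (nnl (%z. enn (nsq (fourier f z)) * (nnl (%om. enn (?w om * ?R (z - om))))))"
  proof (rule nn_integral_cong)
   fix z
   have gen: "enn a * enn (b * c) = enn b * enn (a * c)" if "a >= 0" "b >= 0" "c >= 0" for a b c :: real
    using that by (simp add: ennreal_mult[symmetric] mult.left_commute)
   have "(nnl (%om. enn (?w om) * enn ((nsq (fourier f z)) * ?R (z - om)))) = (nnl (%om. enn (nsq (fourier f z)) * enn (?w om * ?R (z - om))))"
    by (intro nn_integral_cong gen) auto
   then show "(nnl (%om. enn (?w om) * enn ((nsq (fourier f z)) * ?R (z - om)))) = enn (nsq (fourier f z)) * (nnl (%om. enn (?w om * ?R (z - om))))"
    by (simp add: nn_integral_cmult)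
  qed
  also have "... <= (nnl (%z. enn (nsq (fourier f z)) * enn (C * T * (?w z + (if nu > 0 then T powr (-2 * nu) else 0)))))"
   by (intro nn_integral_mono mult_left_mono C(2) T) simp
  also have "... = (nnl (%z. enn (C * T) * (enn (?w z * (nsq (fourier f z))) + enn (if nu > 0 then T powr (-2 * nu) else 0) * enn (nsq (fourier f z)))))"
   using C(1) T by (intro nn_integral_cong) (simp add: ennreal_mult'[symmetric] ennreal_plus[symmetric] algebra_simps del: ennreal_plus)
  also have "... = enn (C * T) * (HN nu f + enn (if nu > 0 then T powr (-2 * nu) else 0) * (nnl (%z. enn (nsq (fourier f z)))))"
   unfolding HN_def by (simp add: nn_integral_cmult nn_integral_add)
  also have "... <= enn (C * T) * (HN nu f + 2 * HN nu f)"
  proof (intro mult_left_mono add_left_mono)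
   show "enn (if nu > 0 then T powr (-2 * nu) else 0) * (nnl (%z. enn (nsq (fourier f z)))) <= 2 * HN nu f"
    using low_frequency_bound[OF _ T f, of nu] by (cases "nu > 0") auto
  qed simp
  also have "enn (2 / pi) * (enn (C * T) * (HN nu f + 2 * HN nu f)) = enn (2 / pi * (3 * C) * T) * HN nu f"
  proof -
   have "HN nu f + 2 * HN nu f = enn 3 * HN nu f"
    using distrib_right[of 1 2 "HN nu f"] by simp
   then show ?thesis using C(1) T
    by (simp add: mult.assoc[symmetric] ennreal_mult'[symmetric] del: ennreal_numeral)
  qed
  finally show "(nnl (%a. ind {0<..<T} a * HN nu (cut a f))) <= enn (2 / pi * (3 * C) * T) * HN nu f"
   by (simp add: mult_left_mono)
 qed
qed

section \<open>Primitives\<close>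

definition prim :: "(real => complex) => real => complex" where
 "prim g t = (LINT s|lborel. ind {..<t} s *R g s)"

lemma prim_continuous: "integrable lborel g ==> continuous_on UNIV (prim g)"
 unfolding prim_def[abs_def] by (rule continuous_indefinite_integral)

lemma prim_borel [measurable (raw)]: "integrable lborel g ==> prim g \<in> bmeas borel"
 using prim_continuous borel_measurable_continuous_onI by blast

lemma prim_norm_le:
 assumes "integrable lborel g" shows "cmod (prim g t) <= (LINT s|lborel. cmod (g s))"
proof -
 have "cmod (prim g t) <= (LINT s|lborel. cmod (ind {..<t} s *R g s))"
  unfolding prim_def by (rule integral_norm_bound)
 also have "... <= (LINT s|lborel. cmod (g s))"
  using assms by (intro integral_mono integrable_norm integrable_mult_indicator) (auto simp: indicator_def)
 finally show ?thesis .
qed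

lemma prim_add: "integrable lborel g ==> integrable lborel h ==> prim (%s. g s + h s) t = prim g t + prim h t"
 unfolding prim_def by (simp add: scaleR_add_right integrable_mult_indicator)

lemma prim_diff: "integrable lborel g ==> integrable lborel h ==> prim (%s. g s - h s) t = prim g t - prim h t"
 unfolding prim_def by (simp add: scaleR_diff_right integrable_mult_indicator)

lemma prim_cmult: "prim (%s. c * g s) t = c * prim g t"
 unfolding prim_def integral_mult_right_zero[symmetric]
 by (intro B_integral_cong) auto

lemma prim_cnj: "prim (%s. cnj (g s)) t = cnj (prim g t)"
 unfolding prim_def B_integral_cnj[symmetric] by (simp only: complex_cnj_scaleR)

lemma prim_left: "(!!s. s <= 0 ==> g s = 0) ==> t <= 0 ==> prim g t = 0"
 unfolding prim_def by (rule integral_eq_zero_AE) (auto simp: indicator_def)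

lemma prim_right: "(!!s. s >= T ==> g s = 0) ==> t >= T ==> prim g t = (LINT s|lborel. g s)"
 unfolding prim_def by (rule B_integral_cong) (auto simp: indicator_def)

lemma prim_zero_outside:
 assumes "!!s. s ~: {0<..<T} ==> g s = 0" "(LINT s|lborel. g s) = 0" "t ~: {0<..<T}"
 shows "prim g t = 0"
 using prim_left[of g t] prim_right[of T g t] assms by (cases "t <= 0") auto

lemma integrable_indicator_interval: "integrable lborel (ind {a<..<b} :: real => real)"
 by (rule integrable_real_indicator) (cases "a <= b"; simp)+

lemma integrable_mult_bounded:
 fixes g b :: "'a => complex"
 assumes "integrable M g" "b \<in> bmeas M" "!!x. cmod (b x) <= B"
 shows "integrable M (%x. b x * g x)"
proof (rule B_integrable_bound[of _ "%x. B *R g x"])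
 show "AE x in M. norm (b x * g x) <= norm (B *R g x)"
  using order_trans[OF assms(3) abs_ge_self] by (auto simp: norm_mult intro!: mult_right_mono)
qed (use assms in auto)

text \<open>The product of the two primitives is the integral of g(s) h(r) over the quadrant s, r <
  t. The diagonal splits it into two parts, which are the two iterated integrals; no
  differentiability is involved.\<close>

lemma prim_mult:
 assumes g: "integrable lborel g" and h: "integrable lborel h"
 shows "integrable lborel (%s. g s * prim h s + prim g s * h s)"
  "prim (%s. g s * prim h s + prim g s * h s) t = prim g t * prim h t"
proof -
 have [measurable]: "g \<in> bmeas borel" "h \<in> bmeas borel" using g h by auto
 have i1: "integrable lborel (%s. g s * prim h s)" if "integrable lborel g" "integrable lborel h" for g h
  using integrable_mult_bounded[OF that(1) _ prim_norm_le[OF that(2)]] prim_borel[OF that(2)] by (simp add: mult.commute)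
 show "integrable lborel (%s. g s * prim h s + prim g s * h s)"
  using i1[OF g h] i1[OF h g] by (simp add: mult.commute)
 let ?G = "%s r. (if r < s then 1 else 0) * ((if s < t then 1 else 0) * (g s * h r)) :: complex"
 let ?H = "%r s. (if s < r then 1 else 0) * ((if r < t then 1 else 0) * (g s * h r)) :: complex"
 have gn: "integrable lborel (%s. cmod (g s))" "integrable lborel (%s. cmod (h s))" using g h by auto
 have A: "prim (%s. g s * prim h s) t = (LINT s|lborel. LINT r|lborel. ?G s r)"
  unfolding prim_def[of "%s. g s * prim h s"]
 proof (rule B_integral_cong[OF refl])
  fix s
  have "(LINT r|lborel. ?G s r) = (LINT r|lborel. (if s < t then 1 else 0) * g s * (ind {..<s} r *R h r))"
   by (rule B_integral_cong) (auto simp: indicator_def)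
  then show "ind {..<t} s *R (g s * prim h s) = (LINT r|lborel. ?G s r)"
   by (simp only: integral_mult_right_zero prim_def[symmetric]) (simp add: indicator_def)
 qed
 have B: "prim (%s. prim g s * h s) t = (LINT r|lborel. LINT s|lborel. ?H r s)"
  unfolding prim_def[of "%s. prim g s * h s"]
 proof (rule B_integral_cong[OF refl])
  fix r
  have "(LINT s|lborel. ?H r s) = (LINT s|lborel. (if r < t then 1 else 0) * h r * (ind {..<r} s *R g s))"
   by (rule B_integral_cong) (auto simp: indicator_def)
  then show "ind {..<t} r *R (prim g r * h r) = (LINT s|lborel. ?H r s)"
   by (simp only: integral_mult_right_zero prim_def[symmetric]) (simp add: indicator_def mult.commute)
 qed
 have B': "(LINT r|lborel. LINT s|lborel. ?H r s) = (LINT s|lborel. LINT r|lborel. ?H r s)"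
  by (rule fubini_dominated(2)[where g="%r. cmod (h r)" and h="%s. cmod (g s)"]) (use gn in "auto simp: norm_mult")
 have iG: "integrable lborel (%s. LINT r|lborel. ?G s r)" "!!s. integrable lborel (%r. ?G s r)"
  by (rule fubini_dominated(5)[where g="%r. cmod (g r)" and h="%s. cmod (h s)"], use gn in "auto simp: norm_mult")
   (rule fubini_dominated(3)[where g="%r. cmod (g r)" and h="%s. cmod (h s)"], use gn in "auto simp: norm_mult")
 have iH: "integrable lborel (%s. LINT r|lborel. ?H r s)" "!!s. integrable lborel (%r. ?H r s)"
  by (rule fubini_dominated(6)[where g="%r. cmod (h r)" and h="%s. cmod (g s)"], use gn in "auto simp: norm_mult")
   (rule fubini_dominated(4)[where g="%r. cmod (h r)" and h="%s. cmod (g s)"], use gn in "auto simp: norm_mult")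
 have "prim (%s. g s * prim h s + prim g s * h s) t = prim (%s. g s * prim h s) t + prim (%s. prim g s * h s) t"
  using i1[OF g h] i1[OF h g] by (intro prim_add) (simp_all add: mult.commute)
 also have "... = (LINT s|lborel. LINT r|lborel. ?G s r + ?H r s)"
  unfolding A B B' using iG iH by simp
 also have "... = (LINT s|lborel. (ind {..<t} s *R g s) * prim h t)"
 proof (rule B_integral_cong[OF refl])
  fix s
  have "(LINT r|lborel. ?G s r + ?H r s) = (LINT r|lborel. (ind {..<t} s *R g s) * (ind {..<t} r *R h r))"
  proof (rule integral_cong_AE)
   show "AE r in lborel. ?G s r + ?H r s = (ind {..<t} s *R g s) * (ind {..<t} r *R h r)"
    using AE_lborel_singleton[of s] by eventually_elim (auto simp: indicator_def)
  qed measurable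
  then show "(LINT r|lborel. ?G s r + ?H r s) = (ind {..<t} s *R g s) * prim h t"
   by (simp only: integral_mult_right_zero prim_def)
 qed
 also have "... = prim g t * prim h t"
  by (simp only: integral_mult_left_zero prim_def)
 finally show "prim (%s. g s * prim h s + prim g s * h s) t = prim g t * prim h t" .
qed

section \<open>Sharp cutoffs in the form\<close>

text \<open>As \<open>enn2real\<close> sends infinity to 0, this is the norm only where
  \<open>HN\<close> is finite, which \<open>HN_integral\<close> secures from decay of the Fourier
  transform.\<close>

definition hn :: "real => (real => complex) => real" where
 "hn nu f = sqrt (enn2real (HN nu f) / (2 * pi))"

lemma hn_nonneg [simp]: "hn nu f >= 0"
 by (simp add: hn_def)

text \<open>Members of \<open>H_space\<close> after extension by zero: genuine functions on the line
  whose primitive is supported in the interval.\<close>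

definition adm :: "real => (real => complex) => bool" where
 "adm T g \<longleftrightarrow> sq_int lborel g & (\<forall>s. s ~: {0<..<T} --> g s = 0) & (LINT s|lborel. g s) = 0"

lemma emeasure_interval_finite: "emeasure lborel {a<..<b::real} < top"
 by (cases "a <= b") auto

lemma adm_integrable:
 assumes "adm T g" shows "integrable lborel g"
proof -
 have "integrable lborel (%x. ind {0<..<T} x *R g x)"
  using assms emeasure_interval_finite by (intro sq_int_finite_integrable) (auto simp: adm_def)
 moreover have "(%x. ind {0<..<T} x *R g x) = g"
  using assms by (auto simp: adm_def indicator_def)
 ultimately show ?thesis by simp
qed

lemma adm_prim_zero: "adm T g ==> t ~: {0<..<T} ==> prim g t = 0"
 using prim_zero_outside[of T g t] by (auto simp: adm_def)

lemma cut_prim_id: "adm T g ==> a >= T ==> cut a (prim g) = prim g"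
 using adm_prim_zero[of T g] by (auto simp: cut_def)

lemma integrable_interval_support:
 fixes f :: "real => complex"
 assumes [measurable]: "f \<in> bmeas borel" and "!!x. cmod (f x) <= M" "!!x. x ~: {0<..<T} ==> f x = 0"
 shows "integrable lborel f" "sq_int lborel f"
proof -
 have i: "integrable lborel (%x. M * ind {0<..<T} x)"
  using integrable_indicator_interval[of 0 T] by simp
 show "integrable lborel f"
  by (rule B_integrable_bound[OF i])
   (use assms in "auto simp: indicator_def intro: order_trans[OF _ abs_ge_self]")
 have M: "M >= 0" using order_trans[OF norm_ge_zero assms(2)] .
 have i2: "integrable lborel (%x. M\<^sup>2 * ind {0<..<T} x)"
  using integrable_indicator_interval[of 0 T] by simp
 have le: "(nsq (f x)) <= M\<^sup>2 * ind {0<..<T} x" for x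
  using power_mono[OF assms(2)[of x], of 2] assms(3)[of x] by (cases "x \<in> {0<..<T}") auto
 have "integrable lborel (%x. (nsq (f x)))"
  by (rule B_integrable_bound[OF i2]) (use le in auto)
 then show "sq_int lborel f" by (simp add: sq_int_def)
qed

lemma adm_prim:
 assumes "adm T g"
 shows "integrable lborel (prim g)" "sq_int lborel (prim g)"
 using integrable_interval_support[OF prim_borel[OF adm_integrable[OF assms]] prim_norm_le[OF adm_integrable[OF assms]] adm_prim_zero[OF assms]]
 by auto

lemma ker_interval_bound:
 assumes "om ~= 0"
 shows "cmod (LINT t|lborel. ind {s<..<b} t *R ker om t) <= 2 / (abs om)"
proof (cases "s < b")
 case True
 let ?F = "%t. ker om t * (\<i> / cpx om)"
 have "AE t in lborel. t ~= s & t ~= b"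
  using AE_lborel_singleton[of s] AE_lborel_singleton[of b] by eventually_elim auto
 then have "AE t in lborel. ind {s<..<b} t *R ker om t = ind {s..b} t *R ker om t"
  by eventually_elim (auto simp: indicator_def)
 then have "(LINT t|lborel. ind {s<..<b} t *R ker om t) = (LINT t|lborel. ind {s..b} t *R ker om t)"
  by (rule integral_cong_AE[rotated 2]) measurable
 also have "... = ?F b - ?F s"
 proof (rule integral_FTC_Icc)
  show "(?F has_vector_derivative ker om t) (at t within {s..b})" for t
  proof -
   have "((%z. exp (- \<i> * cpx om * z) * (\<i> / cpx om)) has_field_derivative exp (- \<i> * cpx om * cpx t)) (at (cpx t))"
    using assms by (auto intro!: derivative_eq_intros)
   then have "((%t. exp (- \<i> * cpx om * cpx t) * (\<i> / cpx om)) has_vector_derivative exp (- \<i> * cpx om * cpx t)) (at t within {s..b})"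
    by (intro has_vector_derivative_real_field has_vector_derivative_at_within)
   then show ?thesis by (simp add: ker_def mult.assoc)
  qed
  show "continuous_on {s..b} (ker om)"
   unfolding ker_def by (intro continuous_intros)
 qed (use True in auto)
 also have "... = (ker om b - ker om s) * (\<i> / cpx om)"
  by (simp only: left_diff_distrib)
 finally have "cmod (LINT t|lborel. ind {s<..<b} t *R ker om t) = cmod (ker om b - ker om s) * (1 / (abs om))"
  by (simp add: norm_mult norm_divide)
 also have "... <= 2 * (1 / (abs om))"
  using norm_triangle_ineq4[of "ker om b" "ker om s"] by (intro mult_right_mono) auto
 finally show ?thesis by simp
qed simp

text \<open>A cut primitive has bounded variation, so its transform is bounded by B and, after one
  integration in the frequency factor, by 2 B / |om|; this gives 5 = 1 + 4. The length T <= 1 enters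
  the first bound. The estimate is uniform in the cut point.\<close>

lemma fourier_cut_prim_bound:
 assumes T: "0 < T" "T <= 1" and g: "adm T g"
 shows "(nsq (fourier (cut a (prim g)) om)) * (1 + om\<^sup>2) <= 5 * (LINT s|lborel. cmod (g s))\<^sup>2"
proof -
 note gi = adm_integrable[OF g]
 have [measurable]: "g \<in> bmeas borel" using gi by auto
 have [measurable]: "prim g \<in> bmeas borel" by (rule prim_borel[OF gi])
 have gn: "integrable lborel (%s. cmod (g s))" using gi by auto
 let ?B = "LINT s|lborel. cmod (g s)"
 let ?F = "fourier (cut a (prim g)) om"
 have B0: "?B >= 0" by simp
 have 1: "cmod ?F <= ?B"
 proof -
  have "cmod ?F <= (LINT t|lborel. cmod (cut a (prim g) t))" by (rule norm_fourier_le)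
  also have "... <= (LINT t|lborel. ?B * ind {0<..<T} t)"
  proof (rule integral_mono)
   show "integrable lborel (%t. cmod (cut a (prim g) t))"
    by (intro integrable_norm integrable_cut adm_prim[OF g])
   show "integrable lborel (%t. ?B * ind {0<..<T} t)"
    using integrable_indicator_interval[of 0 T] by simp
   show "cmod (cut a (prim g) t) <= ?B * ind {0<..<T} t" for t
    using prim_norm_le[OF gi, of t] adm_prim_zero[OF g, of t] B0 by (auto simp: cut_def indicator_def)
  qed
  also have "... = ?B * T" using T by simp
  also have "... <= ?B * 1" using T B0 by (intro mult_left_mono) auto
  finally show ?thesis by simp
 qed
 have 2: "(abs om) * cmod ?F <= 2 * ?B"
 proof (cases "om = 0")
  case False
  let ?b = "min a T"
  let ?K = "%t s. (if 0 < t & t < ?b & s < t then 1 else 0) * (g s * ker om t) :: complex"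
  have "?F = (LINT t|lborel. LINT s|lborel. ?K t s)"
   unfolding fourier_ker
  proof (rule B_integral_cong[OF refl])
   fix t
   have "(LINT s|lborel. ?K t s) = (LINT s|lborel. ((if 0 < t & t < ?b then 1 else 0) * ker om t) * (ind {..<t} s *R g s))"
    by (rule B_integral_cong) (auto simp: indicator_def)
   also have "... = ((if 0 < t & t < ?b then 1 else 0) * ker om t) * prim g t"
    by (simp only: integral_mult_right_zero prim_def)
   finally show "cut a (prim g) t * ker om t = (LINT s|lborel. ?K t s)"
    using adm_prim_zero[OF g, of t] by (auto simp: cut_def)
  qed
  also have "... = (LINT s|lborel. LINT t|lborel. ?K t s)"
   by (rule fubini_dominated(2)[where g="ind {0<..<T}" and h="%s. cmod (g s)"])
    (use gn integrable_indicator_interval[of 0 T] in "auto simp: norm_mult indicator_def")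
  also have "cmod ... <= (LINT s|lborel. cmod (LINT t|lborel. ?K t s))"
   by (rule integral_norm_bound)
  also have "... <= (LINT s|lborel. cmod (g s) * (2 / (abs om)))"
  proof (rule integral_mono)
   show "integrable lborel (%s. cmod (LINT t|lborel. ?K t s))"
    by (rule integrable_norm, rule fubini_dominated(6)[where g="ind {0<..<T}" and h="%s. cmod (g s)"])
     (use gn integrable_indicator_interval[of 0 T] in "auto simp: norm_mult indicator_def")
   show "integrable lborel (%s. cmod (g s) * (2 / (abs om)))" using gn by simp
   fix s
   show "cmod (LINT t|lborel. ?K t s) <= cmod (g s) * (2 / (abs om))"
   proof (cases "s \<in> {0<..<T}")
    case True
    have "(LINT t|lborel. ?K t s) = (LINT t|lborel. g s * (ind {s<..<?b} t *R ker om t))"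
     using True by (intro B_integral_cong) (auto simp: indicator_def)
    then have "(LINT t|lborel. ?K t s) = g s * (LINT t|lborel. ind {s<..<?b} t *R ker om t)"
     by (simp only: integral_mult_right_zero)
    then show ?thesis
     using ker_interval_bound[OF False, of s ?b] by (simp only: norm_mult mult_left_mono norm_ge_zero)
   next
    case False
    then have "g s = 0" using g by (auto simp: adm_def)
    then show ?thesis by simp
   qed
  qed
  also have "... = ?B * (2 / (abs om))" by simp
  finally show ?thesis using False by (simp add: field_simps)
 qed (use B0 in simp)
 have "(nsq ?F) * (1 + om\<^sup>2) = (nsq ?F) + ((abs om) * cmod ?F)\<^sup>2"
  by (simp add: power_mult_distrib algebra_simps)
 also have "... <= ?B\<^sup>2 + (2 * ?B)\<^sup>2"
  using 1 2 by (intro add_mono power_mono) auto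
 finally show ?thesis by (simp add: power_mult_distrib)
qed

lemma HN_weight_le:
 fixes om x :: real
 assumes "x * (1 + om\<^sup>2) <= B"
 shows "(1 + om\<^sup>2) powr nu * x <= B * (1 + om\<^sup>2) powr (- (1 - nu))"
proof -
 have p: "1 + om\<^sup>2 > 0" by (simp add: add_pos_nonneg)
 have "(1 + om\<^sup>2) powr nu * x = (x * (1 + om\<^sup>2)) * ((1 + om\<^sup>2) powr (- (1 - nu)))"
  using p by (simp add: powr_diff powr_minus field_simps)
 also have "... <= B * (1 + om\<^sup>2) powr (- (1 - nu))"
  using assms by (intro mult_right_mono) auto
 finally show ?thesis .
qed

lemma HN_weight_integrable:
 assumes "nu < 1/2"
 shows "integrable lborel (%om::real. B * (1 + om\<^sup>2) powr (- (1 - nu)))"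
proof -
 have "integrable lborel (%om::real. (1 + om\<^sup>2) powr (- (1 - nu)))"
  by (rule integrableI_bounded) (use nn_integral_one_plus_square_powr[of "1 - nu"] assms in auto)
 then show ?thesis by simp
qed

lemma HN_integral:
 assumes nu: "nu < 1/2" and [measurable]: "f \<in> bmeas borel"
  and B: "!!om. (nsq (fourier f om)) * (1 + om\<^sup>2) <= B"
 shows "integrable lborel (%om. (1 + om\<^sup>2) powr nu * (nsq (fourier f om)))"
  "HN nu f = enn (LINT om|lborel. (1 + om\<^sup>2) powr nu * (nsq (fourier f om)))"
  "HN nu f = enn (2 * pi * (hn nu f)\<^sup>2)"
  "hn nu f = sqrt (1 / (2 * pi) * (LINT om|lborel. (1 + om\<^sup>2) powr nu * (nsq (fourier f om))))"
proof -
 show i: "integrable lborel (%om. (1 + om\<^sup>2) powr nu * (nsq (fourier f om)))"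
 proof (rule B_integrable_bound[OF HN_weight_integrable[OF nu, of B]])
  show "AE om in lborel. norm ((1 + om\<^sup>2) powr nu * (nsq (fourier f om))) <= norm (B * (1 + om\<^sup>2) powr (- (1 - nu)))"
   using HN_weight_le[OF B, where nu=nu] by (intro AE_I2) (simp add: order_trans[OF _ abs_ge_self])
 qed measurable
 show e: "HN nu f = enn (LINT om|lborel. (1 + om\<^sup>2) powr nu * (nsq (fourier f om)))"
  unfolding HN_def using i by (intro nn_integral_eq_integral) auto
 show h: "hn nu f = sqrt (1 / (2 * pi) * (LINT om|lborel. (1 + om\<^sup>2) powr nu * (nsq (fourier f om))))"
  unfolding hn_def e by simp
 show "HN nu f = enn (2 * pi * (hn nu f)\<^sup>2)"
  unfolding h e by (simp add: integral_nonneg_AE)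
qed

text \<open>A common bound of order 1 / (1 + om^2) on the squared transforms is an integrable
  majorant against the weight exactly because nu < 1/2.\<close>

lemma hn_tendsto:
 assumes nu: "nu < 1/2" and [measurable]: "!!n. F n \<in> bmeas borel" "f \<in> bmeas borel"
  and B: "!!n om. (nsq (fourier (F n) om)) * (1 + om\<^sup>2) <= B"
  and lim: "!!om. (%n. fourier (F n) om) ---> fourier f om"
 shows "(%n. hn nu (F n)) ---> hn nu f"
proof -
 have Bf: "(nsq (fourier f om)) * (1 + om\<^sup>2) <= B" for om
  by (rule LIMSEQ_le_const2[OF tendsto_mult_right[OF tendsto_power[OF tendsto_norm[OF lim]]]]) (use B in auto)
 have L: "(%n. LINT om|lborel. (1 + om\<^sup>2) powr nu * (nsq (fourier (F n) om))) ---> (LINT om|lborel. (1 + om\<^sup>2) powr nu * (nsq (fourier f om)))"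
 proof (rule integral_dominated_convergence[OF _ _ HN_weight_integrable[OF nu, of B]])
  show "AE om in lborel. (%n. (1 + om\<^sup>2) powr nu * (nsq (fourier (F n) om))) ---> (1 + om\<^sup>2) powr nu * (nsq (fourier f om))"
   by (intro AE_I2 tendsto_intros lim)
  show "AE om in lborel. norm ((1 + om\<^sup>2) powr nu * (nsq (fourier (F n) om))) <= B * (1 + om\<^sup>2) powr (- (1 - nu))" for n
   using HN_weight_le[OF B, where nu=nu] by (intro AE_I2) simp
 qed measurable
 show ?thesis
 proof -
  have "hn nu (F n) = sqrt (1 / (2 * pi) * (LINT om|lborel. (1 + om\<^sup>2) powr nu * (nsq (fourier (F n) om))))" for n
   by (rule HN_integral(4)[OF nu _ B]) measurable
  moreover have "hn nu f = sqrt (1 / (2 * pi) * (LINT om|lborel. (1 + om\<^sup>2) powr nu * (nsq (fourier f om))))"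
   by (rule HN_integral(4)[OF nu _ Bf]) measurable
  ultimately show ?thesis using L by (auto intro!: tendsto_intros)
 qed
qed

lemma fst_borel: "fst \<in> bmeas borel2"
 and snd_borel: "snd \<in> bmeas borel2"
 by (intro borel_measurable_continuous_onI continuous_intros)+

lemma tensor_borel:
 fixes f g :: "real => complex"
 assumes "f \<in> bmeas borel" "g \<in> bmeas borel"
 shows "(%x. f (fst x) * g (snd x)) \<in> bmeas borel"
 by (intro borel_measurable_times measurable_compose[OF fst_borel assms(1)] measurable_compose[OF snd_borel assms(2)])

lemma sq_int_tensor:
 fixes f g :: "real => complex"
 assumes "sq_int lborel f" "sq_int lborel g"
 shows "sq_int lborel (%x. f (fst x) * g (snd x))"
proof -
 have [measurable]: "f \<in> bmeas borel" "g \<in> bmeas borel"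
  using assms by (auto simp: sq_int_def)
 have "(\<integral>\<^sup>+x. enn (nsq (f (fst x) * g (snd x))) \<partial>(lborel \<Otimes>\<^sub>M lborel))
   = (nnl (%s. (nnl (%t. enn (nsq (f s)) * enn (nsq (g t))))))"
  by (subst lborel.nn_integral_fst[symmetric]) (auto simp: norm_mult power_mult_distrib ennreal_mult')
 also have "... = (nnl (%s. enn (nsq (f s)))) * (nnl (%t. enn (nsq (g t))))"
  by (simp add: nn_integral_cmult nn_integral_multc)
 also have "... < \<infinity>"
  using assms by (simp add: sq_int_iff_nn ennreal_mult_less_top)
 finally show ?thesis
  unfolding sq_int_iff_nn lborel_prod[symmetric] by auto
qed

text \<open>The hypothesis on \<open>K\<close> after one integration by parts: the first argument
  already enters through its primitive, the second one still as a derivative, while the bound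
  involves both primitives.\<close>

definition form_bound :: "real => real => real => real => (plane => complex) => bool" where
 "form_bound T nu C D k \<longleftrightarrow> (\<forall>p q. adm T p --> adm T q -->
   cmod (LINT x|lborel. k x * (prim p (fst x) * cnj (q (snd x))))
    <= C * sq_norm lborel (prim p) * sq_norm lborel (prim q) + D * hn nu (prim p) * hn nu (prim q))"

definition ecut :: "bool => real => (real => complex) => real => complex" where
 "ecut b a f s = (if b then cut a f s else f s - cut a f s)"

lemma ecut_eq: "ecut b a f s = (if (s < a) = b then f s else 0)"
 by (auto simp: ecut_def cut_def)

lemma ecut_borel [measurable]:
 assumes [measurable]: "f \<in> bmeas borel"
 shows "ecut b a f \<in> bmeas borel"
 unfolding ecut_def[abs_def] by (cases b) simp_all

text \<open>The cut function jumps and is not the primitive of a square integrable function. It is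
  approximated by products with ramps, whose derivatives stay bounded in L1 though not in L2; this
  is enough for convergence of the \<open>hn\<close> norms. Ramp values lie in [0,1], so the L2 part
  keeps the norm of the uncut function.\<close>

lemma form_bound_ecut:
 assumes nu: "nu < 1/2" and T: "0 < T" "T <= 1" and k: "sq_int lborel k" and H: "form_bound T nu C D k"
  and CD: "C >= 0" "D >= 0" and p: "adm T p" and q: "adm T q"
 shows "cmod (LINT x|lborel. k x * (ecut b a (prim p) (fst x) * cnj (q (snd x))))
    <= C * sq_norm lborel (prim p) * sq_norm lborel (prim q) + D * hn nu (ecut b a (prim p)) * hn nu (prim q)"
proof -
 note pint = adm_integrable[OF p] and qint = adm_integrable[OF q]
 let ?B = "LINT s|lborel. cmod (p s)"
 note fb = prim_norm_le[OF pint]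
 have [measurable]: "p \<in> bmeas borel" "q \<in> bmeas borel" "k \<in> bmeas borel"
  using pint qint k by (auto simp: sq_int_def)
 have [measurable]: "prim p \<in> bmeas borel" by (rule prim_borel[OF pint])
 \<comment> \<open>A block of unit mass just to the left of \<open>a\<close>; its primitive
   \<open>m n\<close> climbs from 0 to 1 and equals 1 at \<open>a\<close> itself, in agreement with
   the strict inequality in \<open>cut\<close>.\<close>
 define rn where "rn n s = real (Suc n) * ind {a - 1 / real (Suc n)<..<a} s" for n s
 define kn where "kn n s = cpx (rn n s)" for n s
 have rint: "integrable lborel (rn n)" "(LINT s|lborel. rn n s) = 1" for n
  unfolding rn_def[abs_def] using integrable_indicator_interval by auto
 have kint: "integrable lborel (kn n)" for n unfolding kn_def[abs_def] using rint by auto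
 define m where "m n t = (LINT s|lborel. ind {..<t} s *R rn n s)" for n t
 have mi: "integrable lborel (%s. ind {..<t} s *R rn n s)" for n t
  by (intro integrable_mult_indicator rint) simp
 have m: "prim (kn n) t = cpx (m n t)" for n t
  unfolding prim_def kn_def m_def integral_complex_of_real[symmetric] by (simp add: scaleR_conv_of_real)
 have m0: "m n t >= 0" for n t
  unfolding m_def by (intro B_integral_nonneg) (auto simp: rn_def)
 have m1: "m n t <= 1" for n t
  unfolding rint(2)[symmetric, of n] m_def using rint(1) mi by (intro integral_mono) (auto simp: rn_def indicator_def)
 have mlim: "(%n. m n t) ---> (if t < a then 0 else 1)" for t
 proof (cases "t < a")
  case True
  have "(%n. 1 / real (Suc n)) ---> 0" by real_asymp
  then have "eventually (%n. 1 / real (Suc n) < a - t) sequentially"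
   using True by (intro order_tendstoD) auto
  then have "eventually (%n. m n t = 0) sequentially"
  proof eventually_elim
   case (elim n)
   then show ?case unfolding m_def by (intro integral_eq_zero_AE) (auto simp: rn_def indicator_def)
  qed
  then show ?thesis using True by (simp add: tendsto_eventually)
 next
  case False
  have "m n t = 1" for n
   unfolding rint(2)[symmetric, of n] m_def
   using False by (intro B_integral_cong) (auto simp: rn_def indicator_def)
  then show ?thesis using False by simp
 qed
 \<comment> \<open>The derivative of ramp times \<open>prim p\<close>, written out by the product
   rule; for \<open>b\<close> the ramp is subtracted from 1.\<close>
 define pn where "pn n s = (if b then p s - (p s * prim (kn n) s + prim p s * kn n s) else p s * prim (kn n) s + prim p s * kn n s)" for n s
 define W where "W n t = (if b then 1 - m n t else m n t)" for n t
 have W: "0 <= W n t" "W n t <= 1" for n t using m0 m1 by (auto simp: W_def)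
 have Wlim: "(%n. W n t) ---> (if (t < a) = b then 1 else 0)" for t
  using mlim[of t] tendsto_diff[OF tendsto_const[of "1::real"] mlim[of t]] unfolding W_def by (cases b; cases "t < a") auto
 have primpn: "prim (pn n) t = cpx (W n t) * prim p t" for n t
  using prim_mult[OF pint kint[of n]] prim_diff[OF pint prim_mult(1)[OF pint kint[of n]], of t] m[of n t]
  unfolding pn_def[abs_def] W_def by (cases b) (simp_all add: algebra_simps)
 have pn_le: "cmod (pn n s) <= cmod (p s) + ?B * rn n s" for n s
 proof -
  have r0: "rn n s >= 0" by (simp add: rn_def)
  have "pn n s = cpx (W n s) * p s + (if b then -1 else 1) * (prim p s * kn n s)"
   unfolding pn_def W_def m by (cases b) (simp_all add: algebra_simps)
  then have "cmod (pn n s) <= W n s * cmod (p s) + cmod (prim p s) * rn n s"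
   using norm_triangle_ineq[of "cpx (W n s) * p s" "(if b then -1 else 1) * (prim p s * kn n s)"] W(1)[of n s] r0
   by (auto simp: norm_mult kn_def split: if_splits)
  also have "... <= 1 * cmod (p s) + ?B * rn n s"
   using W[of n s] fb[of s] r0 by (intro add_mono mult_right_mono) auto
  finally show ?thesis by simp
 qed
 have [measurable]: "prim (kn n) \<in> bmeas borel" for n by (rule prim_borel[OF kint])
 have [measurable]: "kn n \<in> bmeas borel" for n using kint by auto
 have [measurable]: "pn n \<in> bmeas borel" for n unfolding pn_def[abs_def] by (cases b) simp_all
 have pn0: "pn n s = 0" if "s ~: {0<..<T}" for n s
  using that p adm_prim_zero[OF p that] by (auto simp: pn_def adm_def)
 have pnint: "integrable lborel (pn n)" for n
 proof (rule B_integrable_bound[of _ "%s. cmod (p s) + ?B * rn n s"])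
  show "AE s in lborel. norm (pn n s) <= norm (cmod (p s) + ?B * rn n s)"
   unfolding real_norm_def by (intro AE_I2 order_trans[OF pn_le abs_ge_self])
 qed (use pint rint in auto)
 \<comment> \<open>The block has unit mass and \<open>prim p\<close> is bounded by
   \<open>?B\<close>, so the L1 norms do not grow with \<open>n\<close>.\<close>
 have pnL1: "(LINT s|lborel. cmod (pn n s)) <= 2 * ?B" for n
 proof -
  have "(LINT s|lborel. cmod (pn n s)) <= (LINT s|lborel. cmod (p s) + ?B * rn n s)"
   using pint rint pnint by (intro integral_mono pn_le) auto
  also have "... = 2 * ?B" using pint rint by simp
  finally show ?thesis .
 qed
 have adm_pn: "adm T (pn n)" for n
 proof -
  have "sq_int lborel (%s. cpx (?B * rn n s))"
  proof -
   have "(%s. (nsq (cpx (?B * rn n s)))) = (%s. (?B\<^sup>2 * real (Suc n)) * rn n s)"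
   proof
    fix s
    have "(rn n s)\<^sup>2 = real (Suc n) * rn n s"
     by (auto simp: rn_def indicator_def power2_eq_square)
    then show "(nsq (cpx (?B * rn n s))) = (?B\<^sup>2 * real (Suc n)) * rn n s"
     by (simp only: norm_of_real power2_abs power_mult_distrib mult.assoc)
   qed
   then show ?thesis using rint(1)[of n] unfolding sq_int_def by (auto simp del: of_nat_Suc)
  qed
  moreover have "sq_int lborel (%s. cpx (cmod (p s)))"
   using p by (auto simp: adm_def sq_int_def)
  ultimately have "sq_int lborel (%s. cpx (cmod (p s)) + cpx (?B * rn n s))"
   by (rule sq_int_add(1)[rotated])
  then have "sq_int lborel (pn n)"
  proof (rule sq_int_bound(1))
   show "AE s in lborel. cmod (pn n s) <= cmod (cpx (cmod (p s)) + cpx (?B * rn n s))"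
    unfolding of_real_add[symmetric] norm_of_real by (intro AE_I2 order_trans[OF pn_le abs_ge_self])
  qed simp
  moreover have "(LINT s|lborel. pn n s) = 0"
   using prim_right[of T "pn n" T] pn0[of _ n] primpn[of n T] adm_prim_zero[OF p, of T] by auto
  ultimately show ?thesis using pn0 by (auto simp: adm_def)
 qed
 have lhs: "(%n. LINT x|lborel. k x * (prim (pn n) (fst x) * cnj (q (snd x)))) ---> (LINT x|lborel. k x * (ecut b a (prim p) (fst x) * cnj (q (snd x))))"
 proof (rule integral_dominated_convergence)
  have "sq_int lborel q" using q by (simp add: adm_def)
  then have t: "sq_int lborel (%x. prim p (fst x) * q (snd x))"
   by (intro sq_int_tensor adm_prim[OF p])
  show "integrable lborel (%x. cmod (k x) * cmod (prim p (fst x) * q (snd x)))"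
   by (rule sq_int_norm_mult[OF k t])
  have [measurable]: "prim (pn n) \<in> bmeas borel" for n by (rule prim_borel[OF pnint])
  show "(%x. k x * (prim (pn n) (fst x) * cnj (q (snd x)))) \<in> bmeas lborel" for n
   using borel_measurable_times[OF _ tensor_borel[of "prim (pn n)" "%t. cnj (q t)"], of k] by simp
  show "(%x. k x * (ecut b a (prim p) (fst x) * cnj (q (snd x)))) \<in> bmeas lborel"
   using borel_measurable_times[OF _ tensor_borel[of "ecut b a (prim p)" "%t. cnj (q t)"], of k] by simp
  show "AE x in lborel. (%n. k x * (prim (pn n) (fst x) * cnj (q (snd x)))) ---> k x * (ecut b a (prim p) (fst x) * cnj (q (snd x)))"
  proof (rule AE_I2)
   fix x :: "plane"
   have "(%n. cpx (W n (fst x)) * prim p (fst x)) ---> cpx (if (fst x < a) = b then 1 else 0) * prim p (fst x)"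
    by (intro tendsto_intros Wlim)
   also have "cpx (if (fst x < a) = b then 1 else 0) * prim p (fst x) = ecut b a (prim p) (fst x)"
    by (simp add: ecut_eq)
   finally show "(%n. k x * (prim (pn n) (fst x) * cnj (q (snd x)))) ---> k x * (ecut b a (prim p) (fst x) * cnj (q (snd x)))"
    unfolding primpn by (intro tendsto_intros)
  qed
  show "AE x in lborel. cmod (k x * (prim (pn n) (fst x) * cnj (q (snd x)))) <= cmod (k x) * cmod (prim p (fst x) * q (snd x))" for n
   using W by (intro AE_I2) (auto simp: primpn norm_mult intro!: mult_left_mono mult_right_mono mult_left_le_one_le)
 qed
 have sqn: "sq_norm lborel (prim (pn n)) <= sq_norm lborel (prim p)" for n
 proof (rule sq_int_bound(2)[OF adm_prim(2)[OF p]])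
  show "AE t in lborel. cmod (prim (pn n) t) <= cmod (prim p t)"
   using W by (intro AE_I2) (auto simp: primpn norm_mult intro!: mult_left_le_one_le)
 qed (use prim_borel[OF pnint] in simp)
 have hlim: "(%n. hn nu (prim (pn n))) ---> hn nu (ecut b a (prim p))"
 proof (rule hn_tendsto[OF nu])
  show "prim (pn n) \<in> bmeas borel" for n by (rule prim_borel[OF pnint])
  show "(nsq (fourier (prim (pn n)) om)) * (1 + om\<^sup>2) <= 5 * (2 * ?B)\<^sup>2" for n om
  proof -
   have "(nsq (fourier (prim (pn n)) om)) * (1 + om\<^sup>2) <= 5 * (LINT s|lborel. cmod (pn n s))\<^sup>2"
    using fourier_cut_prim_bound[OF T adm_pn, of T n om] cut_prim_id[OF adm_pn, of T n] by simp
   also have "... <= 5 * (2 * ?B)\<^sup>2"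
    by (intro mult_left_mono power_mono pnL1) auto
   finally show ?thesis .
  qed
  show "(%n. fourier (prim (pn n)) om) ---> fourier (ecut b a (prim p)) om" for om
   unfolding fourier_ker
  proof (rule integral_dominated_convergence[where w="%t. cmod (prim p t)"])
   show "AE t in lborel. (%n. prim (pn n) t * ker om t) ---> ecut b a (prim p) t * ker om t"
   proof (rule AE_I2)
    fix t
    have "(%n. cpx (W n t) * prim p t) ---> cpx (if (t < a) = b then 1 else 0) * prim p t"
     by (intro tendsto_intros Wlim)
    also have "cpx (if (t < a) = b then 1 else 0) * prim p t = ecut b a (prim p) t"
     by (simp add: ecut_eq)
    finally show "(%n. prim (pn n) t * ker om t) ---> ecut b a (prim p) t * ker om t"
     unfolding primpn by (intro tendsto_intros)
   qed
   show "AE t in lborel. norm (prim (pn n) t * ker om t) <= cmod (prim p t)" for n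
    using W by (intro AE_I2) (auto simp: primpn norm_mult intro!: mult_left_le_one_le)
   show "(%t. prim (pn n) t * ker om t) \<in> bmeas lborel" for n
    using prim_borel[OF pnint[of n]] by simp
   show "integrable lborel (%t. cmod (prim p t))"
    using adm_prim(1)[OF p] by simp
  qed measurable
 qed measurable
 show ?thesis
 proof (rule LIMSEQ_le[OF tendsto_norm[OF lhs]])
  show "(%n. C * sq_norm lborel (prim p) * sq_norm lborel (prim q) + D * hn nu (prim (pn n)) * hn nu (prim q))
   ---> C * sq_norm lborel (prim p) * sq_norm lborel (prim q) + D * hn nu (ecut b a (prim p)) * hn nu (prim q)"
   by (intro tendsto_intros hlim)
  show "\<exists>N. \<forall>n\<ge>N. norm (LINT x|lborel. k x * (prim (pn n) (fst x) * cnj (q (snd x))))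
    <= C * sq_norm lborel (prim p) * sq_norm lborel (prim q) + D * hn nu (prim (pn n)) * hn nu (prim q)"
  proof (intro exI allI impI)
   fix n
   have "norm (LINT x|lborel. k x * (prim (pn n) (fst x) * cnj (q (snd x))))
    <= C * sq_norm lborel (prim (pn n)) * sq_norm lborel (prim q) + D * hn nu (prim (pn n)) * hn nu (prim q)"
    using H adm_pn q unfolding form_bound_def by blast
   also have "... <= C * sq_norm lborel (prim p) * sq_norm lborel (prim q) + D * hn nu (prim (pn n)) * hn nu (prim q)"
    using CD sqn[of n] by (intro add_right_mono mult_right_mono mult_left_mono) auto
   finally show "norm (LINT x|lborel. k x * (prim (pn n) (fst x) * cnj (q (snd x))))
    <= C * sq_norm lborel (prim p) * sq_norm lborel (prim q) + D * hn nu (prim (pn n)) * hn nu (prim q)" .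
  qed
 qed
qed

lemma adm_half_bound:
 fixes z w :: complex shows "(nsq (z - w)) <= 2 * (nsq z) + 2 * (nsq w)"
proof -
 have "(nsq (z - w)) <= (cmod z + cmod w)\<^sup>2"
  by (intro power_mono norm_triangle_ineq4) auto
 also have "... <= 2 * (nsq z) + 2 * (nsq w)"
  using sum_squares_bound[of "cmod z" "cmod w"] by (simp only: power2_sum)
 finally show ?thesis .
qed

lemma cmod_add_square_le:
 fixes z w :: complex shows "(nsq (z + w)) <= 2 * (nsq z) + 2 * (nsq w)"
 using adm_half_bound[of z "-w"] by simp

lemma ennreal_square_le_imp_le:
 fixes X :: ennreal
 assumes "X\<^sup>2 <= (enn y)\<^sup>2" "y >= 0"
 shows "X <= enn y"
proof (cases X)
 case (real x)
 then have "x\<^sup>2 <= y\<^sup>2" using assms by (simp add: ennreal_power)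
 then have "x <= y" using assms(2) by (rule power2_le_imp_le)
 then show ?thesis using real by (simp add: ennreal_leI)
next
 case top
 then show ?thesis using assms by (simp add: power2_eq_square ennreal_mult'[symmetric] top_unique)
qed

lemma fourier_ecut:
 assumes "integrable lborel f"
 shows "fourier (ecut b a f) om = (if b then fourier (cut a f) om else fourier f om - fourier (cut a f) om)"
 using integrable_mult_ker[OF assms, of om] integrable_mult_ker[OF integrable_cut[OF assms], of a om]
 by (cases b) (simp_all add: ecut_def[abs_def] fourier_ker left_diff_distrib)

lemma ennreal_square_split:
 "enn (w * (2 * x + 2 * y)) = 2 * enn (w * x) + 2 * enn (w * y)" if "w >= 0" "x >= 0" "y >= 0"
 using that by (simp add: distrib_left mult.left_commute ennreal_plus ennreal_mult' flip: ennreal_numeral)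

lemma HN_ecut_le:
 assumes f: "integrable lborel f"
 shows "HN nu (ecut b a f) <= 2 * HN nu f + 2 * HN nu (cut a f)"
proof -
 have [measurable]: "f \<in> bmeas borel" using f by auto
 have "HN nu (ecut b a f) <= (nnl (%om. 2 * enn ((1 + om\<^sup>2) powr nu * (nsq (fourier f om))) + 2 * enn ((1 + om\<^sup>2) powr nu * (nsq (fourier (cut a f) om)))))"
  unfolding HN_def
 proof (rule nn_integral_mono)
  fix om :: real
  have "(nsq (fourier (ecut b a f) om)) <= 2 * (nsq (fourier f om)) + 2 * (nsq (fourier (cut a f) om))"
   using adm_half_bound[of "fourier f om" "fourier (cut a f) om"] by (simp add: fourier_ecut[OF f] add_increasing)
  then have "enn ((1 + om\<^sup>2) powr nu * (nsq (fourier (ecut b a f) om))) <= enn ((1 + om\<^sup>2) powr nu * (2 * (nsq (fourier f om)) + 2 * (nsq (fourier (cut a f) om))))"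
   by (intro ennreal_leI mult_left_mono) auto
  then show "enn ((1 + om\<^sup>2) powr nu * (nsq (fourier (ecut b a f) om))) <= 2 * enn ((1 + om\<^sup>2) powr nu * (nsq (fourier f om))) + 2 * enn ((1 + om\<^sup>2) powr nu * (nsq (fourier (cut a f) om)))"
   by (subst (asm) ennreal_square_split) auto
 qed
 also have "... = 2 * HN nu f + 2 * HN nu (cut a f)"
  unfolding HN_def by (simp add: nn_integral_add nn_integral_cmult)
 finally show ?thesis .
qed

section \<open>Superpositions of cutoffs\<close>

text \<open>A family of multipliers in \<open>t\<close>, indexed by the cut point \<open>a\<close>,
  each a constant plus the primitive of a density. The bounds on rows and columns are those of
  Schur's test and are the quantity \<open>M\<close> of the estimates; the pointwise bound
  \<open>B\<close> secures integrability and may blow up along an approximation.\<close>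

locale kernel =
 fixes T M B :: real and c :: "real => complex" and k :: "real => real => complex"
 assumes T: "0 < T" "T <= 1" and M: "0 <= M"
  and k_meas [measurable]: "(%(a, b). k a b) \<in> bmeas (borel \<Otimes>\<^sub>M borel)"
  and c_meas [measurable]: "c \<in> bmeas borel"
  and k_bound: "!!a b. cmod (k a b) <= B" and k_zero: "!!a b. b ~: {0<..<T} ==> k a b = 0"
  and c_bound: "!!a. cmod (c a) <= M"
  and k_row: "!!a. (nnl (%b. enn (cmod (k a b)))) <= enn M"
  and k_col: "!!b. (nnl (%a. enn (cmod (k a b)))) <= enn M"
begin

definition mult :: "real => real => complex" where
 "mult a t = c a + prim (k a) t"

definition dmult :: "(real => complex) => real => real => complex" where
 "dmult v a t = k a t * prim v t + mult a t * v t"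

lemma k_row_meas [measurable]: "k a \<in> bmeas borel"
 using measurable_Pair2[OF k_meas, of a] by simp

lemma k_int: "integrable lborel (k a)" "sq_int lborel (k a)"
 using integrable_interval_support[OF k_row_meas k_bound k_zero] by auto

lemma k_L1: "(LINT b|lborel. cmod (k a b)) <= M"
proof -
 have "enn (LINT b|lborel. cmod (k a b)) = (nnl (%b. enn (cmod (k a b))))"
  using k_int(1)[of a] by (intro nn_integral_eq_integral[symmetric]) auto
 also have "... <= enn M" by (rule k_row)
 finally show ?thesis by (subst (asm) ennreal_le_iff[OF M])
qed

lemma mult_bound: "cmod (mult a t) <= 2 * M"
 unfolding mult_def using norm_triangle_ineq[of "c a" "prim (k a) t"] c_bound[of a] prim_norm_le[OF k_int(1), of a t] k_L1[of a]
 by linarith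

lemma mult_meas [measurable]: "(%(a, t). mult a t) \<in> bmeas (borel \<Otimes>\<^sub>M borel)"
proof -
 have "(%x. c (fst x) + (LINT b|lborel. (if b < snd x then 1 else 0) *R k (fst x) b)) \<in> bmeas (borel \<Otimes>\<^sub>M borel)"
  by measurable
 moreover have "prim (k a) t = (LINT b|lborel. (if b < t then 1 else 0) *R k a b)" for a t
  unfolding prim_def by (intro B_integral_cong) (auto simp: indicator_def)
 ultimately show ?thesis by (simp add: mult_def case_prod_beta)
qed

lemma mult_row_meas [measurable]: "mult a \<in> bmeas borel"
 using measurable_Pair2[OF mult_meas, of a] by simp

lemma prim_dmult:
 assumes v: "adm T v"
 shows "integrable lborel (dmult v a)" "prim (dmult v a) t = mult a t * prim v t" "adm T (dmult v a)"
proof -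
 note vi = adm_integrable[OF v]
 have eq: "dmult v a = (%t. (k a t * prim v t + prim (k a) t * v t) + c a * v t)"
  by (auto simp: dmult_def mult_def algebra_simps)
 note pm = prim_mult[OF k_int(1)[of a] vi]
 show i: "integrable lborel (dmult v a)"
  unfolding eq using pm(1) vi by auto
 show p: "prim (dmult v a) t = mult a t * prim v t" for t
  unfolding eq by (subst prim_add[OF pm(1)]) (use vi in "simp_all add: pm(2) prim_cmult mult_def distrib_right add.commute")
 have z: "dmult v a t = 0" if "t ~: {0<..<T}" for t
  using v that k_zero[OF that] by (auto simp: dmult_def adm_def)
 have "sq_int lborel (%t. prim v t * k a t)"
  by (rule sq_int_bounded_mult(1)[OF k_int(2), where B="LINT s|lborel. cmod (v s)"])
   (use prim_borel[OF vi] prim_norm_le[OF vi] in auto)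
 moreover have "sq_int lborel (%t. mult a t * v t)"
  by (rule sq_int_bounded_mult(1)[where B="2 * M"]) (use v M mult_bound in "auto simp: adm_def")
 ultimately have "sq_int lborel (dmult v a)"
  using sq_int_add(1) unfolding dmult_def[abs_def] by (metis (no_types, lifting) ext mult.commute)
 moreover have "(LINT t|lborel. dmult v a t) = 0"
  using prim_right[of T "dmult v a" T] z p[of T] adm_prim_zero[OF v, of T] by auto
 ultimately show "adm T (dmult v a)" using z by (auto simp: adm_def)
qed

text \<open>Multiplication by the primitive of \<open>k a\<close> is the superposition, with density
  \<open>k a b\<close>, of the operators that keep only what lies to the right of \<open>b\<close>.
  Thus the multiplier is itself reduced to cuts.\<close>

lemma fourier_mult_prim:
 assumes v: "adm T v"
 shows "fourier (%t. mult a t * prim v t) om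
  = c a * fourier (prim v) om + (LINT b|lborel. k a b * (fourier (prim v) om - fourier (cut b (prim v)) om))"
proof -
 note vi = adm_integrable[OF v] and gi = adm_prim(1)[OF v]
 have [measurable]: "prim v \<in> bmeas borel" by (rule prim_borel[OF vi])
 have gn: "integrable lborel (%t. cmod (prim v t))" "integrable lborel (%b. cmod (k a b))" using gi k_int(1)[of a] by auto
 let ?K = "%t b. (if b < t then 1 else 0) * (k a b * (prim v t * ker om t)) :: complex"
 have meas: "(%(t, b). ?K t b) \<in> bmeas (borel \<Otimes>\<^sub>M borel)" by measurable
 have dom: "cmod (?K t b) <= cmod (prim v t) * cmod (k a b)" for t b by (auto simp: norm_mult mult.commute)
 have t1: "prim (k a) t * prim v t * ker om t = (LINT b|lborel. ?K t b)" for t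
 proof -
  have "(LINT b|lborel. ?K t b) = (LINT b|lborel. (ind {..<t} b *R k a b) * (prim v t * ker om t))"
   by (intro B_integral_cong) (auto simp: indicator_def)
  then show ?thesis by (simp only: integral_mult_left_zero prim_def[of "k a"] mult.assoc)
 qed
 have t2: "(LINT t|lborel. ?K t b) = k a b * (fourier (prim v) om - fourier (cut b (prim v)) om)" for b
 proof -
  have "(LINT t|lborel. ?K t b) = (LINT t|lborel. k a b * (prim v t * ker om t - cut b (prim v) t * ker om t))"
  proof (rule integral_cong_AE)
   show "AE t in lborel. ?K t b = k a b * (prim v t * ker om t - cut b (prim v) t * ker om t)"
    by (rule eventually_mono[OF AE_lborel_singleton[of b]]) (auto simp: cut_def)
  qed measurable
  also have "... = k a b * ((LINT t|lborel. prim v t * ker om t) - (LINT t|lborel. cut b (prim v) t * ker om t))"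
   using integrable_mult_ker[OF gi] integrable_mult_ker[OF integrable_cut[OF gi]] by simp
  finally show ?thesis by (simp add: fourier_ker)
 qed
 have "fourier (%t. mult a t * prim v t) om = (LINT t|lborel. c a * (prim v t * ker om t) + (LINT b|lborel. ?K t b))"
  unfolding fourier_ker
 proof (rule B_integral_cong[OF refl])
  fix t
  show "mult a t * prim v t * ker om t = c a * (prim v t * ker om t) + (LINT b|lborel. ?K t b)"
   unfolding t1[symmetric] mult_def by (simp add: algebra_simps)
 qed
 also have "... = c a * fourier (prim v) om + (LINT t|lborel. LINT b|lborel. ?K t b)"
  using integrable_mult_ker[OF gi] fubini_dominated(5)[OF meas gn dom] by (simp add: fourier_ker)
 also have "(LINT t|lborel. LINT b|lborel. ?K t b) = (LINT b|lborel. LINT t|lborel. ?K t b)"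
  by (rule fubini_dominated(2)[OF meas gn dom])
 finally show ?thesis unfolding t2 .
qed

text \<open>Cauchy-Schwarz in \<open>b\<close> with weight |k a b| uses the row bound, then
  integration over \<open>a\<close> uses the column bound: hence M^2. Squaring sums gives 2 + 4 = 6
  for the uncut part and 4 in front of the averaged cuts.\<close>

lemma HN_mult_average:
 assumes v: "adm T v" and C: "C >= 0"
  and avg: "(nnl (%a. ind {0<..<T} a * HN nu (cut a (prim v)))) <= enn (C * T) * HN nu (prim v)"
 shows "(nnl (%a. ind {0<..<T} a * HN nu (%t. mult a t * prim v t))) <= enn (M\<^sup>2 * T * (6 + 4 * C)) * HN nu (prim v)"
proof -
 note vi = adm_integrable[OF v] and gi = adm_prim(1)[OF v]
 have [measurable]: "prim v \<in> bmeas borel" by (rule prim_borel[OF vi])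
 let ?w = "%om::real. enn ((1 + om\<^sup>2) powr nu)"
 let ?G = "%om. enn (nsq (fourier (prim v) om))"
 let ?Gc = "%b om. enn (nsq (fourier (cut b (prim v)) om))"
 let ?H = "%b om. fourier (prim v) om - fourier (cut b (prim v)) om"
 let ?E = "%a om. enn (nsq (fourier (%t. mult a t * prim v t) om))"
 have HNw: "HN nu f = (nnl (%om. ?w om * enn (nsq (fourier f om))))" for f
  unfolding HN_def by (simp add: ennreal_mult')
 have Emeas [measurable]: "(%(a, om). ?E a om) \<in> bmeas (borel \<Otimes>\<^sub>M borel)"
 proof -
  have "(%x. LINT t|lborel. (case (fst x, t) of (a, t) => mult a t) * prim v t * ker (snd x) t) \<in> bmeas (borel \<Otimes>\<^sub>M borel)"
   by measurable
  then show ?thesis unfolding fourier_ker case_prod_beta by simp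
 qed
 have pt: "?E a om <= enn (2 * M\<^sup>2) * ?G om + enn (2 * M) * (nnl (%b. enn (cmod (k a b)) * enn (nsq (?H b om))))" for a om
 proof -
  let ?I = "LINT b|lborel. k a b * ?H b om"
  have [measurable]: "(%b. ?H b om) \<in> bmeas borel"
   using measurable_compose[OF _ fourier_cut_borel[of "prim v"], of "%b. (b, om)" borel] by simp
  have "enn (cmod ?I) <= (nnl (%b. enn (cmod (k a b * ?H b om))))"
   by (cases "integrable lborel (%b. k a b * ?H b om)") (auto simp: integral_norm_bound_ennreal not_integrable_integral_eq)
  then have "enn (cmod ?I) ^ 2 <= (nnl (%b. enn (cmod (k a b * ?H b om)))) ^ 2"
   by (rule power_mono) simp
  also have "... = (nnl (%b. enn (sqrt (cmod (k a b))) * enn (sqrt (cmod (k a b)) * cmod (?H b om)))) ^ 2"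
   by (simp add: ennreal_mult'[symmetric] norm_mult mult.assoc[symmetric])
  also have "... <= (nnl (%b. enn (sqrt (cmod (k a b))) ^ 2)) * (nnl (%b. enn (sqrt (cmod (k a b)) * cmod (?H b om)) ^ 2))"
   by (rule Cauchy_Schwarz_nn_integral) measurable
  also have "... = (nnl (%b. enn (cmod (k a b)))) * (nnl (%b. enn (cmod (k a b)) * enn (nsq (?H b om))))"
   by (simp add: ennreal_power power_mult_distrib ennreal_mult')
  also have "... <= enn M * (nnl (%b. enn (cmod (k a b)) * enn (nsq (?H b om))))"
   by (intro mult_right_mono k_row) simp
  finally have I: "enn (nsq ?I) <= enn M * (nnl (%b. enn (cmod (k a b)) * enn (nsq (?H b om))))"
   by (simp add: ennreal_power)
  have "(nsq (fourier (%t. mult a t * prim v t) om)) <= 2 * (nsq (c a * fourier (prim v) om)) + 2 * (nsq ?I)"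
   unfolding fourier_mult_prim[OF v] by (rule cmod_add_square_le)
  also have "(nsq (c a * fourier (prim v) om)) <= M\<^sup>2 * (nsq (fourier (prim v) om))"
   using c_bound[of a] by (auto simp: norm_mult power_mult_distrib intro!: mult_right_mono power_mono)
  finally have "?E a om <= enn (2 * (M\<^sup>2 * (nsq (fourier (prim v) om))) + 2 * (nsq ?I))"
   by (intro ennreal_leI) auto
  also have "... = enn (2 * M\<^sup>2) * ?G om + enn 2 * enn (nsq ?I)"
   by (simp add: ennreal_plus ennreal_mult'[symmetric] mult.assoc del: ennreal_numeral)
  also have "... <= enn (2 * M\<^sup>2) * ?G om + enn 2 * (enn M * (nnl (%b. enn (cmod (k a b)) * enn (nsq (?H b om)))))"
   by (intro add_left_mono mult_left_mono I) simp
  also have "enn 2 * (enn M * (nnl (%b. enn (cmod (k a b)) * enn (nsq (?H b om))))) = enn (2 * M) * (nnl (%b. enn (cmod (k a b)) * enn (nsq (?H b om))))"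
   by (subst ennreal_mult') (simp_all add: mult.assoc)
  finally show ?thesis .
 qed
 have Hmeas [measurable]: "(%(b, om). enn (nsq (?H b om))) \<in> bmeas (borel \<Otimes>\<^sub>M borel)"
 proof -
  have "(%x. fourier (prim v) (snd x) - (case x of (b, om) => fourier (cut b (prim v)) om)) \<in> bmeas (borel \<Otimes>\<^sub>M borel)"
   by measurable
  then show ?thesis by (simp add: case_prod_beta)
 qed
 have ofreq: "(nnl (%a. ind {0<..<T} a * ?E a om)) <= enn (6 * M\<^sup>2 * T) * ?G om + enn (4 * M\<^sup>2) * (nnl (%b. ind {0<..<T} b * ?Gc b om))" for om
 proof -
  have [measurable]: "(%b. enn (nsq (?H b om))) \<in> bmeas borel"
   using measurable_compose[OF _ Hmeas, of "%b. (b, om)" borel] by simp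
  have [measurable]: "(%b. fourier (cut b (prim v)) om) \<in> bmeas borel"
   using measurable_compose[OF _ fourier_cut_borel[of "prim v"], of "%b. (b, om)" borel] by simp
  have "(nnl (%a. ind {0<..<T} a * ?E a om)) <=
   (nnl (%a. (enn (2 * M\<^sup>2) * ?G om) * ind {0<..<T} a + enn (2 * M) * (nnl (%b. enn (cmod (k a b)) * enn (nsq (?H b om))))))"
   using pt[of _ om] by (intro nn_integral_mono) (auto simp: indicator_def)
  also have "... = enn (2 * M\<^sup>2) * ?G om * enn T + enn (2 * M) * (nnl (%a. (nnl (%b. enn (cmod (k a b)) * enn (nsq (?H b om))))))"
   using T by (subst nn_integral_add) (auto simp: nn_integral_cmult)
  also have "(nnl (%a. (nnl (%b. enn (cmod (k a b)) * enn (nsq (?H b om))))))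
    = (nnl (%b. (nnl (%a. enn (cmod (k a b)) * enn (nsq (?H b om))))))"
   by (rule lborel_pair.Fubini') measurable
  also have "... <= (nnl (%b. enn (2 * M) * (ind {0<..<T} b * (?G om + ?Gc b om))))"
  proof (rule nn_integral_mono)
   fix b
   have [measurable]: "(%a. k a b) \<in> bmeas borel"
    using measurable_Pair1[OF k_meas, of b] by simp
   have "(nnl (%a. enn (cmod (k a b)) * enn (nsq (?H b om)))) = (nnl (%a. enn (cmod (k a b)))) * enn (nsq (?H b om))"
    by (rule nn_integral_multc) measurable
   also have "... <= (enn M * ind {0<..<T} b) * enn (nsq (?H b om))"
    using k_col[of b] k_zero[of b] by (intro mult_right_mono) (auto simp: indicator_def)
   also have "... <= (enn M * ind {0<..<T} b) * (enn 2 * (?G om + ?Gc b om))"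
   proof (rule mult_left_mono)
    have "enn (nsq (?H b om)) <= enn (2 * (nsq (fourier (prim v) om)) + 2 * (nsq (fourier (cut b (prim v)) om)))"
     by (intro ennreal_leI adm_half_bound)
    then show "enn (nsq (?H b om)) <= enn 2 * (?G om + ?Gc b om)"
     by (simp add: ennreal_plus ennreal_mult' distrib_left)
   qed simp
   also have "... = enn (2 * M) * (ind {0<..<T} b * (?G om + ?Gc b om))"
    by (subst ennreal_mult') (simp_all add: mult_ac)
   finally show "(nnl (%a. enn (cmod (k a b)) * enn (nsq (?H b om)))) <= enn (2 * M) * (ind {0<..<T} b * (?G om + ?Gc b om))" .
  qed
  also have "... = enn (2 * M) * (enn T * ?G om + (nnl (%b. ind {0<..<T} b * ?Gc b om)))"
   using T by (simp add: nn_integral_cmult nn_integral_add distrib_left nn_integral_multc)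
  finally have "(nnl (%a. ind {0<..<T} a * ?E a om)) <= enn (2 * M\<^sup>2) * ?G om * enn T + enn (2 * M) * (enn (2 * M) * (enn T * ?G om + (nnl (%b. ind {0<..<T} b * ?Gc b om))))"
   by (simp add: add_left_mono mult_left_mono)
  also have "... = (enn (2 * M\<^sup>2) * enn T + enn (2 * M) * enn (2 * M) * enn T) * ?G om + (enn (2 * M) * enn (2 * M)) * (nnl (%b. ind {0<..<T} b * ?Gc b om))"
   by (simp only: distrib_left distrib_right mult_ac add_ac)
  also have "enn (2 * M) * enn (2 * M) = enn (4 * M\<^sup>2)"
   using M by (simp add: ennreal_mult[symmetric] power2_eq_square)
  also have "enn (2 * M\<^sup>2) * enn T + enn (4 * M\<^sup>2) * enn T = enn (6 * M\<^sup>2 * T)"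
   using M T by (simp add: ennreal_mult[symmetric] ennreal_plus[symmetric] del: ennreal_plus)
  finally show ?thesis .
 qed
 have wmeas [measurable]: "?w \<in> bmeas borel" by measurable
 have HNE: "(nnl (%a. ind {0<..<T} a * HN nu (f a))) = (nnl (%om. ?w om * (nnl (%a. ind {0<..<T} a * enn (nsq (fourier (f a) om))))))"
  if fm: "(%(a, om). enn (nsq (fourier (f a) om))) \<in> bmeas (borel \<Otimes>\<^sub>M borel)" for f :: "real => real => complex"
 proof -
  note [measurable] = fm
  have [measurable]: "(%om. enn (nsq (fourier (f a) om))) \<in> bmeas borel" for a
   using measurable_Pair2[OF fm, of a] by simp
  have [measurable]: "(%a. enn (nsq (fourier (f a) om))) \<in> bmeas borel" for om
   using measurable_Pair1[OF fm, of om] by simp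
  have "(nnl (%a. ind {0<..<T} a * HN nu (f a))) = (nnl (%a. (nnl (%om. ?w om * (ind {0<..<T} a * enn (nsq (fourier (f a) om)))))))"
   unfolding HNw by (simp add: nn_integral_cmult[symmetric] mult.left_commute)
  also have "... = (nnl (%om. (nnl (%a. ?w om * (ind {0<..<T} a * enn (nsq (fourier (f a) om)))))))"
   by (rule lborel_pair.Fubini') measurable
  also have "... = (nnl (%om. ?w om * (nnl (%a. ind {0<..<T} a * enn (nsq (fourier (f a) om))))))"
   by (simp add: nn_integral_cmult)
  finally show ?thesis .
 qed
 have Gcmeas: "(%(a, om). ?Gc a om) \<in> bmeas (borel \<Otimes>\<^sub>M borel)"
 proof -
  have "(%x. enn (nsq (case x of (b, om) => fourier (cut b (prim v)) om))) \<in> bmeas (borel \<Otimes>\<^sub>M borel)"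
   by measurable
  then show ?thesis by (simp add: case_prod_beta)
 qed
 note [measurable] = Gcmeas
 have "(nnl (%a. ind {0<..<T} a * HN nu (%t. mult a t * prim v t)))
  <= (nnl (%om. ?w om * (enn (6 * M\<^sup>2 * T) * ?G om + enn (4 * M\<^sup>2) * (nnl (%b. ind {0<..<T} b * ?Gc b om)))))"
  unfolding HNE[OF Emeas] by (intro nn_integral_mono mult_left_mono ofreq) simp
 also have "... = (nnl (%om. enn (6 * M\<^sup>2 * T) * (?w om * ?G om) + enn (4 * M\<^sup>2) * (?w om * (nnl (%b. ind {0<..<T} b * ?Gc b om)))))"
  by (intro nn_integral_cong) (simp only: distrib_left mult.left_commute)
 also have "... = enn (6 * M\<^sup>2 * T) * HN nu (prim v) + enn (4 * M\<^sup>2) * (nnl (%a. ind {0<..<T} a * HN nu (cut a (prim v))))"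
  unfolding HNE[OF Gcmeas] HNw[of "prim v"] by (simp add: nn_integral_add nn_integral_cmult)
 also have "... <= enn (6 * M\<^sup>2 * T) * HN nu (prim v) + enn (4 * M\<^sup>2) * (enn (C * T) * HN nu (prim v))"
  by (intro add_left_mono mult_left_mono avg) simp
 also have "... = (enn (6 * M\<^sup>2 * T) + enn (4 * M\<^sup>2) * enn (C * T)) * HN nu (prim v)"
  by (simp only: distrib_right mult.assoc)
 also have "enn (6 * M\<^sup>2 * T) + enn (4 * M\<^sup>2) * enn (C * T) = enn (M\<^sup>2 * T * (6 + 4 * C))"
  using M T C by (simp add: ennreal_mult[symmetric] ennreal_plus[symmetric] algebra_simps del: ennreal_plus)
 finally show ?thesis .
qed

text \<open>For each \<open>a\<close> apply the form to a cut of \<open>prim p\<close> and to the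
  multiplied \<open>prim v\<close>. Cauchy-Schwarz over \<open>a\<close> then combines two squared
  averages, each of order T, into one factor T.\<close>

lemma superposition_bound:
 assumes nu: "nu < 1/2" and C: "C >= 0"
  and avg: "!!g. adm T g ==> (nnl (%a. ind {0<..<T} a * HN nu (cut a (prim g)))) <= enn (C * T) * HN nu (prim g)"
  and k1: "sq_int lborel k1" and H: "form_bound T nu CK DK k1" and CD: "CK >= 0" "DK >= 0"
  and p: "adm T p" and v: "adm T v"
 shows "cmod (LINT a|lborel. ind {0<..<T} a *R (LINT x|lborel. k1 x * (ecut b a (prim p) (fst x) * cnj (dmult v a (snd x)))))
  <= (6 + 4 * C) * M * T * (CK * sq_norm lborel (prim p) * sq_norm lborel (prim v) + DK * hn nu (prim p) * hn nu (prim v))"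
proof -
 define I where "I a = (LINT x|lborel. k1 x * (ecut b a (prim p) (fst x) * cnj (dmult v a (snd x))))" for a
 note pi = adm_integrable[OF p] and fi = adm_prim(1)[OF p] and vi = adm_integrable[OF v] and gi = adm_prim(1)[OF v]
 have [measurable]: "prim v \<in> bmeas borel" "prim p \<in> bmeas borel" using prim_borel[OF vi] prim_borel[OF pi] by auto
 let ?nf = "sq_norm lborel (prim p)" and ?ng = "sq_norm lborel (prim v)"
 let ?hf = "hn nu (prim p)" and ?hg = "hn nu (prim v)"
 let ?e = "%a. hn nu (ecut b a (prim p))" and ?m = "%a. hn nu (%t. mult a t * prim v t)"
 have mm [measurable]: "(%t. mult a t * prim v t) \<in> bmeas borel" for a by measurable
 have Ib: "cmod (I a) <= 2 * M * CK * ?nf * ?ng + DK * ?e a * ?m a" for a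
 proof -
  have pr: "prim (dmult v a) = (%t. mult a t * prim v t)" using prim_dmult(2)[OF v] by blast
  have "cmod (I a) <= CK * ?nf * sq_norm lborel (%t. mult a t * prim v t) + DK * ?e a * ?m a"
   unfolding I_def using form_bound_ecut[OF nu T k1 H CD p prim_dmult(3)[OF v], of b a a] by (simp add: pr)
  also have "... <= CK * ?nf * (2 * M * ?ng) + DK * ?e a * ?m a"
  proof (intro add_right_mono mult_left_mono)
   show "sq_norm lborel (%t. mult a t * prim v t) <= 2 * M * ?ng"
    by (rule sq_int_bounded_mult(2)) (use M mult_bound adm_prim(2)[OF v] in auto)
  qed (use CD in simp)
  finally show ?thesis by (simp add: mult_ac)
 qed
 define X where "X = (nnl (%a. (ind {0<..<T} a * enn (?e a)) * (ind {0<..<T} a * enn (?m a))))"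
 have sq: "(enn (hn nu f))\<^sup>2 <= enn (1 / (2 * pi)) * HN nu f" for f
 proof -
  have "(enn (hn nu f))\<^sup>2 = enn (1 / (2 * pi)) * enn (enn2real (HN nu f))"
   by (simp add: hn_def ennreal_power ennreal_mult'[symmetric])
  also have "... <= enn (1 / (2 * pi)) * HN nu f"
   by (intro mult_left_mono) (cases "HN nu f"; simp)+
  finally show ?thesis .
 qed
 have em [measurable]: "(%a. HN nu (ecut b a (prim p))) \<in> bmeas borel"
 proof -
  have "(%a. (nnl (%om. enn ((1 + om\<^sup>2) powr nu * (nsq (if b then (case (a, om) of (a, om) => fourier (cut a (prim p)) om) else fourier (prim p) om - (case (a, om) of (a, om) => fourier (cut a (prim p)) om))))))) \<in> bmeas borel"
   by measurable
  then show ?thesis unfolding HN_def fourier_ecut[OF fi] by simp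
 qed
 have mmeas [measurable]: "(%a. HN nu (%t. mult a t * prim v t)) \<in> bmeas borel"
 proof -
  have 1: "(%x. LINT t|lborel. (case (fst x, t) of (a, t) => mult a t) * prim v t * ker (snd x) t) \<in> bmeas (borel \<Otimes>\<^sub>M borel)"
   by measurable
  have [measurable]: "(%(a, om). fourier (%t. mult a t * prim v t) om) \<in> bmeas (borel \<Otimes>\<^sub>M borel)"
   using 1 unfolding fourier_ker case_prod_beta by simp
  have "(%a. (nnl (%om. enn ((1 + om\<^sup>2) powr nu * (nsq (case (a, om) of (a, om) => fourier (%t. mult a t * prim v t) om)))))) \<in> bmeas borel"
   by measurable
  then show ?thesis unfolding HN_def by simp
 qed
 have ehn [measurable]: "(%a. ?e a) \<in> bmeas borel" "(%a. ?m a) \<in> bmeas borel"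
  unfolding hn_def by measurable
 have B5: "HN nu (prim g) = enn (2 * pi * (hn nu (prim g))\<^sup>2)" if g: "adm T g" for g
  using fourier_cut_prim_bound[OF T g, of T] cut_prim_id[OF g, of T] prim_borel[OF adm_integrable[OF g]]
  by (intro HN_integral(3)[OF nu, where B="5 * (LINT s|lborel. cmod (g s))\<^sup>2"]) auto
 have A1: "(nnl (%a. (ind {0<..<T} a * enn (?e a))\<^sup>2)) <= enn (T * (6 + 4 * C) * ?hf\<^sup>2)"
 proof -
  have "(nnl (%a. (ind {0<..<T} a * enn (?e a))\<^sup>2)) <= (nnl (%a. enn (1 / (2 * pi)) * (2 * HN nu (prim p) * ind {0<..<T} a + 2 * (ind {0<..<T} a * HN nu (cut a (prim p))))))"
  proof (rule nn_integral_mono)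
   fix a
   have "(enn (?e a))\<^sup>2 <= enn (1 / (2 * pi)) * (2 * HN nu (prim p) + 2 * HN nu (cut a (prim p)))"
    by (rule order_trans[OF sq]) (intro mult_left_mono HN_ecut_le fi, simp)
   then show "(ind {0<..<T} a * enn (?e a))\<^sup>2 <= enn (1 / (2 * pi)) * (2 * HN nu (prim p) * ind {0<..<T} a + 2 * (ind {0<..<T} a * HN nu (cut a (prim p))))"
    by (auto simp: indicator_def)
  qed
  also have "... = enn (1 / (2 * pi)) * (2 * HN nu (prim p) * enn T + 2 * (nnl (%a. ind {0<..<T} a * HN nu (cut a (prim p)))))"
  proof -
   have [measurable]: "(%a. HN nu (cut a (prim p))) \<in> bmeas borel"
   proof -
    have "(%a. (nnl (%om. enn ((1 + om\<^sup>2) powr nu * (nsq (case (a, om) of (a, om) => fourier (cut a (prim p)) om)))))) \<in> bmeas borel"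
     by measurable
    then show ?thesis unfolding HN_def by simp
   qed
   show ?thesis using T by (simp add: nn_integral_cmult nn_integral_add)
  qed
  also have "... <= enn (1 / (2 * pi)) * (2 * HN nu (prim p) * enn T + 2 * (enn (C * T) * HN nu (prim p)))"
   by (intro mult_left_mono add_left_mono avg p) auto
  also have "... = enn (T * (2 + 2 * C) * ?hf\<^sup>2)"
   using T C unfolding B5[OF p]
   by (simp add: ennreal_mult[symmetric] ennreal_plus[symmetric] del: ennreal_plus flip: ennreal_numeral) (simp add: field_simps)
  \<comment> \<open>The constant is enlarged to the one of the other factor, so that the geometric
    mean of the two is free of square roots.\<close>
  also have "... <= enn (T * (6 + 4 * C) * ?hf\<^sup>2)"
   using T C by (intro ennreal_leI mult_right_mono mult_left_mono) auto
  finally show ?thesis .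
 qed
 have A2: "(nnl (%a. (ind {0<..<T} a * enn (?m a))\<^sup>2)) <= enn (M\<^sup>2 * T * (6 + 4 * C) * ?hg\<^sup>2)"
 proof -
  have "(nnl (%a. (ind {0<..<T} a * enn (?m a))\<^sup>2)) <= (nnl (%a. enn (1 / (2 * pi)) * (ind {0<..<T} a * HN nu (%t. mult a t * prim v t))))"
   using sq by (intro nn_integral_mono) (auto simp: indicator_def)
  also have "... = enn (1 / (2 * pi)) * (nnl (%a. ind {0<..<T} a * HN nu (%t. mult a t * prim v t)))"
   by (rule nn_integral_cmult) measurable
  also have "... <= enn (1 / (2 * pi)) * (enn (M\<^sup>2 * T * (6 + 4 * C)) * HN nu (prim v))"
   by (intro mult_left_mono HN_mult_average[OF v C avg[OF v]]) simp
  also have "... = enn (M\<^sup>2 * T * (6 + 4 * C) * ?hg\<^sup>2)"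
   using T C unfolding B5[OF v] by (simp add: ennreal_mult[symmetric])
  finally show ?thesis .
 qed
 have X: "X <= enn ((6 + 4 * C) * M * T * ?hf * ?hg)"
 proof -
  have "X\<^sup>2 <= (nnl (%a. (ind {0<..<T} a * enn (?e a))\<^sup>2)) * (nnl (%a. (ind {0<..<T} a * enn (?m a))\<^sup>2))"
   unfolding X_def by (rule Cauchy_Schwarz_nn_integral) measurable
  also have "... <= enn (T * (6 + 4 * C) * ?hf\<^sup>2) * enn (M\<^sup>2 * T * (6 + 4 * C) * ?hg\<^sup>2)"
   by (intro mult_mono A1 A2) auto
  also have "... = (enn ((6 + 4 * C) * M * T * ?hf * ?hg))\<^sup>2"
   using T C M by (simp add: ennreal_mult[symmetric] ennreal_power power2_eq_square mult_ac)
  finally show ?thesis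
   using T C M by (intro ennreal_square_le_imp_le) (auto intro!: mult_nonneg_nonneg)
 qed
 have "enn (cmod (LINT a|lborel. ind {0<..<T} a *R I a)) <= (nnl (%a. enn (cmod (ind {0<..<T} a *R I a))))"
 proof (cases "integrable lborel (%a. ind {0<..<T} a *R I a)")
  case True
  then show ?thesis by (rule integral_norm_bound_ennreal)
 qed (simp add: not_integrable_integral_eq)
 also have "... <= (nnl (%a. enn (2 * M * CK * ?nf * ?ng) * ind {0<..<T} a + enn DK * ((ind {0<..<T} a * enn (?e a)) * (ind {0<..<T} a * enn (?m a)))))"
 proof (rule nn_integral_mono)
  fix a
  have "enn (cmod (I a)) <= enn (2 * M * CK * ?nf * ?ng + DK * ?e a * ?m a)"
   by (intro ennreal_leI Ib)
  also have "... = enn (2 * M * CK * ?nf * ?ng) + enn DK * (enn (?e a) * enn (?m a))"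
   using M CD by (simp add: ennreal_plus ennreal_mult mult.assoc)
  finally show "enn (cmod (ind {0<..<T} a *R I a)) <= enn (2 * M * CK * ?nf * ?ng) * ind {0<..<T} a + enn DK * ((ind {0<..<T} a * enn (?e a)) * (ind {0<..<T} a * enn (?m a)))"
   by (auto simp: indicator_def)
 qed
 also have "... = enn (2 * M * CK * ?nf * ?ng) * enn T + enn DK * X"
  unfolding X_def using T by (simp add: nn_integral_add nn_integral_cmult)
 also have "... <= enn (2 * M * CK * ?nf * ?ng) * enn T + enn DK * enn ((6 + 4 * C) * M * T * ?hf * ?hg)"
  by (intro add_left_mono mult_left_mono X) simp
 also have "... = enn (2 * M * CK * ?nf * ?ng * T + DK * ((6 + 4 * C) * M * T * ?hf * ?hg))"
  using M T CD C by (simp add: ennreal_mult[symmetric] ennreal_plus[symmetric] del: ennreal_plus)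
 finally have fin: "cmod (LINT a|lborel. ind {0<..<T} a *R I a) <= 2 * M * CK * ?nf * ?ng * T + DK * ((6 + 4 * C) * M * T * ?hf * ?hg)"
  using M T CD C by (subst (asm) ennreal_le_iff) (auto intro!: add_nonneg_nonneg mult_nonneg_nonneg)
 \<comment> \<open>The L2 part comes with the constant 2, which is raised to the common
   constant.\<close>
 have "2 * (M * CK * ?nf * ?ng * T) <= (6 + 4 * C) * (M * CK * ?nf * ?ng * T)"
  using M CD T C by (intro mult_right_mono) auto
 moreover have "(6 + 4 * C) * M * T * (CK * ?nf * ?ng + DK * ?hf * ?hg) = (6 + 4 * C) * (M * CK * ?nf * ?ng * T) + DK * ((6 + 4 * C) * M * T * ?hf * ?hg)"
  "2 * M * CK * ?nf * ?ng * T = 2 * (M * CK * ?nf * ?ng * T)"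
  by (simp_all add: algebra_simps)
 ultimately show ?thesis using fin unfolding I_def by linarith
qed

end

section \<open>Multipliers with a jump on the diagonal\<close>

text \<open>The finite exceptional set accommodates the corners of a ramp.\<close>

lemma LINT_FTC:
 fixes f f' :: "real => complex"
 assumes "finite S" "a <= b" "!!x. x \<in> {a<..<b} - S ==> (f has_vector_derivative f' x) (at x)"
  and "continuous_on {a..b} f" and i: "integrable lborel (%x. ind {a<..<b} x *R f' x)"
 shows "(LINT x|lborel. ind {a<..<b} x *R f' x) = f b - f a"
proof -
 have "(f' has_integral (f b - f a)) {a..b}"
  using assms by (intro fundamental_theorem_of_calculus_interior_strong)
 then have "(f' has_integral (f b - f a)) {a<..<b}"
  by (simp add: has_integral_Icc_iff_Ioo)
 moreover have "(LINT x:{a<..<b}|lborel. f' x) = integral {a<..<b} f'"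
  by (rule set_borel_integral_eq_integral(2)) (use i in "simp add: set_integrable_def")
 ultimately show ?thesis
  by (simp add: set_lebesgue_integral_def integral_unique)
qed

definition sg :: "bool => real" where
 "sg b = (if b then 1 else -1)"

definition between :: "real => real => real set" where
 "between s t = {min s t<..<max s t}"

definition colint :: "(plane => complex) => plane => complex" where
 "colint f x = (LINT a|lborel. ind (between (fst x) (snd x)) a *R f (a, snd x))"

text \<open>The function \<open>jumpX b phi\<close> vanishes on the diagonal and on one of the triangles; on the other
 one its derivative in the first variable is \<open>- sg b * phi\<close>, and \<open>jumpY b\<close> is its derivative in
 the second variable when \<open>psi\<close> is that of \<open>phi\<close>.\<close>

definition jumpX :: "bool => (plane => complex) => plane => complex" where
 "jumpX b phi x = (if fst x ~= snd x & (fst x < snd x) = b then colint phi x else 0)"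

definition jumpY :: "bool => (plane => complex) => (plane => complex) => plane => complex" where
 "jumpY b phi psi x = (if fst x ~= snd x & (fst x < snd x) = b
   then cpx (sg b) * phi (snd x, snd x) + colint psi x else 0)"

text \<open>A continuous substitute for the jump across \<open>t = a\<close>. It rises on the side
  selected by \<open>b\<close> and is zero on the other one, so the product with \<open>phi\<close>
  sees only the triangle on which \<open>phi\<close> is controlled.\<close>

definition ramp :: "bool => nat => real => real => real" where
 "ramp b n a t = max 0 (min 1 (sg b * (t - a) * real (Suc n)))"

definition slope :: "bool => nat => real => real => real" where
 "slope b n a t = (if 0 < sg b * (t - a) & sg b * (t - a) * real (Suc n) < 1 then sg b * real (Suc n) else 0)"

lemma ramp_bounds: "0 <= ramp b n a t" "ramp b n a t <= 1"
 by (auto simp: ramp_def)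

lemma ramp_zero: "sg b * (t - a) <= 0 ==> ramp b n a t = 0"
proof -
 assume "sg b * (t - a) <= 0"
 then have "sg b * (t - a) * real (Suc n) <= 0" by (rule mult_nonpos_nonneg) simp
 then show ?thesis by (simp add: ramp_def)
qed

lemma region_sg: "a ~= t ==> (a < t) = b \<longleftrightarrow> sg b * (t - a) > 0"
 by (auto simp: sg_def)

lemma ramp_borel [measurable]: "(%(a, t). ramp b n a t) \<in> bmeas (borel \<Otimes>\<^sub>M borel)"
 unfolding ramp_def by measurable

lemma slope_borel [measurable]: "(%(a, t). slope b n a t) \<in> bmeas (borel \<Otimes>\<^sub>M borel)"
 unfolding slope_def by measurable

lemma ramp_has_derivative:
 assumes "t ~= a" "sg b * (t - a) * real (Suc n) ~= 1"
 shows "(ramp b n a has_real_derivative slope b n a t) (at t)"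
proof -
 let ?l = "%t. sg b * (t - a) * real (Suc n)"
 have l: "(?l has_real_derivative sg b * real (Suc n)) (at t)"
  by (auto intro!: derivative_eq_intros)
 have c: "isCont ?l t" by (intro continuous_intros)
 have sg0: "?l t ~= 0" using assms(1) by (auto simp: sg_def)
 consider "?l t < 0" | "0 < ?l t" "?l t < 1" | "?l t > 1"
  using sg0 assms(2) by linarith
 then show ?thesis
 proof cases
  case 1
  have "eventually (%x. ?l x < 0) (nhds t)"
   using c 1 by (metis order_tendstoD(2) continuous_at tendsto_at_iff_tendsto_nhds)
  then have ev: "eventually (%x. ramp b n a x = 0) (nhds t)"
   by eventually_elim (simp add: ramp_def)
  have "~ 0 < sg b * (t - a)"
  proof
   assume "0 < sg b * (t - a)"
   then have "0 < sg b * (t - a) * real (Suc n)" by (rule mult_pos_pos) simp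
   then show False using 1 by linarith
  qed
  then have "slope b n a t = 0" by (auto simp: slope_def)
  then show ?thesis using DERIV_cong_ev[OF refl ev refl] by simp
 next
  case 2
  have "eventually (%x. ?l x < 1) (nhds t)" "eventually (%x. ?l x > 0) (nhds t)"
   using c 2 by (metis order_tendstoD continuous_at tendsto_at_iff_tendsto_nhds)+
  then have ev: "eventually (%x. ramp b n a x = ?l x) (nhds t)"
   by eventually_elim (simp add: ramp_def)
  have "slope b n a t = sg b * real (Suc n)" using 2 by (auto simp: slope_def zero_less_mult_iff)
  then show ?thesis using DERIV_cong_ev[OF refl ev refl] l by simp
 next
  case 3
  have "eventually (%x. ?l x > 1) (nhds t)"
   using c 3 by (metis order_tendstoD(1) continuous_at tendsto_at_iff_tendsto_nhds)
  then have ev: "eventually (%x. ramp b n a x = 1) (nhds t)"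
   by eventually_elim (simp add: ramp_def)
  have "slope b n a t = 0" using 3 by (auto simp: slope_def)
  then show ?thesis using DERIV_cong_ev[OF refl ev refl] by simp
 qed
qed

text \<open>The slope resembles a Dirac mass on the diagonal: it is unbounded in \<open>n\<close>
  but of mass at most 1 in each variable, as the row and column bounds of \<open>kernel\<close>
  require.\<close>

lemma slope_mass:
 "(nnl (%t. enn \<bar>slope b n a t\<bar>)) <= 1" "(nnl (%a. enn \<bar>slope b n a t\<bar>)) <= 1"
proof -
 let ?e = "1 / real (Suc n)"
 have le: "enn \<bar>slope b n a t\<bar> <= enn (real (Suc n)) * ind (if b then {a..a + ?e} else {a - ?e..a}) t" for a t
  by (auto simp: slope_def sg_def indicator_def field_simps split: if_splits)
 have le': "enn \<bar>slope b n a t\<bar> <= enn (real (Suc n)) * ind (if b then {t - ?e..t} else {t..t + ?e}) a" for a t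
  by (auto simp: slope_def sg_def indicator_def field_simps split: if_splits)
 have one: "enn (real (Suc n)) * enn ?e = 1"
  by (simp add: ennreal_mult[symmetric] del: of_nat_Suc)
 have "(nnl (%t. enn \<bar>slope b n a t\<bar>)) <= (nnl (%t. enn (real (Suc n)) * ind (if b then {a..a + ?e} else {a - ?e..a}) t))"
  by (intro nn_integral_mono le)
 also have "... = 1"
  using one by (cases b) (simp_all add: nn_integral_cmult del: of_nat_Suc)
 finally show "(nnl (%t. enn \<bar>slope b n a t\<bar>)) <= 1" .
 have "(nnl (%a. enn \<bar>slope b n a t\<bar>)) <= (nnl (%a. enn (real (Suc n)) * ind (if b then {t - ?e..t} else {t..t + ?e}) a))"
  by (intro nn_integral_mono le')
 also have "... = 1"
  using one by (cases b) (simp_all add: nn_integral_cmult del: of_nat_Suc)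
 finally show "(nnl (%a. enn \<bar>slope b n a t\<bar>)) <= 1" .
qed

text \<open>A pair \<open>(phi, psi)\<close> with \<open>psi = \<partial>\<^sub>2phi\<close>, bounded on the triangle selected by \<open>b\<close>.\<close>

locale jump_data =
 fixes T M :: real and b :: bool and phi psi :: "plane => complex"
 assumes T: "0 < T" "T <= 1" and M: "0 <= M"
  and phi_cont: "continuous_on UNIV phi" and psi_cont: "continuous_on UNIV psi"
  and phi_deriv: "!!a t. ((%t. phi (a, t)) has_vector_derivative psi (a, t)) (at t)"
  and bounds: "!!a t. 0 < a ==> a < T ==> 0 < t ==> t < T ==> a ~= t ==> (a < t) = b ==> cmod (phi (a, t)) <= M & cmod (psi (a, t)) <= M"
begin

definition kap :: "nat => real => real => complex" where
 "kap n a t = cpx (ramp b n a t) * phi (a, t)"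

definition dkap :: "nat => real => real => complex" where
 "dkap n a t = cpx (ramp b n a t) * psi (a, t) + cpx (slope b n a t) * phi (a, t)"

lemma meas [measurable]: "phi \<in> bmeas borel" "psi \<in> bmeas borel"
 using phi_cont psi_cont borel_measurable_continuous_onI by blast+

lemma meas_pair [measurable]:
 "(%(a, t). phi (a, t)) \<in> bmeas (borel \<Otimes>\<^sub>M borel)"
 "(%(a, t). psi (a, t)) \<in> bmeas (borel \<Otimes>\<^sub>M borel)"
 using meas by (simp_all add: borel_prod)

lemma dkap_meas: "(%(a, t). dkap n a t) \<in> bmeas (borel \<Otimes>\<^sub>M borel)"
proof -
 have "(%x. cpx (case x of (a, t) => ramp b n a t) * (case x of (a, t) => psi (a, t)) + cpx (case x of (a, t) => slope b n a t) * (case x of (a, t) => phi (a, t))) \<in> bmeas (borel \<Otimes>\<^sub>M borel)"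
  by measurable
 then show ?thesis by (simp add: dkap_def case_prod_beta)
qed

lemma ramp_slope_zero: "~ (a ~= t & (a < t) = b) ==> ramp b n a t = 0 & slope b n a t = 0"
proof -
 assume "~ (a ~= t & (a < t) = b)"
 then have "sg b * (t - a) <= 0" by (auto simp: sg_def)
 then show ?thesis using ramp_zero by (auto simp: slope_def)
qed

lemma dkap_bound:
 assumes "a \<in> {0<..<T}" "t \<in> {0<..<T}"
 shows "cmod (dkap n a t) <= M + M * \<bar>slope b n a t\<bar>"
proof (cases "a ~= t & (a < t) = b")
 case True
 have "cmod (dkap n a t) <= ramp b n a t * cmod (psi (a, t)) + \<bar>slope b n a t\<bar> * cmod (phi (a, t))"
  unfolding dkap_def by (rule order_trans[OF norm_triangle_ineq]) (simp add: norm_mult ramp_bounds)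
 also have "... <= 1 * M + \<bar>slope b n a t\<bar> * M"
  using bounds[of a t] True assms ramp_bounds[of b n a t] by (intro add_mono mult_mono) auto
 finally show ?thesis by (simp add: mult.commute)
qed (use M ramp_slope_zero[of a t n] in "auto simp: dkap_def")

lemma slope_bound: "\<bar>slope b n a t\<bar> <= real (Suc n)"
 by (auto simp: slope_def sg_def)

text \<open>The endpoints, reached by continuity, matter because the constant term \<open>cc\<close>
  of the multiplier is the value at \<open>t = 0\<close>.\<close>

lemma kap_bound:
 assumes "a \<in> {0<..<T}" "t \<in> {0..T}"
 shows "cmod (kap n a t) <= M"
proof -
 have c: "continuous_on UNIV (kap n a)"
  unfolding kap_def ramp_def by (intro continuous_intros continuous_on_compose2[OF phi_cont]) auto
 have in1: "cmod (kap n a t) <= M" if "t \<in> {0<..<T}" for t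
 proof (cases "a ~= t & (a < t) = b")
  case True
  have "cmod (kap n a t) <= 1 * M"
   unfolding kap_def norm_mult using bounds[of a t] True assms that ramp_bounds[of b n a t] by (intro mult_mono) auto
  then show ?thesis by simp
 qed (use M ramp_slope_zero[of a t n] in "auto simp: kap_def")
 have "kap n a ` closure {0<..<T} \<subseteq> cball 0 M"
  by (rule image_closure_subset) (use c in1 in "auto intro: continuous_on_subset")
 moreover have "t \<in> closure {0<..<T}"
  using assms(2) T by (simp add: closure_greaterThanLessThan)
 ultimately show ?thesis by auto
qed

text \<open>The conjugate compensates for the one on the second argument of the form; the indicators
  restrict to the square, where \<open>phi\<close> and \<open>psi\<close> are bounded.\<close>

definition kk :: "nat => real => real => complex" where
 "kk n a t = cnj (cpx (ind {0<..<T} a * ind {0<..<T} t) * dkap n a t)"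

definition cc :: "nat => real => complex" where
 "cc n a = cnj (cpx (ind {0<..<T} a) * kap n a 0)"

lemma kk_norm: "cmod (kk n a t) <= ind {0<..<T} a * ind {0<..<T} t * (M + M * \<bar>slope b n a t\<bar>)"
 using dkap_bound[of a t n] by (auto simp: kk_def norm_mult indicator_def)

text \<open>The bound 2 M is M * T <= M for the part with \<open>psi\<close> plus M for the part
  with the slope, whose mass is at most 1.\<close>

lemma kernel: "kernel T (2 * M) (M + M * real (Suc n)) (cc n) (kk n)"
proof
 show "0 < T" "T <= 1" "0 <= 2 * M" using T M by auto
 note [measurable] = dkap_meas
 have "(%x. cnj (cpx (ind {0<..<T} (fst x) * ind {0<..<T} (snd x)) * (case x of (a, t) => dkap n a t))) \<in> bmeas (borel \<Otimes>\<^sub>M borel)"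
  by measurable
 then show "(%(a, t). kk n a t) \<in> bmeas (borel \<Otimes>\<^sub>M borel)"
  by (simp add: kk_def case_prod_beta)
 have "continuous_on UNIV (%a. kap n a 0)"
  unfolding kap_def ramp_def by (intro continuous_intros continuous_on_compose2[OF phi_cont]) auto
 then have [measurable]: "(%a. kap n a 0) \<in> bmeas borel"
  by (rule borel_measurable_continuous_onI)
 show "cc n \<in> bmeas borel" unfolding cc_def by measurable
 show "cmod (kk n a t) <= M + M * real (Suc n)" for a t
 proof -
  have "cmod (kk n a t) <= ind {0<..<T} a * ind {0<..<T} t * (M + M * \<bar>slope b n a t\<bar>)" by (rule kk_norm)
  also have "... <= 1 * (M + M * real (Suc n))"
   using M slope_bound[of n a t] by (intro mult_mono add_mono mult_left_mono) (auto simp: indicator_def)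
  finally show ?thesis by simp
 qed
 show "kk n a t = 0" if "t ~: {0<..<T}" for a t using that by (simp add: kk_def)
 show "cmod (cc n a) <= 2 * M" for a
  using kap_bound[of a 0 n] T M by (auto simp: cc_def norm_mult indicator_def)
 have bnd: "enn (cmod (kk n a t)) <= enn M * ind {0<..<T} t + enn M * enn \<bar>slope b n a t\<bar>"
  "enn (cmod (kk n a t)) <= enn M * ind {0<..<T} a + enn M * enn \<bar>slope b n a t\<bar>" for a t
  using ennreal_leI[OF kk_norm[of n a t]] M
  by (cases "a \<in> {0<..<T}"; cases "t \<in> {0<..<T}"; simp add: ennreal_plus ennreal_mult)+
 have [measurable]: "slope b n a \<in> bmeas borel" "(%a. slope b n a t) \<in> bmeas borel" for a t
  unfolding slope_def by measurable
 have le2: "enn M * enn T + enn M * 1 <= enn (2 * M)"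
 proof -
  have "enn M * enn T + enn M * 1 = enn (M * T + M)"
   using M T by (simp add: ennreal_mult ennreal_plus)
  also have "... <= enn (2 * M)"
   using M T mult_left_mono[of T 1 M] by (intro ennreal_leI) simp
  finally show ?thesis .
 qed
 show "(nnl (%t. enn (cmod (kk n a t)))) <= enn (2 * M)" for a
 proof -
  have "(nnl (%t. enn (cmod (kk n a t)))) <= (nnl (%t. enn M * ind {0<..<T} t + enn M * enn \<bar>slope b n a t\<bar>))"
   by (intro nn_integral_mono bnd)
  also have "... = enn M * enn T + enn M * (nnl (%t. enn \<bar>slope b n a t\<bar>))"
   using T by (simp add: nn_integral_add nn_integral_cmult)
  also have "... <= enn M * enn T + enn M * 1"
   by (intro add_left_mono mult_left_mono slope_mass) simp
  finally show ?thesis using le2 by (rule order_trans)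
 qed
 show "(nnl (%a. enn (cmod (kk n a t)))) <= enn (2 * M)" for t
 proof -
  have "(nnl (%a. enn (cmod (kk n a t)))) <= (nnl (%a. enn M * ind {0<..<T} a + enn M * enn \<bar>slope b n a t\<bar>))"
   by (intro nn_integral_mono bnd)
  also have "... = enn M * enn T + enn M * (nnl (%a. enn \<bar>slope b n a t\<bar>))"
   using T by (simp add: nn_integral_add nn_integral_cmult)
  also have "... <= enn M * enn T + enn M * 1"
   by (intro add_left_mono mult_left_mono slope_mass) simp
  finally show ?thesis using le2 by (rule order_trans)
 qed
qed

lemma mult_eq:
 assumes a: "a \<in> {0<..<T}" and t: "t \<in> {0<..<T}"
 shows "kernel.mult (cc n) (kk n) a t = cnj (kap n a t)"
proof -
 interpret K: kernel T "2 * M" "M + M * real (Suc n)" "cc n" "kk n" by (rule kernel)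
 \<comment> \<open>The two corners of the ramp, where it is not differentiable.\<close>
 let ?S = "{a, a + sg b / real (Suc n)}"
 have "prim (kk n a) t = (LINT s|lborel. ind {0<..<t} s *R cnj (dkap n a s))"
  unfolding prim_def using a t by (intro B_integral_cong) (auto simp: kk_def indicator_def)
 also have "... = cnj (kap n a t) - cnj (kap n a 0)"
 proof (rule LINT_FTC[of ?S])
  show "((%t. cnj (kap n a t)) has_vector_derivative cnj (dkap n a s)) (at s)" if "s \<in> {0<..<t} - ?S" for s
  proof -
   have ne: "s ~= a" "sg b * (s - a) * real (Suc n) ~= 1"
    using that by (auto simp: sg_def field_simps split: if_splits)
   have "((%t. cpx (ramp b n a t)) has_vector_derivative cpx (slope b n a s)) (at s)"
    using ramp_has_derivative[OF ne] by (intro has_vector_derivative_of_real) (simp add: has_real_derivative_iff_has_vector_derivative)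
   then have "((%t. kap n a t) has_vector_derivative dkap n a s) (at s)"
    unfolding kap_def[abs_def] dkap_def by (intro has_vector_derivative_mult phi_deriv)
   then show ?thesis by (rule bounded_linear.has_vector_derivative[OF bounded_linear_cnj])
  qed
  show "continuous_on {0..t} (%t. cnj (kap n a t))"
   unfolding kap_def ramp_def by (intro continuous_intros continuous_on_compose2[OF phi_cont]) auto
  have "integrable lborel (%s. ind {..<t} s *R kk n a s)"
   by (intro integrable_mult_indicator K.k_int) simp
  also have "(%s. ind {..<t} s *R kk n a s) = (%s. ind {0<..<t} s *R cnj (dkap n a s))"
   using a t by (auto simp: kk_def indicator_def fun_eq_iff)
  finally show "integrable lborel (%s. ind {0<..<t} s *R cnj (dkap n a s))" .
 qed (use t in auto)
 finally show ?thesis using a by (simp add: K.mult_def cc_def)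
qed

definition sel :: "real => real => real" where
 "sel s a = ind {0<..<T} a * (if (s < a) = b then 1 else 0)"

lemma sel_bounds: "0 <= sel s a" "sel s a <= ind {0<..<T} a"
 by (auto simp: sel_def indicator_def)

lemma sel_meas [measurable]: "(%(s, a). sel s a) \<in> bmeas (borel \<Otimes>\<^sub>M borel)"
 unfolding sel_def by (cases b) (simp_all, measurable)

lemma sel_row_meas [measurable]: "sel s \<in> bmeas borel"
 using measurable_Pair2[OF sel_meas, of s] by simp

lemma row_meas [measurable]:
 "(%a. phi (a, t)) \<in> bmeas borel" "(%a. psi (a, t)) \<in> bmeas borel"
 "(%a. ramp b n a t) \<in> bmeas borel" "(%a. slope b n a t) \<in> bmeas borel"
 using measurable_Pair1[OF meas_pair(1), of t] measurable_Pair1[OF meas_pair(2), of t]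
  measurable_Pair1[OF ramp_borel, of t] measurable_Pair1[OF slope_borel, of t] by simp_all

lemma ramp_tendsto:
 assumes "a ~= t"
 shows "(%n. ramp b n a t) ---> (if (a < t) = b then 1 else 0)"
proof (cases "(a < t) = b")
 case True
 then have p: "sg b * (t - a) > 0" using region_sg[OF assms, of b] by simp
 have "eventually (%n. 1 / (sg b * (t - a)) <= real (Suc n)) sequentially"
  using eventually_ge_at_top[of "nat \<lceil>1 / (sg b * (t - a))\<rceil>"] by eventually_elim linarith
 then have "eventually (%n. ramp b n a t = 1) sequentially"
 proof eventually_elim
  case (elim n)
  then have "1 <= sg b * (t - a) * real (Suc n)" using p by (simp add: divide_le_eq mult.commute)
  then show ?case by (simp add: ramp_def)
 qed
 then show ?thesis using True by (simp add: tendsto_eventually)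
next
 case False
 then show ?thesis using ramp_slope_zero[of a t] by simp
qed

text \<open>In the limit the selector puts \<open>a\<close> on one side of \<open>s\<close> and the
  ramp puts it on the opposite side of \<open>t\<close>. Together they describe the interval between
  \<open>s\<close> and \<open>t\<close> on the chosen triangle and the empty set on the
  other.\<close>

lemma ramp_part_tendsto:
 fixes f :: "plane => complex"
 assumes [measurable]: "(%a. f (a, t)) \<in> bmeas borel"
  and f: "!!a. 0 < a ==> a < T ==> a ~= t ==> (a < t) = b ==> cmod (f (a, t)) <= M"
  and st: "s \<in> {0<..<T}" "t \<in> {0<..<T}" "s ~= t"
 shows "(%n. LINT a|lborel. cpx (sel s a * ramp b n a t) * f (a, t)) ---> (if (s < t) = b then colint f (s, t) else 0)"
  "cmod (LINT a|lborel. cpx (sel s a * ramp b n a t) * f (a, t)) <= M"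
  "integrable lborel (%a. cpx (sel s a * ramp b n a t) * f (a, t))"
proof -
 have w: "integrable lborel (%a. ind {0<..<T} a * M)"
  using integrable_indicator_interval[of 0 T] by simp
 have le: "cmod (cpx (sel s a * ramp b n a t) * f (a, t)) <= ind {0<..<T} a * M" for a n
 proof (cases "a ~= t & (a < t) = b & a \<in> {0<..<T}")
  case True
  have "cmod (cpx (sel s a * ramp b n a t) * f (a, t)) = (sel s a * ramp b n a t) * cmod (f (a, t))"
   using sel_bounds(1)[of s a] ramp_bounds(1)[of b n a t] by (simp add: norm_mult)
  also have "... <= (ind {0<..<T} a * 1) * M"
   using sel_bounds[of s a] ramp_bounds[of b n a t] f[of a] True M by (intro mult_mono) auto
  finally show ?thesis by simp
 next
  case False
  then have z: "sel s a * ramp b n a t = 0" using ramp_slope_zero[of a t n] by (auto simp: sel_def)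
  show ?thesis unfolding z using M by simp
 qed
 show i: "integrable lborel (%a. cpx (sel s a * ramp b n a t) * f (a, t))" for n
  by (rule B_integrable_bound[OF w]) (use le M in auto)
 have "cmod (LINT a|lborel. cpx (sel s a * ramp b n a t) * f (a, t)) <= (LINT a|lborel. ind {0<..<T} a * M)"
  by (rule order_trans[OF integral_norm_bound]) (intro integral_mono integrable_norm i w le)
 also have "... = T * M" using T by simp
 also have "... <= 1 * M" using T M by (intro mult_right_mono) auto
 finally show "cmod (LINT a|lborel. cpx (sel s a * ramp b n a t) * f (a, t)) <= M" by simp
 define r where "r a = (if (a < t) = b then 1 else (0::real))" for a
 have [measurable]: "r \<in> bmeas borel"
  unfolding r_def[abs_def] by (cases b) simp_all
 have "(%n. LINT a|lborel. cpx (sel s a * ramp b n a t) * f (a, t)) ---> (LINT a|lborel. cpx (sel s a * r a) * f (a, t))"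
 proof (rule integral_dominated_convergence[OF _ _ w])
  show "AE a in lborel. (%n. cpx (sel s a * ramp b n a t) * f (a, t)) ---> cpx (sel s a * r a) * f (a, t)"
   using AE_lborel_singleton[of t] unfolding r_def by eventually_elim (intro tendsto_intros ramp_tendsto)
  show "AE a in lborel. norm (cpx (sel s a * ramp b n a t) * f (a, t)) <= ind {0<..<T} a * M" for n
   using le by simp
  show "(%a. cpx (sel s a * r a) * f (a, t)) \<in> bmeas lborel"
   by measurable
 qed measurable
 also have "(LINT a|lborel. cpx (sel s a * r a) * f (a, t)) = (if (s < t) = b then colint f (s, t) else 0)"
 proof -
  have "(LINT a|lborel. cpx (sel s a * r a) * f (a, t)) = (LINT a|lborel. (if (s < t) = b then ind (between s t) a *R f (a, t) else 0))"
  proof (rule integral_cong_AE)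
   have "AE a in lborel. a ~= s & a ~= t"
    using AE_lborel_singleton[of s] AE_lborel_singleton[of t] by eventually_elim auto
   then show "AE a in lborel. cpx (sel s a * r a) * f (a, t) = (if (s < t) = b then ind (between s t) a *R f (a, t) else 0)"
    by eventually_elim (use st in "unfold sel_def between_def r_def indicator_def; cases b; auto")
   show "(%a. cpx (sel s a * r a) * f (a, t)) \<in> bmeas lborel"
    by measurable
   have "(ind (between s t) :: real => real) \<in> bmeas borel"
    unfolding between_def by simp
   then show "(%a. if (s < t) = b then ind (between s t) a *R f (a, t) else 0) \<in> bmeas lborel"
    by (cases "(s < t) = b") simp_all
  qed
  then show ?thesis by (simp add: colint_def)
 qed
 finally show "(%n. LINT a|lborel. cpx (sel s a * ramp b n a t) * f (a, t)) ---> (if (s < t) = b then colint f (s, t) else 0)" .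
qed

text \<open>The slope converges to \<open>sg b\<close> times a Dirac mass at \<open>a = t\<close>,
  approached from inside the chosen triangle. Only the continuity of \<open>phi\<close> is used to
  identify the limit.\<close>

lemma slope_part_tendsto:
 assumes st: "s \<in> {0<..<T}" "t \<in> {0<..<T}" "s ~= t"
 shows "(%n. LINT a|lborel. cpx (sel s a * slope b n a t) * phi (a, t)) ---> (if (s < t) = b then cpx (sg b) * phi (t, t) else 0)"
  "cmod (LINT a|lborel. cpx (sel s a * slope b n a t) * phi (a, t)) <= M"
  "integrable lborel (%a. cpx (sel s a * slope b n a t) * phi (a, t))"
proof -
 \<comment> \<open>Blowing up around \<open>t\<close> sends the strip on which the slope lives to
   the fixed interval (0,1) and compensates its height.\<close>
 let ?a = "%n x. t + (- sg b / real (Suc n)) * x"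
 let ?I = "ind {0<..<1} :: real => real"
 have sgn [simp]: "sg b * sg b = 1" "\<bar>sg b\<bar> = 1" "sg b ~= 0" by (auto simp: sg_def)
 have sl: "slope b n (?a n x) t = sg b * real (Suc n) * ?I x" for n x
 proof -
  have "t - ?a n x = sg b * x / real (Suc n)" by simp
  then have "sg b * (t - ?a n x) = (sg b * sg b) * x / real (Suc n)"
   by (simp only: times_divide_eq_right mult.assoc)
  then have eqx: "sg b * (t - ?a n x) = x / real (Suc n)" by simp
  show ?thesis unfolding slope_def eqx by (auto simp: indicator_def zero_less_divide_iff simp del: of_nat_Suc)
 qed
 have region: "?a n x ~= t & (?a n x < t) = b" if "x \<in> {0<..<1}" for n x
  using that by (cases b) (auto simp: sg_def divide_simps)
 let ?g = "%n x. cpx (sel s (?a n x) * (sg b * ?I x)) * phi (?a n x, t)"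
 have gm: "?g n \<in> bmeas lborel" for n
 proof -
  have "(%x. phi (?a n x, t)) \<in> bmeas borel"
   using measurable_compose[OF _ row_meas(1), of "?a n" borel t] by simp
  moreover have "(%x. sel s (?a n x)) \<in> bmeas borel"
   using measurable_compose[OF _ sel_row_meas, of "?a n" borel s] by simp
  ultimately show ?thesis by simp
 qed
 have w: "integrable lborel (%x. ?I x * M)"
  using integrable_indicator_interval[of 0 1] by simp
 have le: "cmod (?g n x) <= ?I x * M" for n x
 proof (cases "x \<in> {0<..<1} & ?a n x \<in> {0<..<T}")
  case True
  have "cmod (?g n x) = sel s (?a n x) * cmod (phi (?a n x, t))"
   using True sel_bounds(1)[of s "?a n x"] by (simp add: norm_mult abs_mult)
  also have "... <= 1 * M"
   using sel_bounds[of s "?a n x"] bounds[of "?a n x" t] region[of x n] True st by (intro mult_mono) auto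
  finally show ?thesis using True by simp
 next
  case False
  then have z: "sel s (?a n x) * (sg b * ?I x) = 0" by (auto simp: sel_def)
  show ?thesis unfolding z using M by simp
 qed
 have gi: "integrable lborel (?g n)" for n
  by (rule B_integrable_bound[OF w gm]) (use le M in auto)
 have c0: "- sg b / real (Suc n) ~= 0" for n by simp
 have sub: "cpx (sel s (?a n x) * slope b n (?a n x) t) * phi (?a n x, t) = real (Suc n) *R ?g n x" for n x
  unfolding sl by (simp add: scaleR_conv_of_real mult_ac del: of_nat_Suc)
 have "integrable lborel (%x. cpx (sel s (?a n x) * slope b n (?a n x) t) * phi (?a n x, t))" for n
  unfolding sub using gi by simp
 then show "integrable lborel (%a. cpx (sel s a * slope b n a t) * phi (a, t))" for n
  using lborel_integrable_real_affine_iff[OF c0[of n], of "%a. cpx (sel s a * slope b n a t) * phi (a, t)" t] by blast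
 have eq: "(LINT a|lborel. cpx (sel s a * slope b n a t) * phi (a, t)) = (LINT x|lborel. ?g n x)" for n
 proof -
  have "(LINT a|lborel. cpx (sel s a * slope b n a t) * phi (a, t)) = \<bar>- sg b / real (Suc n)\<bar> *R (LINT x|lborel. cpx (sel s (?a n x) * slope b n (?a n x) t) * phi (?a n x, t))"
   by (rule lborel_integral_real_affine[OF c0])
  also have "... = \<bar>- sg b / real (Suc n)\<bar> *R (real (Suc n) *R (LINT x|lborel. ?g n x))"
   unfolding sub by simp
  finally show ?thesis by (simp add: abs_divide del: of_nat_Suc)
 qed
 have "cmod (LINT x|lborel. ?g n x) <= (LINT x|lborel. ?I x * M)"
  by (rule order_trans[OF integral_norm_bound]) (intro integral_mono integrable_norm gi w le)
 also have "... = M" by simp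
 finally show "cmod (LINT a|lborel. cpx (sel s a * slope b n a t) * phi (a, t)) <= M"
  unfolding eq .
 have "(%n. LINT x|lborel. ?g n x) ---> (LINT x|lborel. ?I x *R (if (s < t) = b then cpx (sg b) * phi (t, t) else 0))"
 proof (rule integral_dominated_convergence[OF _ gm w])
  show "AE x in lborel. (%n. ?g n x) ---> ?I x *R (if (s < t) = b then cpx (sg b) * phi (t, t) else 0)"
  proof (rule AE_I2)
   fix x
   have at: "(%n. ?a n x) ---> t"
   proof -
    have "(%n. - sg b / real (Suc n)) ---> 0" by real_asymp
    from tendsto_add[OF tendsto_const[of t] tendsto_mult_left_zero[OF this, of x]] show ?thesis by simp
   qed
   have "isCont phi (t, t)" using phi_cont continuous_on_eq_continuous_at[OF open_UNIV] by blast
   then have ph: "(%n. phi (?a n x, t)) ---> phi (t, t)"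
    by (rule isCont_tendsto_compose) (intro tendsto_intros at)
   have "eventually (%n. 0 < ?a n x) sequentially" "eventually (%n. ?a n x < T) sequentially"
    by (rule order_tendstoD[OF at], use st in simp)+
   moreover have "eventually (%n. (s < ?a n x) = (s < t)) sequentially"
   proof (cases "s < t")
    case True
    then show ?thesis using order_tendstoD(1)[OF at, of s] by simp
   next
    case False
    then have "t < s" using st by simp
    then show ?thesis using order_tendstoD(2)[OF at, of s] by (auto elim!: eventually_mono)
   qed
   ultimately have "eventually (%n. sel s (?a n x) = (if (s < t) = b then 1 else 0)) sequentially"
    by eventually_elim (auto simp: sel_def)
   then have "(%n. sel s (?a n x)) ---> (if (s < t) = b then 1 else 0)"
    by (rule tendsto_eventually)
   then have "(%n. ?g n x) ---> cpx ((if (s < t) = b then 1 else 0) * (sg b * ?I x)) * phi (t, t)"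
    by (intro tendsto_intros ph)
   also have "cpx ((if (s < t) = b then 1 else 0) * (sg b * ?I x)) * phi (t, t) = ?I x *R (if (s < t) = b then cpx (sg b) * phi (t, t) else 0)"
    by (auto simp: indicator_def)
   finally show "(%n. ?g n x) ---> ?I x *R (if (s < t) = b then cpx (sg b) * phi (t, t) else 0)" .
  qed
 qed (use le in auto)
 also have "(LINT x|lborel. ?I x *R (if (s < t) = b then cpx (sg b) * phi (t, t) else 0)) = (if (s < t) = b then cpx (sg b) * phi (t, t) else 0)"
  by simp
 finally show "(%n. LINT a|lborel. cpx (sel s a * slope b n a t) * phi (a, t)) ---> (if (s < t) = b then cpx (sg b) * phi (t, t) else 0)"
  unfolding eq .
qed

end

lemma AE_off_diagonal: "AE x in (lborel :: (plane) measure). fst x ~= snd x"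
proof -
 have "AE x in lborel \<Otimes>\<^sub>M lborel. fst x ~= (snd x :: real)"
 proof (rule lborel_pair.AE_pair_measure)
  show "{x \<in> space (lborel \<Otimes>\<^sub>M lborel). fst x ~= (snd x :: real)} \<in> sets (lborel \<Otimes>\<^sub>M lborel)"
   by measurable
  show "AE x in lborel. AE y in lborel. fst (x, y) ~= (snd (x, y) :: real)"
  proof (rule AE_I2)
   fix x :: real
   show "AE y in lborel. fst (x, y) ~= snd (x, y)"
    using AE_lborel_singleton[of x] by eventually_elim auto
  qed
 qed
 then show ?thesis unfolding lborel_prod .
qed

lemma sq_int_tensor_le:
 fixes f :: "real => complex" and w :: "real => real"
 assumes "sq_int lborel k" "sq_int lborel f" "sq_int lborel (%t. cpx (w t))" "!!t. w t >= 0"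
 shows "integrable lborel (%x. cmod (k x) * (cmod (f (fst x)) * w (snd x)))"
 using sq_int_norm_mult(1)[OF assms(1) sq_int_tensor[OF assms(2,3)]] assms(4) by (simp add: norm_mult)

context jump_data
begin

text \<open>\<open>jumpX\<close> and \<open>jumpY\<close> are limits of integrals over
  \<open>a\<close> of regularised products of a cut in \<open>s\<close> and a multiplier in
  \<open>t\<close>. For fixed \<open>n\<close> the estimate is \<open>superposition_bound\<close>
  with constant 2 M, uniform in \<open>n\<close>; the limit passes through off the diagonal by
  dominated convergence.\<close>

lemma multiplier_bound:
 assumes nu: "nu < 1/2" and C: "C >= 0"
  and avg: "!!g. adm T g ==> (nnl (%a. ind {0<..<T} a * HN nu (cut a (prim g)))) <= enn (C * T) * HN nu (prim g)"
  and k1: "sq_int lborel k1" and k1_supp: "!!x. x ~: square T ==> k1 x = 0"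
  and H: "form_bound T nu CK DK k1" and CD: "CK >= 0" "DK >= 0"
  and p: "adm T p" and v: "adm T v"
 shows "cmod (LINT x|lborel. k1 x * (prim p (fst x) * (jumpY b phi psi x * cnj (prim v (snd x)) + jumpX b phi x * cnj (v (snd x)))))
  <= (6 + 4 * C) * (2 * M) * T * (CK * sq_norm lborel (prim p) * sq_norm lborel (prim v) + DK * hn nu (prim p) * hn nu (prim v))"
proof -
 note pi = adm_integrable[OF p] and vi = adm_integrable[OF v]
 note [measurable] = fst_borel snd_borel dkap_meas
 have [measurable]: "k1 \<in> bmeas borel" "v \<in> bmeas borel" using k1 vi by (auto simp: sq_int_def)
 have [measurable]: "prim v \<in> bmeas borel" "prim p \<in> bmeas borel" using prim_borel[OF vi] prim_borel[OF pi] by auto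
 define Xn where "Xn n x = (LINT a|lborel. cpx (sel (fst x) a) * kap n a (snd x))" for n x
 define Yn where "Yn n x = (LINT a|lborel. cpx (sel (fst x) a) * dkap n a (snd x))" for n x
 have phiM: "cmod (phi (a, t)) <= M" "cmod (psi (a, t)) <= M" if "0 < a" "a < T" "a ~= t" "(a < t) = b" "t \<in> {0<..<T}" for a t
  using bounds[of a t] that by auto
 have X: "(%n. Xn n (s, t)) ---> jumpX b phi (s, t)" "!!n. cmod (Xn n (s, t)) <= M"
  "!!n. integrable lborel (%a. cpx (sel s a) * kap n a t)"
  and Y: "(%n. Yn n (s, t)) ---> jumpY b phi psi (s, t)" "!!n. cmod (Yn n (s, t)) <= 2 * M"
  "!!n. integrable lborel (%a. cpx (sel s a) * dkap n a t)"
  if st: "s \<in> {0<..<T}" "t \<in> {0<..<T}" "s ~= t" for s t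
 proof -
  have b1: "!!a. 0 < a ==> a < T ==> a ~= t ==> (a < t) = b ==> cmod (phi (a, t)) <= M"
   and b2: "!!a. 0 < a ==> a < T ==> a ~= t ==> (a < t) = b ==> cmod (psi (a, t)) <= M"
   using phiM st(2) by blast+
  note 1 = ramp_part_tendsto[OF row_meas(1) b1 st]
  note 2 = ramp_part_tendsto[OF row_meas(2) b2 st]
  note 3 = slope_part_tendsto[OF st]
  have Xeq: "(%a. cpx (sel s a) * kap n a t) = (%a. cpx (sel s a * ramp b n a t) * phi (a, t))" for n
   by (auto simp: kap_def)
  have Yeq: "(%a. cpx (sel s a) * dkap n a t) = (%a. cpx (sel s a * ramp b n a t) * psi (a, t) + cpx (sel s a * slope b n a t) * phi (a, t))" for n
   by (auto simp: dkap_def algebra_simps)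
  have jX: "jumpX b phi (s, t) = (if (s < t) = b then colint phi (s, t) else 0)"
   using st(3) by (simp only: jumpX_def fst_conv snd_conv not_False_eq_True simp_thms)
  have jY: "jumpY b phi psi (s, t) = (if (s < t) = b then colint psi (s, t) else 0) + (if (s < t) = b then cpx (sg b) * phi (t, t) else 0)"
   using st(3) by (simp only: jumpY_def fst_conv snd_conv not_False_eq_True simp_thms add.commute if_distrib[where f="(+) _"] add_0_left add_0_right split: if_split) simp
  have Xn: "Xn n (s, t) = (LINT a|lborel. cpx (sel s a * ramp b n a t) * phi (a, t))" for n
   unfolding Xn_def fst_conv snd_conv Xeq ..
  show "(%n. Xn n (s, t)) ---> jumpX b phi (s, t)"
   unfolding Xn jX by (rule 1(1))
  show "cmod (Xn n (s, t)) <= M" for n unfolding Xn by (rule 1(2))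
  show "integrable lborel (%a. cpx (sel s a) * kap n a t)" for n unfolding Xeq by (rule 1(3))
  have Y2: "Yn n (s, t) = (LINT a|lborel. cpx (sel s a * ramp b n a t) * psi (a, t)) + (LINT a|lborel. cpx (sel s a * slope b n a t) * phi (a, t))" for n
   unfolding Yn_def fst_conv snd_conv Yeq by (rule B_integral_add[OF 2(3) 3(3)])
  show "(%n. Yn n (s, t)) ---> jumpY b phi psi (s, t)"
   unfolding Y2 jY by (intro tendsto_add 2(1) 3(1))
  show "cmod (Yn n (s, t)) <= 2 * M" for n
   unfolding Y2 by (rule order_trans[OF norm_triangle_ineq order_trans[OF add_mono[OF 2(2) 3(2)] eq_refl[OF mult_2[symmetric]]]])
  show "integrable lborel (%a. cpx (sel s a) * dkap n a t)" for n
   unfolding Yeq by (rule B_integrable_add[OF 2(3) 3(3)])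
 qed
 have [measurable]: "(%x. Xn n x) \<in> bmeas borel" "(%x. Yn n x) \<in> bmeas borel" for n
  proof -
   have [measurable]: "(%z. sel (fst (fst z)) (snd z)) \<in> bmeas (borel2 \<Otimes>\<^sub>M borel)"
    using measurable_compose[OF _ sel_meas, of "%z. (fst (fst z), snd z)" "borel \<Otimes>\<^sub>M borel"] by simp
   have [measurable]: "(%z. dkap n (snd z) (snd (fst z))) \<in> bmeas (borel2 \<Otimes>\<^sub>M borel)"
    using measurable_compose[OF _ dkap_meas, of "%z. (snd z, snd (fst z))" "borel \<Otimes>\<^sub>M borel"] by simp
   have [measurable]: "(%z. ramp b n (snd z) (snd (fst z))) \<in> bmeas (borel2 \<Otimes>\<^sub>M borel)"
    using measurable_compose[OF _ ramp_borel, of "%z. (snd z, snd (fst z))" "borel \<Otimes>\<^sub>M borel"] by simp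
   have [measurable]: "(%z. phi (snd z, snd (fst z))) \<in> bmeas (borel2 \<Otimes>\<^sub>M borel)"
    using measurable_compose[OF _ meas_pair(1), of "%z. (snd z, snd (fst z))" "borel \<Otimes>\<^sub>M borel"] by simp
   show "(%x. Xn n x) \<in> bmeas borel" unfolding Xn_def kap_def by measurable
   show "(%x. Yn n x) \<in> bmeas borel" unfolding Yn_def by measurable
  qed
 let ?L = "%n. LINT x|lborel. k1 x * (prim p (fst x) * (Yn n x * cnj (prim v (snd x)) + Xn n x * cnj (v (snd x))))"
 have bound: "cmod (?L n) <= (6 + 4 * C) * (2 * M) * T * (CK * sq_norm lborel (prim p) * sq_norm lborel (prim v) + DK * hn nu (prim p) * hn nu (prim v))" for n
 proof -
  interpret K: kernel T "2 * M" "M + M * real (Suc n)" "cc n" "kk n" by (rule kernel)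
  let ?B = "M + M * real (Suc n)"
  let ?F = "%a x. cpx (sel (fst x) a) * (k1 x * (prim p (fst x) * (dkap n a (snd x) * cnj (prim v (snd x)) + kap n a (snd x) * cnj (v (snd x)))))"
  let ?w = "%t. ?B * cmod (prim v t) + ?B * cmod (v t)"
  have eqF: "ind {0<..<T} a *R (k1 x * (ecut b a (prim p) (fst x) * cnj (K.dmult v a (snd x)))) = ?F a x" for a x
  proof (cases "a \<in> {0<..<T} & x \<in> square T")
   case True
   then have t: "snd x \<in> {0<..<T}" by (auto simp: square_def)
   have "cnj (K.dmult v a (snd x)) = dkap n a (snd x) * cnj (prim v (snd x)) + kap n a (snd x) * cnj (v (snd x))"
    unfolding K.dmult_def using mult_eq[of a "snd x" n] True t by (simp add: kk_def)
   then show ?thesis using True by (simp add: ecut_eq sel_def)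
  next
   case False
   then show ?thesis using k1_supp[of x] by (auto simp: sel_def)
  qed
  have Fb: "cmod (?F a x) <= ind {0<..<T} a * (cmod (k1 x) * (cmod (prim p (fst x)) * ?w (snd x)))" for a x
  proof (cases "a \<in> {0<..<T} & x \<in> square T")
   case True
   then have t: "snd x \<in> {0<..<T}" by (auto simp: square_def)
   have d: "cmod (dkap n a (snd x)) <= ?B"
    using dkap_bound[of a "snd x" n] True t mult_left_mono[OF slope_bound M, of n a "snd x"] by simp
   have k: "cmod (kap n a (snd x)) <= ?B"
    using kap_bound[of a "snd x" n] True t M by (smt (verit) greaterThanLessThan_iff atLeastAtMost_iff mult_nonneg_nonneg of_nat_0_le_iff)
   have "cmod (dkap n a (snd x) * cnj (prim v (snd x)) + kap n a (snd x) * cnj (v (snd x))) <= ?w (snd x)"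
    by (rule order_trans[OF norm_triangle_ineq]) (use d k in "auto simp: norm_mult intro!: add_mono mult_right_mono")
   then have "cmod (?F a x) <= 1 * (cmod (k1 x) * (cmod (prim p (fst x)) * ?w (snd x)))"
    unfolding norm_mult norm_of_real using sel_bounds[of "fst x" a] True by (intro mult_mono) (auto intro!: mult_nonneg_nonneg)
   then show ?thesis using True by simp
  next
   case False
   then have z: "?F a x = 0" using k1_supp[of x] by (auto simp: sel_def)
   have "0 <= ind {0<..<T} a * (cmod (k1 x) * (cmod (prim p (fst x)) * ?w (snd x)))"
    using M by (intro mult_nonneg_nonneg add_nonneg_nonneg) auto
   then show ?thesis unfolding z by simp
  qed
  have wsq: "sq_int lborel (%t. cpx (?w t))"
  proof -
   have "sq_int lborel (%t. cpx ?B * cpx (cmod (prim v t)) + cpx ?B * cpx (cmod (v t)))"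
   proof (intro sq_int_add(1) sq_int_scale(1))
    show "sq_int lborel (%t. cpx (cmod (prim v t)))"
     using adm_prim(2)[OF v] by (auto simp: sq_int_def)
    show "sq_int lborel (%t. cpx (cmod (v t)))"
     using v by (auto simp: sq_int_def adm_def)
   qed
   then show ?thesis by simp
  qed
  have hint: "integrable lborel (%x. cmod (k1 x) * (cmod (prim p (fst x)) * ?w (snd x)))"
   by (rule sq_int_tensor_le[OF k1 adm_prim(2)[OF p] wsq]) (use M in auto)
  have Fm: "(%(a, x). ?F a x) \<in> bmeas (borel \<Otimes>\<^sub>M borel)"
  proof -
   have [measurable]: "(%z. sel (fst (snd z)) (fst z)) \<in> bmeas (borel \<Otimes>\<^sub>M borel2)"
    using measurable_compose[OF _ sel_meas, of "%z. (fst (snd z), fst z)" "borel \<Otimes>\<^sub>M borel"] by simp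
   have [measurable]: "(%z. dkap n (fst z) (snd (snd z))) \<in> bmeas (borel \<Otimes>\<^sub>M borel2)"
    using measurable_compose[OF _ dkap_meas, of "%z. (fst z, snd (snd z))" "borel \<Otimes>\<^sub>M borel"] by simp
   have [measurable]: "(%z. ramp b n (fst z) (snd (snd z))) \<in> bmeas (borel \<Otimes>\<^sub>M borel2)"
    using measurable_compose[OF _ ramp_borel, of "%z. (fst z, snd (snd z))" "borel \<Otimes>\<^sub>M borel"] by simp
   have [measurable]: "(%z. phi (fst z, snd (snd z))) \<in> bmeas (borel \<Otimes>\<^sub>M borel2)"
    using measurable_compose[OF _ meas_pair(1), of "%z. (fst z, snd (snd z))" "borel \<Otimes>\<^sub>M borel"] by simp
   show ?thesis unfolding case_prod_beta kap_def by measurable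
  qed
  have "?L n = (LINT x|lborel. LINT a|lborel. ?F a x)"
  proof (rule integral_cong_AE)
   have iF: "integrable lborel (%x. LINT a|lborel. ?F a x)"
    by (rule fubini_dominated(6)[OF Fm integrable_indicator_interval hint Fb])
   then show "(%x. LINT a|lborel. ?F a x) \<in> bmeas lborel" by auto
   show AEq: "AE x in lborel. k1 x * (prim p (fst x) * (Yn n x * cnj (prim v (snd x)) + Xn n x * cnj (v (snd x)))) = (LINT a|lborel. ?F a x)"
    using AE_off_diagonal
   proof eventually_elim
    case (elim x)
    show ?case
    proof (cases "x \<in> square T")
     case True
     then have st: "fst x \<in> {0<..<T}" "snd x \<in> {0<..<T}" "fst x ~= snd x" using elim by (auto simp: square_def)
     have "(LINT a|lborel. ?F a x) = (LINT a|lborel. k1 x * (prim p (fst x) * ((cpx (sel (fst x) a) * dkap n a (snd x)) * cnj (prim v (snd x)) + (cpx (sel (fst x) a) * kap n a (snd x)) * cnj (v (snd x)))))"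
      by (intro B_integral_cong) (auto simp: algebra_simps)
     also have "... = k1 x * (prim p (fst x) * (Yn n x * cnj (prim v (snd x)) + Xn n x * cnj (v (snd x))))"
      unfolding Yn_def Xn_def using X(3)[OF st] Y(3)[OF st] by simp
     finally show ?thesis by simp
    qed (use k1_supp in simp)
   qed
   show "(%x. k1 x * (prim p (fst x) * (Yn n x * cnj (prim v (snd x)) + Xn n x * cnj (v (snd x))))) \<in> bmeas lborel"
    by measurable
  qed
  also have "... = (LINT a|lborel. LINT x|lborel. ?F a x)"
   by (rule fubini_dominated(2)[OF Fm integrable_indicator_interval hint Fb, symmetric])
  also have "... = (LINT a|lborel. ind {0<..<T} a *R (LINT x|lborel. k1 x * (ecut b a (prim p) (fst x) * cnj (K.dmult v a (snd x)))))"
   unfolding eqF[symmetric] by simp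
  finally show ?thesis
   using K.superposition_bound[OF nu C avg k1 H CD p v, of b] by simp
 qed
 let ?G = "%x. k1 x * (prim p (fst x) * (jumpY b phi psi x * cnj (prim v (snd x)) + jumpX b phi x * cnj (v (snd x))))"
 let ?g = "%n x. k1 x * (prim p (fst x) * (Yn n x * cnj (prim v (snd x)) + Xn n x * cnj (v (snd x))))"
 let ?w = "%t. 2 * M * cmod (prim v t) + M * cmod (v t)"
 have pt: "(%n. ?g n x) ---> ?G x" if "fst x ~= snd x" for x
 proof (cases "x \<in> square T")
  case True
  then have st: "fst x \<in> {0<..<T}" "snd x \<in> {0<..<T}" by (auto simp: square_def)
  show ?thesis using X(1)[OF st that] Y(1)[OF st that] by (intro tendsto_intros) simp_all
 qed (use k1_supp in simp)
 \<comment> \<open>Convergence holds off the diagonal only. Setting the approximants to 0 on the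
   diagonal, where \<open>jumpX\<close> and \<open>jumpY\<close> are 0, makes it hold everywhere and
   yields measurability of the limit.\<close>
 have Gm: "?G \<in> bmeas lborel"
 proof (rule borel_measurable_LIMSEQ_metric)
  fix x
  show "(%n. if fst x = snd x then 0 else ?g n x) ---> ?G x"
   using pt[of x] by (cases "fst x = snd x") (simp_all add: jumpX_def jumpY_def)
 qed measurable
 have w: "integrable lborel (%x. cmod (k1 x) * (cmod (prim p (fst x)) * ?w (snd x)))"
 proof (rule sq_int_tensor_le[OF k1 adm_prim(2)[OF p]])
  have "sq_int lborel (%t. cpx (2 * M) * cpx (cmod (prim v t)) + cpx M * cpx (cmod (v t)))"
  proof (intro sq_int_add(1) sq_int_scale(1))
   show "sq_int lborel (%t. cpx (cmod (prim v t)))"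
    using adm_prim(2)[OF v] by (auto simp: sq_int_def)
   show "sq_int lborel (%t. cpx (cmod (v t)))"
    using v by (auto simp: sq_int_def adm_def)
  qed
  then show "sq_int lborel (%t. cpx (?w t))" by simp
 qed (use M in auto)
 have lim: "?L ---> (LINT x|lborel. ?G x)"
 proof (rule integral_dominated_convergence[OF Gm _ w])
  show "AE x in lborel. (%n. ?g n x) ---> ?G x"
   using AE_off_diagonal by eventually_elim (rule pt)
  show "AE x in lborel. norm (?g n x) <= cmod (k1 x) * (cmod (prim p (fst x)) * ?w (snd x))" for n
   using AE_off_diagonal
  proof eventually_elim
   case (elim x)
   show ?case
   proof (cases "x \<in> square T")
    case True
    then have st: "fst x \<in> {0<..<T}" "snd x \<in> {0<..<T}" by (auto simp: square_def)
    have "cmod (Yn n x * cnj (prim v (snd x)) + Xn n x * cnj (v (snd x))) <= ?w (snd x)"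
     by (rule order_trans[OF norm_triangle_ineq])
      (use X(2)[OF st elim, of n] Y(2)[OF st elim, of n] in "auto simp: norm_mult intro!: add_mono mult_right_mono")
    then show ?thesis unfolding norm_mult by (intro mult_left_mono) auto
   qed (use k1_supp in simp)
  qed
  show "?g n \<in> bmeas lborel" for n by measurable
 qed
 show ?thesis
  by (rule LIMSEQ_le_const2[OF tendsto_norm[OF lim]]) (use bound in auto)
qed

end

section \<open>Weak derivatives on subdomains\<close>

text \<open>Local integrability speaks of compact subsets; measurability on the whole open set
  follows by exhausting it with countably many of them.\<close>

lemma locally_integrable_borel:
 assumes "open Om" "locally_integrable Om f"
 shows "(%x. ind Om x *R f x) \<in> bmeas lborel"
proof -
 obtain C where C0: "!!n. compact (C n)" "!!n. C n \<subseteq> Om" "!!n. C n \<subseteq> interior (C (Suc n))" "\<Union>(range C) = Om"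
  "!!K. compact K ==> K \<subseteq> Om ==> \<exists>N. \<forall>n\<ge>N. K \<subseteq> C n"
  by (rule open_Union_compact_subsets[OF assms(1)]) (rule that)
 note C = C0(1,2,5)
 show ?thesis
 proof (rule borel_measurable_LIMSEQ_metric)
  show "(%x. ind (C n) x *R f x) \<in> bmeas lborel" for n
  proof -
   have "set_integrable lborel (C n) f" using assms(2) C(1,2)[of n] by (simp add: locally_integrable_def)
   then show ?thesis unfolding set_integrable_def by (rule borel_measurable_integrable)
  qed
  show "(%n. ind (C n) x *R f x) ---> ind Om x *R f x" for x
  proof (cases "x \<in> Om")
   case True
   then obtain N where "\<forall>n\<ge>N. {x} \<subseteq> C n" using C(3)[of "{x}"] by auto
   then have "eventually (%n. ind (C n) x *R f x = ind Om x *R f x) sequentially"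
    using True unfolding eventually_sequentially by (intro exI[of _ N]) auto
   then show ?thesis by (rule tendsto_eventually)
  next
   case False
   then have "x ~: C n" for n using C(2) by blast
   then show ?thesis using False by simp
  qed
 qed
qed

lemma set_integrable_locally_integrable:
 assumes "set_integrable lborel Om f" shows "locally_integrable Om f"
 unfolding locally_integrable_def
 by (intro allI impI set_integrable_subset[OF assms]) (auto dest: compact_imp_closed intro: borel_closed)

lemma locally_integrable_subset: "locally_integrable Om f ==> Om' \<subseteq> Om ==> locally_integrable Om' f"
 unfolding locally_integrable_def by blast

text \<open>Measurability of the new representative is a separate assumption since
  \<open>lborel\<close> is not complete: a function equal almost everywhere to a Borel function need
  not be Borel.\<close>

lemma locally_integrable_cong_AE:
 assumes f: "locally_integrable Om f" and eq: "AE x\<in>Om in lborel. f x = f' x"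
  and m: "(%x. ind Om x *R f' x) \<in> bmeas lborel"
 shows "locally_integrable Om f'"
 unfolding locally_integrable_def
proof (intro allI impI)
 fix S assume S: "compact S & S \<subseteq> Om"
 then have [measurable]: "S \<in> sets borel" by (blast intro: borel_closed compact_imp_closed)
 have i: "integrable lborel (%x. ind S x *R f x)"
  using f S by (simp add: locally_integrable_def set_integrable_def)
 have e: "(%x. ind S x *R f' x) = (%x. ind S x *R (ind Om x *R f' x))"
  using S by (auto simp: indicator_def fun_eq_iff)
 have "(%x. ind S x *R f' x) \<in> bmeas lborel"
  unfolding e using m by measurable
 moreover have "AE x in lborel. ind S x *R f x = ind S x *R f' x"
  using eq by eventually_elim (use S in "auto simp: indicator_def")
 ultimately show "set_integrable lborel S f'"
  unfolding set_integrable_def using i integrable_cong_AE[OF borel_measurable_integrable[OF i]] by blast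
qed

lemma pderiv_dir_local:
 assumes "open U" "x \<in> U" "!!y. y \<in> U ==> f y = g y"
 shows "pderiv_dir e f x = pderiv_dir e g x"
proof -
 have "(f has_derivative f') (at x) \<longleftrightarrow> (g has_derivative f') (at x)" for f'
  using has_derivative_transform_within_open[of f f' x UNIV U g] has_derivative_transform_within_open[of g f' x UNIV U f] assms by auto
 then show ?thesis unfolding pderiv_dir_def frechet_derivative_def by simp
qed

lemma pderiv_dir_zero: "pderiv_dir e (%x. 0) x = 0"
 by (rule pderiv_dir_eqI[THEN trans]) (auto intro: has_derivative_const)

lemma test_function_zero:
 assumes "test_function Om psi" "x ~: Om"
 shows "psi x = 0" "pderiv_dir e psi x = 0"
proof -
 have x: "x ~: closure {x. psi x ~= 0}" using assms unfolding test_function_def by blast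
 then show "psi x = 0" using closure_subset[of "{x. psi x ~= 0}"] by blast
 have "pderiv_dir e psi x = pderiv_dir e (%x. 0) x"
  by (rule pderiv_dir_local[of "- closure {x. psi x ~= 0}"]) (use x closure_subset[of "{x. psi x ~= 0}"] in auto)
 then show "pderiv_dir e psi x = 0" by (simp add: pderiv_dir_zero)
qed

lemma test_function_bounded_support:
 assumes "test_function Om psi"
 obtains R where "!!x. norm x > R ==> psi x = 0" "!!e x. norm x > R ==> pderiv_dir e psi x = 0"
proof -
 have "bounded (closure {x. psi x ~= 0})" using assms compact_imp_bounded unfolding test_function_def by blast
 then obtain R where R: "!!x. x \<in> closure {x. psi x ~= 0} ==> norm x <= R" unfolding bounded_iff by blast
 have 1: "psi x = 0" if "norm x > R" for x
  using R[of x] that closure_subset[of "{x. psi x ~= 0}"] by fastforce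
 show ?thesis by (rule that[OF 1]) (use pderiv_dir_support[OF 1] in auto)
qed

lemma test_function_bound:
 fixes psi :: "'a::euclidean_space => real"
 assumes t: "test_function Om psi" and e: "e \<in> Basis"
 obtains B where "!!x. \<bar>psi x\<bar> <= B" "!!x. \<bar>pderiv_dir e psi x\<bar> <= B"
proof -
 obtain R where R: "!!x. norm x > R ==> psi x = 0" "!!x. norm x > R ==> pderiv_dir e psi x = 0"
  using test_function_bounded_support[OF t] by metis
 have s: "smooth psi" using t by (simp add: test_function_def)
 obtain B1 where B1: "!!x. \<bar>psi x\<bar> <= B1" using bounded_bounded_support[OF smooth_continuous[OF s] R(1)] by blast
 obtain B2 where B2: "!!x. \<bar>pderiv_dir e psi x\<bar> <= B2"
  using bounded_bounded_support[OF smooth_continuous[OF smooth_pderiv_dir[OF s e]] R(2)] by blast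
 show ?thesis by (rule that[of "max B1 B2"]) (use B1 B2 in "auto simp: le_max_iff_disj")
qed

lemma has_weak_deriv_subset:
 assumes w: "has_weak_deriv Om e f g" and sub: "Om' \<subseteq> Om"
 shows "has_weak_deriv Om' e f g"
 unfolding has_weak_deriv_def
proof (intro conjI allI impI)
 show "locally_integrable Om' f" "locally_integrable Om' g"
  using w sub locally_integrable_subset unfolding has_weak_deriv_def by blast+
 fix psi :: "'a => real" assume t: "test_function Om' psi"
 then have t2: "test_function Om psi" using sub unfolding test_function_def by blast
 have i: "(LINT x:Om'|lborel. a x *R h x) = (LINT x:Om|lborel. a x *R h x)" if "!!x. x ~: Om' ==> a x = 0" for a and h :: "'a => complex"
  unfolding set_lebesgue_integral_def by (rule B_integral_cong) (use that sub in "auto simp: indicator_def")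
 show "(LINT x:Om'|lborel. pderiv_dir e psi x *R f x) = - (LINT x:Om'|lborel. psi x *R g x)"
  using w t2 i[of "pderiv_dir e psi" f] i[of psi g] test_function_zero[OF t] unfolding has_weak_deriv_def by metis
qed

lemma has_weak_deriv_cong_AE:
 assumes w: "has_weak_deriv Om e f g" and eq: "AE x\<in>Om in lborel. f x = f' x" "AE x\<in>Om in lborel. g x = g' x"
  and m: "(%x. ind Om x *R f' x) \<in> bmeas lborel" "(%x. ind Om x *R g' x) \<in> bmeas lborel"
  and Om: "open Om" and e: "e \<in> Basis"
 shows "has_weak_deriv Om e f' g'"
 unfolding has_weak_deriv_def
proof (intro conjI allI impI)
 show "locally_integrable Om f'" "locally_integrable Om g'"
  using w locally_integrable_cong_AE eq m unfolding has_weak_deriv_def by blast+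
 fix psi assume t: "test_function Om psi"
 have s: "smooth psi" using t by (simp add: test_function_def)
 have [measurable]: "psi \<in> bmeas borel" "pderiv_dir e psi \<in> bmeas borel"
  using s e by (auto intro!: borel_measurable_continuous_onI smooth_continuous smooth_pderiv_dir)
 have i: "(LINT x:Om|lborel. a x *R h x) = (LINT x:Om|lborel. a x *R h' x)"
  if [measurable]: "a \<in> bmeas borel" and hh: "AE x\<in>Om in lborel. h x = h' x"
  and [measurable]: "(%x. ind Om x *R h x) \<in> bmeas lborel" "(%x. ind Om x *R h' x) \<in> bmeas lborel"
  for a and h h' :: "'a => complex"
 proof -
  have "(LINT x|lborel. a x *R (ind Om x *R h x)) = (LINT x|lborel. a x *R (ind Om x *R h' x))"
  proof (rule integral_cong_AE)
   show "AE x in lborel. a x *R (ind Om x *R h x) = a x *R (ind Om x *R h' x)"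
    using hh by eventually_elim (auto simp: indicator_def)
  qed measurable
  then show ?thesis by (simp add: set_lebesgue_integral_def mult.commute)
 qed
 have mf: "(%x. ind Om x *R f x) \<in> bmeas lborel" "(%x. ind Om x *R g x) \<in> bmeas lborel"
  using w Om locally_integrable_borel unfolding has_weak_deriv_def by blast+
 show "(LINT x:Om|lborel. pderiv_dir e psi x *R f' x) = - (LINT x:Om|lborel. psi x *R g' x)"
  using w t i[of "pderiv_dir e psi", OF _ eq(1) mf(1) m(1)] i[of psi, OF _ eq(2) mf(2) m(2)] unfolding has_weak_deriv_def by simp
qed

lemma weak_derivI: "has_weak_deriv Om e f g ==> has_weak_deriv Om e f (weak_deriv Om e f)"
 unfolding weak_deriv_def by (rule someI[where P="has_weak_deriv Om e f"])

text \<open>The support avoids the common boundary of the two parts: the closure of \<open>U\<close>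
  does not meet the open set \<open>V\<close>, so the part of the support belonging to
  \<open>U\<close> is compact in \<open>U\<close>, and no jump is created.\<close>

lemma test_function_component:
 assumes U: "open U" "open V" "U \<inter> V = {}" and t: "test_function (U \<union> V) psi"
 shows "test_function U (%x. ind U x * psi x)"
proof -
 let ?u = "%x. ind U x * psi x"
 have s: "smooth psi" and cl: "closure {x. psi x ~= 0} \<subseteq> U \<union> V" and co: "compact (closure {x. psi x ~= 0})"
  using t by (auto simp: test_function_def)
 have "closure U \<inter> V = {}" using U by (simp add: open_Int_closure_eq_empty Int_commute)
 moreover have "closure {x. ?u x ~= 0} \<subseteq> closure U"
  by (rule closure_mono) (auto simp: indicator_def)
 moreover have cs: "closure {x. ?u x ~= 0} \<subseteq> closure {x. psi x ~= 0}"
  by (rule closure_mono) (auto simp: indicator_def)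
 ultimately have "closure {x. ?u x ~= 0} \<subseteq> U" using cl by blast
 moreover have "compact (closure {x. ?u x ~= 0})"
  using compact_Int_closed[OF co closed_closure[of "{x. ?u x ~= 0}"]] cs by (simp add: Int_absorb1)
 moreover have "smooth ?u" unfolding smooth_def
 proof
  fix k
  show "C_k k ?u"
  proof (rule C_k_local)
   fix x
   show "\<exists>W g. open W & x \<in> W & C_k k g & (\<forall>y\<in>W. ?u y = g y)"
   proof (cases "x \<in> U")
    case True
    then show ?thesis using U s unfolding smooth_def by (intro exI[of _ U] exI[of _ psi]) auto
   next
    case False
    show ?thesis
    proof (cases "x \<in> V")
     case True
     then show ?thesis using U by (intro exI[of _ V] exI[of _ "%x. 0"]) (auto simp: indicator_def C_k_const)
    next
     case f2: False
     then have "x \<in> - closure {x. psi x ~= 0}" using False cl by blast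
     then show ?thesis using closure_subset[of "{x. psi x ~= 0}"]
      by (intro exI[of _ "- closure {x. psi x ~= 0}"] exI[of _ "%x. 0"]) (auto simp: C_k_const)
    qed
   qed
  qed
 qed
 ultimately show ?thesis unfolding test_function_def by blast
qed

text \<open>Every test function on the disjoint union splits into one on each part. In
  \<open>Upsilon\<close> the mixed derivative is taken on the union of the triangles, whereas the
  assumptions on \<open>chi\<close> concern each triangle separately.\<close>

lemma has_weak_deriv_union:
 assumes U: "open U" "open V" "U \<inter> V = {}" and e: "e \<in> Basis"
  and wU: "has_weak_deriv U e f g" and wV: "has_weak_deriv V e f g"
  and i: "set_integrable lborel U f" "set_integrable lborel U g" "set_integrable lborel V f" "set_integrable lborel V g"
 shows "has_weak_deriv (U \<union> V) e f g"
 unfolding has_weak_deriv_def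
proof (intro conjI allI impI)
 have [measurable]: "U \<in> sets borel" "V \<in> sets borel" using U by auto
 show "locally_integrable (U \<union> V) f" "locally_integrable (U \<union> V) g"
  using i U by (auto intro!: set_integrable_locally_integrable set_integrable_Un)
 fix psi assume t: "test_function (U \<union> V) psi"
 obtain B where B: "!!x. \<bar>psi x\<bar> <= B" "!!x. \<bar>pderiv_dir e psi x\<bar> <= B" using test_function_bound[OF t e] by blast
 have s: "smooth psi" using t by (simp add: test_function_def)
 have m: "psi \<in> bmeas borel" "pderiv_dir e psi \<in> bmeas borel"
  using s e by (auto intro!: borel_measurable_continuous_onI smooth_continuous smooth_pderiv_dir)
 have int: "set_integrable lborel W (%x. a x *R h x)"
  if "set_integrable lborel W h" "a \<in> bmeas borel" "!!x. \<bar>a x\<bar> <= B" for W a and h :: "'a => complex"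
  using integrable_mult_bounded[of lborel "%x. ind W x *R h x" "%x. cpx (a x)" B] that
  unfolding set_integrable_def by (simp add: scaleR_conv_of_real mult_ac)
 have part: "(LINT x:W|lborel. pderiv_dir e psi x *R f x) = - (LINT x:W|lborel. psi x *R g x)"
  if W: "open W" "has_weak_deriv W e f g" and tW: "test_function W (%x. ind W x * psi x)" for W
 proof -
  have "(LINT x:W|lborel. pderiv_dir e psi x *R f x) = (LINT x:W|lborel. pderiv_dir e (%x. ind W x * psi x) x *R f x)"
  proof (rule set_lebesgue_integral_cong)
   show "\<forall>x. x \<in> W --> pderiv_dir e psi x *R f x = pderiv_dir e (%x. ind W x * psi x) x *R f x"
    using pderiv_dir_local[OF W(1), of _ psi "%x. ind W x * psi x" e] by auto
  qed (use W in auto)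
  also have "... = - (LINT x:W|lborel. (ind W x * psi x) *R g x)"
   using W tW unfolding has_weak_deriv_def by blast
  also have "(LINT x:W|lborel. (ind W x * psi x) *R g x) = (LINT x:W|lborel. psi x *R g x)"
   unfolding set_lebesgue_integral_def by (rule B_integral_cong) (auto simp: indicator_def)
  finally show ?thesis .
 qed
 have tV: "test_function V (%x. ind V x * psi x)"
  by (rule test_function_component[OF U(2,1)]) (use U t in "auto simp: Un_commute")
 show "(LINT x:(U \<union> V)|lborel. pderiv_dir e psi x *R f x) = - (LINT x:(U \<union> V)|lborel. psi x *R g x)"
  using part[OF U(1) wU test_function_component[OF U t]] part[OF U(2) wV tV]
   set_integral_Un[OF U(3) int[OF i(1) m(2) B(2)] int[OF i(3) m(2) B(2)]]
   set_integral_Un[OF U(3) int[OF i(2) m(1) B(1)] int[OF i(4) m(1) B(1)]] by simp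
qed

section \<open>Bounds and regularity of the chosen weak derivatives\<close>

lemma Linf_norm_AE:
 assumes f: "Linf_on Om f" and [measurable]: "Om \<in> sets borel"
 shows "AE x\<in>Om in lborel. cmod (f x) <= Linf_norm Om f"
proof -
 let ?R = "restrict_space lborel Om" and ?f = "%x. ereal (cmod (f x))"
 obtain C where C: "AE x\<in>Om in lborel. cmod (f x) <= C" using f by (auto simp: Linf_on_def)
 have "f \<in> bmeas ?R"
  using f by (simp add: Linf_on_def set_borel_measurable_def borel_measurable_restrict_space_iff scaleR_conv_of_real)
 then have m: "?f \<in> bmeas ?R" by measurable
 have le: "esssup ?R ?f <= ereal C"
  by (rule esssup_I[OF m]) (use C in "simp add: AE_restrict_space_iff")
 have "AE x in ?R. ?f x <= esssup ?R ?f" by (rule esssup_AE)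
 then have ae: "AE x\<in>Om in lborel. ?f x <= esssup ?R ?f" by (simp add: AE_restrict_space_iff)
 show ?thesis
 proof (cases "esssup ?R ?f")
  case (real r)
  then show ?thesis using ae by (simp add: Linf_norm_def)
 next
  \<comment> \<open>An essential supremum of minus infinity, which \<open>real_of_ereal\<close> maps
    to 0, occurs only for a null domain, where the claim is void.\<close>
  case MInf
  then have "AE x in lborel. x ~: Om" using ae by simp
  then show ?thesis by eventually_elim simp
 qed (use le in simp)
qed

lemma Linf_on_cong_AE:
 assumes "Linf_on Om f" "AE x\<in>Om in lborel. f x = f' x" "(%x. ind Om x *R f' x) \<in> bmeas lborel"
 shows "Linf_on Om f'"
proof -
 obtain C where "AE x\<in>Om in lborel. cmod (f x) <= C" using assms by (auto simp: Linf_on_def)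
 then have "AE x\<in>Om in lborel. cmod (f' x) <= C" using assms(2) by eventually_elim auto
 then show ?thesis using assms(3) by (auto simp: Linf_on_def set_borel_measurable_def)
qed

lemma weak_deriv_AE:
 fixes f :: "plane => complex"
 assumes "open Om" "has_weak_deriv Om e f g"
 shows "AE x\<in>Om in lborel. weak_deriv Om e f x = g x"
  "(%x. ind Om x *R weak_deriv Om e f x) \<in> bmeas lborel"
  "locally_integrable Om (weak_deriv Om e f)"
 using has_weak_deriv_unique[OF assms(1) weak_derivI[OF assms(2)] assms(2)] weak_derivI[OF assms(2)] locally_integrable_borel[OF assms(1)]
 unfolding has_weak_deriv_def by blast+

text \<open>The definition of the Sobolev space provides some weak derivative with the required
  regularity, while \<open>weak_deriv\<close> chooses possibly another one. Uniqueness almost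
  everywhere transfers the regularity to the chosen representative.\<close>

lemma W_k_inf_weak_deriv:
 fixes f :: "plane => complex"
 assumes Om: "open Om" and e: "e \<in> Basis" and f: "W_k_inf (Suc k) Om f"
 shows "Linf_on Om f" "has_weak_deriv Om e f (weak_deriv Om e f)" "W_k_inf k Om (weak_deriv Om e f)"
proof -
 obtain g where g: "has_weak_deriv Om e f g" "W_k_inf k Om g" and "Linf_on Om f" using f e by auto
 then show "Linf_on Om f" "has_weak_deriv Om e f (weak_deriv Om e f)" using weak_derivI by blast+
 let ?g = "weak_deriv Om e f"
 have ae: "AE x\<in>Om in lborel. g x = ?g x" using weak_deriv_AE(1)[OF Om g(1)] by eventually_elim auto
 have L: "Linf_on Om ?g"
  by (rule Linf_on_cong_AE[OF _ ae weak_deriv_AE(2)[OF Om g(1)]]) (use g(2) in "cases k; simp")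
 show "W_k_inf k Om ?g"
 proof (cases k)
  case (Suc j)
  have "\<exists>h. has_weak_deriv Om e' ?g h & W_k_inf j Om h" if e': "e' \<in> Basis" for e'
  proof -
   obtain h where h: "has_weak_deriv Om e' g h" "W_k_inf j Om h" using g(2) e' Suc by auto
   have hm: "(%x. ind Om x *R h x) \<in> bmeas lborel"
    using h(1) locally_integrable_borel[OF Om] unfolding has_weak_deriv_def by blast
   have "has_weak_deriv Om e' ?g h"
    by (rule has_weak_deriv_cong_AE[OF h(1) ae _ weak_deriv_AE(2)[OF Om g(1)] hm Om e']) simp
   then show ?thesis using h(2) by blast
  qed
  then show ?thesis using L Suc by simp
 qed (use L in simp)
qed

lemma H_k_weak_deriv:
 fixes f :: "plane => complex"
 assumes Om: "open Om" and e: "e \<in> Basis" and f: "H_k 1 Om f"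
 shows "L2_on Om f" "has_weak_deriv Om e f (weak_deriv Om e f)" "L2_on Om (weak_deriv Om e f)"
proof -
 obtain g where g: "has_weak_deriv Om e f g" "L2_on Om g" and "L2_on Om f" using f e by auto
 then show "L2_on Om f" "has_weak_deriv Om e f (weak_deriv Om e f)" using weak_derivI by blast+
 have gm: "(%x. ind Om x *R g x) \<in> bmeas lborel"
  using g(1) locally_integrable_borel[OF Om] unfolding has_weak_deriv_def by blast
 have "AE x in lborel. ind Om x *R g x = ind Om x *R weak_deriv Om e f x"
  using weak_deriv_AE(1)[OF Om g(1)] by eventually_elim (auto simp: indicator_def)
 from sq_int_cong_AE(1)[OF this gm weak_deriv_AE(2)[OF Om g(1)]]
 show "L2_on Om (weak_deriv Om e f)" using g(2) by (simp add: L2_on_sq_int)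
qed

lemma Linf_on_L2_on:
 assumes f: "Linf_on Om f" and [measurable]: "Om \<in> sets borel" and fin: "emeasure lborel Om < \<infinity>"
 shows "L2_on Om f"
proof -
 obtain C where C: "AE x\<in>Om in lborel. cmod (f x) <= C" using f by (auto simp: Linf_on_def)
 have "(nsq (ind Om x * cpx C)) = ind Om x *R C\<^sup>2" for x
  by (simp add: norm_mult power_mult_distrib indicator_def)
 moreover have "integrable lborel (%x. ind Om x *R C\<^sup>2)"
  using fin by (intro integrable_indicator) auto
 ultimately have "sq_int lborel (%x. ind Om x * cpx C)"
  unfolding sq_int_def by simp
 then show ?thesis unfolding L2_on_sq_int
 proof (rule sq_int_bound(1))
  show "(%x. ind Om x *R f x) \<in> bmeas lborel"
   using f by (simp add: Linf_on_def set_borel_measurable_def)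
  show "AE x in lborel. cmod (ind Om x *R f x) <= cmod (ind Om x * cpx C)"
   using C by eventually_elim (auto simp: indicator_def)
 qed
qed

lemma L2_on_set_integrable:
 assumes "L2_on Om f" "Om \<in> sets borel" "emeasure lborel Om < \<infinity>"
 shows "set_integrable lborel Om f"
proof -
 have "integrable lborel (%x. ind Om x *R (ind Om x *R f x))"
  using sq_int_finite_integrable[of lborel "%x. ind Om x *R f x" Om] assms by (simp add: L2_on_sq_int)
 moreover have "(%x. ind Om x *R (ind Om x *R f x)) = (%x. ind Om x *R f x)"
  by (auto simp: indicator_def)
 ultimately show ?thesis unfolding set_integrable_def by metis
qed

lemma W_2_inf_bounds:
 fixes f :: "plane => complex"
 assumes Om: "open Om" and f: "W_k_inf 2 Om f" and e: "e \<in> Basis" "e' \<in> Basis"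
 shows "AE x\<in>Om in lborel. cmod (f x) <= W_k_inf_norm 2 Om f"
  "AE x\<in>Om in lborel. cmod (weak_deriv Om e f x) <= W_k_inf_norm 2 Om f"
  "AE x\<in>Om in lborel. cmod (weak_deriv Om e' (weak_deriv Om e f) x) <= W_k_inf_norm 2 Om f"
proof -
 have Omm: "Om \<in> sets borel" using Om by simp
 have f2: "W_k_inf (Suc 1) Om f" using f by (simp add: numeral_2_eq_2)
 note a = W_k_inf_weak_deriv[OF Om e(1) f2]
 have a3: "W_k_inf (Suc 0) Om (weak_deriv Om e f)" using a(3) by simp
 note b = W_k_inf_weak_deriv[OF Om e(2) a3]
 have N: "W_k_inf_norm 2 Om f = Max (insert (Linf_norm Om f) ((%e. Max (insert (Linf_norm Om (weak_deriv Om e f)) ((%e'. Linf_norm Om (weak_deriv Om e' (weak_deriv Om e f))) ` Basis))) ` Basis))"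
  by (simp add: numeral_2_eq_2)
 have in1: "Max (insert (Linf_norm Om (weak_deriv Om e f)) ((%e'. Linf_norm Om (weak_deriv Om e' (weak_deriv Om e f))) ` Basis)) <= W_k_inf_norm 2 Om f"
  unfolding N by (rule Max_ge) (use e in auto)
 have l0: "Linf_norm Om f <= W_k_inf_norm 2 Om f" unfolding N by (rule Max_ge) auto
 have l1: "Linf_norm Om (weak_deriv Om e f) <= W_k_inf_norm 2 Om f"
  by (rule order_trans[OF Max_ge in1]) auto
 have l2: "Linf_norm Om (weak_deriv Om e' (weak_deriv Om e f)) <= W_k_inf_norm 2 Om f"
  by (rule order_trans[OF Max_ge in1]) (use e in auto)
 show "AE x\<in>Om in lborel. cmod (f x) <= W_k_inf_norm 2 Om f"
  using Linf_norm_AE[OF a(1) Omm] by eventually_elim (use l0 in auto)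
 show "AE x\<in>Om in lborel. cmod (weak_deriv Om e f x) <= W_k_inf_norm 2 Om f"
  using Linf_norm_AE[OF b(1) Omm] by eventually_elim (use l1 in auto)
 show "AE x\<in>Om in lborel. cmod (weak_deriv Om e' (weak_deriv Om e f) x) <= W_k_inf_norm 2 Om f"
  using Linf_norm_AE[OF b(3)[unfolded sobolev.simps] Omm] by eventually_elim (use l2 in auto)
qed

lemma smooth_mult:
 fixes f g :: "'a::euclidean_space => complex"
 assumes "smooth f" "smooth g"
 shows "smooth (%x. f x * g x)"
  "e \<in> Basis ==> pderiv_dir e (%x. f x * g x) x = f x * pderiv_dir e g x + pderiv_dir e f x * g x"
proof -
 have "C_k k f ==> C_k k g ==> C_k k (%x. f x * g x)" for k and f g :: "'a => complex"
 proof (induction k arbitrary: f g)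
  case 0
  then show ?case by (simp add: continuous_on_mult)
 next
  case (Suc k)
  note d = C_k_Suc_has_derivative[OF Suc.prems(1)] C_k_Suc_has_derivative[OF Suc.prems(2)]
  show ?case
  proof (rule C_k_SucI[OF has_derivative_mult[OF d]])
   fix e :: 'a assume e: "e \<in> Basis"
   have "C_k k (%x. f x * pderiv_dir e g x + pderiv_dir e f x * g x)"
    using Suc.prems e by (intro C_k_add Suc.IH C_k_Suc_imp[OF Suc.prems(1)] C_k_Suc_imp[OF Suc.prems(2)]) auto
   then show "C_k k (%x. f x * (\<Sum>b\<in>Basis. (e \<bullet> b) *R pderiv_dir b g x) + (\<Sum>b\<in>Basis. (e \<bullet> b) *R pderiv_dir b f x) * g x)"
    by (simp only: sum_Basis_pick[OF e])
  qed
 qed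
 then show "smooth (%x. f x * g x)" using assms by (simp add: smooth_def)
 show "pderiv_dir e (%x. f x * g x) x = f x * pderiv_dir e g x + pderiv_dir e f x * g x" if "e \<in> Basis"
  using pderiv_dir_eqI[OF has_derivative_mult[OF smooth_has_derivative[OF assms(1)] smooth_has_derivative[OF assms(2)]], of e x]
  by (simp only: sum_Basis_pick[OF that])
qed

lemma pderiv_dir_scaleR:
 assumes "smooth f" shows "pderiv_dir e (%x. a *R f x) x = a *R pderiv_dir e f x"
proof -
 note d = smooth_has_derivative[OF assms, of x]
 show ?thesis
  using pderiv_dir_eqI[OF has_derivative_scaleR_right[OF d, of a], of e] pderiv_dir_eqI[OF d, of e] by simp
qed

lemma Basis_plane: "(1, 0) \<in> (Basis :: plane set)" "(0, 1) \<in> (Basis :: plane set)"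
 by (auto simp: Basis_prod_def)

lemma Basis_plane_eq: "(Basis :: plane set) = {(1, 0), (0, 1)}"
 by (auto simp: Basis_prod_def)

lemma smooth_line_derivs:
 fixes A :: "plane => complex"
 assumes "smooth A"
 shows "((%s. A (s, t)) has_vector_derivative pderiv_dir (1, 0) A (s, t)) (at s)"
  "((%t. A (s, t)) has_vector_derivative pderiv_dir (0, 1) A (s, t)) (at t)"
proof -
 note d = smooth_has_derivative[OF assms, of "(s, t)"]
 have "((%s. A (s, t)) has_derivative (%v. \<Sum>b\<in>Basis. ((v, 0) \<bullet> b) *R pderiv_dir b A (s, t))) (at s)"
  by (rule has_derivative_compose[where f="%s. (s, t)" and g=A, OF _ d]) (auto intro!: derivative_eq_intros)
 then show "((%s. A (s, t)) has_vector_derivative pderiv_dir (1, 0) A (s, t)) (at s)"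
  by (simp add: has_vector_derivative_def Basis_plane_eq)
 have "((%t. A (s, t)) has_derivative (%v. \<Sum>b\<in>Basis. ((0, v) \<bullet> b) *R pderiv_dir b A (s, t))) (at t)"
  by (rule has_derivative_compose[where f="%t. (s, t)" and g=A, OF _ d]) (auto intro!: derivative_eq_intros)
 then show "((%t. A (s, t)) has_vector_derivative pderiv_dir (0, 1) A (s, t)) (at t)"
  by (simp add: has_vector_derivative_def Basis_plane_eq)
qed

section \<open>Approximation in the energy norm\<close>

lemma smooth_Linf_on:
 fixes F :: "'a::euclidean_space => complex"
 assumes F: "continuous_on UNIV F" and Om: "bounded Om" "Om \<in> sets borel"
 shows "Linf_on Om F"
proof -
 have "compact (closure Om)" using Om(1) by simp
 then have "compact (F ` closure Om)"
  by (rule compact_continuous_image[OF continuous_on_subset[OF F subset_UNIV]])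
 then obtain C where C: "\<forall>y\<in>F ` closure Om. norm y <= C"
  by (metis compact_imp_bounded bounded_iff)
 have "cmod (F x) <= C" if "x \<in> Om" for x using C closure_subset that by blast
 moreover have [measurable]: "F \<in> bmeas borel" using F by (rule borel_measurable_continuous_onI)
 ultimately show ?thesis
  using Om(2) unfolding Linf_on_def set_borel_measurable_def by (intro conjI exI[of _ C] borel_measurable_scaleR borel_measurable_indicator) simp_all
qed

lemma smooth_L2_on:
 fixes F :: "'a::euclidean_space => complex"
 assumes "continuous_on UNIV F" "bounded Om" "Om \<in> sets borel"
 shows "L2_on Om F"
 by (rule Linf_on_L2_on[OF smooth_Linf_on[OF assms] assms(3)]) (use emeasure_bounded_finite[OF assms(2)] in simp)

lemma L2_on_diff: "L2_on Om f ==> L2_on Om g ==> L2_on Om (%x. f x - g x)"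
 unfolding L2_on_sq_int scaleR_diff_right by (rule sq_int_diff)

lemma L2_norm_mono_set:
 assumes "L2_on Om f" "Om' \<subseteq> Om" "Om' \<in> sets borel"
 shows "L2_on Om' f" "L2_norm Om' f <= L2_norm Om f"
proof -
 have f: "sq_int lborel (%x. ind Om x *R f x)" using assms by (simp add: L2_on_sq_int)
 have e: "(%x. ind Om' x *R f x) = (%x. ind Om' x *R (ind Om x *R f x))"
  using assms(2) by (auto simp: indicator_def fun_eq_iff)
 have m: "(%x. ind Om' x *R f x) \<in> bmeas lborel"
  unfolding e using assms(3) by (intro borel_measurable_scaleR[OF borel_measurable_indicator sq_int_measurable[OF f]]) simp
 have le: "AE x in lborel. cmod (ind Om' x *R f x) <= cmod (ind Om x *R f x)"
  using assms(2) by (intro AE_I2) (auto simp: indicator_def)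
 show "L2_on Om' f" "L2_norm Om' f <= L2_norm Om f"
  using sq_int_bound[OF f m le] by (simp_all add: L2_on_sq_int L2_norm_sq_norm)
qed

context convex_domain
begin

lemma dom_sets: "Om \<in> sets borel"
 using open_dom by simp

lemma dom_fin: "emeasure lborel Om < \<infinity>"
 using emeasure_bounded_finite[OF bounded_dom] by simp

lemma L2_integrable: "L2_on Om f ==> set_integrable lborel Om f"
 using L2_on_set_integrable dom_sets dom_fin by blast

lemma smo_L2_on: "L2_on Om f ==> L2_on Om (smo n f)"
 by (rule smooth_L2_on[OF smooth_continuous[OF smooth_smo[OF L2_integrable]] bounded_dom dom_sets])

lemma smo_tendsto:
 assumes f: "L2_on Om f"
 shows "(%n. L2_norm Om (%x. smo n f x - f x)) ---> 0"
proof -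
 let ?h = "%x. ind Om x *R f x"
 have hs: "sq_int lborel ?h" using f by (simp add: L2_on_sq_int)
 have hi: "integrable lborel ?h" using L2_integrable[OF f] by (simp add: set_integrable_def)
 have lim: "(%n. (nnl (%x. enn (cmod (smoothing c r n ?h x - ?h x) ^ 2)))) ---> 0"
  by (rule smoothing_tendsto_Lp[OF _ r_pos hi]) (use hs in "auto simp: sq_int_def")
 have m: "(%x. ind Om x *R (smo n f x - f x)) \<in> bmeas lborel" for n
  using L2_on_diff[OF smo_L2_on[OF f] f] by (auto simp: L2_on_sq_int sq_int_def)
 have "(%n. (nnl (%x. enn (nsq (ind Om x *R (smo n f x - f x)))))) ---> 0"
 proof (rule tendsto_sandwich[OF _ _ tendsto_const lim])
  show "\<forall>\<^sub>F n in sequentially. (nnl (%x. enn (nsq (ind Om x *R (smo n f x - f x))))) <= (nnl (%x. enn (cmod (smoothing c r n ?h x - ?h x) ^ 2)))"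
   by (intro always_eventually allI nn_integral_mono ennreal_leI) (auto simp: indicator_def smo_def)
 qed simp
 then show ?thesis unfolding L2_norm_sq_norm by (rule nn_tendsto_sq_norm[OF m])
qed

text \<open>Each differentiation of a smoothing produces a factor 1 - 1/(n+2) from the dilation;
  such factors tend to 1 and leave the limit unchanged.\<close>

lemma scaled_smo_tendsto:
 assumes g: "L2_on Om g" and a: "a ---> (1::real)" and F: "!!n x. x \<in> Om ==> F n x = a n *R smo n g x"
 shows "(%n. L2_norm Om (%x. F n x - g x)) ---> 0"
proof -
 have s1: "sq_int lborel (%x. ind Om x *R (smo n g x - g x))" for n
  using L2_on_diff[OF smo_L2_on[OF g] g] by (simp add: L2_on_sq_int)
 have s2: "sq_int lborel (%x. ind Om x *R g x)" using g by (simp add: L2_on_sq_int)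
 have eq: "ind Om x *R (F n x - g x) = cpx (a n) * (ind Om x *R (smo n g x - g x)) + cpx (a n - 1) * (ind Om x *R g x)" for n x
  by (cases "x \<in> Om") (simp_all add: F scaleR_conv_of_real algebra_simps)
 have le: "L2_norm Om (%x. F n x - g x) <= \<bar>a n\<bar> * L2_norm Om (%x. smo n g x - g x) + \<bar>a n - 1\<bar> * L2_norm Om g" for n
  unfolding L2_norm_sq_norm eq
  using sq_int_add(2)[OF sq_int_scale(1)[OF s1[of n], of "cpx (a n)"] sq_int_scale(1)[OF s2, of "cpx (a n - 1)"]]
   sq_int_scale(2)[OF s1[of n], of "cpx (a n)"] sq_int_scale(2)[OF s2, of "cpx (a n - 1)"]
  by (simp only: norm_of_real)
 have "(%n. \<bar>a n\<bar> * L2_norm Om (%x. smo n g x - g x) + \<bar>a n - 1\<bar> * L2_norm Om g) ---> (abs 1) * 0 + \<bar>1 - 1\<bar> * L2_norm Om g"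
  by (intro tendsto_intros a smo_tendsto g)
 then have z: "(%n. \<bar>a n\<bar> * L2_norm Om (%x. smo n g x - g x) + \<bar>a n - 1\<bar> * L2_norm Om g) ---> 0"
  by simp
 show ?thesis by (rule tendsto_sandwich[OF _ _ tendsto_const z]) (use le in simp_all)
qed

lemma smo_deriv:
 assumes w: "has_weak_deriv Om e f g" and f: "L2_on Om f" and g: "L2_on Om g" and e: "e \<in> Basis"
 shows "(%n. L2_norm Om (%x. pderiv_dir e (smo n f) x - g x)) ---> 0"
  "x \<in> Om ==> AE x\<in>Om in lborel. cmod (g x) <= M ==> M >= 0 ==> cmod (pderiv_dir e (smo n f) x) <= M"
proof -
 have 1: "pderiv_dir e (smo n f) x = (1 - 1 / (real n + 2)) *R smo n g x" if "x \<in> Om" for n x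
  by (rule pderiv_dir_smo[OF w L2_integrable[OF f] e that])
 have a: "(%n. 1 - 1 / (real n + 2)) ---> 1" by real_asymp
 show "(%n. L2_norm Om (%x. pderiv_dir e (smo n f) x - g x)) ---> 0"
  by (rule scaled_smo_tendsto[OF g a 1])
 assume x: "x \<in> Om" and M: "AE x\<in>Om in lborel. cmod (g x) <= M" "M >= 0"
 have "cmod (pderiv_dir e (smo n f) x) <= 1 * M"
  unfolding 1[OF x] norm_scaleR by (intro mult_mono smo_bound[OF L2_integrable[OF g] M]) (auto simp: field_simps)
 then show "cmod (pderiv_dir e (smo n f) x) <= M" by simp
qed

lemma smo_deriv2:
 assumes w: "has_weak_deriv Om e f g" "has_weak_deriv Om e' g h" and f: "L2_on Om f" and g: "L2_on Om g" and h: "L2_on Om h"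
  and e: "e \<in> Basis" "e' \<in> Basis"
 shows "(%n. L2_norm Om (%x. pderiv_dir e' (pderiv_dir e (smo n f)) x - h x)) ---> 0"
  "x \<in> Om ==> AE x\<in>Om in lborel. cmod (h x) <= M ==> M >= 0 ==> cmod (pderiv_dir e' (pderiv_dir e (smo n f)) x) <= M"
proof -
 have 1: "pderiv_dir e' (pderiv_dir e (smo n f)) x = ((1 - 1 / (real n + 2)) * (1 - 1 / (real n + 2))) *R smo n h x" if "x \<in> Om" for n x
 proof -
  \<comment> \<open>The formula for the first derivative holds only on the domain; as the domain is
    open, it may still be differentiated once more.\<close>
  have "pderiv_dir e' (pderiv_dir e (smo n f)) x = pderiv_dir e' (%x. (1 - 1 / (real n + 2)) *R smo n g x) x"
   by (rule pderiv_dir_local[OF open_dom that]) (rule pderiv_dir_smo[OF w(1) L2_integrable[OF f] e(1)])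
  then show ?thesis
   by (simp add: pderiv_dir_scaleR[OF smooth_smo[OF L2_integrable[OF g]]] pderiv_dir_smo[OF w(2) L2_integrable[OF g] e(2) that])
 qed
 have a: "(%n. (1 - 1 / (real n + 2)) * (1 - 1 / (real n + 2))) ---> 1" by real_asymp
 show "(%n. L2_norm Om (%x. pderiv_dir e' (pderiv_dir e (smo n f)) x - h x)) ---> 0"
  by (rule scaled_smo_tendsto[OF h a 1])
 assume x: "x \<in> Om" and M: "AE x\<in>Om in lborel. cmod (h x) <= M" "M >= 0"
 have le1: "\<bar>1 - 1 / (real n + 2)\<bar> <= 1" by (auto simp: field_simps)
 have "cmod (pderiv_dir e' (pderiv_dir e (smo n f)) x) <= (1 * 1) * M"
  unfolding 1[OF x] norm_scaleR abs_mult by (intro mult_mono smo_bound[OF L2_integrable[OF h] M] le1) auto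
 then show "cmod (pderiv_dir e' (pderiv_dir e (smo n f)) x) <= M" by simp
qed

end

section \<open>Integration by parts\<close>

lemma fubini_plane:
 fixes F :: "plane => complex"
 assumes "integrable lborel F"
 shows "(LINT x|lborel. F x) = (LINT s|lborel. LINT t|lborel. F (s, t))"
  "(LINT x|lborel. F x) = (LINT t|lborel. LINT s|lborel. F (s, t))"
  "AE s in lborel. integrable lborel (%t. F (s, t))" "AE t in lborel. integrable lborel (%s. F (s, t))"
  "integrable lborel (%s. LINT t|lborel. F (s, t))" "integrable lborel (%t. LINT s|lborel. F (s, t))"
proof -
 have i: "integrable (lborel \<Otimes>\<^sub>M lborel) F" using assms by (simp add: lborel_prod)
 then have i': "integrable (lborel \<Otimes>\<^sub>M lborel) (case_prod (%s t. F (s, t)))" by simp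
 show "(LINT x|lborel. F x) = (LINT s|lborel. LINT t|lborel. F (s, t))"
  using lborel_pair.integral_fst[OF i'] by (simp add: lborel_prod)
 show "(LINT x|lborel. F x) = (LINT t|lborel. LINT s|lborel. F (s, t))"
  using lborel_pair.integral_snd[OF i'] by (simp add: lborel_prod)
 show "AE s in lborel. integrable lborel (%t. F (s, t))" using lborel_pair.AE_integrable_fst[OF i'] by simp
 show "AE t in lborel. integrable lborel (%s. F (s, t))" using lborel_pair.AE_integrable_snd[OF i'] by simp
 show "integrable lborel (%s. LINT t|lborel. F (s, t))" using lborel_pair.integrable_fst[OF i'] by simp
 show "integrable lborel (%t. LINT s|lborel. F (s, t))" using lborel_pair.integrable_snd[OF i'] by simp
qed

text \<open>Here \<open>w\<close> is merely integrable. The derivative of \<open>B\<close>, cut off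
  to the interval, has primitive B - B(a) there, so \<open>prim_mult\<close> gives the identity up
  to the constant B(a), which is integrated separately.\<close>

lemma LINT_ibp:
 fixes B B' w :: "real => complex"
 assumes ab: "a <= b" and B: "!!t. (B has_vector_derivative B' t) (at t)" and B': "continuous_on UNIV B'"
  and w: "integrable lborel w"
 shows "(LINT t|lborel. ind {a<..<b} t *R (B t * w t))
  = B b * prim w b - B a * prim w a - (LINT t|lborel. ind {a<..<b} t *R (B' t * prim w t))"
proof -
 have Bc: "continuous_on UNIV B"
  using B has_vector_derivative_continuous continuous_at_imp_continuous_on by blast
 let ?h = "%t. ind {a<..<b} t *R B' t"
 have seti: "set_integrable lborel {c<..<d} B'" for c d
  by (rule set_integrable_subset[OF borel_integrable_atLeastAtMost'[of c d B']]) (auto intro: continuous_on_subset[OF B'])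
 have h: "integrable lborel ?h" using seti[of a b] by (simp add: set_integrable_def)
 have ph: "prim ?h t = B t - B a" if "a <= t" "t <= b" for t
 proof -
  have "prim ?h t = (LINT s|lborel. ind {a<..<t} s *R B' s)"
   unfolding prim_def by (rule B_integral_cong) (use that in "auto simp: indicator_def")
  also have "... = B t - B a"
   by (rule LINT_FTC[of "{}"]) (use that B seti[of a t] in "auto simp: set_integrable_def intro: continuous_on_subset[OF Bc]")
  finally show ?thesis .
 qed
 have ph0: "prim ?h s = 0" if "s <= a" for s
  unfolding prim_def by (rule integral_eq_zero_AE) (use that in "auto simp: indicator_def")
 have Bw: "integrable lborel (%t. ind {a<..<b} t *R (B t * w t))"
 proof -
  obtain C where C: "!!y. y \<in> B ` {a..b} ==> norm y <= C"
   using compact_imp_bounded[OF compact_continuous_image[OF continuous_on_subset[OF Bc], of "{a..b}"]] unfolding bounded_iff by auto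
  have [measurable]: "B \<in> bmeas borel" using Bc by (rule borel_measurable_continuous_onI)
  have "integrable lborel (%t. (ind {a<..<b} t *R B t) * w t)"
  proof (rule integrable_mult_bounded[OF w])
   show "cmod (ind {a<..<b} x *R B x) <= (abs C)" for x
    using C[of "B x"] by (auto simp: indicator_def intro: order_trans)
  qed measurable
  then show ?thesis by simp
 qed
 have w1: "integrable lborel (%t. ind {a<..<b} t *R w t)"
  by (rule B_integrable_bound[OF w]) (use w in "auto simp: indicator_def")
 have B'p: "integrable lborel (%t. ind {a<..<b} t *R (B' t * prim w t))"
 proof -
  have "prim w \<in> bmeas lborel" using prim_borel[OF w] by simp
  from integrable_mult_bounded[OF h this prim_norm_le[OF w]] show ?thesis by (simp add: mult_ac)
 qed
 have wab: "(LINT t|lborel. ind {a<..<b} t *R w t) = prim w b - prim w a"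
 proof -
  have i: "integrable lborel (%s. ind {..<c} s *R w s)" for c :: real
   by (rule B_integrable_bound[OF w]) (use w in "auto simp: indicator_def")
  have "prim w b - prim w a = (LINT s|lborel. ind {..<b} s *R w s - ind {..<a} s *R w s)"
   unfolding prim_def by (rule B_integral_diff[OF i i, symmetric])
  also have "... = (LINT t|lborel. ind {a<..<b} t *R w t)"
  proof (rule integral_cong_AE)
   show "AE s in lborel. ind {..<b} s *R w s - ind {..<a} s *R w s = ind {a<..<b} s *R w s"
    using AE_lborel_singleton[of a] by eventually_elim (use ab in "auto simp: indicator_def")
  qed (use i[of a] i[of b] w1 in auto)
  finally show ?thesis by simp
 qed
 have "prim w b * prim ?h b = prim (%s. w s * prim ?h s + prim w s * ?h s) b"
  by (rule prim_mult(2)[OF w h, symmetric])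
 also have "... = (LINT t|lborel. ind {a<..<b} t *R (B t * w t) - B a * (ind {a<..<b} t *R w t) + ind {a<..<b} t *R (B' t * prim w t))"
  unfolding prim_def[of "%s. w s * prim ?h s + prim w s * ?h s"]
 proof (rule B_integral_cong[OF refl])
  fix s
  consider "s <= a" | "a < s" "s < b" | "b <= s" by linarith
  then show "ind {..<b} s *R (w s * prim ?h s + prim w s * ?h s) = ind {a<..<b} s *R (B s * w s) - B a * (ind {a<..<b} s *R w s) + ind {a<..<b} s *R (B' s * prim w s)"
  proof cases
   case 1
   then show ?thesis using ph0[OF 1] by simp
  next
   case 2
   then have e: "prim ?h s = B s - B a" using ph[of s] by simp
   show ?thesis unfolding e using 2 by (simp add: algebra_simps)
  qed (use ab in simp)
 qed
 also have "... = (LINT t|lborel. ind {a<..<b} t *R (B t * w t)) - B a * (prim w b - prim w a) + (LINT t|lborel. ind {a<..<b} t *R (B' t * prim w t))"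
  by (simp only: B_integral_add[OF B_integrable_diff[OF Bw integrable_mult_right[OF w1]] B'p]
   B_integral_diff[OF Bw integrable_mult_right[OF w1]] integral_mult_right_zero wab)
 finally show ?thesis using ph[of b] ab by (simp add: algebra_simps)
qed

text \<open>Both triangles under one Boolean index: each argument is carried out once, with
  \<open>sg b\<close> recording the orientation of the diagonal.\<close>

definition tri :: "bool => real => plane set" where
 "tri b T = {x \<in> square T. fst x ~= snd x & (fst x < snd x) = b}"

lemma tri_Delta: "Delta_plus T = tri True T" "Delta_minus T = tri False T"
 by (auto simp: tri_def Delta_plus_def Delta_minus_def)

lemma open_square: "open (square T)" "bounded (square T)"
 unfolding square_def by (auto intro: open_Times bounded_Times)

lemma open_tri: "open (tri b T)"
proof -
 have "tri b T = square T \<inter> (if b then {x. fst x < snd x} else {x. snd x < fst x})"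
  by (auto simp: tri_def)
 moreover have "open {x::real\<times>real. fst x < snd x}" "open {x::real\<times>real. snd x < fst x}"
  by (intro open_Collect_less continuous_intros)+
 ultimately show ?thesis using open_square by (auto intro: open_Int)
qed

lemma tri_subset: "tri b T \<subseteq> square T" by (auto simp: tri_def)

lemma bounded_tri: "bounded (tri b T)" using open_square(2) tri_subset bounded_subset by blast

lemma tri_row: "s \<in> {0<..<T} ==> ind (tri b T) (s, t) = ind (if b then {s<..<T} else {0<..<s}) t"
 by (auto simp: tri_def square_def indicator_def)

lemma tri_col: "t \<in> {0<..<T} ==> ind (tri b T) (s, t) = ind (if b then {0<..<t} else {t<..<T}) s"
 by (auto simp: tri_def square_def indicator_def)

lemma integrable_smooth_weight:
 assumes "continuous_on UNIV A" "bounded Om" "Om \<in> sets borel" "sq_int lborel W"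
 shows "integrable lborel (%x. ind Om x *R A x * W x)"
 by (rule sq_int_mult[OF smooth_L2_on[OF assms(1-3), unfolded L2_on_sq_int] assms(4)])

text \<open>On a row of the triangle one endpoint lies on the side of the square, where
  \<open>prim w\<close> vanishes, and the other on the diagonal. The diagonal is the lower end for
  \<open>b\<close> and the upper one otherwise, whence the sign.\<close>

lemma green_triangle:
 assumes A: "smooth A" and p: "adm T p" and w: "adm T w"
 shows "(LINT x|lborel. ind (tri b T) x *R A x * (prim p (fst x) * w (snd x)))
  = - cpx (sg b) * (LINT s|lborel. ind {0<..<T} s *R A (s, s) * (prim p s * prim w s))
   - (LINT x|lborel. ind (tri b T) x *R pderiv_dir (0, 1) A x * (prim p (fst x) * prim w (snd x)))"
proof -
 have Ac: "continuous_on UNIV A" "continuous_on UNIV (pderiv_dir (0, 1) A)"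
  using A by (auto intro!: smooth_continuous smooth_pderiv_dir Basis_plane)
 have wsq: "sq_int lborel w" "sq_int lborel (prim w)" "sq_int lborel (prim p)" using p w adm_prim by (auto simp: adm_def)
 note wi = adm_integrable[OF w]
 have i: "integrable lborel (%x. ind (tri b T) x *R A x * (prim p (fst x) * w (snd x)))"
  "integrable lborel (%x. ind (tri b T) x *R pderiv_dir (0, 1) A x * (prim p (fst x) * prim w (snd x)))"
  by (intro integrable_smooth_weight sq_int_tensor Ac wsq open_tri bounded_tri borel_open)+
 have di: "integrable lborel (%s. ind {0<..<T} s *R A (s, s) * (prim p s * prim w s))"
 proof -
  have "integrable lborel (%s. prim w s * (ind {0<..<T} s *R A (s, s) * prim p s))"
  proof (rule integrable_mult_bounded[of _ _ _ "LINT s|lborel. cmod (w s)"])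
   have c: "continuous_on UNIV (%s. A (s, s))" by (intro continuous_on_compose2[OF Ac(1)] continuous_intros) auto
   show "integrable lborel (%s. ind {0<..<T} s *R A (s, s) * prim p s)"
    by (rule integrable_smooth_weight[OF c]) (use wsq in auto)
   show "prim w \<in> bmeas lborel" using wsq by (auto simp: sq_int_def)
  qed (rule prim_norm_le[OF wi])
  then show ?thesis by (simp add: mult_ac)
 qed
 have row: "(LINT t|lborel. ind (tri b T) (s, t) *R A (s, t) * (prim p s * w t))
  = - cpx (sg b) * (ind {0<..<T} s *R A (s, s) * (prim p s * prim w s)) - (LINT t|lborel. ind (tri b T) (s, t) *R pderiv_dir (0, 1) A (s, t) * (prim p s * prim w t))" for s
 proof (cases "s \<in> {0<..<T}")
  case True
  let ?a = "if b then s else 0" and ?b = "if b then T else s"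
  have ind: "ind (tri b T) (s, t) = (ind {?a<..<?b} t :: real)" for t using tri_row[OF True, of b t] by (cases b) auto
  have pz: "prim w T = 0" "prim w 0 = 0" using adm_prim_zero[OF w] by auto
  have c2: "continuous_on UNIV (%t. pderiv_dir (0, 1) A (s, t))" by (intro continuous_on_compose2[OF Ac(2)] continuous_intros) auto
  have "(LINT t|lborel. ind {?a<..<?b} t *R (A (s, t) * w t))
   = A (s, ?b) * prim w ?b - A (s, ?a) * prim w ?a - (LINT t|lborel. ind {?a<..<?b} t *R (pderiv_dir (0, 1) A (s, t) * prim w t))"
   by (rule LINT_ibp[OF _ smooth_line_derivs(2)[OF A] c2 wi]) (use True in auto)
  also have "A (s, ?b) * prim w ?b - A (s, ?a) * prim w ?a = - cpx (sg b) * (A (s, s) * prim w s)"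
   using pz by (cases b) (simp_all add: sg_def)
  finally have e: "(LINT t|lborel. ind {?a<..<?b} t *R (A (s, t) * w t))
   = - cpx (sg b) * (A (s, s) * prim w s) - (LINT t|lborel. ind {?a<..<?b} t *R (pderiv_dir (0, 1) A (s, t) * prim w t))" .
  have pull: "(LINT t|lborel. ind (tri b T) (s, t) *R G t * (prim p s * v t)) = prim p s * (LINT t|lborel. ind {?a<..<?b} t *R (G t * v t))" for G v
   unfolding ind integral_mult_right_zero[symmetric] by (rule B_integral_cong) (auto simp: scaleR_conv_of_real)
  show ?thesis unfolding pull e using True by (simp add: algebra_simps)
 next
  case False
  then have "ind (tri b T) (s, t) = (0::real)" for t by (auto simp: tri_def square_def indicator_def)
  then show ?thesis using False by simp
 qed
 show ?thesis
  unfolding fubini_plane(1)[OF i(1)] fubini_plane(1)[OF i(2)] fst_conv snd_conv row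
  by (subst B_integral_diff[OF integrable_mult_right[OF di] fubini_plane(5)[OF i(2), unfolded fst_conv snd_conv]])
   (simp only: integral_mult_right_zero)
qed

lemma green_square:
 assumes A: "smooth A" and T: "0 < T" and p: "adm T p" and w: "adm T w"
 shows "(LINT x|lborel. ind (square T) x *R A x * (p (fst x) * w (snd x)))
  = - (LINT x|lborel. ind (square T) x *R pderiv_dir (1, 0) A x * (prim p (fst x) * w (snd x)))"
proof -
 have Ac: "continuous_on UNIV A" "continuous_on UNIV (pderiv_dir (1, 0) A)"
  using A by (auto intro!: smooth_continuous smooth_pderiv_dir Basis_plane)
 have wsq: "sq_int lborel w" "sq_int lborel p" "sq_int lborel (prim p)" using p w adm_prim by (auto simp: adm_def)
 have i: "integrable lborel (%x. ind (square T) x *R A x * (p (fst x) * w (snd x)))"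
  "integrable lborel (%x. ind (square T) x *R pderiv_dir (1, 0) A x * (prim p (fst x) * w (snd x)))"
  by (intro integrable_smooth_weight sq_int_tensor Ac wsq open_square borel_open)+
 have col: "(LINT s|lborel. ind (square T) (s, t) *R A (s, t) * (p s * w t))
  = - (LINT s|lborel. ind (square T) (s, t) *R pderiv_dir (1, 0) A (s, t) * (prim p s * w t))" for t
 proof -
  have pz: "prim p T = 0" "prim p 0 = 0" using adm_prim_zero[OF p] by auto
  have c2: "continuous_on UNIV (%s. pderiv_dir (1, 0) A (s, t))" by (intro continuous_on_compose2[OF Ac(2)] continuous_intros) auto
  have e: "(LINT s|lborel. ind {0<..<T} s *R (A (s, t) * p s))
   = A (T, t) * prim p T - A (0, t) * prim p 0 - (LINT s|lborel. ind {0<..<T} s *R (pderiv_dir (1, 0) A (s, t) * prim p s))"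
   by (rule LINT_ibp[OF _ smooth_line_derivs(1)[OF A] c2 adm_integrable[OF p]]) (use T in auto)
  have pull: "(LINT s|lborel. ind (square T) (s, t) *R G s * (v s * w t)) = (ind {0<..<T} t *R w t) * (LINT s|lborel. ind {0<..<T} s *R (G s * v s))" for G v
   unfolding integral_mult_right_zero[symmetric] by (rule B_integral_cong) (auto simp: scaleR_conv_of_real square_def indicator_def)
  show ?thesis unfolding pull e pz by simp
 qed
 show ?thesis
  unfolding fubini_plane(2)[OF i(1)] fubini_plane(2)[OF i(2)] fst_conv snd_conv col by simp
qed

definition pairing :: "'a::euclidean_space set => ('a => complex) => ('a => complex) => complex" where
 "pairing Om F W = (LINT x|lborel. ind Om x *R F x * W x)"

lemma pairing_tendsto:
 assumes "!!n. L2_on Om (F n)" "L2_on Om f" "sq_int lborel W" "(%n. L2_norm Om (%x. F n x - f x)) ---> 0"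
 shows "(%n. pairing Om (F n) W) ---> pairing Om f W"
 unfolding pairing_def using assms
 by (intro sq_int_tendsto_integral) (simp_all only: L2_on_sq_int L2_norm_sq_norm scaleR_diff_right)

lemma pairing_mult:
 "pairing Om (%x. F x * G x) W = pairing Om F (%x. ind Om x *R G x * W x)"
 "pairing Om (%x. F x * G x) W = pairing Om G (%x. ind Om x *R F x * W x)"
 unfolding pairing_def by (rule B_integral_cong; simp add: indicator_def)+

lemma pairing_add:
 assumes "L2_on Om F" "L2_on Om G" "sq_int lborel W"
 shows "pairing Om (%x. F x + G x) W = pairing Om F W + pairing Om G W"
 unfolding pairing_def scaleR_add_right distrib_right
 by (rule B_integral_add; rule sq_int_mult) (use assms in "simp_all only: L2_on_sq_int")

lemma Linf_mult_sq_int: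
 assumes b: "Linf_on Om b" and W: "sq_int lborel W"
 shows "sq_int lborel (%x. ind Om x *R b x * W x)"
proof -
 obtain C where C: "AE x\<in>Om in lborel. cmod (b x) <= C" using b by (auto simp: Linf_on_def)
 show ?thesis
 proof (rule sq_int_bounded_mult(1)[OF W])
  show "(%x. ind Om x *R b x) \<in> bmeas lborel" using b by (simp add: Linf_on_def set_borel_measurable_def)
  show "AE x in lborel. cmod (ind Om x *R b x) <= (abs C)"
   using C by eventually_elim (auto simp: indicator_def)
 qed simp
qed

definition energy_approx :: "real => plane set => plane => (plane => complex) => (plane => complex)
  => (real => complex) => (nat => plane => complex) => bool" where
 "energy_approx T Om e f f' tau phi \<longleftrightarrow> L2_on Om f & L2_on Om f' & L2_on {0<..<T} tau & (\<forall>n. smooth (phi n)) &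
   (%n. L2_norm Om (%x. phi n x - f x)) ---> 0 &
   (%n. L2_norm Om (%x. pderiv_dir e (phi n) x - f' x)) ---> 0 &
   (%n. L2_norm {0<..<T} (%s. phi n (s, s) - tau s)) ---> 0"

lemma smooth_diag: "smooth phi ==> continuous_on UNIV (%s::real. (phi :: plane => complex) (s, s))"
 by (rule continuous_on_compose2[OF smooth_continuous, of phi UNIV "%s. (s, s)"]) (simp_all add: continuous_on_Pair)

text \<open>Each term is linear in the function and tests it, its derivative or its trace against a
  square integrable weight, so it is continuous in the energy norm. The term with \<open>V1\<close>
  leaves room for the derivative of a second factor hidden in the weights.\<close>

lemma green_limit:
 assumes Om: "bounded Om" "Om \<in> sets borel" and e: "e \<in> Basis"
  and V: "sq_int lborel V0" "sq_int lborel V1" "sq_int lborel V2" "sq_int lborel dl"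
  and green: "!!A. smooth A ==> pairing Om A V0 = sig * pairing {0<..<T} (%s. A (s, s)) dl - pairing Om A V1 - pairing Om (pderiv_dir e A) V2"
  and phi: "energy_approx T Om e f f' tau phi"
 shows "pairing Om f V0 = sig * pairing {0<..<T} tau dl - pairing Om f V1 - pairing Om f' V2"
proof -
 have s: "smooth (phi n)" for n using phi by (simp add: energy_approx_def)
 have L: "L2_on Om (phi n)" "L2_on Om (pderiv_dir e (phi n))" "L2_on {0<..<T} (%s. phi n (s, s))" for n
  using smooth_continuous[OF s[of n]] smooth_continuous[OF smooth_pderiv_dir[OF s[of n] e]] smooth_diag[OF s[of n]] Om
  by (simp_all add: smooth_L2_on)
 have f: "L2_on Om f" "L2_on Om f'" "L2_on {0<..<T} tau"
  and c: "(%n. L2_norm Om (%x. phi n x - f x)) ---> 0" "(%n. L2_norm Om (%x. pderiv_dir e (phi n) x - f' x)) ---> 0"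
   "(%n. L2_norm {0<..<T} (%s. phi n (s, s) - tau s)) ---> 0"
  using phi by (simp_all add: energy_approx_def)
 note lim = pairing_tendsto[OF L(1) f(1) V(1) c(1)] pairing_tendsto[OF L(1) f(1) V(2) c(1)]
  pairing_tendsto[OF L(2) f(2) V(3) c(2)] pairing_tendsto[OF L(3) f(3) V(4) c(3)]
 have "(%n. pairing Om (phi n) V0) ---> sig * pairing {0<..<T} tau dl - pairing Om f V1 - pairing Om f' V2"
  unfolding green[OF s] by (intro tendsto_intros lim)
 with lim(1) show ?thesis by (rule LIMSEQ_unique)
qed

text \<open>Only one of the two factors is bounded, so they are approximated one after the other:
 each passage to the limit then takes place in an integral that is linear in the factor and has
 square integrable coefficients.\<close>

lemma green_product:
 assumes Om: "bounded Om" "Om \<in> sets borel" and e: "e \<in> Basis"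
  and W: "sq_int lborel W0" "sq_int lborel W1" and d: "sq_int lborel d" "!!s. cmod (d s) <= B"
  and green: "!!A. smooth A ==> pairing Om A W0 = sig * pairing {0<..<T} (%s. A (s, s)) d - pairing Om (pderiv_dir e A) W1"
  and f: "energy_approx T Om e f f' tau phi" "Linf_on Om f" "Linf_on Om f'" and k: "energy_approx T Om e k k' kp K"
 shows "pairing Om (%x. f x * k x) W0 = sig * pairing {0<..<T} (%s. tau s * kp s) d - pairing Om (%x. f' x * k x) W1 - pairing Om (%x. f x * k' x) W1"
proof -
 have B0: "0 <= B" using d(2)[of 0] norm_ge_zero order_trans by blast
 have taud: "sq_int lborel (%s. ind {0<..<T} s *R tau s * d s)"
 proof -
  have "sq_int lborel (%s. ind {0<..<T} s *R tau s)" using f(1) by (simp add: energy_approx_def L2_on_sq_int)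
  from sq_int_bounded_mult(1)[OF this sq_int_measurable[OF d(1)] AE_I2[OF d(2)] B0] show ?thesis by (simp only: mult.commute)
 qed
 have "pairing Om k (%x. ind Om x *R f x * W0 x)
  = sig * pairing {0<..<T} kp (%s. ind {0<..<T} s *R tau s * d s)
   - pairing Om k (%x. ind Om x *R f' x * W1 x) - pairing Om k' (%x. ind Om x *R f x * W1 x)"
 proof (rule green_limit[OF Om e Linf_mult_sq_int[OF f(2) W(1)] Linf_mult_sq_int[OF f(3) W(2)] Linf_mult_sq_int[OF f(2) W(2)] taud _ k])
  \<comment> \<open>With a smooth \<open>A\<close> in the place of \<open>k\<close>, the weights
    containing \<open>A\<close> are square integrable and \<open>f\<close> is the factor to be
    approximated.\<close>
  fix A :: "plane => complex" assume A: "smooth A"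
  have Ab: "Linf_on Om A" "Linf_on Om (pderiv_dir e A)" "Linf_on {0<..<T} (%s. A (s, s))"
   using smooth_continuous[OF A] smooth_continuous[OF smooth_pderiv_dir[OF A e]] smooth_diag[OF A] Om
   by (simp_all add: smooth_Linf_on)
  have "pairing Om f (%x. ind Om x *R A x * W0 x)
   = sig * pairing {0<..<T} tau (%s. ind {0<..<T} s *R A (s, s) * d s)
   - pairing Om f (%x. ind Om x *R pderiv_dir e A x * W1 x) - pairing Om f' (%x. ind Om x *R A x * W1 x)"
  proof (rule green_limit[OF Om e Linf_mult_sq_int[OF Ab(1) W(1)] Linf_mult_sq_int[OF Ab(2) W(2)] Linf_mult_sq_int[OF Ab(1) W(2)] Linf_mult_sq_int[OF Ab(3) d(1)] _ f(1)])
   fix B :: "plane => complex" assume B: "smooth B"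
   have BL: "L2_on Om (%x. B x * pderiv_dir e A x)" "L2_on Om (%x. pderiv_dir e B x * A x)"
    using smooth_continuous[OF A] smooth_continuous[OF smooth_pderiv_dir[OF A e]] smooth_continuous[OF B] smooth_continuous[OF smooth_pderiv_dir[OF B e]] Om
    by (auto intro!: smooth_L2_on continuous_on_mult)
   show "pairing Om B (%x. ind Om x *R A x * W0 x)
    = sig * pairing {0<..<T} (%s. B (s, s)) (%s. ind {0<..<T} s *R A (s, s) * d s)
    - pairing Om B (%x. ind Om x *R pderiv_dir e A x * W1 x) - pairing Om (pderiv_dir e B) (%x. ind Om x *R A x * W1 x)"
    unfolding pairing_mult(1)[symmetric] green[OF smooth_mult(1)[OF B A]] smooth_mult(2)[OF B A e] pairing_add[OF BL W(2)] by simp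
  qed
  then show "pairing Om A (%x. ind Om x *R f x * W0 x)
   = sig * pairing {0<..<T} (%s. A (s, s)) (%s. ind {0<..<T} s *R tau s * d s)
   - pairing Om A (%x. ind Om x *R f' x * W1 x) - pairing Om (pderiv_dir e A) (%x. ind Om x *R f x * W1 x)"
   unfolding pairing_mult(1)[symmetric] by (simp only: mult.commute[of "A _"] mult.commute[of "pderiv_dir e A _"] diff_diff_eq add.commute)
 qed
 then show ?thesis unfolding pairing_mult(2) .
qed

section \<open>Traces on the diagonal\<close>

text \<open>Cauchy-Schwarz on a row of length T <= 1. If the row is not square integrable, the
  right-hand side is infinite.\<close>

lemma row_integral_bound:
 fixes H :: "real => real => complex"
 assumes [measurable]: "(%(s, t). H s t) \<in> bmeas (borel \<Otimes>\<^sub>M borel)"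
  and supp: "!!s t. t ~: {0<..<T} ==> H s t = 0" and T: "0 < T" "T <= 1"
 shows "(nnl (%s. enn (nsq (LINT t|lborel. H s t)))) <= (nnl (%s. (nnl (%t. enn (nsq (H s t))))))"
proof (rule nn_integral_mono)
 fix s :: real
 have Hm: "H s \<in> bmeas lborel" by measurable
 let ?i = "%t. cpx (ind {0<..<T} t)"
 show "enn (nsq (LINT t|lborel. H s t)) <= (nnl (%t. enn (nsq (H s t))))"
 proof (cases "(nnl (%t. enn (nsq (H s t)))) < \<infinity>")
  case True
  then have sq: "sq_int lborel (H s)" using Hm by (simp add: sq_int_iff_nn)
  have ii: "(nsq (?i t)) = ind {0<..<T} t" for t by (simp add: indicator_def)
  have isq: "sq_int lborel ?i" unfolding sq_int_def ii using integrable_indicator_interval by auto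
  have inorm: "sq_norm lborel ?i <= 1" unfolding sq_norm_def ii using T by simp
  have "(LINT t|lborel. H s t) = (LINT t|lborel. H s t * ?i t)"
   by (rule B_integral_cong) (use supp[of _ s] in "auto simp: indicator_def")
  then have "cmod (LINT t|lborel. H s t) <= sq_norm lborel (H s) * sq_norm lborel ?i" using sq_int_CS[OF sq isq] by simp
  also have "... <= sq_norm lborel (H s)" using mult_left_mono[OF inorm sq_norm_nonneg, of lborel "H s"] by simp
  finally have "(nsq (LINT t|lborel. H s t)) <= (sq_norm lborel (H s))\<^sup>2" by (intro power_mono) auto
  then show ?thesis using sq_norm_nn[OF sq] by (simp add: ennreal_leI)
 qed (simp add: not_less top_unique)
qed

definition rint :: "(plane => complex) => real => complex" where
 "rint h s = (LINT t|lborel. h (s, t))"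

definition cint :: "(plane => complex) => real => complex" where
 "cint h t = (LINT s|lborel. h (s, t))"

lemma rint_cint_bound:
 assumes h: "sq_int lborel h" and supp: "!!x. x ~: square T ==> h x = 0" and T: "0 < T" "T <= 1"
 shows "sq_int lborel (rint h)" "sq_norm lborel (rint h) <= sq_norm lborel h"
  "sq_int lborel (cint h)" "sq_norm lborel (cint h) <= sq_norm lborel h"
proof -
 have [measurable]: "h \<in> bmeas (borel \<Otimes>\<^sub>M borel)" using h by (simp add: sq_int_def borel_prod)
 have m: "(%(s, t). h (s, t)) \<in> bmeas (borel \<Otimes>\<^sub>M borel)" "(%(t, s). h (s, t)) \<in> bmeas (borel \<Otimes>\<^sub>M borel)" by measurable
 have z: "h (s, t) = 0" if "t ~: {0<..<T} | s ~: {0<..<T}" for s t using supp[of "(s, t)"] that by (auto simp: square_def)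
 have fin: "sq_int lborel f & sq_norm lborel f <= sq_norm lborel h"
  if fm: "f \<in> bmeas lborel" and le: "(nnl (%s. enn (nsq (f s)))) <= (nnl (%x. enn (nsq (h x))))" for f :: "real => complex"
 proof -
  have "(nnl (%x. enn (nsq (h x)))) < \<infinity>" using h by (simp add: sq_int_iff_nn)
  then have f: "sq_int lborel f" unfolding sq_int_iff_nn using fm le_less_trans[OF le] by blast
  then have "(sq_norm lborel f)\<^sup>2 <= (sq_norm lborel h)\<^sup>2" using le by (simp add: sq_norm_nn[OF f] sq_norm_nn[OF h])
  from f power2_le_imp_le[OF this sq_norm_nonneg] show ?thesis ..
 qed
 have "(nnl (%s. enn (nsq (LINT t|lborel. h (s, t))))) <= (nnl (%s. (nnl (%t. enn (nsq (h (s, t)))))))"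
  by (rule row_integral_bound[OF m(1) _ T]) (use z in auto)
 also have "... = (nnl (%x. enn (nsq (h x))))"
  unfolding lborel_prod[symmetric] by (rule lborel.nn_integral_fst) measurable
 finally have 1: "(nnl (%s. enn (nsq (rint h s)))) <= (nnl (%x. enn (nsq (h x))))"
  by (simp only: rint_def)
 have "(nnl (%t. enn (nsq (LINT s|lborel. h (s, t))))) <= (nnl (%t. (nnl (%s. enn (nsq (h (s, t)))))))"
  by (rule row_integral_bound[OF m(2) _ T]) (use z in auto)
 also have "... = (nnl (%x. enn (nsq (h x))))"
  unfolding lborel_prod[symmetric] by (rule lborel_pair.nn_integral_snd) measurable
 finally have 2: "(nnl (%t. enn (nsq (cint h t)))) <= (nnl (%x. enn (nsq (h x))))"
  by (simp only: cint_def)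
 have "rint h \<in> bmeas lborel" unfolding rint_def[abs_def] by measurable
 from fin[OF this 1] show "sq_int lborel (rint h)" "sq_norm lborel (rint h) <= sq_norm lborel h" by auto
 have "cint h \<in> bmeas lborel" unfolding cint_def[abs_def] by measurable
 from fin[OF this 2] show "sq_int lborel (cint h)" "sq_norm lborel (cint h) <= sq_norm lborel h" by auto
qed

lemma sq_int_square_integrable:
 assumes h: "sq_int lborel h" and supp: "!!x. x ~: square T ==> h x = 0"
 shows "integrable lborel h"
proof -
 have "integrable lborel (%x. ind (square T) x *R h x)"
  by (rule sq_int_finite_integrable[OF h]) (use open_square emeasure_bounded_finite[of "square T"] in auto)
 moreover have "(%x. ind (square T) x *R h x) = h" using supp by (auto simp: indicator_def fun_eq_iff)
 ultimately show ?thesis by simp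
qed

lemma rint_cint_tendsto:
 assumes H: "!!n. sq_int lborel (H n)" "!!n x. x ~: square T ==> H n x = 0"
  and h: "sq_int lborel h" "!!x. x ~: square T ==> h x = 0" and T: "0 < T" "T <= 1"
  and lim: "(%n. sq_norm lborel (%x. H n x - h x)) ---> 0"
 shows "(%n. sq_norm lborel (%s. rint (H n) s - rint h s)) ---> 0"
  "(%n. sq_norm lborel (%s. cint (H n) s - cint h s)) ---> 0"
proof -
 let ?d = "%n x. H n x - h x"
 have d: "sq_int lborel (?d n)" "!!x. x ~: square T ==> ?d n x = 0" for n using sq_int_diff(1)[OF H(1) h(1)] H h by auto
 have iH: "integrable lborel (H n)" for n by (rule sq_int_square_integrable[OF H(1) H(2)])
 have ih: "integrable lborel h" by (rule sq_int_square_integrable[OF h])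
 note bd = rint_cint_bound[OF d(1) d(2) T] and bH = rint_cint_bound[OF H(1) H(2) T] and bh = rint_cint_bound[OF h T]
 have ae: "AE s in lborel. rint (?d n) s = rint (H n) s - rint h s" "AE s in lborel. cint (?d n) s = cint (H n) s - cint h s" for n
 proof -
  show "AE s in lborel. rint (?d n) s = rint (H n) s - rint h s"
   using fubini_plane(3)[OF iH[of n]] fubini_plane(3)[OF ih] by eventually_elim (simp add: rint_def)
  show "AE s in lborel. cint (?d n) s = cint (H n) s - cint h s"
   using fubini_plane(4)[OF iH[of n]] fubini_plane(4)[OF ih] by eventually_elim (simp add: cint_def)
 qed
 have "sq_norm lborel (%s. rint (H n) s - rint h s) <= sq_norm lborel (?d n)" for n
  using sq_int_cong_AE(2)[OF ae(1)[of n] sq_int_measurable[OF bd(1)] sq_int_measurable[OF sq_int_diff(1)[OF bH(1)[of n] bh(1)]]] bd(2)[of n] by simp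
 then show "(%n. sq_norm lborel (%s. rint (H n) s - rint h s)) ---> 0"
  by (intro tendsto_sandwich[OF _ _ tendsto_const lim]) simp_all
 have "sq_norm lborel (%s. cint (H n) s - cint h s) <= sq_norm lborel (?d n)" for n
  using sq_int_cong_AE(2)[OF ae(2)[of n] sq_int_measurable[OF bd(3)] sq_int_measurable[OF sq_int_diff(1)[OF bH(3)[of n] bh(3)]]] bd(4)[of n] by simp
 then show "(%n. sq_norm lborel (%s. cint (H n) s - cint h s)) ---> 0"
  by (intro tendsto_sandwich[OF _ _ tendsto_const lim]) simp_all
qed

text \<open>The weight vanishes on the side of the square where a row (or column) of the triangle ends.\<close>

definition wgt :: "bool => real => real => real" where
 "wgt b T t = (if b then t - T else t)"

lemma weighted_FTC:
 fixes f f' :: "real => complex"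
 assumes "a <= c" and d: "!!t. (f has_vector_derivative f' t) (at t)" and f': "continuous_on UNIV f'"
 shows "(LINT t|lborel. ind {a<..<c} t *R (f t + wgt b T t *R f' t)) = wgt b T c *R f c - wgt b T a *R f a"
proof (rule LINT_FTC[of "{}"])
 have w: "(wgt b T has_real_derivative 1) (at t)" for t
  unfolding wgt_def[abs_def] by (cases b) (auto intro!: derivative_eq_intros)
 show D: "((%t. wgt b T t *R f t) has_vector_derivative f t + wgt b T t *R f' t) (at t)" for t
  using has_vector_derivative_scaleR[OF w d, of t] by (simp add: add.commute)
 show "continuous_on {a..c} (%t. wgt b T t *R f t)"
  using D has_vector_derivative_continuous continuous_at_imp_continuous_on by blast
 have fc: "continuous_on UNIV f" using d has_vector_derivative_continuous continuous_at_imp_continuous_on by blast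
 have "continuous_on {a..c} (%t. f t + wgt b T t *R f' t)"
  unfolding wgt_def by (cases b; simp; intro continuous_intros continuous_on_subset[OF f'] continuous_on_subset[OF fc]) auto
 then have "set_integrable lborel {a..c} (%t. f t + wgt b T t *R f' t)" by (rule borel_integrable_atLeastAtMost')
 then have "set_integrable lborel {a<..<c} (%t. f t + wgt b T t *R f' t)" by (rule set_integrable_subset) auto
 then show "integrable lborel (%t. ind {a<..<c} t *R (f t + wgt b T t *R f' t))" by (simp add: set_integrable_def)
qed (use assms in auto)

definition trow :: "bool => real => (plane => complex) => (plane => complex) => plane => complex" where
 "trow b T f g x = ind (tri b T) x *R (f x + wgt b T (snd x) *R g x)"

definition tcol :: "bool => real => (plane => complex) => (plane => complex) => plane => complex" where
 "tcol b T f g x = ind (tri b T) x *R (f x + wgt (~ b) T (fst x) *R g x)"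

text \<open>Integrating the derivative of weight times \<open>phi\<close> along the row leaves only
  the diagonal end, with coefficient T - x or x; the column contributes the complementary
  coefficient, so the sum is T for every x. This expresses diagonal values by integrals over the
  triangle.\<close>

lemma diag_formula:
 assumes phi: "smooth phi" and x: "x \<in> {0<..<T}"
 shows "cpx T * phi (x, x) = rint (trow b T phi (pderiv_dir (0, 1) phi)) x + cint (tcol b T phi (pderiv_dir (1, 0) phi)) x"
proof -
 have c: "continuous_on UNIV (%t. pderiv_dir (0, 1) phi (x, t))" "continuous_on UNIV (%s. pderiv_dir (1, 0) phi (s, x))"
  by (intro continuous_on_compose2[OF smooth_continuous[OF smooth_pderiv_dir[OF phi Basis_plane(2)]]] continuous_on_compose2[OF smooth_continuous[OF smooth_pderiv_dir[OF phi Basis_plane(1)]]] continuous_intros; simp)+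
 have r: "rint (trow b T phi (pderiv_dir (0, 1) phi)) x = (if b then cpx (T - x) * phi (x, x) else cpx x * phi (x, x))"
  using weighted_FTC[OF _ smooth_line_derivs(2)[OF phi] c(1), of "if b then x else 0" "if b then T else x" b T] x
  unfolding rint_def trow_def tri_row[OF x] by (cases b) (simp_all add: wgt_def scaleR_conv_of_real algebra_simps)
 have k: "cint (tcol b T phi (pderiv_dir (1, 0) phi)) x = (if b then cpx x * phi (x, x) else cpx (T - x) * phi (x, x))"
  using weighted_FTC[OF _ smooth_line_derivs(1)[OF phi] c(2), of "if b then 0 else x" "if b then x else T" "~ b" T] x
  unfolding cint_def tcol_def tri_col[OF x] by (cases b) (simp_all add: wgt_def scaleR_conv_of_real algebra_simps)
 show ?thesis unfolding r k by (simp add: algebra_simps)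
qed

lemma weighted_tendsto:
 fixes w :: "'a::euclidean_space => real"
 assumes F: "!!n. L2_on Om (F n)" "L2_on Om f" "(%n. L2_norm Om (%x. F n x - f x)) ---> 0"
  and G: "!!n. L2_on Om (G n)" "L2_on Om g" "(%n. L2_norm Om (%x. G n x - g x)) ---> 0"
  and [measurable]: "w \<in> bmeas borel" "Om \<in> sets borel" and w: "!!x. x \<in> Om ==> \<bar>w x\<bar> <= 1"
 shows "sq_int lborel (%x. ind Om x *R (F n x + w x *R G n x))" "sq_int lborel (%x. ind Om x *R (f x + w x *R g x))"
  "(%n. sq_norm lborel (%x. ind Om x *R (F n x + w x *R G n x) - ind Om x *R (f x + w x *R g x))) ---> 0"
proof -
 let ?b = "%x. cpx (ind Om x * w x)"
 have b: "?b \<in> bmeas lborel" "AE x in lborel. cmod (?b x) <= 1" using w by (auto simp: indicator_def)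
 have eq: "ind Om x *R (p x + w x *R q x) = ind Om x *R p x + ?b x * (ind Om x *R q x)" for p q :: "'a => complex" and x
  by (cases "x \<in> Om") (simp_all add: scaleR_conv_of_real)
 have s: "sq_int lborel (%x. ind Om x *R (p x + w x *R q x))" "sq_norm lborel (%x. ind Om x *R (p x + w x *R q x)) <= L2_norm Om p + L2_norm Om q"
  if "L2_on Om p" "L2_on Om q" for p q
 proof -
  have p: "sq_int lborel (%x. ind Om x *R p x)" and q: "sq_int lborel (%x. ind Om x *R q x)" using that by (simp_all add: L2_on_sq_int)
  note bq = sq_int_bounded_mult[OF q b, of]
  show "sq_int lborel (%x. ind Om x *R (p x + w x *R q x))" "sq_norm lborel (%x. ind Om x *R (p x + w x *R q x)) <= L2_norm Om p + L2_norm Om q"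
   unfolding eq L2_norm_sq_norm using sq_int_add[OF p bq(1)] bq(2) by auto
 qed
 show "sq_int lborel (%x. ind Om x *R (F n x + w x *R G n x))" "sq_int lborel (%x. ind Om x *R (f x + w x *R g x))"
  using s(1) F G by blast+
 have "ind Om x *R (F n x + w x *R G n x) - ind Om x *R (f x + w x *R g x) = ind Om x *R ((F n x - f x) + w x *R (G n x - g x))" for n x
  by (simp add: algebra_simps)
 then have le: "sq_norm lborel (%x. ind Om x *R (F n x + w x *R G n x) - ind Om x *R (f x + w x *R g x)) <= L2_norm Om (%x. F n x - f x) + L2_norm Om (%x. G n x - g x)" for n
  using s(2)[OF L2_on_diff[OF F(1)[of n] F(2)] L2_on_diff[OF G(1)[of n] G(2)]] by simp
 have z: "(%n. L2_norm Om (%x. F n x - f x) + L2_norm Om (%x. G n x - g x)) ---> 0"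
  using tendsto_add[OF F(3) G(3)] by simp
 show "(%n. sq_norm lborel (%x. ind Om x *R (F n x + w x *R G n x) - ind Om x *R (f x + w x *R g x))) ---> 0"
  by (rule tendsto_sandwich[OF _ _ tendsto_const z]) (use le in simp_all)
qed

text \<open>By \<open>diag_formula\<close> the diagonal values depend continuously, in L2, on the
  function and its two derivatives on the triangle. The trace is the same expression evaluated at
  the limits.\<close>

lemma trace_exists:
 assumes T: "0 < T" "T <= 1" and phi: "!!n. smooth (phi n)"
  and f: "L2_on (tri b T) f" "L2_on (tri b T) g1" "L2_on (tri b T) g2"
  and lim: "(%n. L2_norm (tri b T) (%x. phi n x - f x)) ---> 0"
   "(%n. L2_norm (tri b T) (%x. pderiv_dir (1, 0) (phi n) x - g1 x)) ---> 0"
   "(%n. L2_norm (tri b T) (%x. pderiv_dir (0, 1) (phi n) x - g2 x)) ---> 0"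
 shows "\<exists>tau. L2_on {0<..<T} tau & (%n. L2_norm {0<..<T} (%s. phi n (s, s) - tau s)) ---> 0"
proof -
 have trim: "tri b T \<in> sets borel" using open_tri by simp
 have L: "L2_on (tri b T) (phi n)" "L2_on (tri b T) (pderiv_dir (1, 0) (phi n))" "L2_on (tri b T) (pderiv_dir (0, 1) (phi n))" for n
  using smooth_continuous[OF phi[of n]] smooth_continuous[OF smooth_pderiv_dir[OF phi[of n] Basis_plane(1)]] smooth_continuous[OF smooth_pderiv_dir[OF phi[of n] Basis_plane(2)]] trim bounded_tri
  by (simp_all add: smooth_L2_on)
 have wm: "(%x :: plane. wgt b T (snd x)) \<in> bmeas borel" "(%x :: plane. wgt (~ b) T (fst x)) \<in> bmeas borel"
 proof -
  have "wgt c T \<in> bmeas borel" for c unfolding wgt_def[abs_def] by (cases c) simp_all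
  from measurable_compose[OF snd_borel this[of b]] measurable_compose[OF fst_borel this[of "~ b"]]
  show "(%x :: plane. wgt b T (snd x)) \<in> bmeas borel" "(%x :: plane. wgt (~ b) T (fst x)) \<in> bmeas borel" .
 qed
 have wb: "\<bar>wgt b T (snd x)\<bar> <= 1" "\<bar>wgt (~ b) T (fst x)\<bar> <= 1" if "x \<in> tri b T" for x
  using that T by (cases b; force simp: wgt_def tri_def square_def)+
 note R = weighted_tendsto[OF L(1) f(1) lim(1) L(3) f(3) lim(3) wm(1) trim wb(1), folded trow_def]
 note C = weighted_tendsto[OF L(1) f(1) lim(1) L(2) f(2) lim(2) wm(2) trim wb(2), folded tcol_def]
 have z: "trow b T p q x = 0" "tcol b T p q x = 0" if "x ~: square T" for p q x
 proof -
  have "x ~: tri b T" using that tri_subset by blast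
  then show "trow b T p q x = 0" "tcol b T p q x = 0" by (simp_all add: trow_def tcol_def)
 qed
 note Rb = rint_cint_bound[OF R(1) z(1) T] and Cb = rint_cint_bound[OF C(1) z(2) T]
 note rb = rint_cint_bound[OF R(2) z(1) T] and cb = rint_cint_bound[OF C(2) z(2) T]
 note Rt = rint_cint_tendsto(1)[OF R(1) z(1) R(2) z(1) T R(3)] and Ct = rint_cint_tendsto(2)[OF C(1) z(2) C(2) z(2) T C(3)]
 have out: "rint (trow b T p q) s = 0" "cint (tcol b T p q) s = 0" if "s ~: {0<..<T}" for p q s
 proof -
  have "trow b T p q (s, t) = 0" "tcol b T p q (t, s) = 0" for t using that z by (auto simp: square_def)
  then show "rint (trow b T p q) s = 0" "cint (tcol b T p q) s = 0" by (simp_all add: rint_def cint_def)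
 qed
 define tau where "tau s = cpx (1 / T) * (rint (trow b T f g2) s + cint (tcol b T f g1) s)" for s
 have tau0: "ind {0<..<T} s *R tau s = tau s" for s using out[of s] by (cases "s \<in> {0<..<T}") (auto simp: tau_def)
 have "sq_int lborel tau" unfolding tau_def by (intro sq_int_scale(1) sq_int_add(1) rb(1) cb(3))
 then have 1: "L2_on {0<..<T} tau" unfolding L2_on_sq_int tau0 .
 have eq: "ind {0<..<T} s *R (phi n (s, s) - tau s) = cpx (1 / T) * ((rint (trow b T (phi n) (pderiv_dir (0, 1) (phi n))) s - rint (trow b T f g2) s)
   + (cint (tcol b T (phi n) (pderiv_dir (1, 0) (phi n))) s - cint (tcol b T f g1) s))" for n s
 proof (cases "s \<in> {0<..<T}")
  case True
  have "phi n (s, s) = cpx (1 / T) * (cpx T * phi n (s, s))" using T by simp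
  then show ?thesis using True unfolding diag_formula[OF phi True, of n b] tau_def by (simp add: right_diff_distrib distrib_left)
 qed (simp add: out)
 let ?B = "%n. (1 / T) * (sq_norm lborel (%s. rint (trow b T (phi n) (pderiv_dir (0, 1) (phi n))) s - rint (trow b T f g2) s)
   + sq_norm lborel (%s. cint (tcol b T (phi n) (pderiv_dir (1, 0) (phi n))) s - cint (tcol b T f g1) s))"
 have "L2_norm {0<..<T} (%s. phi n (s, s) - tau s) <= ?B n" for n
 proof -
  have d: "sq_int lborel (%s. rint (trow b T (phi n) (pderiv_dir (0, 1) (phi n))) s - rint (trow b T f g2) s)"
   "sq_int lborel (%s. cint (tcol b T (phi n) (pderiv_dir (1, 0) (phi n))) s - cint (tcol b T f g1) s)"
  proof -
   show "sq_int lborel (%s. rint (trow b T (phi n) (pderiv_dir (0, 1) (phi n))) s - rint (trow b T f g2) s)"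
    by (rule sq_int_diff(1)[OF Rb(1)[of n] rb(1)])
   show "sq_int lborel (%s. cint (tcol b T (phi n) (pderiv_dir (1, 0) (phi n))) s - cint (tcol b T f g1) s)"
    by (rule sq_int_diff(1)[OF Cb(3)[of n] cb(3)])
  qed
  have n: "cmod (cpx (1 / T)) = 1 / T" unfolding norm_of_real using T by simp
  note sc = sq_int_scale(2)[OF sq_int_add(1)[OF d], of "cpx (1 / T)", unfolded n]
  have "1 / T * sq_norm lborel (%s. (rint (trow b T (phi n) (pderiv_dir (0, 1) (phi n))) s - rint (trow b T f g2) s)
   + (cint (tcol b T (phi n) (pderiv_dir (1, 0) (phi n))) s - cint (tcol b T f g1) s)) <= ?B n"
   by (rule mult_left_mono[OF sq_int_add(2)[OF d] divide_nonneg_pos[OF zero_le_one T(1)]])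
  then show ?thesis unfolding L2_norm_sq_norm eq sc .
 qed
 moreover have "?B ---> 0"
  using tendsto_mult_left[OF tendsto_add[OF Rt Ct], of "1 / T"] by simp
 ultimately have "(%n. L2_norm {0<..<T} (%s. phi n (s, s) - tau s)) ---> 0"
  by (intro tendsto_sandwich[OF _ _ tendsto_const \<open>?B ---> 0\<close>]) simp_all
 then show ?thesis using 1 by blast
qed

section \<open>Multipliers vanishing on the diagonal\<close>

lemma convex_domain_tri:
 assumes T: "0 < T"
 shows "\<exists>c r. convex_domain (tri b T) c r"
proof -
 let ?c = "if b then (T / 4, 3 * T / 4) else (3 * T / 4, T / 4)"
 have "convex_domain (tri b T) ?c (T / 8)"
 proof
  show "open (tri b T)" "bounded (tri b T)" by (rule open_tri bounded_tri)+
  show "T / 8 > 0" using T by simp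
  show "?c + v \<in> tri b T" if "\<bar>fst v\<bar> <= T / 8" "\<bar>snd v\<bar> <= T / 8" for v
   using that T by (cases v; cases b) (auto simp: tri_def square_def abs_le_iff)
  have "tri b T = {0<..<T} \<times> {0<..<T} \<inter> {x. inner (if b then (1, -1) else (-1, 1)) x < 0}"
   by (cases b) (auto simp: tri_def square_def)
  then show "convex (tri b T)"
   by (auto intro!: convex_Int convex_Times convex_halfspace_lt)
 qed
 then show ?thesis by blast
qed

lemma convex_domain_square:
 assumes T: "0 < T"
 shows "\<exists>c r. convex_domain (square T) c r"
proof -
 have "convex_domain (square T) (T / 2, T / 2) (T / 4)"
 proof
  show "open (square T)" "bounded (square T)" by (rule open_square)+
  show "T / 4 > 0" using T by simp
  show "(T / 2, T / 2) + v \<in> square T" if "\<bar>fst v\<bar> <= T / 4" "\<bar>snd v\<bar> <= T / 4" for v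
   using that T by (cases v) (auto simp: square_def abs_le_iff)
  show "convex (square T)" unfolding square_def by (intro convex_Times) auto
 qed
 then show ?thesis by blast
qed

lemma diag_has_vector_derivative:
 fixes F :: "plane => complex"
 assumes "smooth F"
 shows "((%t. F (t, t)) has_vector_derivative pderiv_dir (1, 0) F (t, t) + pderiv_dir (0, 1) F (t, t)) (at t)"
proof -
 have "((%t. F (t, t)) has_derivative (%v. \<Sum>b\<in>Basis. ((v, v) \<bullet> b) *R pderiv_dir b F (t, t))) (at t)"
  by (rule has_derivative_compose[where f="%t. (t, t)" and g=F, OF _ smooth_has_derivative[OF assms]]) (auto intro!: derivative_eq_intros)
 then show ?thesis by (simp add: has_vector_derivative_def Basis_plane_eq scaleR_add_right)
qed

lemma smooth_line_continuous:
 fixes F :: "plane => complex"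
 assumes "smooth F"
 shows "continuous_on A (%a. F (a, t))" "continuous_on A (%t. F (a, t))"
 by (rule continuous_on_compose2[OF smooth_continuous[OF assms]]; simp add: continuous_on_Pair)+

lemma LINT_open_interval:
 fixes f :: "real => complex"
 assumes "continuous_on {a..c} f"
 shows "(LINT x|lborel. ind {a<..<c} x *R f x) = integral {a..c} f"
proof -
 have "set_integrable lborel {a<..<c} f"
  by (rule set_integrable_subset[OF borel_integrable_atLeastAtMost'[OF assms]]) auto
 from set_borel_integral_eq_integral(2)[OF this] show ?thesis
  by (simp add: set_lebesgue_integral_def integral_open_interval_real)
qed

text \<open>Comparing \<open>\<partial>\<^sub>2\<close> of \<open>F (c, t) - F (a, t)\<close> with differentiation under the integral of
 \<open>\<partial>\<^sub>1F\<close> avoids the symmetry of second derivatives.\<close>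

lemma mixed_derivative_integral:
 fixes F :: "plane => complex"
 assumes F: "smooth F" and ac: "a <= c"
 shows "(LINT x|lborel. ind {a<..<c} x *R pderiv_dir (0, 1) (pderiv_dir (1, 0) F) (x, t)) = pderiv_dir (0, 1) F (c, t) - pderiv_dir (0, 1) F (a, t)"
  "(LINT x|lborel. ind {a<..<c} x *R pderiv_dir (1, 0) F (x, t)) = F (c, t) - F (a, t)"
proof -
 let ?D = "pderiv_dir (1, 0) F" and ?E = "pderiv_dir (0, 1) (pderiv_dir (1, 0) F)"
 have s: "smooth ?D" "smooth ?E" using F Basis_plane by (auto intro: smooth_pderiv_dir)
 have ftc: "integral {a..c} (%x. ?D (x, t)) = F (c, t) - F (a, t)" for t
  by (rule integral_unique, rule fundamental_theorem_of_calculus[OF ac])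
   (rule has_vector_derivative_at_within[OF smooth_line_derivs(1)[OF F]])
 show "(LINT x|lborel. ind {a<..<c} x *R ?D (x, t)) = F (c, t) - F (a, t)"
  unfolding LINT_open_interval[OF smooth_line_continuous(1)[OF s(1)]] by (rule ftc)
 have "((%t. integral (cbox a c) (%x. ?D (x, t))) has_vector_derivative integral (cbox a c) (%x. ?E (x, t))) (at t within UNIV)"
 proof (rule leibniz_rule_vector_derivative)
  show "((%t. ?D (x, t)) has_vector_derivative ?E (x, t)) (at t within UNIV)" for x t by (rule smooth_line_derivs(2)[OF s(1)])
  show "(%x. ?D (x, t)) integrable_on cbox a c" for t
   by (rule integrable_continuous) (rule smooth_line_continuous(1)[OF s(1)])
  have "continuous_on UNIV (%z :: plane. ?E (snd z, fst z))"
   by (rule continuous_on_compose2[OF smooth_continuous[OF s(2)]]) (auto intro!: continuous_intros)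
  then show "continuous_on (UNIV \<times> cbox a c) (%(t, x). ?E (x, t))"
   unfolding case_prod_beta by (rule continuous_on_subset) simp
 qed auto
 then have 1: "((%t. F (c, t) - F (a, t)) has_vector_derivative integral {a..c} (%x. ?E (x, t))) (at t)"
  by (simp add: ftc)
 have 2: "((%t. F (c, t) - F (a, t)) has_vector_derivative pderiv_dir (0, 1) F (c, t) - pderiv_dir (0, 1) F (a, t)) (at t)"
  by (intro has_vector_derivative_diff smooth_line_derivs(2) F)
 show "(LINT x|lborel. ind {a<..<c} x *R ?E (x, t)) = pderiv_dir (0, 1) F (c, t) - pderiv_dir (0, 1) F (a, t)"
  unfolding LINT_open_interval[OF smooth_line_continuous(1)[OF s(2)]] by (rule vector_derivative_unique_at[OF 1 2])
qed

text \<open>When \<open>phi\<close> is the first partial derivative of \<open>F\<close>, the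
  integral over \<open>a\<close> telescopes to the difference between the value on the diagonal and
  \<open>F\<close>. The diagonal term is there because a smoothed function need not vanish on the
  diagonal.\<close>

lemma jump_smooth:
 fixes F :: "plane => complex"
 assumes F: "smooth F" and x: "x \<in> square T"
 shows "jumpX b (pderiv_dir (1, 0) F) x = ind (tri b T) x *R (cpx (sg b) * (F (snd x, snd x) - F x))"
  "jumpY b (pderiv_dir (1, 0) F) (pderiv_dir (0, 1) (pderiv_dir (1, 0) F)) x
   = ind (tri b T) x *R (cpx (sg b) * ((pderiv_dir (1, 0) F (snd x, snd x) + pderiv_dir (0, 1) F (snd x, snd x)) - pderiv_dir (0, 1) F x))"
proof -
 obtain s t where st: "x = (s, t)" by (cases x)
 have 1: "colint (pderiv_dir (1, 0) F) (s, t) = cpx (sg b) * (F (t, t) - F (s, t))"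
  "colint (pderiv_dir (0, 1) (pderiv_dir (1, 0) F)) (s, t) = cpx (sg b) * (pderiv_dir (0, 1) F (t, t) - pderiv_dir (0, 1) F (s, t))"
  if "s ~= t" "(s < t) = b"
  using that mixed_derivative_integral[OF F, of s t t] mixed_derivative_integral[OF F, of t s t]
  by (cases b; simp add: colint_def between_def sg_def min_def max_def)+
 show "jumpX b (pderiv_dir (1, 0) F) x = ind (tri b T) x *R (cpx (sg b) * (F (snd x, snd x) - F x))"
  "jumpY b (pderiv_dir (1, 0) F) (pderiv_dir (0, 1) (pderiv_dir (1, 0) F)) x
   = ind (tri b T) x *R (cpx (sg b) * ((pderiv_dir (1, 0) F (snd x, snd x) + pderiv_dir (0, 1) F (snd x, snd x)) - pderiv_dir (0, 1) F x))"
  using 1 x unfolding st jumpX_def jumpY_def by (auto simp: tri_def indicator_def algebra_simps)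
qed

text \<open>A point of the diagonal is a limit of points of the triangle on the same row, so a bound
  on the open triangle persists by continuity.\<close>

lemma diag_bound:
 fixes F :: "plane => complex"
 assumes F: "continuous_on UNIV F" and b: "!!x. x \<in> tri b T ==> cmod (F x) <= M" and t: "t \<in> {0<..<T}"
 shows "cmod (F (t, t)) <= M"
proof -
 let ?c = "%n. t - sg b * (min t (T - t) / (real n + 2))"
 have "(%n. min t (T - t) / (real n + 2)) ---> 0" by real_asymp
 then have "?c ---> t - sg b * 0" by (intro tendsto_intros)
 then have "(%n. (?c n, t)) ---> (t, t)" by (intro tendsto_Pair) simp_all
 moreover have "isCont F (t, t)" using F continuous_on_eq_continuous_at[OF open_UNIV] by blast
 ultimately have lim: "(%n. F (?c n, t)) ---> F (t, t)" by (rule isCont_tendsto_compose[rotated])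
 have "cmod (F (?c n, t)) <= M" for n
 proof (rule b)
  have m: "0 < min t (T - t)" using t by auto
  have "min t (T - t) / (real n + 2) < min t (T - t)" using divide_strict_left_mono[of 1 "real n + 2" "min t (T - t)"] m by simp
  moreover have "0 < min t (T - t) / (real n + 2)" using m by simp
  ultimately show "(?c n, t) \<in> tri b T" using t by (cases b) (auto simp: tri_def square_def sg_def)
 qed
 then show ?thesis by (intro LIMSEQ_le_const2[OF tendsto_norm[OF lim]]) auto
qed

lemma AE_snd:
 assumes "AE t in lborel. P (t :: real)"
 shows "AE x in lborel. P (snd (x :: plane))"
proof -
 obtain N where N: "{t. ~ P t} \<subseteq> N" "emeasure lborel N = 0" "N \<in> sets lborel"
  using AE_E[OF assms] by auto
 have "AE x in lborel \<Otimes>\<^sub>M lborel. snd (x :: plane) ~: N"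
 proof (rule lborel_pair.AE_pair_measure)
  show "{x \<in> space (lborel \<Otimes>\<^sub>M lborel). snd (x :: plane) ~: N} \<in> sets (lborel \<Otimes>\<^sub>M lborel)"
   using N(3) by measurable
  have "AE y in lborel. y ~: N" by (rule AE_not_in) (use N in "simp add: null_sets_def")
  then show "AE x in lborel. AE y in lborel. snd (x :: real, y) ~: N" by simp
 qed
 then have "AE x in lborel. snd (x :: plane) ~: N" unfolding lborel_prod .
 then show ?thesis by eventually_elim (use N in auto)
qed

text \<open>On every line the integrand is the derivative in \<open>t\<close> of a product with
  bounded support. It tests the diagonal functions, viewed as functions of the second variable, as
  distributions in the plane.\<close>

lemma test_function_ibp_snd:
 fixes dl dl' :: "real => complex" and psi :: "plane => real"
 assumes t: "test_function Om psi" and Om: "bounded Om" "Om \<in> sets borel"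
  and d: "!!t. (dl has_vector_derivative dl' t) (at t)" and d': "continuous_on UNIV dl'"
 shows "(LINT x|lborel. ind Om x *R (psi x *R dl' (snd x) + pderiv_dir (0, 1) psi x *R dl (snd x))) = 0"
proof -
 have s: "smooth psi" using t by (simp add: test_function_def)
 have c: "continuous_on UNIV psi" "continuous_on UNIV (pderiv_dir (0, 1) psi)"
  by (rule smooth_continuous[OF s], rule smooth_continuous[OF smooth_pderiv_dir[OF s Basis_plane(2)]])
 have dlc: "continuous_on UNIV dl" using d has_vector_derivative_continuous continuous_at_imp_continuous_on by blast
 let ?G = "%x. psi x *R dl' (snd x) + pderiv_dir (0, 1) psi x *R dl (snd x)"
 have Gc: "continuous_on UNIV ?G"
  by (intro continuous_on_add continuous_on_scaleR c continuous_on_compose2[OF d'] continuous_on_compose2[OF dlc] continuous_on_snd continuous_on_id) auto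
 have i: "integrable lborel (%x. ind Om x *R ?G x)"
  using L2_on_set_integrable[OF smooth_L2_on[OF Gc Om] Om(2)] emeasure_bounded_finite[OF Om(1)] by (simp add: set_integrable_def)
 have Gz: "ind Om x *R ?G x = ?G x" for x
  using test_function_zero(1)[OF t, of x] test_function_zero(2)[OF t, of x "(0, 1)"] by (cases "x \<in> Om") auto
 obtain R where R: "!!x. norm x > R ==> psi x = 0" "!!x. norm x > R ==> pderiv_dir (0, 1) psi x = 0"
  using test_function_bounded_support[OF t] by metis
 let ?R = "(abs R) + 1"
 have out: "psi (s, t) = 0" "pderiv_dir (0, 1) psi (s, t) = 0" if "(abs t) >= ?R" for s t
 proof -
  have "norm (s, t) > R" using norm_snd_le[where x=s and y=t] that by simp
  then show "psi (s, t) = 0" "pderiv_dir (0, 1) psi (s, t) = 0" using R by blast+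
 qed
 have "(LINT t|lborel. ?G (s, t)) = 0" for s
 proof -
  have "(psi has_derivative (%v. \<Sum>b\<in>Basis. (v \<bullet> b) *R pderiv_dir b psi (s, t))) (at (s, t))" for t
   by (rule smooth_has_derivative[OF s])
  have p: "((%t. psi (s, t)) has_real_derivative pderiv_dir (0, 1) psi (s, t)) (at t)" for t
  proof -
   have "((%t. psi (s, t)) has_derivative (%v. \<Sum>b\<in>Basis. ((0, v) \<bullet> b) *R pderiv_dir b psi (s, t))) (at t)"
    by (rule has_derivative_compose[where f="%t. (s, t)" and g=psi, OF _ smooth_has_derivative[OF s]]) (auto intro!: derivative_eq_intros)
   then show ?thesis by (simp add: has_field_derivative_def Basis_plane_eq mult_commute_abs)
  qed
  have D: "((%t. psi (s, t) *R dl t) has_vector_derivative ?G (s, t)) (at t)" for t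
   using has_vector_derivative_scaleR[OF p d] by simp
  have gc: "continuous_on UNIV (%t. ?G (s, t))"
   by (rule continuous_on_compose2[OF Gc]) (simp_all add: continuous_on_Pair)
  have "(LINT t|lborel. ?G (s, t)) = (LINT t|lborel. ind {- ?R<..<?R} t *R ?G (s, t))"
  proof (rule B_integral_cong[OF refl])
   fix t show "?G (s, t) = ind {- ?R<..<?R} t *R ?G (s, t)"
   proof (cases "(abs t) < ?R")
    case True
    then have "t \<in> {- ?R<..<?R}" unfolding greaterThanLessThan_iff by linarith
    then show ?thesis by (simp only: indicator_simps scaleR_one)
   qed (use out[of t s] in simp)
  qed
  also have "... = psi (s, ?R) *R dl ?R - psi (s, - ?R) *R dl (- ?R)"
  proof (rule LINT_FTC[of "{}"])
   show "continuous_on {- ?R..?R} (%t. psi (s, t) *R dl t)"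
    using D has_vector_derivative_continuous continuous_at_imp_continuous_on by blast
   have "set_integrable lborel {- ?R<..<?R} (%t. ?G (s, t))"
    by (rule set_integrable_subset[OF borel_integrable_atLeastAtMost'[of "- ?R" ?R, OF continuous_on_subset[OF gc]]]) auto
   then show "integrable lborel (%t. ind {- ?R<..<?R} t *R ?G (s, t))" by (simp add: set_integrable_def)
  qed (use D in auto)
  also have "... = 0" using out by simp
  finally show ?thesis .
 qed
 then show ?thesis
  using fubini_plane(1)[OF i] by (simp only: Gz) simp
qed

lemma L2_AE_subseq:
 fixes f :: "nat => 'a::euclidean_space => complex"
 assumes "!!n. L2_on Om (f n)" "L2_on Om f0" "(%n. L2_norm Om (%x. f n x - f0 x)) ---> 0"
 obtains r :: "nat => nat" where "strict_mono r" "AE x\<in>Om in lborel. (%n. f (r n) x) ---> f0 x"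
proof -
 obtain r :: "nat => nat" where r: "strict_mono r" "AE x in lborel. (%n. ind Om x *R f (r n) x) ---> ind Om x *R f0 x"
  by (rule sq_int_tendsto_AE_subseq[of lborel "%n x. ind Om x *R f n x" "%x. ind Om x *R f0 x"])
   (use assms in "simp_all only: L2_on_sq_int L2_norm_sq_norm scaleR_diff_right")
 show ?thesis by (rule that[OF r(1)]) (use r(2) in eventually_elim, auto)
qed

lemma L2_AE_subseq2:
 fixes f :: "nat => 'a::euclidean_space => complex" and g :: "nat => 'b::euclidean_space => complex"
 assumes f: "!!n. L2_on Om (f n)" "L2_on Om f0" "(%n. L2_norm Om (%x. f n x - f0 x)) ---> 0"
  and g: "!!n. L2_on Om' (g n)" "L2_on Om' g0" "(%n. L2_norm Om' (%x. g n x - g0 x)) ---> 0"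
 obtains r :: "nat => nat" where "strict_mono r" "AE x\<in>Om in lborel. (%n. f (r n) x) ---> f0 x"
  "AE x\<in>Om' in lborel. (%n. g (r n) x) ---> g0 x"
proof -
 obtain r where r: "strict_mono r" "AE x\<in>Om in lborel. (%n. f (r n) x) ---> f0 x"
  using L2_AE_subseq[OF f] by blast
 have "(%n. L2_norm Om' (%x. g (r n) x - g0 x)) ---> 0"
  using LIMSEQ_subseq_LIMSEQ[OF g(3) r(1)] by (simp add: comp_def)
 then obtain r' where r': "strict_mono r'" "AE x\<in>Om' in lborel. (%n. g (r (r' n)) x) ---> g0 x"
  using L2_AE_subseq[of Om' "%n. g (r n)" g0] g by blast
 show ?thesis
 proof (rule that[of "%n. r (r' n)"])
  show "strict_mono (%n. r (r' n))" using r(1) r'(1) by (simp add: strict_mono_def)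
  show "AE x\<in>Om in lborel. (%n. f (r (r' n)) x) ---> f0 x"
   using r(2)
  proof eventually_elim
   case (elim x)
   show ?case
   proof
    assume "x \<in> Om"
    then show "(%n. f (r (r' n)) x) ---> f0 x"
     using LIMSEQ_subseq_LIMSEQ[of "%n. f (r n) x" "f0 x" r'] elim r'(1) by (simp add: comp_def)
   qed
  qed
 qed (rule r'(2))
qed

lemma L2_on_snd:
 assumes "L2_on {0<..<T} tau"
 shows "L2_on (square T) (%x. tau (snd x))"
proof -
 have "(nsq (cpx (ind {0<..<T} t))) = ind {0<..<T} t" for t by (simp add: indicator_def)
 then have "sq_int lborel (%t. cpx (ind {0<..<T} t))"
  unfolding sq_int_def using integrable_indicator_interval[of 0 T] by auto
 from sq_int_tensor[OF this assms[unfolded L2_on_sq_int]]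
 have "sq_int lborel (%x. cpx (ind {0<..<T} (fst x)) * (ind {0<..<T} (snd x) *R tau (snd x)))" .
 moreover have "(%x. cpx (ind {0<..<T} (fst x)) * (ind {0<..<T} (snd x) *R tau (snd x))) = (%x. ind (square T) x *R tau (snd x))"
  by (auto simp: square_def indicator_def fun_eq_iff)
 ultimately show ?thesis unfolding L2_on_sq_int by simp
qed

text \<open>Near a diagonal point the continuous representative is small, and so is its extension by
  zero from the triangle; the averages therefore tend to 0 although they see only one side of the
  diagonal.\<close>

lemma smo_diag_tendsto:
 fixes chi chi' :: "plane => complex"
 assumes cd: "convex_domain (tri b T) c r" and chi: "L2_on (tri b T) chi"
  and cont: "continuous_on (square T) chi'" "AE x\<in>square T in lborel. chi x = chi' x" "chi' (t, t) = 0" and t: "t \<in> {0<..<T}"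
 shows "(%n. convex_domain.smo (tri b T) c r n chi (t, t)) ---> 0"
proof -
 interpret convex_domain "tri b T" c r by (rule cd)
 show ?thesis unfolding smo_def
 proof (rule smoothing_pointwise[OF r_pos])
  show "integrable lborel (%x. ind (tri b T) x *R chi x)"
   using L2_integrable[OF chi] by (simp add: set_integrable_def)
  fix e :: real assume e: "e > 0"
  have tt: "(t, t) \<in> square T" using t by (simp add: square_def)
  then have "isCont chi' (t, t)" using cont(1) open_square(1) continuous_on_eq_continuous_at by blast
  then obtain d where d: "d > 0" "!!y. dist y (t, t) < d ==> dist (chi' y) (chi' (t, t)) < e"
   using e unfolding continuous_at_eps_delta by blast
  have "AE y in lborel. dist y (t, t) < d --> cmod (ind (tri b T) y *R chi y - 0) <= e"
   using cont(2)
  proof eventually_elim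
   case (elim y)
   show ?case
   proof (intro impI, cases "y \<in> tri b T")
    case True
    assume "dist y (t, t) < d"
    then have "cmod (chi' y) < e" using d(2)[of y] cont(3) by (simp add: dist_norm)
    then show "cmod (ind (tri b T) y *R chi y - 0) <= e" using True elim tri_subset by auto
   qed (use e in simp)
  qed
  then show "\<exists>d>0. AE y in lborel. dist y (t, t) < d --> cmod (ind (tri b T) y *R chi y - 0) <= e" using d(1) by blast
 qed
qed

text \<open>Apply \<open>multiplier_bound\<close> to the first derivative of the smoothings
  \<open>F n\<close> of \<open>chi\<close>, for which the constant is uniform in \<open>n\<close>.
  By \<open>jump_smooth\<close> the multiplier is, up to sign, \<open>F n\<close> minus its diagonal
  value \<open>dl n\<close>. In the limit \<open>chi\<close> remains provided \<open>dl n\<close>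
  and, less obviously, its derivative \<open>dl' n\<close> tend to 0.\<close>

lemma jump_multiplier_bound:
 fixes chi chi' :: "plane => complex"
 assumes nu: "nu < 1/2" and C: "C >= 0" and T: "0 < T" "T <= 1"
  and avg: "!!g. adm T g ==> (nnl (%a. ind {0<..<T} a * HN nu (cut a (prim g)))) <= enn (C * T) * HN nu (prim g)"
  and k1: "sq_int lborel k1" and k1_supp: "!!x. x ~: square T ==> k1 x = 0"
  and H: "form_bound T nu CK DK k1" and CD: "CK >= 0" "DK >= 0"
  and p: "adm T p" and v: "adm T v"
  and chi: "W_k_inf 2 (tri b T) chi"
  and cont: "continuous_on (square T) chi'" "AE x\<in>square T in lborel. chi x = chi' x" "!!s. s \<in> {0<..<T} ==> chi' (s, s) = 0"
 shows "cmod (LINT x|lborel. k1 x * (prim p (fst x) * (ind (tri b T) x *R weak_deriv (tri b T) (0, 1) chi x * cnj (prim v (snd x)) + ind (tri b T) x *R chi x * cnj (v (snd x)))))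
  <= (6 + 4 * C) * (2 * \<bar>W_k_inf_norm 2 (tri b T) chi\<bar>) * T * (CK * sq_norm lborel (prim p) * sq_norm lborel (prim v) + DK * hn nu (prim p) * hn nu (prim v))"
proof -
 obtain c r where cd: "convex_domain (tri b T) c r" using convex_domain_tri[OF T(1)] by blast
 interpret convex_domain "tri b T" c r by (rule cd)
 define M where "M = \<bar>W_k_inf_norm 2 (tri b T) chi\<bar>"
 have M: "M >= 0" by (simp add: M_def)
 let ?d = "weak_deriv (tri b T)"
 have chi2: "W_k_inf (Suc 1) (tri b T) chi" using chi by (simp add: numeral_2_eq_2)
 note w1 = W_k_inf_weak_deriv[OF open_dom _ chi2]
 have w1c: "W_k_inf (Suc 0) (tri b T) (?d e chi)" if "e \<in> Basis" for e using w1(3)[OF that] by simp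
 note w2 = W_k_inf_weak_deriv[OF open_dom _ w1c]
 note B = Basis_plane
 have L: "L2_on (tri b T) chi" "L2_on (tri b T) (?d e chi)" "L2_on (tri b T) (?d e' (?d e chi))" if "e \<in> Basis" "e' \<in> Basis" for e e'
  using w1(1)[OF that(1)] w2(1)[OF that(2,1)] w2(3)[OF that(2,1)] Linf_on_L2_on[OF _ dom_sets dom_fin] by auto
 have bd: "AE x\<in>tri b T in lborel. cmod (chi x) <= M" "AE x\<in>tri b T in lborel. cmod (?d e chi x) <= M"
  "AE x\<in>tri b T in lborel. cmod (?d e' (?d e chi) x) <= M" if e: "e \<in> Basis" "e' \<in> Basis" for e e'
 proof -
  note W = W_2_inf_bounds[OF open_dom chi e]
  show "AE x\<in>tri b T in lborel. cmod (chi x) <= M" using W(1) unfolding M_def by eventually_elim auto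
  show "AE x\<in>tri b T in lborel. cmod (?d e chi x) <= M" using W(2) unfolding M_def by eventually_elim auto
  show "AE x\<in>tri b T in lborel. cmod (?d e' (?d e chi) x) <= M" using W(3) unfolding M_def by eventually_elim auto
 qed
 define F where "F n = smo n chi" for n
 have Fs: "smooth (F n)" for n unfolding F_def by (rule smooth_smo[OF L2_integrable[OF L(1)[OF B]]])
 have Fd: "smooth (pderiv_dir e (F n))" if "e \<in> Basis" for e n by (rule smooth_pderiv_dir[OF Fs that])
 have Fc: "continuous_on UNIV (F n)" "continuous_on UNIV (pderiv_dir (1, 0) (F n))" "continuous_on UNIV (pderiv_dir (0, 1) (F n))" for n
  using smooth_continuous[OF Fs] smooth_continuous[OF Fd[OF B(1)]] smooth_continuous[OF Fd[OF B(2)]] by auto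
 have Fb: "cmod (F n x) <= M" for n x unfolding F_def by (rule smo_bound[OF L2_integrable[OF L(1)[OF B]] bd(1)[OF B] M])
 have Fdb: "cmod (pderiv_dir e (F n) x) <= M" if "x \<in> tri b T" "e \<in> Basis" for e n x
  unfolding F_def by (rule smo_deriv(2)[OF w1(2)[OF that(2)] L(1)[OF B] L(2)[OF that(2) B(1)] that(2) that(1) bd(2)[OF that(2) B(1)] M])
 define dl where "dl n t = F n (t, t)" for n t
 define dl' where "dl' n t = pderiv_dir (1, 0) (F n) (t, t) + pderiv_dir (0, 1) (F n) (t, t)" for n t
 have dld: "(dl n has_vector_derivative dl' n t) (at t)" for n t
  unfolding dl_def dl'_def by (rule diag_has_vector_derivative[OF Fs])
 have dg: "continuous_on UNIV (%t. F n (t, t))" "continuous_on UNIV (%t. pderiv_dir (1, 0) (F n) (t, t))" "continuous_on UNIV (%t. pderiv_dir (0, 1) (F n) (t, t))" for n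
  using smooth_diag[OF Fs] smooth_diag[OF Fd[OF B(1)]] smooth_diag[OF Fd[OF B(2)]] by auto
 have dlc: "continuous_on UNIV (dl n)" "continuous_on UNIV (dl' n)" for n
  unfolding dl_def dl'_def by (intro continuous_on_add dg)+
 have dlb: "cmod (dl n t) <= M" for n t unfolding dl_def by (rule Fb)
 have dl'b: "cmod (dl' n t) <= 2 * M" if "t \<in> {0<..<T}" for n t
 proof -
  have "cmod (pderiv_dir (1, 0) (F n) (t, t)) <= M" by (rule diag_bound[OF Fc(2)[of n] Fdb[OF _ B(1)] that])
  moreover have "cmod (pderiv_dir (0, 1) (F n) (t, t)) <= M" by (rule diag_bound[OF Fc(3)[of n] Fdb[OF _ B(2)] that])
  ultimately show ?thesis
   unfolding dl'_def using norm_triangle_ineq[of "pderiv_dir (1, 0) (F n) (t, t)" "pderiv_dir (0, 1) (F n) (t, t)"] by linarith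
 qed
 have dl0: "(%n. dl n t) ---> 0" if "t \<in> {0<..<T}" for t
  unfolding dl_def F_def by (rule smo_diag_tendsto[OF cd L(1)[OF B] cont(1,2) cont(3)[OF that] that])
 \<comment> \<open>The second derivatives of the smoothings also converge in L2, so the first
   derivatives have limits on the diagonal, and \<open>dl' n\<close> converges almost everywhere
   along a subsequence.\<close>
 have tr: "\<exists>tau. L2_on {0<..<T} tau & (%n. L2_norm {0<..<T} (%s. pderiv_dir e (F n) (s, s) - tau s)) ---> 0" if e: "e \<in> Basis" for e
  unfolding F_def
  by (rule trace_exists[OF T Fd[OF e, unfolded F_def] L(2)[OF e e] L(3)[OF e B(1)] L(3)[OF e B(2)]
   smo_deriv(1)[OF w1(2)[OF e] L(1)[OF e e] L(2)[OF e e] e]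
   smo_deriv2(1)[OF w1(2)[OF e] w2(2)[OF B(1) e] L(1)[OF e e] L(2)[OF e e] L(3)[OF e B(1)] e B(1)]
   smo_deriv2(1)[OF w1(2)[OF e] w2(2)[OF B(2) e] L(1)[OF e e] L(2)[OF e e] L(3)[OF e B(2)] e B(2)]])
 obtain tau1 where tau1: "L2_on {0<..<T} tau1" "(%n. L2_norm {0<..<T} (%s. pderiv_dir (1, 0) (F n) (s, s) - tau1 s)) ---> 0"
  using tr[OF B(1)] by blast
 obtain tau2 where tau2: "L2_on {0<..<T} tau2" "(%n. L2_norm {0<..<T} (%s. pderiv_dir (0, 1) (F n) (s, s) - tau2 s)) ---> 0"
  using tr[OF B(2)] by blast
 have dL: "L2_on {0<..<T} (%s. pderiv_dir (1, 0) (F n) (s, s))" "L2_on {0<..<T} (%s. pderiv_dir (0, 1) (F n) (s, s))" for n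
  using smooth_L2_on[OF dg(2)] smooth_L2_on[OF dg(3)] by auto
 obtain r1 where r1: "strict_mono r1" "AE s\<in>{0<..<T} in lborel. (%n. pderiv_dir (1, 0) (F (r1 n)) (s, s)) ---> tau1 s"
  "AE s\<in>{0<..<T} in lborel. (%n. pderiv_dir (0, 1) (F (r1 n)) (s, s)) ---> tau2 s"
  using L2_AE_subseq2[OF dL(1) tau1 dL(2) tau2] by blast
 define tau where "tau s = tau1 s + tau2 s" for s
 have taulim: "AE s in lborel. s \<in> {0<..<T} --> (%n. dl' (r1 n) s) ---> tau s"
  using r1(2,3) unfolding dl'_def tau_def by eventually_elim (auto intro: tendsto_add)
 have dlr: "(%n. dl (r1 n) t) ---> 0" if "t \<in> {0<..<T}" for t
  using LIMSEQ_subseq_LIMSEQ[OF dl0[OF that] r1(1)] by (simp add: comp_def)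
 have tauL: "L2_on (tri b T) (%x. tau (snd x))"
 proof -
  have "L2_on {0<..<T} tau" using tau1(1) tau2(1) unfolding L2_on_sq_int tau_def scaleR_add_right by (rule sq_int_add(1))
  from L2_norm_mono_set(1)[OF L2_on_snd[OF this] tri_subset dom_sets] show ?thesis .
 qed
 have tri_snd: "snd x \<in> {0<..<T}" if "x \<in> tri b T" for x using that by (auto simp: tri_def square_def)
 have const: "integrable lborel (%x. ind (tri b T) x * K)" for K :: real
  using dom_sets dom_fin by simp
 \<comment> \<open>Since \<open>dl n\<close> tends to 0, the limit \<open>tau\<close> of its
   derivatives is a weak derivative of 0. It is read as a function of \<open>snd x\<close> on the
   triangle so that \<open>has_weak_deriv_unique\<close> forces it to vanish.\<close>
 have wz: "has_weak_deriv (tri b T) (0, 1) (%x. 0) (%x. tau (snd x))"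
  unfolding has_weak_deriv_def
 proof (intro conjI allI impI)
  show "locally_integrable (tri b T) (%x. 0)" by (simp add: locally_integrable_def set_integrable_def)
  show "locally_integrable (tri b T) (%x. tau (snd x))"
   by (rule set_integrable_locally_integrable[OF L2_integrable[OF tauL]])
  fix psi assume t: "test_function (tri b T) psi"
  obtain K where K: "!!x. \<bar>psi x\<bar> <= K" "!!x. \<bar>pderiv_dir (0, 1) psi x\<bar> <= K" using test_function_bound[OF t B(2)] by blast
  have K0: "K >= 0" using K(1)[of 0] by linarith
  have s: "smooth psi" using t by (simp add: test_function_def)
  have c: "continuous_on UNIV psi" "continuous_on UNIV (pderiv_dir (0, 1) psi)"
   by (rule smooth_continuous[OF s], rule smooth_continuous[OF smooth_pderiv_dir[OF s B(2)]])
  let ?G = "%n x. ind (tri b T) x *R (psi x *R dl' (r1 n) (snd x) + pderiv_dir (0, 1) psi x *R dl (r1 n) (snd x))"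
  let ?L = "%x. psi x *R (ind (tri b T) x *R tau (snd x))"
  have cm: "continuous_on UNIV (%x. psi x *R dl' (r1 n) (snd x) + pderiv_dir (0, 1) psi x *R dl (r1 n) (snd x))" for n
   by (intro continuous_on_add continuous_on_scaleR c continuous_on_compose2[OF dlc(1)] continuous_on_compose2[OF dlc(2)] continuous_on_snd continuous_on_id) auto
  have "(%n. LINT x|lborel. ?G n x) ---> (LINT x|lborel. ?L x)"
  proof (rule integral_dominated_convergence[OF _ _ const[of "K * (2 * M) + K * M"]])
   have "psi \<in> bmeas lborel" using borel_measurable_continuous_onI[OF c(1)] by simp
   moreover have "(%x. ind (tri b T) x *R tau (snd x)) \<in> bmeas lborel"
    using tauL by (simp add: L2_on_def set_borel_measurable_def)
   ultimately show "?L \<in> bmeas lborel" by (rule borel_measurable_scaleR)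
   show "?G n \<in> bmeas lborel" for n
    using borel_measurable_scaleR[OF borel_measurable_indicator[OF dom_sets] borel_measurable_continuous_onI[OF cm[of n]]] by simp
   show "AE x in lborel. (%n. ?G n x) ---> ?L x"
    using AE_snd[OF taulim]
   proof eventually_elim
    case (elim x)
    show ?case
    proof (cases "x \<in> tri b T")
     case True
     have "(%n. psi x *R dl' (r1 n) (snd x) + pderiv_dir (0, 1) psi x *R dl (r1 n) (snd x)) ---> psi x *R tau (snd x) + pderiv_dir (0, 1) psi x *R 0"
      using elim tri_snd[OF True] by (intro tendsto_intros dlr) auto
     then show ?thesis using True by simp
    qed simp
   qed
   show "AE x in lborel. norm (?G n x) <= ind (tri b T) x * (K * (2 * M) + K * M)" for n
   proof (rule AE_I2)
    fix x
    have "norm (psi x *R dl' (r1 n) (snd x) + pderiv_dir (0, 1) psi x *R dl (r1 n) (snd x)) <= K * (2 * M) + K * M" if x: "x \<in> tri b T"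
     by (rule order_trans[OF norm_triangle_ineq], unfold norm_scaleR, intro add_mono mult_mono K dlb dl'b tri_snd[OF x]) (use K0 in auto)
    then show "norm (?G n x) <= ind (tri b T) x * (K * (2 * M) + K * M)" by (cases "x \<in> tri b T") auto
   qed
  qed
  moreover have "(LINT x|lborel. ?G n x) = 0" for n
   by (rule test_function_ibp_snd[OF t bounded_dom dom_sets dld dlc(2)])
  ultimately have "(LINT x|lborel. ?L x) = 0" by (simp add: LIMSEQ_const_iff)
  then show "(LINT x:tri b T|lborel. pderiv_dir (0, 1) psi x *R (0::complex)) = - (LINT x:tri b T|lborel. psi x *R tau (snd x))"
   by (simp add: set_lebesgue_integral_def mult.commute)
 qed
 have w0: "has_weak_deriv (tri b T) (0, 1) (%x. 0) (%x. 0)"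
  by (simp add: has_weak_deriv_def locally_integrable_def set_integrable_def)
 have tau0: "AE x\<in>tri b T in lborel. tau (snd x) = 0" by (rule has_weak_deriv_unique[OF open_dom wz w0])
 let ?c2 = "?d (0, 1) chi"
 have FL: "L2_on (tri b T) (F n)" "L2_on (tri b T) (pderiv_dir (0, 1) (F n))" for n
  using smooth_L2_on[OF Fc(1) bounded_dom dom_sets] smooth_L2_on[OF Fc(3) bounded_dom dom_sets] by auto
 have lims: "(%n. L2_norm (tri b T) (%x. F n x - chi x)) ---> 0" "(%n. L2_norm (tri b T) (%x. pderiv_dir (0, 1) (F n) x - ?c2 x)) ---> 0"
  unfolding F_def by (rule smo_tendsto[OF L(1)[OF B]]) (rule smo_deriv(1)[OF w1(2)[OF B(2)] L(1)[OF B] L(2)[OF B(2) B(2)] B(2)])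
 \<comment> \<open>A further subsequence, along which \<open>F\<close> and its second partial
   derivative converge almost everywhere as well.\<close>
 obtain r2 where r2: "strict_mono r2" "AE x\<in>tri b T in lborel. (%n. F (r1 (r2 n)) x) ---> chi x"
  "AE x\<in>tri b T in lborel. (%n. pderiv_dir (0, 1) (F (r1 (r2 n))) x) ---> ?c2 x"
  using L2_AE_subseq2[of "tri b T" "%n. F (r1 n)" chi "tri b T" "%n. pderiv_dir (0, 1) (F (r1 n))" ?c2]
   LIMSEQ_subseq_LIMSEQ[OF lims(1) r1(1)] LIMSEQ_subseq_LIMSEQ[OF lims(2) r1(1)] FL L(1)[OF B] L(2)[OF B(2) B(2)]
  unfolding comp_def by blast
 define q where "q n = r1 (r2 n)" for n
 note pi = adm_integrable[OF p] and vi = adm_integrable[OF v]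
 let ?Y = "%n x. ind (tri b T) x *R (cpx (sg b) * (dl' (q n) (snd x) - pderiv_dir (0, 1) (F (q n)) x))"
 let ?X = "%n x. ind (tri b T) x *R (cpx (sg b) * (dl (q n) (snd x) - F (q n) x))"
 let ?g = "%n x. k1 x * (prim p (fst x) * (?Y n x * cnj (prim v (snd x)) + ?X n x * cnj (v (snd x))))"
 let ?G = "%x. k1 x * (prim p (fst x) * (ind (tri b T) x *R ?c2 x * cnj (prim v (snd x)) + ind (tri b T) x *R chi x * cnj (v (snd x))))"
 let ?bnd = "(6 + 4 * C) * (2 * M) * T * (CK * sq_norm lborel (prim p) * sq_norm lborel (prim v) + DK * hn nu (prim p) * hn nu (prim v))"
 have bound: "cmod (LINT x|lborel. ?g n x) <= ?bnd" for n
 proof -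
  let ?phi = "pderiv_dir (1, 0) (F (q n))" and ?psi = "pderiv_dir (0, 1) (pderiv_dir (1, 0) (F (q n)))"
  interpret J: jump_data T M b ?phi ?psi
  proof
   show "continuous_on UNIV ?phi" "continuous_on UNIV ?psi" by (rule Fc smooth_continuous[OF smooth_pderiv_dir[OF Fd[OF B(1)] B(2)]])+
   show "((%t. ?phi (a, t)) has_vector_derivative ?psi (a, t)) (at t)" for a t by (rule smooth_line_derivs(2)[OF Fd[OF B(1)]])
   show "cmod (?phi (a, t)) <= M & cmod (?psi (a, t)) <= M" if "0 < a" "a < T" "0 < t" "t < T" "a ~= t" "(a < t) = b" for a t
   proof -
    have x: "(a, t) \<in> tri b T" using that by (auto simp: tri_def square_def)
    have "cmod (?psi (a, t)) <= M" unfolding F_def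
     by (rule smo_deriv2(2)[OF w1(2)[OF B(1)] w2(2)[OF B(2) B(1)] L(1)[OF B] L(2)[OF B(1) B(1)] L(3)[OF B(1) B(2)] B(1) B(2) x bd(3)[OF B(1) B(2)] M])
    then show ?thesis using Fdb[OF x B(1)] by simp
   qed
  qed (use T M in auto)
  have "(LINT x|lborel. ?g n x) = (LINT x|lborel. k1 x * (prim p (fst x) * (jumpY b ?phi ?psi x * cnj (prim v (snd x)) + jumpX b ?phi x * cnj (v (snd x)))))"
  proof (rule B_integral_cong[OF refl])
   fix x
   show "?g n x = k1 x * (prim p (fst x) * (jumpY b ?phi ?psi x * cnj (prim v (snd x)) + jumpX b ?phi x * cnj (v (snd x))))"
   proof (cases "x \<in> square T")
    case True
    show ?thesis unfolding dl_def dl'_def jump_smooth[OF Fs True] ..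
   next
    case False
    show ?thesis by (simp only: k1_supp[OF False] mult_zero_left)
   qed
  qed
  then show ?thesis using J.multiplier_bound[OF nu C avg k1 k1_supp H CD p v] by simp
 qed
 have lim: "(%n. LINT x|lborel. ?g n x) ---> (LINT x|lborel. - cpx (sg b) * ?G x)"
 proof (rule integral_dominated_convergence)
  note [measurable] = fst_borel snd_borel
  have [measurable]: "k1 \<in> bmeas borel" "v \<in> bmeas borel" using k1 vi by (auto simp: sq_int_def)
  have [measurable]: "prim v \<in> bmeas borel" "prim p \<in> bmeas borel" using prim_borel[OF vi] prim_borel[OF pi] by auto
  have [measurable]: "(%x. ind (tri b T) x *R ?c2 x) \<in> bmeas borel" "(%x. ind (tri b T) x *R chi x) \<in> bmeas borel"
   using L(1)[OF B] L(2)[OF B(2) B(2)] by (simp_all add: L2_on_def set_borel_measurable_def)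
  show "(%x. - cpx (sg b) * ?G x) \<in> bmeas lborel" by measurable
  have [measurable]: "dl n \<in> bmeas borel" "dl' n \<in> bmeas borel" "F n \<in> bmeas borel" "pderiv_dir (0, 1) (F n) \<in> bmeas borel" for n
   using dlc Fc by (auto intro: borel_measurable_continuous_onI)
  have [measurable]: "tri b T \<in> sets borel" by (rule dom_sets)
  show "?g n \<in> bmeas lborel" for n by measurable
  \<comment> \<open>The constants are 2 M + M for \<open>dl'\<close> against one derivative of
    \<open>F\<close>, and M + M for \<open>dl\<close> against \<open>F\<close>.\<close>
  let ?w = "%t. 3 * M * cmod (prim v t) + 2 * M * cmod (v t)"
  show "integrable lborel (%x. cmod (k1 x) * (cmod (prim p (fst x)) * ?w (snd x)))"
  proof (rule sq_int_tensor_le[OF k1 adm_prim(2)[OF p]])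
   have "sq_int lborel (%t. cpx (3 * M) * cpx (cmod (prim v t)) + cpx (2 * M) * cpx (cmod (v t)))"
   proof (intro sq_int_add(1) sq_int_scale(1))
    show "sq_int lborel (%t. cpx (cmod (prim v t)))"
     using adm_prim(2)[OF v] by (auto simp: sq_int_def)
    show "sq_int lborel (%t. cpx (cmod (v t)))"
     using v by (auto simp: sq_int_def adm_def)
   qed
   then show "sq_int lborel (%t. cpx (?w t))" by simp
  qed (use M in auto)
  have sg1: "\<bar>sg b\<bar> = 1" by (simp add: sg_def)
  show "AE x in lborel. norm (?g n x) <= cmod (k1 x) * (cmod (prim p (fst x)) * ?w (snd x))" for n
  proof (rule AE_I2)
   fix x
   have Y: "cmod (?Y n x) <= 3 * M"
   proof (cases "x \<in> tri b T")
    case True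
    have "cmod (dl' (q n) (snd x) - pderiv_dir (0, 1) (F (q n)) x) <= 3 * M"
     using norm_triangle_ineq4[of "dl' (q n) (snd x)" "pderiv_dir (0, 1) (F (q n)) x"] dl'b[OF tri_snd[OF True], of "q n"] Fdb[OF True B(2), of "q n"] by linarith
    then show ?thesis using True by (simp add: norm_mult sg1)
   qed (use M in simp)
   have X: "cmod (?X n x) <= 2 * M"
   proof (cases "x \<in> tri b T")
    case True
    have "cmod (dl (q n) (snd x) - F (q n) x) <= 2 * M"
     using norm_triangle_ineq4[of "dl (q n) (snd x)" "F (q n) x"] dlb[of "q n" "snd x"] Fb[of "q n" x] by linarith
    then show ?thesis using True by (simp add: norm_mult sg1)
   qed (use M in simp)
   have "cmod (?Y n x * cnj (prim v (snd x)) + ?X n x * cnj (v (snd x))) <= ?w (snd x)"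
    by (rule order_trans[OF norm_triangle_ineq], unfold norm_mult[of "?Y n x"] norm_mult[of "?X n x"] complex_mod_cnj, intro add_mono mult_right_mono X Y) auto
   then show "norm (?g n x) <= cmod (k1 x) * (cmod (prim p (fst x)) * ?w (snd x))"
    unfolding norm_mult[of "k1 x"] norm_mult[of "prim p (fst x)"] by (intro mult_left_mono) auto
  qed
  show "AE x in lborel. (%n. ?g n x) ---> - cpx (sg b) * ?G x"
   using r2(2,3) tau0 AE_snd[OF taulim]
  proof eventually_elim
   case (elim x)
   show ?case
   proof (cases "x \<in> tri b T")
    case True
    have "(%n. dl' (r1 n) (snd x)) ---> 0" using elim tri_snd[OF True] True by simp
    from LIMSEQ_subseq_LIMSEQ[OF this r2(1)] have 1: "(%n. dl' (q n) (snd x)) ---> 0" by (simp add: comp_def q_def)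
    from LIMSEQ_subseq_LIMSEQ[OF dlr[OF tri_snd[OF True]] r2(1)] have 2: "(%n. dl (q n) (snd x)) ---> 0" by (simp add: comp_def q_def)
    have 3: "(%n. F (q n) x) ---> chi x" "(%n. pderiv_dir (0, 1) (F (q n)) x) ---> ?c2 x" using elim True by (simp_all add: q_def)
    have "(%n. ?g n x) ---> k1 x * (prim p (fst x) * (ind (tri b T) x *R (cpx (sg b) * (0 - ?c2 x)) * cnj (prim v (snd x))
      + ind (tri b T) x *R (cpx (sg b) * (0 - chi x)) * cnj (v (snd x))))"
     by (intro tendsto_intros 1 2 3)
    also have "k1 x * (prim p (fst x) * (ind (tri b T) x *R (cpx (sg b) * (0 - ?c2 x)) * cnj (prim v (snd x))
      + ind (tri b T) x *R (cpx (sg b) * (0 - chi x)) * cnj (v (snd x)))) = - cpx (sg b) * ?G x"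
     using True by (simp add: algebra_simps)
    finally show ?thesis .
   qed simp
  qed
 qed
 have "cmod (LINT x|lborel. - cpx (sg b) * ?G x) <= ?bnd"
  by (rule LIMSEQ_le_const2[OF tendsto_norm[OF lim]]) (use bound in auto)
 then show ?thesis by (simp add: norm_mult sg_def M_def split: if_splits)
qed

section \<open>Reduction to the kernel \<open>\<partial>\<^sub>1K\<close>\<close>

text \<open>A negative value would bound a modulus almost everywhere, so the triangle would be a
  null set, which a nonempty open set is not. This makes the norm of each triangle at most the
  maximum in absolute value.\<close>

lemma W_2_inf_norm_nonneg:
 assumes T: "0 < T" and f: "W_k_inf 2 (tri b T) f"
 shows "0 <= W_k_inf_norm 2 (tri b T) f"
proof (rule ccontr)
 assume n: "~ 0 <= W_k_inf_norm 2 (tri b T) f"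
 have "AE x\<in>tri b T in lborel. cmod (f x) <= W_k_inf_norm 2 (tri b T) f"
  by (rule W_2_inf_bounds(1)[OF open_tri f Basis_plane])
 then have "AE x in lborel. x ~: tri b T"
 proof eventually_elim
  case (elim x)
  then show ?case using n norm_ge_zero[of "f x"] by (meson order_trans)
 qed
 then have "tri b T \<in> null_sets lborel"
  using open_tri by (subst (asm) AE_iff_null) auto
 then have "negligible (tri b T)" by (simp add: negligible_iff_null_sets null_sets_completionI)
 moreover have "tri b T ~= {}"
 proof -
  have "(if b then (T / 4, T / 2) else (T / 2, T / 4)) \<in> tri b T" using T by (cases b) (auto simp: tri_def square_def)
  then show ?thesis by blast
 qed
 ultimately show False using open_not_negligible[OF open_tri] by blast
qed

lemma primitive_prim:
 assumes "0 < T"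
 shows "ind {0<..<T} t *R primitive u t = ind {0<..<T} t *R prim (%s. ind {0<..<T} s *R u s) t"
proof (cases "t \<in> {0<..<T}")
 case True
 have "primitive u t = prim (%s. ind {0<..<T} s *R u s) t"
  unfolding primitive_def prim_def set_lebesgue_integral_def
  by (rule B_integral_cong) (use True in "auto simp: indicator_def")
 then show ?thesis by simp
qed simp

lemma H_space_adm: "u \<in> H_space T ==> adm T (%s. ind {0<..<T} s *R u s)"
 by (simp add: H_space_def adm_def L2_on_sq_int set_lebesgue_integral_def)

lemma adm_indicator:
 assumes "adm T p" shows "(%s. ind {0<..<T} s *R p s) = p"
proof
 fix s show "ind {0<..<T} s *R p s = p s"
  using assms by (cases "s \<in> {0<..<T}") (simp_all add: adm_def)
qed

lemma adm_H_space: assumes "adm T p" shows "p \<in> H_space T"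
 using assms adm_indicator[OF assms] unfolding H_space_def L2_on_sq_int set_lebesgue_integral_def adm_def by simp

lemma adm_cnj: "adm T p ==> adm T (%s. cnj (p s))"
 by (auto simp: adm_def sq_int_def)

lemma CD_bound_eq:
 assumes T: "0 < T" "T <= 1" and nu: "nu < 1/2" and u: "u \<in> H_space T" and v: "v \<in> H_space T"
 shows "CD_bound T nu C D u v = C * sq_norm lborel (prim (%s. ind {0<..<T} s *R u s)) * sq_norm lborel (prim (%s. ind {0<..<T} s *R v s))
  + D * hn nu (prim (%s. ind {0<..<T} s *R u s)) * hn nu (prim (%s. ind {0<..<T} s *R v s))"
proof -
 have "L2_norm {0<..<T} (primitive u) = sq_norm lborel (prim (%s. ind {0<..<T} s *R u s))
  & Htilde_norm T nu (primitive u) = hn nu (prim (%s. ind {0<..<T} s *R u s))" if "u \<in> H_space T" for u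
 proof -
  let ?u = "%s. ind {0<..<T} s *R u s"
  note a = H_space_adm[OF that]
  have e: "ind {0<..<T} t *R prim ?u t = prim ?u t" for t
   using adm_prim_zero[OF a, of t] by (cases "t \<in> {0<..<T}") auto
  have e2: "(%t. ind {0<..<T} t * primitive u t) = prim ?u"
  proof
   fix t
   have "ind {0<..<T} t * primitive u t = ind {0<..<T} t *R primitive u t" by (simp add: indicator_def)
   then show "ind {0<..<T} t * primitive u t = prim ?u t" by (simp only: primitive_prim[OF T(1)] e)
  qed
  have B: "(nsq (fourier (prim ?u) om)) * (1 + om\<^sup>2) <= 5 * (LINT s|lborel. cmod (?u s))\<^sup>2" for om
   using fourier_cut_prim_bound[OF T a, of T om] by (simp only: cut_prim_id[OF a order_refl])
  show ?thesis
   unfolding L2_norm_sq_norm primitive_prim[OF T(1)] e Htilde_norm_def e2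
   using HN_integral(4)[OF nu prim_borel[OF adm_integrable[OF a]] B] by simp
 qed
 then show ?thesis using u v by (simp add: CD_bound_def)
qed

lemma approx_subset:
 fixes F :: "nat => plane => complex"
 assumes F: "!!n. continuous_on UNIV (F n)" "L2_on Om f" "(%n. L2_norm Om (%x. F n x - f x)) ---> 0"
  and Om: "bounded Om" "Om \<in> sets borel" and sub: "Om' \<subseteq> Om" "Om' \<in> sets borel"
 shows "L2_on Om' f" "(%n. L2_norm Om' (%x. F n x - f x)) ---> 0"
proof -
 show "L2_on Om' f" by (rule L2_norm_mono_set(1)[OF F(2) sub])
 have "L2_norm Om' (%x. F n x - f x) <= L2_norm Om (%x. F n x - f x)" for n
  by (rule L2_norm_mono_set(2)[OF L2_on_diff[OF smooth_L2_on[OF F(1) Om] F(2)] sub])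
 then show "(%n. L2_norm Om' (%x. F n x - f x)) ---> 0"
  by (intro tendsto_sandwich[OF _ _ tendsto_const F(3)]) simp_all
qed

lemma energy_approx_subset:
 assumes a: "energy_approx T Om e f f' tau phi" and e: "e \<in> Basis" and Om: "bounded Om" "Om \<in> sets borel" and sub: "Om' \<subseteq> Om" "Om' \<in> sets borel"
 shows "energy_approx T Om' e f f' tau phi"
proof -
 have s: "smooth (phi n)" for n using a by (simp add: energy_approx_def)
 have c: "continuous_on UNIV (phi n)" "continuous_on UNIV (pderiv_dir e (phi n))" for n
  by (rule smooth_continuous[OF s], rule smooth_continuous[OF smooth_pderiv_dir[OF s e]])
 have A: "L2_on Om f" "L2_on Om f'" "(%n. L2_norm Om (%x. phi n x - f x)) ---> 0" "(%n. L2_norm Om (%x. pderiv_dir e (phi n) x - f' x)) ---> 0"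
  using a by (simp_all add: energy_approx_def)
 show ?thesis using a approx_subset[OF c(1) A(1,3) Om sub] approx_subset[OF c(2) A(2,4) Om sub] unfolding energy_approx_def by blast
qed

text \<open>The smoothings show that some trace exists, the triangle inside \<open>Om\<close> giving
  convergence on the diagonal. The sequence \<open>phi\<close> is then the one certified by the
  choice in \<open>diag_trace\<close>, so it belongs to precisely this trace.\<close>

lemma diag_trace_energy_approx:
 fixes f :: "plane => complex"
 assumes T: "0 < T" "T <= 1" and cd: "\<exists>c r. convex_domain Om c r" and sub: "tri b T \<subseteq> Om" and f: "H_k 1 Om f" and e: "e \<in> Basis"
 shows "\<exists>phi. energy_approx T Om e f (weak_deriv Om e f) (diag_trace T Om f) phi"
proof -
 obtain c r where "convex_domain Om c r" using cd by blast
 then interpret convex_domain Om c r .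
 note w = H_k_weak_deriv[OF open_dom _ f]
 note f2 = w(1)[OF e]
 have Fs: "smooth (smo n f)" for n by (rule smooth_smo[OF L2_integrable[OF f2]])
 have Fc: "continuous_on UNIV (smo n f)" for n by (rule smooth_continuous[OF Fs])
 have Fd: "continuous_on UNIV (pderiv_dir e (smo n f))" if "e \<in> Basis" for n e by (rule smooth_continuous[OF smooth_pderiv_dir[OF Fs that]])
 note d = smo_deriv(1)[OF w(2) f2 w(3)]
 note sb = bounded_dom dom_sets sub borel_open[OF open_tri]
 note A0 = approx_subset[OF Fc f2 smo_tendsto[OF f2] sb]
 note A1 = approx_subset[OF Fd[OF Basis_plane(1)] w(3)[OF Basis_plane(1)] d[OF Basis_plane(1) Basis_plane(1) Basis_plane(1)] sb]
 note A2 = approx_subset[OF Fd[OF Basis_plane(2)] w(3)[OF Basis_plane(2)] d[OF Basis_plane(2) Basis_plane(2) Basis_plane(2)] sb]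
 obtain tau where tau: "L2_on {0<..<T} tau" "(%n. L2_norm {0<..<T} (%s. smo n f (s, s) - tau s)) ---> 0"
  using trace_exists[OF T Fs A0(1) A1(1) A2(1) A0(2) A1(2) A2(2)] by blast
 have "has_diag_trace T Om f tau"
  unfolding has_diag_trace_def
  using f tau Fs smo_tendsto[OF f2] d by (intro conjI exI[of _ "%n. smo n f"]) auto
 then have "has_diag_trace T Om f (diag_trace T Om f)" unfolding diag_trace_def by (rule someI[where P="has_diag_trace T Om f"])
 then show ?thesis using f2 w(3)[OF e] e unfolding has_diag_trace_def energy_approx_def by blast
qed

text \<open>Splitting a pairing into sums is legitimate only for integrable summands; this predicate
  carries that side condition.\<close>

definition pairable :: "'a::euclidean_space set => ('a => complex) => ('a => complex) => bool" where
 "pairable Om F W \<longleftrightarrow> integrable lborel (%x. ind Om x *R F x * W x)"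

lemma pairable_mult:
 assumes "Linf_on Om b" "L2_on Om K" "sq_int lborel W"
 shows "pairable Om (%x. b x * K x) W"
proof -
 have "integrable lborel (%x. ind Om x *R K x * (ind Om x *R b x * W x))"
  by (rule sq_int_mult[OF assms(2)[unfolded L2_on_sq_int] Linf_mult_sq_int[OF assms(1,3)]])
 moreover have "(%x. ind Om x *R K x * (ind Om x *R b x * W x)) = (%x. ind Om x *R (b x * K x) * W x)"
  by (auto simp: indicator_def fun_eq_iff)
 ultimately show ?thesis by (simp only: pairable_def)
qed

lemma pairing_linear:
 assumes "pairable Om F W" "pairable Om G W"
 shows "pairing Om (%x. F x + G x) W = pairing Om F W + pairing Om G W" "pairable Om (%x. F x + G x) W"
  "pairing Om (%x. F x - G x) W = pairing Om F W - pairing Om G W"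
 using assms unfolding pairing_def pairable_def scaleR_add_right scaleR_diff_right distrib_right left_diff_distrib
 by (auto intro: B_integral_add B_integral_diff)

lemma pairing_cong_AE:
 assumes "AE x\<in>Om in lborel. F x = G x" "pairable Om F W" "pairable Om G W"
 shows "pairing Om F W = pairing Om G W"
 unfolding pairing_def
proof (rule integral_cong_AE)
 show "AE x in lborel. ind Om x *R F x * W x = ind Om x *R G x * W x"
  using assms(1) by eventually_elim (auto simp: indicator_def)
qed (use assms in "auto simp only: pairable_def dest: borel_measurable_integrable")

lemma pairing_split:
 assumes "pairable (tri True T) F W" "pairable (tri False T) F W" "pairable (square T) F W"
 shows "pairing (tri True T \<union> tri False T) F W = pairing (tri True T) F W + pairing (tri False T) F W"
  "pairing (square T) F W = pairing (tri True T) F W + pairing (tri False T) F W"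
proof -
 have e: "ind (tri True T \<union> tri False T) x *R F x * W x = ind (tri True T) x *R F x * W x + ind (tri False T) x *R F x * W x" for x
  by (auto simp: indicator_def tri_def)
 have i: "integrable lborel (%x. ind (tri True T \<union> tri False T) x *R F x * W x)"
  unfolding e using assms(1,2) unfolding pairable_def by (rule B_integrable_add)
 show 1: "pairing (tri True T \<union> tri False T) F W = pairing (tri True T) F W + pairing (tri False T) F W"
  unfolding pairing_def e using assms(1,2) unfolding pairable_def by (rule B_integral_add)
 have "AE x in lborel. ind (tri True T \<union> tri False T) x *R F x * W x = ind (square T) x *R F x * W x"
  using AE_off_diagonal by eventually_elim (auto simp: indicator_def tri_def)
 then have "pairing (square T) F W = pairing (tri True T \<union> tri False T) F W"
  unfolding pairing_def
  by (intro integral_cong_AE[symmetric] borel_measurable_integrable[OF i] borel_measurable_integrable[OF assms(3)[unfolded pairable_def]])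
 then show "pairing (square T) F W = pairing (tri True T) F W + pairing (tri False T) F W" using 1 by simp
qed

lemma sq_int_adm:
 assumes "adm T p" shows "sq_int lborel p" "sq_int lborel (prim p)"
 using assms adm_prim(2)[OF assms] by (simp_all add: adm_def)

text \<open>With the constant 1 as first factor, the product formula specialises to integration by
  parts for a single function.\<close>

lemma energy_approx_one: "energy_approx T (square T) e (%x. 1) (%x. 0) (%s. 1) (%n x. 1)"
proof -
 have "pderiv_dir e (%x. 1 :: complex) = (%x. 0)"
  by (rule ext) (rule pderiv_dir_eqI[THEN trans], rule has_derivative_const, simp)
 moreover have "L2_on (square T) (%x. c)" "L2_on {0<..<T} (%x. c)" for c
  using smooth_L2_on[of "%x. c" "square T"] smooth_L2_on[of "%x. c" "{0<..<T}"] open_square by auto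
 moreover have "L2_norm Om (%x. 0) = 0" for Om :: "'a::euclidean_space set" by (simp add: L2_norm_def set_lebesgue_integral_def)
 ultimately show ?thesis by (simp add: energy_approx_def smooth_def C_k_const L2_norm_def set_lebesgue_integral_def)
qed

lemma green_square_product:
 assumes T: "0 < T" and p: "adm T p" and w: "adm T w"
  and f: "energy_approx T (square T) (1, 0) f f' tau phi" "Linf_on (square T) f" "Linf_on (square T) f'"
  and k: "energy_approx T (square T) (1, 0) k k' kp K"
 shows "pairing (square T) (%x. f x * k x) (%x. p (fst x) * w (snd x))
  = - pairing (square T) (%x. f' x * k x) (%x. prim p (fst x) * w (snd x)) - pairing (square T) (%x. f x * k' x) (%x. prim p (fst x) * w (snd x))"
proof -
 have z: "sq_int lborel (%s::real. 0)" by (simp add: sq_int_def)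
 have "pairing (square T) (%x. f x * k x) (%x. p (fst x) * w (snd x))
  = 0 * pairing {0<..<T} (%s. tau s * kp s) (%s. 0) - pairing (square T) (%x. f' x * k x) (%x. prim p (fst x) * w (snd x)) - pairing (square T) (%x. f x * k' x) (%x. prim p (fst x) * w (snd x))"
 proof (rule green_product[OF open_square(2) borel_open[OF open_square(1)] Basis_plane(1) _ _ z _ _ f k, where B=0])
  show "sq_int lborel (%x. p (fst x) * w (snd x))" "sq_int lborel (%x. prim p (fst x) * w (snd x))"
   by (rule sq_int_tensor[OF sq_int_adm(1)[OF p] sq_int_adm(1)[OF w]]) (rule sq_int_tensor[OF sq_int_adm(2)[OF p] sq_int_adm(1)[OF w]])
  show "pairing (square T) A (%x. p (fst x) * w (snd x)) = 0 * pairing {0<..<T} (%s. A (s, s)) (%s. 0) - pairing (square T) (pderiv_dir (1, 0) A) (%x. prim p (fst x) * w (snd x))"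
   if "smooth A" for A
   unfolding pairing_def green_square[OF that T p w] by simp
 qed simp
 then show ?thesis by simp
qed

text \<open>Integration by parts in \<open>s\<close> moves the derivative from \<open>prim p\<close>
  to \<open>K\<close>; the boundary terms vanish together with \<open>prim p\<close>, and the sign
  is lost in the modulus.\<close>

lemma form_bound_deriv:
 assumes T: "0 < T" "T <= 1" and nu: "nu < 1/2" and K: "H_k 1 (square T) K"
  and H: "\<forall>u\<in>H_space T. \<forall>v\<in>H_space T. cmod (LINT p:square T|lborel. K p * u (fst p) * cnj (v (snd p))) <= CD_bound T nu C D u v"
 shows "form_bound T nu C D (%x. ind (square T) x *R weak_deriv (square T) (1, 0) K x)"
 unfolding form_bound_def
proof (intro allI impI)
 fix p q assume p: "adm T p" and q: "adm T q"
 obtain phi where phi: "energy_approx T (square T) (1, 0) K (weak_deriv (square T) (1, 0) K) (diag_trace T (square T) K) phi"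
  using diag_trace_energy_approx[OF T convex_domain_square[OF T(1)] tri_subset[of True] K Basis_plane(1)] by blast
 have L: "Linf_on (square T) (%x. c)" for c
  using smooth_Linf_on[of "%x. c" "square T"] open_square by auto
 have "pairing (square T) (%x. 1 * K x) (%x. p (fst x) * cnj (q (snd x)))
  = - pairing (square T) (%x. 0 * K x) (%x. prim p (fst x) * cnj (q (snd x))) - pairing (square T) (%x. 1 * weak_deriv (square T) (1, 0) K x) (%x. prim p (fst x) * cnj (q (snd x)))"
  by (rule green_square_product[OF T(1) p adm_cnj[OF q] energy_approx_one L L phi])
 then have G: "pairing (square T) K (%x. p (fst x) * cnj (q (snd x))) = - pairing (square T) (weak_deriv (square T) (1, 0) K) (%x. prim p (fst x) * cnj (q (snd x)))"
  by (simp add: pairing_def)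
 have "cmod (LINT x:square T|lborel. K x * p (fst x) * cnj (q (snd x))) <= CD_bound T nu C D p q"
  using H adm_H_space[OF p] adm_H_space[OF q] by blast
 also have "(LINT x:square T|lborel. K x * p (fst x) * cnj (q (snd x))) = pairing (square T) K (%x. p (fst x) * cnj (q (snd x)))"
  unfolding pairing_def set_lebesgue_integral_def by (simp add: mult.assoc)
 finally have "cmod (pairing (square T) (weak_deriv (square T) (1, 0) K) (%x. prim p (fst x) * cnj (q (snd x)))) <= CD_bound T nu C D p q"
  by (simp only: G norm_minus_cancel)
 then show "cmod (LINT x|lborel. ind (square T) x *R weak_deriv (square T) (1, 0) K x * (prim p (fst x) * cnj (q (snd x))))
   <= C * sq_norm lborel (prim p) * sq_norm lborel (prim q) + D * hn nu (prim p) * hn nu (prim q)"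
  unfolding CD_bound_eq[OF T nu adm_H_space[OF p] adm_H_space[OF q]] adm_indicator[OF p] adm_indicator[OF q] pairing_def .
qed

lemma Linf_on_subset:
 assumes "Linf_on Om f" "Om' \<subseteq> Om" "Om' \<in> sets borel"
 shows "Linf_on Om' f"
proof -
 obtain C where C: "AE x\<in>Om in lborel. cmod (f x) <= C" using assms(1) by (auto simp: Linf_on_def)
 have "AE x\<in>Om' in lborel. cmod (f x) <= C" using C by eventually_elim (use assms(2) in auto)
 moreover have e: "(%x. ind Om' x *R f x) = (%x. ind Om' x *R (ind Om x *R f x))"
  using assms(2) by (auto simp: indicator_def fun_eq_iff)
 have "(%x. ind Om' x *R f x) \<in> bmeas lborel"
  unfolding e by (rule borel_measurable_scaleR[OF borel_measurable_indicator]) (use assms in "simp_all add: Linf_on_def set_borel_measurable_def")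
 ultimately show ?thesis unfolding Linf_on_def set_borel_measurable_def by blast
qed

lemma H_k_1I:
 assumes "L2_on Om f" "!!e. e \<in> Basis ==> has_weak_deriv Om e f (g e)" "!!e. e \<in> Basis ==> L2_on Om (g e)"
 shows "H_k 1 Om f"
 unfolding One_nat_def sobolev.simps using assms by blast

text \<open>Integrating by parts once in the first variable on the square and once in the second
 variable on each triangle, everything on the left except two terms in \<open>\<partial>\<^sub>1K\<close> cancels.\<close>

lemma reduction:
 assumes T: "0 < T" "T <= 1" and K: "H_k 1 (square T) K" and chi: "W_k_inf 1 (square T) chi"
  and chi2: "!!b. W_k_inf 2 (tri b T) chi"
  and p: "adm T p" and w: "adm T w"
 defines "J b \<equiv> LINT x|lborel. ind (square T) x *R weak_deriv (square T) (1, 0) K x * (prim p (fst x) *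
   (ind (tri b T) x *R weak_deriv (tri b T) (0, 1) chi x * prim w (snd x) + ind (tri b T) x *R chi x * w (snd x)))"
 shows "pairing (square T) (%x. chi x * K x) (%x. p (fst x) * w (snd x))
  - pairing {0<..<T} (diag_weight T chi K) (%s. prim p s * prim w s)
  - pairing (Delta_plus T \<union> Delta_minus T) (Upsilon T chi K) (%x. prim p (fst x) * prim w (snd x)) = - J True - J False"
proof -
 let ?Q = "square T" and ?D = "tri True T \<union> tri False T"
 let ?fw = "%x. prim p (fst x) * w (snd x)" and ?fg = "%x. prim p (fst x) * prim w (snd x)" and ?d = "%s. prim p s * prim w s"
 let ?x1 = "weak_deriv ?Q (1, 0) chi" and ?x2 = "weak_deriv ?Q (0, 1) chi"
 let ?K1 = "weak_deriv ?Q (1, 0) K" and ?K2 = "weak_deriv ?Q (0, 1) K"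
 let ?rho = "weak_deriv ?D (0, 1) ?x1"
 let ?r = "%b. weak_deriv (tri b T) (0, 1) ?x1"
 let ?tau = "%b. diag_trace T (tri b T) ?x1" and ?kp = "diag_trace T ?Q K"
 note B = Basis_plane
 have Qo: "open ?Q" "bounded ?Q" "?Q \<in> sets borel" using open_square by auto
 have trm: "tri b T \<in> sets borel" for b using open_tri by simp
 have fin: "emeasure lborel ?Q < \<infinity>" "emeasure lborel (tri b T) < \<infinity>" for b
  using emeasure_bounded_finite[OF Qo(2)] emeasure_bounded_finite[OF bounded_tri] by auto
 have Wfw: "sq_int lborel ?fw" by (rule sq_int_tensor[OF sq_int_adm(2)[OF p] sq_int_adm(1)[OF w]])
 have Wfg: "sq_int lborel ?fg" by (rule sq_int_tensor[OF sq_int_adm(2)[OF p] sq_int_adm(2)[OF w]])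
 have pm: "prim p \<in> bmeas lborel" using sq_int_adm(2)[OF p] by (rule sq_int_measurable)
 have nn: "0 <= (LINT s|lborel. cmod (h s))" for h :: "real => complex" by (rule B_integral_nonneg) simp
 have d: "sq_int lborel ?d"
  by (rule sq_int_bounded_mult(1)[OF sq_int_adm(2)[OF w] pm AE_I2[OF prim_norm_le[OF adm_integrable[OF p]]] nn])
 have db: "cmod (?d s) <= (LINT s|lborel. cmod (p s)) * (LINT s|lborel. cmod (w s))" for s
  unfolding norm_mult by (intro mult_mono prim_norm_le adm_integrable[OF p] adm_integrable[OF w] nn) simp
 have chiS: "W_k_inf (Suc 0) ?Q chi" using chi by simp
 note wQ = W_k_inf_weak_deriv[OF Qo(1) _ chiS]
 have X: "Linf_on ?Q chi" "Linf_on ?Q ?x1" "Linf_on ?Q ?x2" using wQ(1,3)[OF B(1)] wQ(3)[OF B(2)] by simp_all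
 have Xt: "Linf_on (tri b T) chi" "Linf_on (tri b T) ?x1" "Linf_on (tri b T) ?x2" for b
  using X Linf_on_subset[OF _ tri_subset trm] by blast+
 have KL: "L2_on ?Q K" "L2_on ?Q ?K1" "L2_on ?Q ?K2"
  using H_k_weak_deriv[OF Qo(1) _ K] B by blast+
 have Kt: "L2_on (tri b T) K" "L2_on (tri b T) ?K1" "L2_on (tri b T) ?K2" for b
  using KL L2_norm_mono_set(1)[OF _ tri_subset trm] by blast+
 have chi2S: "W_k_inf (Suc 1) (tri b T) chi" for b using chi2 by (simp add: numeral_2_eq_2)
 note wt = W_k_inf_weak_deriv[OF open_tri _ chi2S]
 have wt1: "W_k_inf (Suc 0) (tri b T) (weak_deriv (tri b T) e chi)" if "e \<in> Basis" for b e using wt(3)[OF that] by simp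
 note wtt = W_k_inf_weak_deriv[OF open_tri _ wt1]
 \<comment> \<open>The derivatives chosen on a triangle and on the square agree almost everywhere;
   this links the regularity on the triangles with the terms of \<open>Upsilon\<close>, written with
   derivatives on the square.\<close>
 have eq: "AE x\<in>tri b T in lborel. weak_deriv (tri b T) e chi x = weak_deriv ?Q e chi x" if "e \<in> Basis" for b e
  by (rule has_weak_deriv_unique[OF open_tri wt(2)[OF that] has_weak_deriv_subset[OF wQ(2)[OF that] tri_subset]])
 have ms: "(%x. ind Om x *R h x) \<in> bmeas lborel" if "Linf_on Om h" for Om and h :: "plane => complex"
  using that by (simp add: Linf_on_def set_borel_measurable_def)
 have wx: "has_weak_deriv (tri b T) e ?x1 (weak_deriv (tri b T) e (weak_deriv (tri b T) (1, 0) chi))"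
  and Lx: "Linf_on (tri b T) (weak_deriv (tri b T) e (weak_deriv (tri b T) (1, 0) chi))" if e: "e \<in> Basis" for b e
 proof -
  show L: "Linf_on (tri b T) (weak_deriv (tri b T) e (weak_deriv (tri b T) (1, 0) chi))" using wtt(3)[OF e B(1)] by simp
  show "has_weak_deriv (tri b T) e ?x1 (weak_deriv (tri b T) e (weak_deriv (tri b T) (1, 0) chi))"
   by (rule has_weak_deriv_cong_AE[OF wtt(2)[OF e B(1)] eq[OF B(1)] _ ms[OF Xt(2)] ms[OF L] open_tri e]) simp
 qed
 have H1x: "H_k 1 (tri b T) ?x1" for b
  by (rule H_k_1I[OF Linf_on_L2_on[OF Xt(2) trm fin(2)] wx Linf_on_L2_on[OF Lx trm fin(2)]])
 have H1c: "H_k 1 ?Q chi"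
  by (rule H_k_1I[OF Linf_on_L2_on[OF X(1) Qo(3) fin(1)] wQ(2) Linf_on_L2_on[OF wQ(3)[unfolded sobolev.simps] Qo(3) fin(1)]])
 have rL: "Linf_on (tri b T) (?r b)" for b
 proof -
  have ae: "AE x\<in>tri b T in lborel. weak_deriv (tri b T) (0, 1) (weak_deriv (tri b T) (1, 0) chi) x = ?r b x"
   using weak_deriv_AE(1)[OF open_tri wx[OF B(2), of b]] by eventually_elim auto
  show ?thesis by (rule Linf_on_cong_AE[OF Lx[OF B(2)] ae weak_deriv_AE(2)[OF open_tri wx[OF B(2)]]])
 qed
 have wr: "has_weak_deriv (tri b T) (0, 1) ?x1 (?r b)" for b by (rule weak_derivI[OF wx[OF B(2)]])
 \<comment> \<open>A candidate for the mixed derivative on the union, glued from the two triangles.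
   It guarantees that the choice \<open>?rho\<close> made in \<open>Upsilon\<close> is a weak
   derivative.\<close>
 define G where "G x = (if x \<in> tri True T then ?r True x else ?r False x)" for x
 have G: "G x = ?r b x" if "x \<in> tri b T" for b x using that by (cases b) (auto simp: G_def tri_def)
 have GL: "Linf_on (tri b T) G" for b
 proof -
  have e: "(%x. ind (tri b T) x *R G x) = (%x. ind (tri b T) x *R ?r b x)"
   using G by (auto simp: fun_eq_iff indicator_def)
  show ?thesis by (rule Linf_on_cong_AE[OF rL AE_I2]) (use G ms[OF rL] in "auto simp only: e")
 qed
 have wG: "has_weak_deriv (tri b T) (0, 1) ?x1 G" for b
  by (rule has_weak_deriv_cong_AE[OF wr _ AE_I2 ms[OF Xt(2)] ms[OF GL] open_tri B(2)]) (use G in auto)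
 have si: "set_integrable lborel (tri b T) h" if "Linf_on (tri b T) h" for b h
  by (rule L2_on_set_integrable[OF Linf_on_L2_on[OF that trm fin(2)] trm fin(2)])
 have wD: "has_weak_deriv ?D (0, 1) ?x1 G"
  by (rule has_weak_deriv_union[OF open_tri open_tri _ B(2) wG wG si[OF Xt(2)] si[OF GL] si[OF Xt(2)] si[OF GL]]) (auto simp: tri_def)
 have wrho: "has_weak_deriv (tri b T) (0, 1) ?x1 ?rho" for b
  by (rule has_weak_deriv_subset[OF weak_derivI[OF wD]]) (cases b; auto)
 have rrho: "AE x\<in>tri b T in lborel. ?r b x = ?rho x" for b by (rule has_weak_deriv_unique[OF open_tri wr wrho])
 have rhoL: "Linf_on (tri b T) ?rho" for b
  by (rule Linf_on_cong_AE[OF rL rrho]) (use wrho[of b] locally_integrable_borel[OF open_tri] in "simp add: has_weak_deriv_def")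
 have sQ: "tri True T \<subseteq> ?Q" by (rule tri_subset)
 obtain phic where phic: "energy_approx T ?Q (1, 0) chi ?x1 (diag_trace T ?Q chi) phic"
  using diag_trace_energy_approx[OF T convex_domain_square[OF T(1)] sQ H1c B(1)] by blast
 obtain phi1 where phi1: "energy_approx T ?Q (1, 0) K ?K1 ?kp phi1"
  using diag_trace_energy_approx[OF T convex_domain_square[OF T(1)] sQ K B(1)] by blast
 obtain phi2 where phi2: "energy_approx T ?Q (0, 1) K ?K2 ?kp phi2"
  using diag_trace_energy_approx[OF T convex_domain_square[OF T(1)] sQ K B(2)] by blast
 have A: "pairing ?Q (%x. chi x * K x) (%x. p (fst x) * w (snd x)) = - pairing ?Q (%x. ?x1 x * K x) ?fw - pairing ?Q (%x. chi x * ?K1 x) ?fw"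
  by (rule green_square_product[OF T(1) p w phic X(1,2) phi1])
 have Bt: "\<exists>phi. energy_approx T (tri b T) (0, 1) ?x1 (?r b) (?tau b) phi" for b
  by (rule diag_trace_energy_approx[OF T convex_domain_tri[OF T(1)] subset_refl H1x B(2)])
 \<comment> \<open>Integration by parts in \<open>t\<close>, with \<open>?x1\<close> as the bounded
   factor; the one-sided trace of \<open>?x1\<close> and the trace of \<open>K\<close> appear on the
   diagonal.\<close>
 have Bb: "pairing (tri b T) (%x. ?x1 x * K x) ?fw = - cpx (sg b) * pairing {0<..<T} (%s. ?tau b s * ?kp s) ?d
   - pairing (tri b T) (%x. ?rho x * K x) ?fg - pairing (tri b T) (%x. ?x1 x * ?K2 x) ?fg" for b
 proof -
  obtain phi where phi: "energy_approx T (tri b T) (0, 1) ?x1 (?r b) (?tau b) phi" using Bt by blast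
  have "pairing (tri b T) (%x. ?x1 x * K x) ?fw = - cpx (sg b) * pairing {0<..<T} (%s. ?tau b s * ?kp s) ?d
   - pairing (tri b T) (%x. ?r b x * K x) ?fg - pairing (tri b T) (%x. ?x1 x * ?K2 x) ?fg"
   by (rule green_product[OF bounded_tri trm B(2) Wfw Wfg d db _ phi Xt(2) rL energy_approx_subset[OF phi2 B(2) Qo(2,3) tri_subset trm]])
    (unfold pairing_def, rule green_triangle[OF _ p w])
  also have "pairing (tri b T) (%x. ?r b x * K x) ?fg = pairing (tri b T) (%x. ?rho x * K x) ?fg"
  proof (rule pairing_cong_AE[OF _ pairable_mult[OF rL Kt(1) Wfg] pairable_mult[OF rhoL Kt(1) Wfg]])
   show "AE x\<in>tri b T in lborel. ?r b x * K x = ?rho x * K x" using rrho[of b] by eventually_elim auto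
  qed
  finally show ?thesis .
 qed
 have S1: "pairing ?Q (%x. ?x1 x * K x) ?fw = pairing (tri True T) (%x. ?x1 x * K x) ?fw + pairing (tri False T) (%x. ?x1 x * K x) ?fw"
  by (rule pairing_split(2)[OF pairable_mult[OF Xt(2) Kt(1) Wfw] pairable_mult[OF Xt(2) Kt(1) Wfw] pairable_mult[OF X(2) KL(1) Wfw]])
 have S2: "pairing ?Q (%x. chi x * ?K1 x) ?fw = pairing (tri True T) (%x. chi x * ?K1 x) ?fw + pairing (tri False T) (%x. chi x * ?K1 x) ?fw"
  by (rule pairing_split(2)[OF pairable_mult[OF Xt(1) Kt(2) Wfw] pairable_mult[OF Xt(1) Kt(2) Wfw] pairable_mult[OF X(1) KL(2) Wfw]])
 have U: "Upsilon T chi K = (%x. (?rho x * K x + ?x2 x * ?K1 x) + ?x1 x * ?K2 x)"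
  by (simp add: fun_eq_iff Upsilon_def tri_Delta mult.commute[of "K _"])
 note U1 = pairable_mult[OF rhoL Kt(1) Wfg] and U2 = pairable_mult[OF Xt(3) Kt(2) Wfg] and U3 = pairable_mult[OF Xt(2) Kt(3) Wfg]
 have Ub: "pairing (tri b T) (Upsilon T chi K) ?fg = (pairing (tri b T) (%x. ?rho x * K x) ?fg + pairing (tri b T) (%x. ?x2 x * ?K1 x) ?fg) + pairing (tri b T) (%x. ?x1 x * ?K2 x) ?fg"
  and Up: "pairable (tri b T) (Upsilon T chi K) ?fg" for b
  unfolding U pairing_linear(1)[OF pairing_linear(2)[OF U1 U2] U3] pairing_linear(1)[OF U1 U2]
  by (rule refl) (rule pairing_linear(2)[OF pairing_linear(2)[OF U1 U2] U3])
 have e: "ind ?D x *R Upsilon T chi K x * ?fg x = ind (tri True T) x *R Upsilon T chi K x * ?fg x + ind (tri False T) x *R Upsilon T chi K x * ?fg x" for x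
  by (auto simp: indicator_def tri_def)
 have S3: "pairing ?D (Upsilon T chi K) ?fg = pairing (tri True T) (Upsilon T chi K) ?fg + pairing (tri False T) (Upsilon T chi K) ?fg"
  unfolding pairing_def e by (rule B_integral_add; rule Up[unfolded pairable_def])
 have S4: "pairing {0<..<T} (diag_weight T chi K) ?d = pairing {0<..<T} (%s. ?tau True s * ?kp s) ?d - pairing {0<..<T} (%s. ?tau False s * ?kp s) ?d"
 proof -
  have kpL: "L2_on {0<..<T} ?kp" using phi1 by (simp add: energy_approx_def)
  have tauL: "L2_on {0<..<T} (?tau b)" for b using Bt[of b] by (auto simp: energy_approx_def)
  have "pairable {0<..<T} (%s. ?tau b s * ?kp s) ?d" for b
  proof -
   have "sq_int lborel (%s. ?d s * (ind {0<..<T} s *R ?kp s))"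
    by (rule sq_int_bounded_mult(1)[OF kpL[unfolded L2_on_sq_int] sq_int_measurable[OF d] AE_I2[OF db]]) (intro mult_nonneg_nonneg nn)
   from sq_int_mult[OF tauL[unfolded L2_on_sq_int, of b] this]
   have "integrable lborel (%s. ind {0<..<T} s *R ?tau b s * (?d s * (ind {0<..<T} s *R ?kp s)))" .
   moreover have "(%s. ind {0<..<T} s *R ?tau b s * (?d s * (ind {0<..<T} s *R ?kp s))) = (%s. ind {0<..<T} s *R (?tau b s * ?kp s) * ?d s)"
    by (auto simp: indicator_def fun_eq_iff)
   ultimately show ?thesis by (simp only: pairable_def)
  qed
  note this[of True] this[of False]
  moreover have "diag_weight T chi K = (%s. ?tau True s * ?kp s - ?tau False s * ?kp s)"
   by (simp add: fun_eq_iff diag_weight_def tri_Delta left_diff_distrib)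
  ultimately show ?thesis by (simp only: pairing_linear(3))
 qed
 have Jb: "J b = pairing (tri b T) (%x. chi x * ?K1 x) ?fw + pairing (tri b T) (%x. ?x2 x * ?K1 x) ?fg" for b
 proof -
  let ?c = "weak_deriv (tri b T) (0, 1) chi"
  have cL: "Linf_on (tri b T) ?c" using wtt(1)[OF B(1) B(2)] .
  note pc = pairable_mult[OF cL Kt(2) Wfg] and pw = pairable_mult[OF Xt(1) Kt(2) Wfw, of b]
  have "pairing (tri b T) (%x. ?x2 x * ?K1 x) ?fg = pairing (tri b T) (%x. ?c x * ?K1 x) ?fg"
  proof (rule pairing_cong_AE[OF _ U2 pc])
   show "AE x\<in>tri b T in lborel. ?x2 x * ?K1 x = ?c x * ?K1 x" using eq[OF B(2), of b] by eventually_elim auto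
  qed
  then have "pairing (tri b T) (%x. chi x * ?K1 x) ?fw + pairing (tri b T) (%x. ?x2 x * ?K1 x) ?fg
   = (LINT x|lborel. ind (tri b T) x *R (chi x * ?K1 x) * ?fw x + ind (tri b T) x *R (?c x * ?K1 x) * ?fg x)"
   using B_integral_add[OF pw[unfolded pairable_def] pc[unfolded pairable_def]] by (simp only: pairing_def)
  also have "... = J b" unfolding J_def
  proof (rule B_integral_cong[OF refl])
   fix x
   show "ind (tri b T) x *R (chi x * ?K1 x) * ?fw x + ind (tri b T) x *R (?c x * ?K1 x) * ?fg x
    = ind ?Q x *R ?K1 x * (prim p (fst x) * (ind (tri b T) x *R ?c x * prim w (snd x) + ind (tri b T) x *R chi x * w (snd x)))"
   proof (cases "x \<in> tri b T")
    case True
    then have "x \<in> ?Q" using tri_subset by blast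
    then show ?thesis using True by (simp add: algebra_simps)
   qed simp
  qed
  finally show ?thesis by simp
 qed
 \<comment> \<open>The traces, weighted by \<open>sg b\<close>, add up to the diagonal weight, and
   the terms with \<open>?rho\<close> and \<open>?K2\<close> cancel against \<open>Upsilon\<close>.
   What is left are the terms with \<open>?K1\<close>, which form the two \<open>J\<close>.\<close>
 show ?thesis
  unfolding tri_Delta A S1 S2 S3 S4 Ub Jb Bb[of True] Bb[of False] by (simp add: sg_def algebra_simps)
qed

section \<open>Assembly of the estimate for a fixed exponent\<close>

lemma kernel_bound:
 assumes T: "0 < T" "T <= 1" and nu: "nu < 1/2" and C: "C >= 0"
  and avg: "!!g. adm T g ==> (nnl (%a. ind {0<..<T} a * HN nu (cut a (prim g)))) <= enn (C * T) * HN nu (prim g)"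
  and K: "H_k 1 (square T) K" and CD: "CK > 0" "DK > 0"
  and H: "\<forall>u\<in>H_space T. \<forall>v\<in>H_space T. cmod (LINT p:square T|lborel. K p * u (fst p) * cnj (v (snd p))) <= CD_bound T nu CK DK u v"
  and chi: "W_k_inf 1 (square T) chi" "vanishes_on_diagonal T chi" "W_k_inf 2 (Delta_plus T) chi" "W_k_inf 2 (Delta_minus T) chi"
  and u: "u \<in> H_space T" and v: "v \<in> H_space T"
 shows "cmod ((LINT p:square T|lborel. chi p * K p * u (fst p) * cnj (v (snd p)))
   - (LINT s:{0<..<T}|lborel. diag_weight T chi K s * primitive u s * cnj (primitive v s))
   - (LINT p:(Delta_plus T \<union> Delta_minus T)|lborel. Upsilon T chi K p * primitive u (fst p) * cnj (primitive v (snd p))))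
  <= T * (4 * (6 + 4 * C)) * (\<bar>max (W_k_inf_norm 2 (Delta_plus T) chi) (W_k_inf_norm 2 (Delta_minus T) chi)\<bar> + 1) * CD_bound T nu CK DK u v"
proof -
 let ?Q = "square T" and ?u = "%s. ind {0<..<T} s *R u s" and ?v = "%s. ind {0<..<T} s *R v s"
 let ?w = "%s. cnj (?v s)"
 let ?k1 = "%x. ind ?Q x *R weak_deriv ?Q (1, 0) K x"
 define N where "N b = W_k_inf_norm 2 (tri b T) chi" for b
 let ?m = "max (N True) (N False)"
 note p = H_space_adm[OF u] and q = H_space_adm[OF v]
 have chi2: "W_k_inf 2 (tri b T) chi" for b using chi(3,4) by (cases b) (simp_all only: tri_Delta)
 have pw: "prim ?w s = cnj (prim ?v s)" for s by (rule prim_cnj)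
 have prm: "primitive h s = prim (%s. ind {0<..<T} s *R h s) s" if "s \<in> {0<..<T}" for h s
  using primitive_prim[OF T(1), of s h] that by simp
 have 1: "(LINT p:?Q|lborel. chi p * K p * u (fst p) * cnj (v (snd p))) = pairing ?Q (%x. chi x * K x) (%x. ?u (fst x) * ?w (snd x))"
  unfolding pairing_def set_lebesgue_integral_def
  by (rule B_integral_cong) (auto simp: square_def indicator_def)
 have 2: "(LINT s:{0<..<T}|lborel. diag_weight T chi K s * primitive u s * cnj (primitive v s)) = pairing {0<..<T} (diag_weight T chi K) (%s. prim ?u s * prim ?w s)"
  unfolding pairing_def set_lebesgue_integral_def pw
 proof (rule B_integral_cong[OF refl])
  fix s
  show "ind {0<..<T} s *R (diag_weight T chi K s * primitive u s * cnj (primitive v s)) = ind {0<..<T} s *R diag_weight T chi K s * (prim ?u s * cnj (prim ?v s))"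
   by (cases "s \<in> {0<..<T}") (simp_all add: prm mult.assoc)
 qed
 have 3: "(LINT p:(Delta_plus T \<union> Delta_minus T)|lborel. Upsilon T chi K p * primitive u (fst p) * cnj (primitive v (snd p)))
  = pairing (Delta_plus T \<union> Delta_minus T) (Upsilon T chi K) (%x. prim ?u (fst x) * prim ?w (snd x))"
  unfolding pairing_def set_lebesgue_integral_def pw
 proof (rule B_integral_cong[OF refl])
  fix x
  show "ind (Delta_plus T \<union> Delta_minus T) x *R (Upsilon T chi K x * primitive u (fst x) * cnj (primitive v (snd x)))
   = ind (Delta_plus T \<union> Delta_minus T) x *R Upsilon T chi K x * (prim ?u (fst x) * cnj (prim ?v (snd x)))"
  proof (cases "x \<in> Delta_plus T \<union> Delta_minus T")
   case True
   then have "fst x \<in> {0<..<T}" "snd x \<in> {0<..<T}" by (auto simp: tri_Delta tri_def square_def)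
   then show ?thesis using True by (simp only: prm indicator_simps scaleR_one mult.assoc)
  next
   case False
   then show ?thesis by (simp only: indicator_simps scaleR_zero_left mult_zero_left not_False_eq_True)
  qed
 qed
 let ?J = "%b. LINT x|lborel. ?k1 x * (prim ?u (fst x) * (ind (tri b T) x *R weak_deriv (tri b T) (0, 1) chi x * prim ?w (snd x) + ind (tri b T) x *R chi x * ?w (snd x)))"
 let ?CD = "CD_bound T nu CK DK u v"
 have CDeq: "?CD = CK * sq_norm lborel (prim ?u) * sq_norm lborel (prim ?v) + DK * hn nu (prim ?u) * hn nu (prim ?v)"
  by (rule CD_bound_eq[OF T nu u v])
 have CD0: "0 <= ?CD" unfolding CDeq using CD by (intro add_nonneg_nonneg mult_nonneg_nonneg) auto
 obtain chi' where chi': "continuous_on ?Q chi'" "AE x\<in>?Q in lborel. chi x = chi' x" "!!s. s \<in> {0<..<T} ==> chi' (s, s) = 0"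
  using chi(2) unfolding vanishes_on_diagonal_def by blast
 have k1: "sq_int lborel ?k1" using H_k_weak_deriv(3)[OF open_square(1) Basis_plane(1) K] by (simp add: L2_on_sq_int)
 have fb: "form_bound T nu CK DK ?k1" by (rule form_bound_deriv[OF T nu K H])
 \<comment> \<open>The factor 2 comes from the row and column bound 2 M of the regularised kernels;
   adding the two triangles makes it 4.\<close>
 have J: "cmod (?J b) <= 2 * (6 + 4 * C) * T * ?m * ?CD" for b
 proof -
  have Nb: "\<bar>N b\<bar> <= ?m" using W_2_inf_norm_nonneg[OF T(1) chi2[of b]] unfolding N_def by (cases b) auto
  have "cmod (?J b) <= (6 + 4 * C) * (2 * \<bar>N b\<bar>) * T * ?CD"
   unfolding pw CDeq N_def
   by (rule jump_multiplier_bound[OF nu C T avg k1 _ fb _ _ p q chi2 chi']) (use CD in auto)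
  also have "... <= (6 + 4 * C) * (2 * ?m) * T * ?CD"
   using Nb C T CD0 by (intro mult_right_mono mult_left_mono) auto
  finally show ?thesis by (simp only: mult_ac)
 qed
 have "cmod (- ?J True - ?J False) <= cmod (?J True) + cmod (?J False)"
  using norm_triangle_ineq4[of "- ?J True" "?J False"] by (simp only: norm_minus_cancel)
 also have "... <= 2 * (6 + 4 * C) * T * ?m * ?CD + 2 * (6 + 4 * C) * T * ?m * ?CD" by (intro add_mono J)
 also have "... = T * (4 * (6 + 4 * C)) * ?m * ?CD" by (simp add: algebra_simps)
 \<comment> \<open>Passage to the positive function of the norm announced in the theorem.\<close>
 also have "... <= T * (4 * (6 + 4 * C)) * ((abs ?m) + 1) * ?CD"
  using C T CD0 by (intro mult_right_mono mult_left_mono) auto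
 finally show ?thesis
  unfolding 1 2 3 reduction[OF T K chi(1) chi2 p adm_cnj[OF q]] unfolding N_def tri_Delta .
qed

theorem proposition5p6:
  shows "\<exists>C_chi :: real \<Rightarrow> real. (\<forall>r. C_chi r > 0) \<and>
    (\<forall>\<nu> :: real. - 1/2 < \<nu> \<and> \<nu> < 1/2 \<longrightarrow>
      (\<exists>C_nu > 0. \<forall>(T :: real) (K :: real \<times> real \<Rightarrow> complex) (C_K :: real) (D_K :: real)
          (chi :: real \<times> real \<Rightarrow> complex).
        0 < T \<and> T \<le> 1 \<and> H_k 1 (square T) K \<and> C_K > 0 \<and> D_K > 0 \<and>
        (\<forall>u\<in>H_space T. \<forall>v\<in>H_space T.
           cmod (LINT p:square T|lborel. K p * u (fst p) * cnj (v (snd p)))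
             \<le> CD_bound T \<nu> C_K D_K u v) \<and>
        W_k_inf 1 (square T) chi \<and> vanishes_on_diagonal T chi \<and>
        W_k_inf 2 (Delta_plus T) chi \<and> W_k_inf 2 (Delta_minus T) chi \<longrightarrow>
        (\<forall>u\<in>H_space T. \<forall>v\<in>H_space T.
           cmod ((LINT p:square T|lborel. chi p * K p * u (fst p) * cnj (v (snd p)))
                 - (LINT s:{0<..<T}|lborel.
                      diag_weight T chi K s * primitive u s * cnj (primitive v s))
                 - (LINT p:(Delta_plus T \<union> Delta_minus T)|lborel.
                      Upsilon T chi K p * primitive u (fst p) * cnj (primitive v (snd p))))
             \<le> T * C_nu
                * C_chi (max (W_k_inf_norm 2 (Delta_plus T) chi) (W_k_inf_norm 2 (Delta_minus T) chi))
                * CD_bound T \<nu> C_K D_K u v)))"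
\<comment> \<open>The dependence on the norm of \<open>chi\<close> is linear; the absolute value and
  the summand 1 make the witness positive at every real argument.\<close>
proof (intro exI[of _ "\<lambda>r. \<bar>r\<bar> + 1"] conjI allI impI)
  show "0 < \<bar>r\<bar> + 1" for r :: real by linarith
  fix \<nu> :: real assume \<nu>: "- 1/2 < \<nu> \<and> \<nu> < 1/2"
  then obtain C where C: "C > 0" "\<And>T f M. 0 < T \<Longrightarrow> T \<le> 1 \<Longrightarrow> integrable lborel f \<Longrightarrow> continuous_on UNIV f \<Longrightarrow>
    (\<And>x. cmod (f x) \<le> M) \<Longrightarrow> (\<And>x. x \<notin> {0<..<T} \<Longrightarrow> f x = 0) \<Longrightarrow>
    (\<integral>\<^sup>+a. indicator {0<..<T} a * HN \<nu> (cut a f) \<partial>lborel) \<le> ennreal (C * T) * HN \<nu> f"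
    using cut_average[of \<nu>] by auto
  have avg: "(\<integral>\<^sup>+a. indicator {0<..<T} a * HN \<nu> (cut a (prim g)) \<partial>lborel) \<le> ennreal (C * T) * HN \<nu> (prim g)"
    if "0 < T" "T \<le> 1" "adm T g" for T g
    by (rule C(2)[OF that(1,2) adm_prim(1)[OF that(3)] prim_continuous[OF adm_integrable[OF that(3)]] prim_norm_le[OF adm_integrable[OF that(3)]] adm_prim_zero[OF that(3)]])
  have \<nu>2: "\<nu> < 1/2" and C0: "0 \<le> C" using \<nu> C(1) by auto
  show "\<exists>C_nu>0. \<forall>T K C_K D_K chi.
      0 < T \<and> T \<le> 1 \<and> H_k 1 (square T) K \<and> C_K > 0 \<and> D_K > 0 \<and>
      (\<forall>u\<in>H_space T. \<forall>v\<in>H_space T. cmod (LINT p:square T|lborel. K p * u (fst p) * cnj (v (snd p))) \<le> CD_bound T \<nu> C_K D_K u v) \<and>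
      W_k_inf 1 (square T) chi \<and> vanishes_on_diagonal T chi \<and> W_k_inf 2 (Delta_plus T) chi \<and> W_k_inf 2 (Delta_minus T) chi \<longrightarrow>
      (\<forall>u\<in>H_space T. \<forall>v\<in>H_space T.
        cmod ((LINT p:square T|lborel. chi p * K p * u (fst p) * cnj (v (snd p)))
          - (LINT s:{0<..<T}|lborel. diag_weight T chi K s * primitive u s * cnj (primitive v s))
          - (LINT p:(Delta_plus T \<union> Delta_minus T)|lborel. Upsilon T chi K p * primitive u (fst p) * cnj (primitive v (snd p))))
        \<le> T * C_nu * (\<bar>max (W_k_inf_norm 2 (Delta_plus T) chi) (W_k_inf_norm 2 (Delta_minus T) chi)\<bar> + 1) * CD_bound T \<nu> C_K D_K u v)"
  \<comment> \<open>This depends on \<nu> alone, through the constant of \<open>cut_average\<close>,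
    and is fixed before T, the kernel and \<open>chi\<close>.\<close>
  proof (intro exI[of _ "4 * (6 + 4 * C)"] conjI allI impI ballI)
    show "0 < 4 * (6 + 4 * C)" using C(1) by simp
  qed (elim conjE, rule kernel_bound[OF _ _ \<nu>2 C0 avg]; assumption)
qed

end
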